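(* Let $\lambda=(\mathcal L,\mu)$ be a measured geodesic lamination on $\mathbb H^2$ invariant under a group $\Gamma<\mathrm{Isom}^+(\mathbb H^2)=PSL(2,\mathbb R)$ acting freely and properly on $\mathbb H^2$. For $t\ge0$ let $\rho^1_{t\lambda}:\Gamma\to PSL(2,\mathbb C)$, $\rho^1_{t\lambda}(\gamma)=B_{t\lambda}(x_0,\gamma x_0)\gamma$. The derivative of $\rho^1_{t\lambda}$ at $t=0$ is an imaginary cocycle in $$H^1_{\mathrm{Ad}}(\Gamma,\mathfrak{sl}(2,\mathbb C))=H^1_{\mathrm{Ad}}(\Gamma,\mathfrak{sl}(2,\mathbb R))\oplus iH^1_{\mathrm{Ad}}(\Gamma,\mathfrak{sl}(2,\mathbb R)).$$ Moreover, up to the identification of $\mathfrak{sl}(2,\mathbb R)$ with $\mathbb R^3$, $$\dot\rho(0)=\frac i2\,\tau_\lambda,$$ where $\tau_\lambda\in H^1(\Gamma,\mathbb R^3)$ is the class of the translation part of $f_\lambda$.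
   Context: $\mathbb R^3$ carries $\langle v,w\rangle=-v_0w_0+v_1w_1+v_2w_2$ and $\mathbb H^2=\{v:\langle v,v\rangle=-1,v_0>0\}$, oriented by the standard orientation of $\mathbb R^3$ with the future normal first; $PSL(2,\mathbb R)\cong SO^+(2,1)$. A measured geodesic lamination $\lambda=(\mathcal L,\mu)$ on $\mathbb H^2$ is a closed set $L$ partitioned into complete geodesics (leaves) with a transverse measure $\mu$: a Radon measure $\mu_k$ with support $k\cap L$ on each rectifiable transverse arc $k$, compatible with restriction to subarcs and with homotopy through transverse arcs. $L_W$ is the union of the leaves carrying an atom; $t\lambda=(\mathcal L,t\mu)$. Fix $x_0\in\mathbb H^2\setminus L_W$. $f_\lambda(\gamma)=\gamma+\tau_\lambda(\gamma)$ with $\tau_\lambda(\gamma)=\int_{[x_0,\gamma x_0]}v\,d\mu\in\mathbb R^3$, where $v(t)$ is the unit vector tangent to $\mathbb H^2$ at $t\in L$, orthogonal to the leaf through $t$ and pointing towards $\gamma x_0$. $PSL(2,\mathbb C)=\mathrm{Isom}^+(\mathbb H^3)$ with $\mathbb H^2\subset\mathbb H^3$ the totally geodesic plane preserved by $PSL(2,\mathbb R)$. For an oriented geodesic $l$ of $\mathbb H^2$, $X(l)\in\mathfrak{sl}(2,\mathbb R)$ is the unit generator of positive translations along $l$ ($\exp(tX(l))$ has translation length $2t$); $iX(l)/2$ is the standard generator of positive rotations around $l$ (period $2\pi$). The bending cocycle $B_\lambda(x,y)$ is the limit as the mesh tends to $0$ of the ordered products $\exp(im_1X(l_1)/2)\cdots\exp(im_rX(l_r)/2)$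 over subdivisions of $[x,y]$ into consecutive intervals $c_j$ with interior subdivision points not in $L_W$, $m_j=\mu(c_j)$, $l_j$ a leaf meeting $c_j$ (if $m_j>0$) oriented as boundary of the half-plane containing $x$ (so $x$ is on its left), atoms at the endpoints $x,y$ counted with half their mass. The identification $\mathfrak{sl}(2,\mathbb R)\cong\mathbb R^3$ is the $PSL(2,\mathbb R)$-equivariant linear isometry (from the form $\frac12\mathrm{tr}(XY)$ to $\langle\cdot,\cdot\rangle$) sending $X(l)$ to the unit spacelike vector orthogonal to $l$ and pointing to the right of the oriented geodesic $l$. The derivative at $t=0$ of a family $\rho_t$ of representations is the class of the cocycle $\gamma\mapsto\frac{d}{dt}\big|_{t=0}\rho_t(\gamma)\rho_0(\gamma)^{-1}$. *)

theory Defs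
  imports "HOL-Analysis.Analysis" "HOL-Algebra.Coset"
begin

section \<open>The hyperboloid model of the hyperbolic plane\<close>

text \<open>The index type 3 of the library is \<open>{1, 2, 3}\<close> with \<open>0 = 3\<close>, so the time coordinate
  \<open>v\<^sub>0\<close> is \<open>v $ 3\<close>. The cyclic change from the order (0, 1, 2) to (1, 2, 3) is even, so
  \<^const>\<open>det\<close> below is the determinant for the standard orientation of the basis with the time
  vector first.\<close>

definition lform :: "real^3 \<Rightarrow> real^3 \<Rightarrow> real" where
  "lform v w = - v$3 * w$3 + v$1 * w$1 + v$2 * w$2"

definition hyp2 :: "(real^3) set" where
  "hyp2 = {v. lform v v = -1 \<and> v$3 > 0}"

definition hdist :: "real^3 \<Rightarrow> real^3 \<Rightarrow> real" where
  "hdist x y = arcosh (- lform x y)"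

definition hseg :: "real^3 \<Rightarrow> real^3 \<Rightarrow> real \<Rightarrow> real^3" where
  "hseg x y s = (let z = (1 - s) *\<^sub>R x + s *\<^sub>R y in z /\<^sub>R sqrt (- lform z z))"

text \<open>An oriented complete geodesic is given by a point and a unit tangent vector at that point;
  this also chooses a unit speed parametrisation.\<close>

type_synonym ogeod = "(real^3) \<times> (real^3)"

definition is_ogeod :: "ogeod \<Rightarrow> bool" where
  "is_ogeod l \<longleftrightarrow> fst l \<in> hyp2 \<and> lform (snd l) (snd l) = 1 \<and> lform (fst l) (snd l) = 0"

definition gpoint :: "ogeod \<Rightarrow> real \<Rightarrow> real^3" where
  "gpoint l s = cosh s *\<^sub>R fst l + sinh s *\<^sub>R snd l"

definition gset :: "ogeod \<Rightarrow> (real^3) set" where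
  "gset l = range (gpoint l)"

text \<open>Positive strictly to the left of the oriented geodesic, zero on it, negative strictly to the
  right: a tangent vector \<open>w\<close> points to the left of the unit tangent \<open>u\<close> at \<open>p\<close> iff \<open>(u, w)\<close> is a
  positive basis of the tangent plane, i.e. iff \<open>(p, u, w)\<close> is positive in the ambient space.\<close>

definition side :: "ogeod \<Rightarrow> real^3 \<Rightarrow> real" where
  "side l z = det (vector [fst l, snd l, z])"

definition right_normal :: "ogeod \<Rightarrow> real^3 \<Rightarrow> bool" where
  "right_normal l n \<longleftrightarrow> lform n n = 1 \<and> (\<forall>z\<in>gset l. lform n z = 0) \<and> side l n < 0"


section \<open>The groups SL(2) and PSL(2) and their actions\<close>

definition SL2 :: "('a::field^2^2) monoid" where
  "SL2 = \<lparr>carrier = {A. det A = 1}, mult = (**), one = mat 1\<rparr>"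

definition PSL2 :: "('a::field^2^2) set monoid" where
  "PSL2 = SL2 Mod {mat 1, - mat 1}"

definition psl :: "'a::field^2^2 \<Rightarrow> ('a^2^2) set" where
  "psl A = {mat 1, - mat 1} #>\<^bsub>SL2\<^esub> A"

definition cmat :: "real^2^2 \<Rightarrow> complex^2^2" where
  "cmat A = map_matrix of_real A"

definition cmult :: "complex \<Rightarrow> complex^2^2 \<Rightarrow> complex^2^2" where
  "cmult c A = map_matrix ((*) c) A"

text \<open>\<open>\<real>\<^sup>3\<close> as the space of symmetric matrices, with \<open>lform v v = - det (symm v)\<close>; SL(2) acts by
  \<open>S \<mapsto> A S A\<^sup>T\<close>. The point \<open>A A\<^sup>T\<close> of the hyperboloid corresponds to the point \<open>A \<cdot> \<i>\<close> of the upper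
  half plane, and with the coordinates below this correspondence is orientation preserving.\<close>

definition symm :: "real^3 \<Rightarrow> real^2^2" where
  "symm v = vector [vector [v$3 + v$2, v$1], vector [v$1, v$3 - v$2]]"

definition unsymm :: "real^2^2 \<Rightarrow> real^3" where
  "unsymm S = vector [S$1$2, (S$1$1 - S$2$2) / 2, (S$1$1 + S$2$2) / 2]"

definition mact :: "real^2^2 \<Rightarrow> real^3 \<Rightarrow> real^3" where
  "mact A v = unsymm (A ** symm v ** transpose A)"

text \<open>Elements of PSL(2) are sets \<open>{A, -A}\<close>, and both representatives act in the same way.\<close>

definition pact :: "(real^2^2) set \<Rightarrow> real^3 \<Rightarrow> real^3" where
  "pact g v = mact (SOME A. A \<in> g) v"

definition Ad :: "('a::field^2^2) set \<Rightarrow> 'a^2^2 \<Rightarrow> 'a^2^2" where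
  "Ad g X = (let A = (SOME A. A \<in> g) in A ** X ** matrix_inv A)"

definition sl2 :: "('a::field^2^2) set" where
  "sl2 = {X. trace X = 0}"

text \<open>The multiplication of the type of matrices is componentwise, hence the explicit powers.\<close>

definition mexp :: "'a::real_normed_field^2^2 \<Rightarrow> 'a^2^2" where
  "mexp A = (\<Sum>n. (((**) A) ^^ n) (mat 1) /\<^sub>R fact n)"

definition is_translation_generator :: "ogeod \<Rightarrow> real^2^2 \<Rightarrow> bool" where
  "is_translation_generator l X \<longleftrightarrow> X \<in> sl2 \<and> trace (X ** X) / 2 = 1 \<and>
     (\<forall>s t. mact (mexp (t *\<^sub>R X)) (gpoint l s) = gpoint l (s + 2 * t))"

definition Xgen :: "ogeod \<Rightarrow> real^2^2" where
  "Xgen l = (THE X. is_translation_generator l X)"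

text \<open>Inverse of the identification of \<open>sl(2, \<real>)\<close> with \<open>\<real>\<^sup>3\<close>.\<close>

definition is_sl2_identification :: "(real^3 \<Rightarrow> real^2^2) \<Rightarrow> bool" where
  "is_sl2_identification j \<longleftrightarrow> linear j \<and> bij_betw j UNIV sl2 \<and>
     (\<forall>v w. trace (j v ** j w) / 2 = lform v w) \<and>
     (\<forall>g\<in>carrier PSL2. \<forall>v. j (pact g v) = Ad g (j v)) \<and>
     (\<forall>l n. is_ogeod l \<longrightarrow> right_normal l n \<longrightarrow> j n = Xgen l)"

definition to_sl2 :: "real^3 \<Rightarrow> real^2^2" where
  "to_sl2 = (THE j. is_sl2_identification j)"


subsection \<open>Existence and uniqueness of the generators and of the identification\<close>

definition vec_sl2 :: "real^3 \<Rightarrow> real^2^2" where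
  "vec_sl2 v = vector [vector [v$1, - (v$3 + v$2)], vector [v$3 - v$2, - v$1]]"

definition rnormal :: "ogeod \<Rightarrow> real^3" where
  "rnormal l = (let c = cross3 (fst l) (snd l) in vector [- c$1, - c$2, c$3])"

lemmas mat2 = vec_eq_iff forall_2 forall_3 matrix_matrix_mult_def sum_2 sum_3 mat_def transpose_def
  trace_def det_2 det_3

lemma lform_rnormal: "lform (rnormal l) z = - side l z"
  by (simp add: lform_def rnormal_def side_def cross3_simps Let_def mat2 algebra_simps)

lemma lform_rnormal_self:
  assumes "is_ogeod l" shows "lform (rnormal l) (rnormal l) = 1"
proof -
  obtain p u where l: "l = (p, u)" by force
  have "lform (rnormal l) (rnormal l) = (lform p u)^2 - lform p p * lform u u"
    unfolding l by (simp add: lform_def rnormal_def cross3_simps Let_def power2_eq_square algebra_simps)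
  then show ?thesis using assms by (simp add: l is_ogeod_def hyp2_def)
qed

lemma gset_orth: "(\<forall>z\<in>gset l. lform n z = 0) \<longleftrightarrow> lform n (fst l) = 0 \<and> lform n (snd l) = 0"
proof -
  have e: "lform n (gpoint l s) = cosh s * lform n (fst l) + sinh s * lform n (snd l)" for s
    by (simp add: gpoint_def lform_def algebra_simps)
  show ?thesis
  proof
    assume "\<forall>z\<in>gset l. lform n z = 0"
    then have *: "lform n (gpoint l s) = 0" for s by (auto simp: gset_def)
    from *[of 0] *[of 1] show "lform n (fst l) = 0 \<and> lform n (snd l) = 0" by (simp add: e)
  qed (auto simp: gset_def e)
qed

lemma side_orth: "side l (fst l) = 0" "side l (snd l) = 0"
  by (simp_all add: side_def det_3 algebra_simps)

lemma orth_rnormal: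
  assumes l: "is_ogeod l" and "lform n (fst l) = 0" "lform n (snd l) = 0"
  shows "n = lform n (rnormal l) *\<^sub>R rnormal l"
proof -
  obtain p u where pu: "l = (p, u)" by force
  let ?N = "rnormal l"
  have pp: "lform p p = -1" "lform u u = 1" "lform p u = 0"
    using l by (auto simp: pu is_ogeod_def hyp2_def)
  have "lform ?N ?N *\<^sub>R n - lform n ?N *\<^sub>R ?N =
      (lform n u * lform p u - lform n p * lform u u) *\<^sub>R p +
      (lform n p * lform p u - lform n u * lform p p) *\<^sub>R u"
    unfolding pu by (simp add: vec_eq_iff forall_3 lform_def rnormal_def cross3_simps Let_def algebra_simps)
  then show ?thesis using assms(2,3) lform_rnormal_self[OF l] by (simp add: pu)
qed

lemma right_normal_iff:
  assumes l: "is_ogeod l" shows "right_normal l n \<longleftrightarrow> n = rnormal l"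
proof
  assume n: "right_normal l n"
  define c where "c = lform n (rnormal l)"
  have n': "n = c *\<^sub>R rnormal l"
    using orth_rnormal[OF l] n by (auto simp: right_normal_def gset_orth c_def)
  have "lform n n = c * c * lform (rnormal l) (rnormal l)"
    unfolding n' by (simp add: lform_def algebra_simps)
  then have "c * c = 1" using n lform_rnormal_self[OF l] by (simp add: right_normal_def)
  moreover have "lform (rnormal l) n > 0" using n by (simp add: right_normal_def lform_rnormal)
  then have "c > 0" by (simp add: c_def lform_def algebra_simps)
  ultimately have "c = 1" by (simp add: square_eq_1_iff)
  then show "n = rnormal l" using n' by simp
next
  assume "n = rnormal l"
  then show "right_normal l n"
    using lform_rnormal[of l] lform_rnormal_self[OF l] side_orth[of l] gset_orth[of l "rnormal l"]
    by (simp add: right_normal_def)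
qed

lemma vec_sl2_trace: "trace (vec_sl2 v ** vec_sl2 w) / 2 = lform v w"
  by (simp add: vec_sl2_def mat2 lform_def) algebra

lemma vec_sl2_mem: "vec_sl2 v \<in> sl2"
  by (simp add: vec_sl2_def sl2_def mat2)

lemma vec_sl2_surj:
  assumes "X \<in> sl2" shows "\<exists>v. X = vec_sl2 v"
  using assms
  by (intro exI[of _ "vector [X$1$1, - (X$1$2 + X$2$1) / 2, (X$2$1 - X$1$2) / 2]"])
     (auto simp: vec_sl2_def sl2_def mat2 field_simps)

lemma vec_sl2_inj: "vec_sl2 v = vec_sl2 w \<longleftrightarrow> v = w"
  by (auto simp: vec_sl2_def mat2)

lemma linear_vec_sl2: "linear vec_sl2"
  by (auto intro!: linearI simp: vec_sl2_def mat2 algebra_simps)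

lemma mexp_involution:
  fixes X :: "real^2^2"
  assumes X: "X ** X = mat 1"
  shows "mexp (t *\<^sub>R X) = cosh t *\<^sub>R mat 1 + sinh t *\<^sub>R X"
proof -
  let ?P = "(1/2) *\<^sub>R (mat 1 + X)" and ?Q = "(1/2) *\<^sub>R (mat 1 - X)"
  have pw: "(((**) (t *\<^sub>R X)) ^^ n) (mat 1) = t ^ n *\<^sub>R ?P + (- t) ^ n *\<^sub>R ?Q" for n
  proof (induction n)
    case 0 show ?case by (simp add: vec_eq_iff field_simps)
  next
    case (Suc n)
    have "(t *\<^sub>R X) ** (a *\<^sub>R (mat 1 + X) + b *\<^sub>R (mat 1 - X)) =
        (t * (a - b)) *\<^sub>R (X ** X) + (t * (a + b)) *\<^sub>R X" for a b
      by (simp add: vec_eq_iff forall_2 matrix_matrix_mult_def sum_2 mat_def algebra_simps)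
    then have "(t *\<^sub>R X) ** (a *\<^sub>R (mat 1 + X) + b *\<^sub>R (mat 1 - X)) =
        (t * a) *\<^sub>R (mat 1 + X) + (- t * b) *\<^sub>R (mat 1 - X)" for a b
      by (simp add: X) (simp add: vec_eq_iff algebra_simps)
    then show ?case using Suc by simp
  qed
  have "(\<lambda>n. (t ^ n /\<^sub>R fact n) *\<^sub>R ?P + ((- t) ^ n /\<^sub>R fact n) *\<^sub>R ?Q) sums (exp t *\<^sub>R ?P + exp (- t) *\<^sub>R ?Q)"
    by (intro sums_add sums_scaleR_left exp_converges)
  moreover have "(\<lambda>n. (t ^ n /\<^sub>R fact n) *\<^sub>R ?P + ((- t) ^ n /\<^sub>R fact n) *\<^sub>R ?Q) =
      (\<lambda>n. (((**) (t *\<^sub>R X)) ^^ n) (mat 1) /\<^sub>R fact n)"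
    unfolding pw by (simp add: fun_eq_iff scaleR_add_right)
  ultimately have "mexp (t *\<^sub>R X) = exp t *\<^sub>R ?P + exp (- t) *\<^sub>R ?Q"
    unfolding mexp_def by (simp add: sums_iff)
  also have "\<dots> = cosh t *\<^sub>R mat 1 + sinh t *\<^sub>R X"
    by (simp add: cosh_def sinh_def vec_eq_iff field_simps)
  finally show ?thesis .
qed

lemma vec_sl2_square: "vec_sl2 w ** vec_sl2 w = lform w w *\<^sub>R mat 1"
  by (simp add: vec_sl2_def mat2 lform_def algebra_simps)

definition lcross :: "real^3 \<Rightarrow> real^3 \<Rightarrow> real^3" where
  "lcross w v = vector [cross3 v w $ 1, cross3 v w $ 2, - cross3 v w $ 3]"

lemma mact_vec_sl2:
  "mact (a *\<^sub>R mat 1 + b *\<^sub>R vec_sl2 w) v = (a^2 + b^2 * lform w w) *\<^sub>R v + (2*a*b) *\<^sub>R lcross w v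
     - (2 * b^2 * lform w v) *\<^sub>R w"
  by (simp add: mact_def symm_def unsymm_def vec_sl2_def mat2 lform_def lcross_def cross3_simps) algebra

lemma lcross_rnormal:
  assumes "is_ogeod l"
  shows "lcross (rnormal l) (fst l) = snd l" "lcross (rnormal l) (snd l) = fst l"
proof -
  obtain p u where pu: "l = (p, u)" by force
  have pp: "lform p p = -1" "lform u u = 1" "lform p u = 0"
    using assms by (auto simp: pu is_ogeod_def hyp2_def)
  have "lcross (rnormal l) p = lform p u *\<^sub>R p - lform p p *\<^sub>R u"
       "lcross (rnormal l) u = lform u u *\<^sub>R p - lform p u *\<^sub>R u"
    unfolding pu by (simp_all add: vec_eq_iff forall_3 lform_def rnormal_def lcross_def cross3_simps Let_def)
  then show "lcross (rnormal l) (fst l) = snd l" "lcross (rnormal l) (snd l) = fst l"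
    using pp by (simp_all add: pu)
qed

lemma lcross_linear: "lcross w (a *\<^sub>R x + b *\<^sub>R y) = a *\<^sub>R lcross w x + b *\<^sub>R lcross w y"
  by (simp add: vec_eq_iff forall_3 lcross_def cross3_simps algebra_simps)

lemma translation_vec_sl2:
  assumes "lform w w = 1"
  shows "mact (mexp (t *\<^sub>R vec_sl2 w)) v = cosh (2*t) *\<^sub>R v + sinh (2*t) *\<^sub>R lcross w v
     - (2 * (sinh t)^2 * lform w v) *\<^sub>R w"
  using assms
  by (simp add: mexp_involution vec_sl2_square mact_vec_sl2 cosh_double sinh_double)

lemma is_translation_generator_iff:
  assumes l: "is_ogeod l"
  shows "is_translation_generator l X \<longleftrightarrow> X = vec_sl2 (rnormal l)"
proof
  assume X: "X = vec_sl2 (rnormal l)"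
  have n: "lform (rnormal l) (rnormal l) = 1" by (rule lform_rnormal_self[OF l])
  have "lform (rnormal l) (gpoint l s) = 0" for s
    using side_orth[of l] lform_rnormal[of l] gset_orth[of l "rnormal l"] by (auto simp: gset_def)
  then have "mact (mexp (t *\<^sub>R X)) (gpoint l s) = gpoint l (s + 2 * t)" for s t
    unfolding X by (simp add: translation_vec_sl2[OF n])
      (simp add: gpoint_def lcross_linear lcross_rnormal[OF l] cosh_add sinh_add algebra_simps)
  then show "is_translation_generator l X"
    unfolding is_translation_generator_def X using vec_sl2_mem n by (auto simp: vec_sl2_trace)
next
  assume X: "is_translation_generator l X"
  then obtain w where w: "X = vec_sl2 w" using vec_sl2_surj unfolding is_translation_generator_def by blast
  have ww: "lform w w = 1" using X by (simp add: w is_translation_generator_def vec_sl2_trace)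
  have act: "mact (mexp (t *\<^sub>R vec_sl2 w)) (gpoint l s) = gpoint l (s + 2 * t)" for s t
    using X by (simp add: w is_translation_generator_def)
  have c: "cosh (2::real) *\<^sub>R v + sinh 2 *\<^sub>R lcross w v - (2 * (sinh 1)^2 * lform w v) *\<^sub>R w = gpoint l (s + 2)"
       "cosh (2::real) *\<^sub>R v - sinh 2 *\<^sub>R lcross w v - (2 * (sinh 1)^2 * lform w v) *\<^sub>R w = gpoint l (s - 2)"
    if "v = gpoint l s" for v s
    using act[of 1 s] act[of "-1" s] that unfolding translation_vec_sl2[OF ww] by simp_all
  have gsum: "gpoint l (s + 2) + gpoint l (s - 2) = (2 * cosh 2) *\<^sub>R gpoint l s" for s
    by (simp add: vec_eq_iff gpoint_def cosh_add sinh_add cosh_diff sinh_diff algebra_simps)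
  have "w \<noteq> 0" using ww by (auto simp: lform_def)
  have wg: "lform w (gpoint l s) = 0" for s
  proof -
    have "(4 * (sinh 1)^2 * lform w (gpoint l s)) *\<^sub>R w = 0"
      using c[OF refl, of s] gsum[of s] by (simp add: vec_eq_iff algebra_simps)
    then show ?thesis using \<open>w \<noteq> 0\<close> by simp
  qed
  have wn: "w = lform w (rnormal l) *\<^sub>R rnormal l"
    using orth_rnormal[OF l] gset_orth[of l w] wg by (auto simp: gset_def)
  define d where "d = lform w (rnormal l)"
  have "lcross w (fst l) = d *\<^sub>R snd l"
  proof -
    have "lcross w v = d *\<^sub>R lcross (rnormal l) v" for v
      by (subst wn) (simp add: d_def vec_eq_iff forall_3 lcross_def cross3_simps)
    then show ?thesis by (simp add: lcross_rnormal[OF l])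
  qed
  moreover have "gpoint l 0 = fst l" by (simp add: gpoint_def)
  ultimately have "sinh 2 *\<^sub>R (d *\<^sub>R snd l) = sinh 2 *\<^sub>R snd l"
    using c(1)[OF refl, of 0] wg[of 0] by (simp add: gpoint_def)
  moreover have "snd l \<noteq> 0" using l by (auto simp: is_ogeod_def lform_def)
  ultimately have "d = 1" by simp
  then show "X = vec_sl2 (rnormal l)" using wn w by (simp add: d_def)
qed

lemma Xgen_eq: "is_ogeod l \<Longrightarrow> Xgen l = vec_sl2 (rnormal l)"
  by (simp add: Xgen_def is_translation_generator_iff)

lemma psl_eq: "psl A = {A, - A}"
proof -
  have "- mat 1 ** A = - A"
    by (simp add: vec_eq_iff forall_2 matrix_matrix_mult_def sum_2 mat_def)
  then show ?thesis by (auto simp: psl_def r_coset_def SL2_def)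
qed

lemma carrier_PSL2: "carrier PSL2 = psl ` {A. det A = 1}"
  by (simp add: PSL2_def carrier_FactGroup psl_def[abs_def] SL2_def)

lemma pact_psl: "pact (psl A) v = mact A v"
proof -
  have "(SOME B. B \<in> psl A) \<in> psl A" by (rule someI[of _ A]) (simp add: psl_eq)
  moreover have "mact (- A) v = mact A v" by (simp add: mact_def unsymm_def mat2 algebra_simps)
  ultimately show ?thesis by (auto simp: pact_def psl_eq)
qed

lemma matrix_inv_2:
  fixes A :: "'a::field^2^2"
  assumes "det A = 1"
  shows "matrix_inv A = vector [vector [A$2$2, - A$1$2], vector [- A$2$1, A$1$1]]"
proof -
  let ?B = "vector [vector [A$2$2, - A$1$2], vector [- A$2$1, A$1$1]] :: 'a^2^2"
  have AB: "A ** ?B = mat 1" and BA: "?B ** A = mat 1"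
    using assms by (simp_all add: mat2 algebra_simps)
  have "A ** matrix_inv A = mat 1"
    unfolding matrix_inv_def by (rule someI2[of _ ?B]) (use AB BA in auto)
  then have "?B ** (A ** matrix_inv A) = ?B" by simp
  then show ?thesis using BA by (simp add: matrix_mul_assoc)
qed

lemma Ad_psl:
  assumes "det A = 1" shows "Ad (psl A) X = A ** X ** matrix_inv A"
proof -
  have "(SOME B. B \<in> psl A) \<in> psl A" by (rule someI[of _ A]) (simp add: psl_eq)
  moreover have "det (- A) = 1" using assms by (simp add: det_2)
  then have "(- A) ** X ** matrix_inv (- A) = A ** X ** matrix_inv A"
    using assms by (simp add: matrix_inv_2) (simp add: mat2 algebra_simps)
  ultimately show ?thesis by (auto simp: Ad_def psl_eq Let_def)
qed

lemma vec_sl2_equivariant: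
  assumes "g \<in> carrier PSL2" shows "vec_sl2 (pact g v) = Ad g (vec_sl2 v)"
proof -
  obtain A where A: "g = psl A" "det A = 1" using assms by (auto simp: carrier_PSL2)
  then show ?thesis
    by (simp add: pact_psl Ad_psl matrix_inv_2)
       (simp add: mact_def symm_def unsymm_def vec_sl2_def mat2 algebra_simps add_divide_distrib diff_divide_distrib)
qed

lemma is_sl2_identification_vec_sl2: "is_sl2_identification vec_sl2"
proof -
  have "bij_betw vec_sl2 UNIV sl2"
    using vec_sl2_surj vec_sl2_mem by (force simp: bij_betw_def inj_on_def vec_sl2_inj)
  then show ?thesis
    unfolding is_sl2_identification_def
    by (simp add: linear_vec_sl2 vec_sl2_trace vec_sl2_equivariant right_normal_iff Xgen_eq)
qed

lemma is_sl2_identification_iff: "is_sl2_identification j \<longleftrightarrow> j = vec_sl2"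
proof
  assume j: "is_sl2_identification j"
  have lin: "linear j" using j by (simp add: is_sl2_identification_def)
  have jn: "j (rnormal l) = vec_sl2 (rnormal l)" if "is_ogeod l" for l
    using j that right_normal_iff[OF that] Xgen_eq[OF that] unfolding is_sl2_identification_def by metis
  define e :: "real^3" where "e = vector [0, 0, 1]"
  define e1 :: "real^3" where "e1 = vector [1, 0, 0]"
  define e2 :: "real^3" where "e2 = vector [0, 1, 0]"
  define n :: "real^3" where "n = vector [5/4, 0, 3/4]"
  have o: "is_ogeod (e, e2)" "is_ogeod (e, - e1)" "is_ogeod (vector [3/4, 0, 5/4], e2)"
    by (simp_all add: is_ogeod_def hyp2_def lform_def e_def e1_def e2_def)
  have r: "rnormal (e, e2) = e1" "rnormal (e, - e1) = e2" "rnormal (vector [3/4, 0, 5/4], e2) = n"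
    by (simp_all add: rnormal_def Let_def cross3_simps vec_eq_iff forall_3 e_def e1_def e2_def n_def)
  have k: "j e1 = vec_sl2 e1" "j e2 = vec_sl2 e2" "j n = vec_sl2 n"
    using jn[OF o(1)] jn[OF o(2)] jn[OF o(3)] unfolding r by auto
  show "j = vec_sl2"
  proof
    fix v :: "real^3"
    have v: "v = (v$1 - 5/3 * v$3) *\<^sub>R e1 + v$2 *\<^sub>R e2 + (4/3 * v$3) *\<^sub>R n"
      by (simp add: vec_eq_iff forall_3 e1_def e2_def n_def)
    show "j v = vec_sl2 v"
      by (subst (1 2) v) (simp add: linear_add[OF lin] linear_scale[OF lin] k
          linear_add[OF linear_vec_sl2] linear_scale[OF linear_vec_sl2])
  qed
qed (simp add: is_sl2_identification_vec_sl2)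

lemma to_sl2_eq: "to_sl2 = vec_sl2"
  by (simp add: to_sl2_def is_sl2_identification_iff)


section \<open>Measured geodesic laminations\<close>

definition hrectifiable :: "(real \<Rightarrow> real^3) \<Rightarrow> bool" where
  "hrectifiable g \<longleftrightarrow> (\<exists>C. \<forall>n::nat. \<forall>s::nat \<Rightarrow> real.
     mono_on {..n} s \<longrightarrow> s ` {..n} \<subseteq> {0..1} \<longrightarrow> (\<Sum>i<n. hdist (g (s i)) (g (s (Suc i)))) \<le> C)"

text \<open>Transversality of a rectifiable arc is topological: locally the arc meets every leaf at most
  once, and there it crosses the leaf from one side to the other.\<close>

definition transverse_arc :: "(real^3) set set \<Rightarrow> (real \<Rightarrow> real^3) \<Rightarrow> bool" where
  "transverse_arc \<L> g \<longleftrightarrow> arc g \<and> path_image g \<subseteq> hyp2 \<and> hrectifiable g \<and>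
     (\<forall>s\<in>{0..1}. \<exists>e>0. \<forall>k\<in>\<L>. \<forall>u\<in>{0..1} \<inter> ball s e. g u \<in> k \<longrightarrow>
        (\<exists>l. is_ogeod l \<and> gset l = k \<and>
          (\<forall>w\<in>{0..1} \<inter> ball s e. sgn (side l (g w)) = sgn (w - u))))"

definition msupport :: "'a::topological_space measure \<Rightarrow> 'a set" where
  "msupport M = {p\<in>space M. \<forall>U. open U \<longrightarrow> p \<in> U \<longrightarrow> emeasure M (U \<inter> space M) \<noteq> 0}"

text \<open>The transverse measure is a function of the arc as a set.\<close>

record mlam =
  leaves :: "(real^3) set set"
  tmeas :: "(real^3) set \<Rightarrow> (real^3) measure"

definition lamset :: "mlam \<Rightarrow> (real^3) set" where
  "lamset lam = \<Union>(leaves lam)"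

definition geodesic_lamination :: "(real^3) set set \<Rightarrow> bool" where
  "geodesic_lamination \<L> \<longleftrightarrow> closedin (top_of_set hyp2) (\<Union>\<L>) \<and> disjoint \<L> \<and>
     (\<forall>k\<in>\<L>. \<exists>l. is_ogeod l \<and> k = gset l)"

text \<open>A homotopy through transverse arcs, under which every point stays on its leaf or stays off the
  lamination. (Without this a homotopy could push an arc across a leaf.)\<close>

definition transverse_homotopy :: "(real^3) set set \<Rightarrow> (real \<Rightarrow> real \<Rightarrow> real^3) \<Rightarrow> bool" where
  "transverse_homotopy \<L> H \<longleftrightarrow>
     continuous_on ({0..1} \<times> {0..1}) (\<lambda>(s, t). H s t) \<and>
     (\<forall>s\<in>{0..1}. transverse_arc \<L> (H s)) \<and>
     (\<forall>t\<in>{0..1}. (\<exists>k\<in>\<L>. \<forall>s\<in>{0..1}. H s t \<in> k) \<or> (\<forall>s\<in>{0..1}. H s t \<notin> \<Union>\<L>))"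

text \<open>The equality of the support with the intersection of the arc and the lamination is not demanded
  at the endpoints of an arc. There it would contradict the compatibility with subarcs: if a leaf \<open>k\<close>
  without atom is isolated from one side, an arc reaching \<open>k\<close> from that side and ending on \<open>k\<close> meets
  the lamination near \<open>k\<close> in that endpoint only.\<close>

definition measured_lamination :: "mlam \<Rightarrow> bool" where
  "measured_lamination lam \<longleftrightarrow> geodesic_lamination (leaves lam) \<and>
     (\<forall>g. transverse_arc (leaves lam) g \<longrightarrow>
        (let k = path_image g; M = tmeas lam k in
          space M = k \<and> sets M = sets (restrict_space borel k) \<and> emeasure M k < \<infinity> \<and>
          msupport M \<subseteq> k \<inter> lamset lam \<and>
          k \<inter> lamset lam - {pathstart g, pathfinish g} \<subseteq> msupport M)) \<and>
     (\<forall>g h. transverse_arc (leaves lam) g \<longrightarrow> transverse_arc (leaves lam) h \<longrightarrow>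
        path_image h \<subseteq> path_image g \<longrightarrow>
        tmeas lam (path_image h) = restrict_space (tmeas lam (path_image g)) (path_image h)) \<and>
     (\<forall>H. transverse_homotopy (leaves lam) H \<longrightarrow>
        (\<forall>T\<in>sets borel. T \<subseteq> {0..1} \<longrightarrow>
          emeasure (tmeas lam (path_image (H 0))) (H 0 ` T) =
          emeasure (tmeas lam (path_image (H 1))) (H 1 ` T)))"

definition weighted_part :: "mlam \<Rightarrow> (real^3) set" where
  "weighted_part lam = \<Union>{k\<in>leaves lam. \<exists>g. transverse_arc (leaves lam) g \<and>
     (\<exists>p\<in>k \<inter> path_image g. emeasure (tmeas lam (path_image g)) {p} > 0)}"

definition scale_lam :: "real \<Rightarrow> mlam \<Rightarrow> mlam" where
  "scale_lam t lam = \<lparr>leaves = leaves lam, tmeas = (\<lambda>k. scale_measure (ennreal t) (tmeas lam k))\<rparr>"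

definition invariant_lam :: "(real^2^2) set set \<Rightarrow> mlam \<Rightarrow> bool" where
  "invariant_lam \<Gamma> lam \<longleftrightarrow> (\<forall>\<gamma>\<in>\<Gamma>.
     (\<forall>k\<in>leaves lam. pact \<gamma> ` k \<in> leaves lam) \<and>
     (\<forall>g. transverse_arc (leaves lam) g \<longrightarrow>
        (\<forall>E\<in>sets (tmeas lam (path_image g)).
           emeasure (tmeas lam (pact \<gamma> ` path_image g)) (pact \<gamma> ` E) =
           emeasure (tmeas lam (path_image g)) E)))"

definition acts_freely :: "(real^2^2) set set \<Rightarrow> bool" where
  "acts_freely \<Gamma> \<longleftrightarrow> (\<forall>\<gamma>\<in>\<Gamma>. \<forall>x\<in>hyp2. pact \<gamma> x = x \<longrightarrow> \<gamma> = \<one>\<^bsub>PSL2\<^esub>)"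

definition acts_properly :: "(real^2^2) set set \<Rightarrow> bool" where
  "acts_properly \<Gamma> \<longleftrightarrow>
     (\<forall>K. compact K \<longrightarrow> K \<subseteq> hyp2 \<longrightarrow> finite {\<gamma>\<in>\<Gamma>. pact \<gamma> ` K \<inter> K \<noteq> {}})"


section \<open>The translation cocycle and the bending cocycle\<close>

text \<open>The measure on \<open>[x, y]\<close>. The segment fails to be transverse only if \<open>x = y\<close> or if it lies in a
  leaf; then it carries no measure.\<close>

definition seg_measure :: "mlam \<Rightarrow> real^3 \<Rightarrow> real^3 \<Rightarrow> (real^3) measure" where
  "seg_measure lam x y =
     (if transverse_arc (leaves lam) (hseg x y) then tmeas lam (path_image (hseg x y))
      else null_measure borel)"

text \<open>At the endpoints of \<open>[x, y]\<close>, pointing towards \<open>y\<close> means pointing from \<open>x\<close> to \<open>y\<close>; this is why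
  both inequalities occur.\<close>

definition is_dirvec :: "mlam \<Rightarrow> real^3 \<Rightarrow> real^3 \<Rightarrow> real^3 \<Rightarrow> real^3 \<Rightarrow> bool" where
  "is_dirvec lam x y p v \<longleftrightarrow> lform v p = 0 \<and> lform v v = 1 \<and>
     (\<forall>u. is_ogeod (p, u) \<longrightarrow> gset (p, u) \<in> leaves lam \<longrightarrow> lform v u = 0) \<and>
     lform v x \<le> 0 \<and> 0 \<le> lform v y"

definition dirvec :: "mlam \<Rightarrow> real^3 \<Rightarrow> real^3 \<Rightarrow> real^3 \<Rightarrow> real^3" where
  "dirvec lam x y p = (if p \<in> lamset lam then (THE v. is_dirvec lam x y p v) else 0)"

definition tau :: "mlam \<Rightarrow> real^3 \<Rightarrow> (real^2^2) set \<Rightarrow> real^3" where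
  "tau lam x0 \<gamma> =
     integral\<^sup>L (seg_measure lam x0 (pact \<gamma> x0)) (dirvec lam x0 (pact \<gamma> x0))"

definition flam :: "mlam \<Rightarrow> real^3 \<Rightarrow> (real^2^2) set \<Rightarrow> real^3 \<Rightarrow> real^3" where
  "flam lam x0 \<gamma> v = pact \<gamma> v + tau lam x0 \<gamma>"

definition seg_mass :: "mlam \<Rightarrow> real^3 \<Rightarrow> real^3 \<Rightarrow> (real^3) set \<Rightarrow> real" where
  "seg_mass lam x y c = measure (seg_measure lam x y) (c - {x, y}) +
     measure (seg_measure lam x y) (c \<inter> {x, y}) / 2"

text \<open>A subdivision \<open>(r, s, l)\<close> of \<open>[x, y]\<close> consists of the parameters \<open>s 0 < \<dots> < s r\<close> of its points
  and of oriented leaves \<open>l j\<close> for \<open>j < r\<close>. A chosen leaf may pass through \<open>x\<close>; it is then oriented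
  so that \<open>y\<close> is on its right.\<close>

type_synonym subdiv = "nat \<times> (nat \<Rightarrow> real) \<times> (nat \<Rightarrow> ogeod)"

definition cell :: "real^3 \<Rightarrow> real^3 \<Rightarrow> (nat \<Rightarrow> real) \<Rightarrow> nat \<Rightarrow> (real^3) set" where
  "cell x y s j = hseg x y ` {s j..s (Suc j)}"

definition is_subdiv :: "mlam \<Rightarrow> real^3 \<Rightarrow> real^3 \<Rightarrow> subdiv \<Rightarrow> bool" where
  "is_subdiv lam x y = (\<lambda>(r, s, l). r > 0 \<and> s 0 = 0 \<and> s r = 1 \<and>
     (\<forall>j<r. s j < s (Suc j)) \<and>
     (\<forall>j. 0 < j \<longrightarrow> j < r \<longrightarrow> hseg x y (s j) \<notin> weighted_part lam) \<and>
     (\<forall>j<r. seg_mass lam x y (cell x y s j) > 0 \<longrightarrow>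
        is_ogeod (l j) \<and> gset (l j) \<in> leaves lam \<and> gset (l j) \<inter> cell x y s j \<noteq> {} \<and>
        side (l j) x \<ge> 0 \<and> side (l j) y \<le> 0))"

definition mesh :: "real^3 \<Rightarrow> real^3 \<Rightarrow> subdiv \<Rightarrow> real" where
  "mesh x y = (\<lambda>(r, s, l). Max ((\<lambda>j. hdist (hseg x y (s j)) (hseg x y (s (Suc j)))) ` {..<r}))"

primrec ordprod :: "(nat \<Rightarrow> 'a::field^2^2) \<Rightarrow> nat \<Rightarrow> 'a^2^2" where
  "ordprod f 0 = mat 1"
| "ordprod f (Suc n) = ordprod f n ** f n"

definition bend_prod :: "mlam \<Rightarrow> real^3 \<Rightarrow> real^3 \<Rightarrow> subdiv \<Rightarrow> complex^2^2" where
  "bend_prod lam x y = (\<lambda>(r, s, l). ordprod (\<lambda>j.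
     mexp (cmult (\<i> * of_real (seg_mass lam x y (cell x y s j)) / 2) (cmat (Xgen (l j))))) r)"

definition mesh_filter :: "mlam \<Rightarrow> real^3 \<Rightarrow> real^3 \<Rightarrow> subdiv filter" where
  "mesh_filter lam x y =
     (INF \<delta>\<in>{0<..}. principal {\<sigma>. is_subdiv lam x y \<sigma> \<and> mesh x y \<sigma> < \<delta>})"

definition bending :: "mlam \<Rightarrow> real^3 \<Rightarrow> real^3 \<Rightarrow> (complex^2^2) set" where
  "bending lam x y = psl (Lim (mesh_filter lam x y) (bend_prod lam x y))"

definition cpsl :: "(real^2^2) set \<Rightarrow> (complex^2^2) set" where
  "cpsl g = cmat ` g"

definition rho :: "mlam \<Rightarrow> real^3 \<Rightarrow> (real^2^2) set \<Rightarrow> (complex^2^2) set" where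
  "rho lam x0 \<gamma> = bending lam x0 (pact \<gamma> x0) \<otimes>\<^bsub>PSL2\<^esub> cpsl \<gamma>"

text \<open>The derivative at \<open>0\<close> of a curve \<open>[0, \<infinity>) \<rightarrow> PSL(2, \<complex>)\<close> starting at the identity, via the covering
  by SL(2, \<open>\<complex>\<close>), whose tangent space at the identity is \<open>sl(2, \<complex>)\<close>.\<close>

definition psl_derivative :: "(real \<Rightarrow> (complex^2^2) set) \<Rightarrow> complex^2^2 \<Rightarrow> bool" where
  "psl_derivative c X \<longleftrightarrow> (\<exists>A. A 0 = mat 1 \<and> (\<forall>t\<ge>0. det (A t) = 1 \<and> c t = psl (A t)) \<and>
     (A has_vector_derivative X) (at 0 within {0..}))"


section \<open>First group cohomology\<close>

text \<open>For a group \<open>G\<close> acting through \<open>a\<close> on an additive group \<open>V\<close>.\<close>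

definition Z1 :: "'g monoid \<Rightarrow> ('g \<Rightarrow> 'v \<Rightarrow> 'v) \<Rightarrow> 'v::ab_group_add set \<Rightarrow> ('g \<Rightarrow> 'v) monoid" where
  "Z1 G a V = \<lparr>carrier = {c \<in> carrier G \<rightarrow>\<^sub>E V.
       \<forall>\<alpha>\<in>carrier G. \<forall>\<beta>\<in>carrier G. c (\<alpha> \<otimes>\<^bsub>G\<^esub> \<beta>) = c \<alpha> + a \<alpha> (c \<beta>)},
     mult = (\<lambda>c d. \<lambda>\<gamma>\<in>carrier G. c \<gamma> + d \<gamma>), one = (\<lambda>\<gamma>\<in>carrier G. 0)\<rparr>"

definition B1 :: "'g monoid \<Rightarrow> ('g \<Rightarrow> 'v \<Rightarrow> 'v) \<Rightarrow> 'v::ab_group_add set \<Rightarrow> ('g \<Rightarrow> 'v) set" where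
  "B1 G a V = (\<lambda>v. \<lambda>\<gamma>\<in>carrier G. a \<gamma> v - v) ` V"

definition H1 :: "'g monoid \<Rightarrow> ('g \<Rightarrow> 'v \<Rightarrow> 'v) \<Rightarrow> 'v::ab_group_add set \<Rightarrow> ('g \<Rightarrow> 'v) set monoid" where
  "H1 G a V = Z1 G a V Mod B1 G a V"

definition H1_class ::
  "'g monoid \<Rightarrow> ('g \<Rightarrow> 'v \<Rightarrow> 'v) \<Rightarrow> 'v::ab_group_add set \<Rightarrow> ('g \<Rightarrow> 'v) \<Rightarrow> ('g \<Rightarrow> 'v) set" where
  "H1_class G a V c = B1 G a V #>\<^bsub>Z1 G a V\<^esub> c"

text \<open>The map to \<open>H\<^sup>1(G, W)\<close> induced by an equivariant additive map \<open>f\<close> from the coefficient module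
  of a class \<open>h\<close> to \<open>W\<close>; the union is over equal sets.\<close>

definition H1_map :: "'g monoid \<Rightarrow> ('g \<Rightarrow> 'w \<Rightarrow> 'w) \<Rightarrow> 'w::ab_group_add set \<Rightarrow> ('v \<Rightarrow> 'w) \<Rightarrow>
    ('g \<Rightarrow> 'v) set \<Rightarrow> ('g \<Rightarrow> 'w) set" where
  "H1_map G b W f h = (\<Union>c\<in>h. H1_class G b W (\<lambda>\<gamma>\<in>carrier G. f (c \<gamma>)))"

abbreviation subPSL :: "(real^2^2) set set \<Rightarrow> (real^2^2) set monoid" where
  "subPSL \<Gamma> \<equiv> PSL2\<lparr>carrier := \<Gamma>\<rparr>"

abbreviation cAd :: "(real^2^2) set \<Rightarrow> complex^2^2 \<Rightarrow> complex^2^2" where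
  "cAd \<gamma> \<equiv> Ad (cpsl \<gamma>)"

end

theory Submission
  imports Defs
begin

text \<open>Put \<open>Z n = \<i> X\<close> for the image \<open>X\<close> of a unit spacelike vector \<open>n\<close> in \<open>sl(2, \<real>)\<close>. Then
  \<open>Z n ** Z n = - 1\<close>, so the rotation by \<open>m\<close> around the leaf with normal \<open>n\<close> is
  \<open>cos (m/2) + sin (m/2) Z n = 1 + (m/2) Z n + O(m\<^sup>2)\<close>. An ordered product of such factors is
  \<open>1 + (1/2) \<Sum> m\<^sub>j Z n\<^sub>j\<close> up to an error that is quadratic in the total mass. For the lamination
  \<open>t\<lambda>\<close> the masses are \<open>t m\<^sub>j\<close>, and \<open>\<Sum> m\<^sub>j n\<^sub>j\<close> is a Riemann sum of the integral of the unit normal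
  field, which is \<open>\<tau>(\<gamma>)\<close>. In the limit of fine subdivisions, \<open>B(t) = 1 + (t/2) Z (\<tau>(\<gamma>)) + O(t\<^sup>2)\<close>
  (\<open>bend_limit\<close>). Hence the derivative at \<open>0\<close> is \<open>(\<i>/2) \<tau>(\<gamma>)\<close> as a cocycle, not only as a class, and
  the factor \<open>\<gamma>\<close> of \<open>\<rho>\<close> cancels against \<open>\<rho>\<^sub>0(\<gamma>)\<^sup>-\<^sup>1\<close>.

  Everything about a lamination is expressed through the unit normals of its leaves. Two
  disjoint geodesics have normals with \<open>\<bar>\<langle>n, m\<rangle>\<bar> \<ge> 1\<close>, so the difference of two normals oriented
  alike is causal. Pairing a causal vector with a point of the hyperbolic plane is, up to
  constants, its third coordinate. Consequently the leaves that separate \<open>x\<close> from \<open>y\<close> are linearly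
  ordered by \<open>n$3\<close>, and their normals are a Lipschitz function of the point at which they cross
  \<open>[x, y]\<close> (\<open>normals_lipschitz\<close>). This makes the normal field integrable, makes the Riemann sums converge
  (\<open>riemann_sum\<close>) and bounds the distance of the products of two fine subdivisions
  (\<open>cutprod_compare\<close>), so that the bending cocycle exists.

  That \<open>\<tau>\<close> is a cocycle amounts to additivity, \<open>\<tau>(x, z) = \<tau>(x, y) + \<tau>(y, z)\<close> (\<open>transl_additive\<close>), and
  to equivariance (\<open>transl_pact\<close>). A leaf that meets the triangle in none of its vertices separates one
  of them from the two others. So it suffices that the leaves that cut off the corner \<open>x\<close> have the same
  measure on \<open>[x, y]\<close> and on \<open>[x, z]\<close> (\<open>corner\<close>). This follows from the invariance under homotopies
  through transverse arcs, once a homotopy between segments is constructed that moves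
  each point along its leaf (\<open>leaf_homotopy\<close>). The same homotopies show that a leaf with an atom on one
  transverse arc has an atom on each segment that crosses it (\<open>weighted_atom\<close>). So only countably many
  points of a segment are weighted, and the subdivisions that the bending cocycle
  requires exist for every mesh size (\<open>ex_subdiv\<close>).\<close>

section \<open>Minkowski geometry\<close>

lemma bounded_bilinear_lform: "bounded_bilinear lform"
proof (rule bounded_bilinear.intro)
  show "\<exists>K. \<forall>a b. norm (lform a b) \<le> norm a * norm b * K"
  proof (intro exI[of _ 1] allI)
    fix a b :: "real^3"
    let ?a = "vector [a$1, a$2, - a$3] :: real^3"
    have "lform a b = ?a \<bullet> b" by (simp add: lform_def inner_vec_def sum_3)
    also have "\<bar>\<dots>\<bar> \<le> norm ?a * norm b" by (rule Cauchy_Schwarz_ineq2)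
    also have "norm ?a = norm a" by (simp add: norm_vec_def L2_set_def sum_3)
    finally show "norm (lform a b) \<le> norm a * norm b * 1" by simp
  qed
qed (simp_all add: lform_def algebra_simps)

interpretation lform: bounded_bilinear lform by (rule bounded_bilinear_lform)

lemma lform_commute: "lform v w = lform w v"
  by (simp add: lform_def algebra_simps)

lemma lform_le_norm: "\<bar>lform a b\<bar> \<le> norm a * norm b"
proof -
  let ?a = "vector [a$1, a$2, - a$3] :: real^3"
  have "lform a b = ?a \<bullet> b" by (simp add: lform_def inner_vec_def sum_3)
  also have "\<bar>\<dots>\<bar> \<le> norm ?a * norm b" by (rule Cauchy_Schwarz_ineq2)
  also have "norm ?a = norm a" by (simp add: norm_vec_def L2_set_def sum_3)
  finally show ?thesis .
qed

lemma norm_sq_3: "(norm (v::real^3))\<^sup>2 = (v$1)\<^sup>2 + (v$2)\<^sup>2 + (v$3)\<^sup>2"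
  by (simp add: norm_vec_def L2_set_def sum_3)

text \<open>The Gram determinant of three vectors for a form of signature \<open>(2, 1)\<close> is minus the square of
  their determinant.\<close>

lemma lform_gram:
  "lform y y * (lform v v * lform w w - (lform v w)\<^sup>2) =
     (lform y v)\<^sup>2 * lform w w - 2 * lform y v * lform y w * lform v w + (lform y w)\<^sup>2 * lform v v
     - (det (vector [y, v, w] :: real^3^3))\<^sup>2"
  by (simp add: lform_def det_3 power2_eq_square algebra_simps)

text \<open>The form is positive on the orthogonal complement of a timelike vector.\<close>

lemma lform_cauchy_schwarz_orth:
  assumes "lform y y < 0" "lform y v = 0" "lform y w = 0"
  shows "(lform v w)\<^sup>2 \<le> lform v v * lform w w"
proof -
  have "lform y y * (lform v v * lform w w - (lform v w)\<^sup>2) \<le> 0"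
    by (subst lform_gram) (simp add: assms)
  then show ?thesis using assms(1) by (auto simp: mult_le_0_iff)
qed

text \<open>This is the convex hull of the hyperbolic plane. Points of a segment and of a homotopy are formed
  here by affine combination and then projected radially; the values and the signs of \<open>lform n\<close> stay
  affine functions until the projection, which preserves their signs.\<close>

definition future :: "(real^3) set" where
  "future = {z. lform z z \<le> -1 \<and> z$3 > 0}"

lemma hyp2_subset_future: "hyp2 \<subseteq> future"
  by (auto simp: hyp2_def future_def)

lemma hyp2_future: "z \<in> hyp2 \<Longrightarrow> z \<in> future"
  using hyp2_subset_future by auto

lemma abs_cs2: "\<bar>a*b + c*d\<bar> \<le> sqrt (a\<^sup>2 + c\<^sup>2) * sqrt (b\<^sup>2 + d\<^sup>2)" for a b c d :: real
proof -
  have "(a*b + c*d)\<^sup>2 \<le> (a\<^sup>2 + c\<^sup>2) * (b\<^sup>2 + d\<^sup>2)"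
    using zero_le_power2[of "a*d - c*b"] by (simp add: power2_eq_square algebra_simps)
  then show ?thesis by (metis real_sqrt_abs real_sqrt_le_mono real_sqrt_mult)
qed

text \<open>The gap \<open>1 / (2 * z$3)\<close> between \<open>z\<close> and the light cone is the source of the constant in the lower
  estimate for causal vectors.\<close>

lemma future_bound:
  assumes "z \<in> future"
  shows "z$3 \<ge> 1" "sqrt ((z$1)\<^sup>2 + (z$2)\<^sup>2) \<le> z$3 - 1 / (2 * z$3)"
proof -
  have p: "z$3 > 0" and q: "(z$1)\<^sup>2 + (z$2)\<^sup>2 \<le> (z$3)\<^sup>2 - 1"
    using assms by (auto simp: future_def lform_def power2_eq_square)
  have "1 \<le> (z$3)\<^sup>2" using q sum_power2_ge_zero[of "z$1" "z$2"] by linarith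
  then have "1\<^sup>2 \<le> (z$3)\<^sup>2" by simp
  then show 1: "z$3 \<ge> 1" by (rule power2_le_imp_le) (use p in simp)
  have "(z$3 - 1 / (2 * z$3))\<^sup>2 = (z$3)\<^sup>2 - 2 * (z$3 * (1 / (2 * z$3))) + (1 / (2 * z$3))\<^sup>2"
    by (simp add: power2_diff)
  also have "z$3 * (1 / (2 * z$3)) = 1/2" using p by simp
  finally have "(z$3)\<^sup>2 - 1 \<le> (z$3 - 1 / (2 * z$3))\<^sup>2" by simp
  then have "sqrt ((z$1)\<^sup>2 + (z$2)\<^sup>2) \<le> \<bar>z$3 - 1 / (2 * z$3)\<bar>"
    using q by (intro real_le_lsqrt order_trans[OF q]) (auto intro: order_trans[OF q])
  also have "\<bar>z$3 - 1 / (2 * z$3)\<bar> = z$3 - 1 / (2 * z$3)"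
  proof -
    have "1 / (2 * z$3) \<le> 1" using 1 by (simp add: divide_le_eq)
    then show ?thesis using 1 by linarith
  qed
  finally show "sqrt ((z$1)\<^sup>2 + (z$2)\<^sup>2) \<le> z$3 - 1 / (2 * z$3)" .
qed

text \<open>For causal \<open>w\<close>, the number \<open>lform w z\<close> is comparable with \<open>- w$3\<close>, with constants that depend on \<open>z\<close>
  only. All comparisons between normals of leaves come from this fact.\<close>

lemma causal_upper:
  assumes w: "lform w w \<le> 0" and z: "z \<in> future"
  shows "\<bar>lform w z\<bar> \<le> 2 * z$3 * \<bar>w$3\<bar>"
proof -
  have "(w$1)\<^sup>2 + (w$2)\<^sup>2 \<le> (w$3)\<^sup>2" using w by (simp add: lform_def power2_eq_square)
  then have a: "sqrt ((w$1)\<^sup>2 + (w$2)\<^sup>2) \<le> \<bar>w$3\<bar>" by (metis real_sqrt_abs real_sqrt_le_mono)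
  have "0 < z$3" using future_bound(1)[OF z] by simp
  then have b: "sqrt ((z$1)\<^sup>2 + (z$2)\<^sup>2) \<le> z$3" using future_bound(2)[OF z]
    by (smt (verit) divide_nonneg_pos)
  have "\<bar>w$1 * z$1 + w$2 * z$2\<bar> \<le> \<bar>w$3\<bar> * z$3"
    using abs_cs2[of "w$1" "z$1" "w$2" "z$2"] a b
    by (smt (verit) mult_mono real_sqrt_ge_zero sum_power2_ge_zero)
  moreover have "\<bar>w$3 * z$3\<bar> = \<bar>w$3\<bar> * z$3" using \<open>0 < z$3\<close> by (simp add: abs_mult)
  ultimately have "\<bar>- (w$3 * z$3) + (w$1 * z$1 + w$2 * z$2)\<bar> \<le> 2 * (\<bar>w$3\<bar> * z$3)" by linarith
  then show ?thesis by (simp add: lform_def mult_ac add_ac)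
qed

lemma causal_lower:
  assumes w: "lform w w \<le> 0" and z: "z \<in> future"
  shows "\<bar>w$3\<bar> \<le> - 2 * z$3 * (sgn (w$3) * lform w z)"
proof -
  have "(w$1)\<^sup>2 + (w$2)\<^sup>2 \<le> (w$3)\<^sup>2" using w by (simp add: lform_def power2_eq_square)
  then have a: "sqrt ((w$1)\<^sup>2 + (w$2)\<^sup>2) \<le> \<bar>w$3\<bar>" by (metis real_sqrt_abs real_sqrt_le_mono)
  have z3: "0 < z$3" using future_bound(1)[OF z] by simp
  have *: "\<bar>w$1 * z$1 + w$2 * z$2\<bar> \<le> \<bar>w$3\<bar> * (z$3 - 1 / (2 * z$3))"
    using abs_cs2[of "w$1" "z$1" "w$2" "z$2"] a future_bound(2)[OF z]
    by (smt (verit) mult_mono real_sqrt_ge_zero sum_power2_ge_zero)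
  have "sgn (w$3) * (w$1 * z$1 + w$2 * z$2) \<le> \<bar>w$1 * z$1 + w$2 * z$2\<bar>"
    by (auto simp: sgn_real_def)
  moreover have "sgn (w$3) * lform w z = sgn (w$3) * (w$1 * z$1 + w$2 * z$2) - \<bar>w$3\<bar> * z$3"
    by (simp add: lform_def sgn_real_def algebra_simps)
  ultimately have "sgn (w$3) * lform w z \<le> - \<bar>w$3\<bar> / (2 * z$3)" using * by (simp add: algebra_simps)
  then show ?thesis using z3 by (simp add: field_simps)
qed

lemma causal_sign:
  assumes w: "lform w w \<le> 0" and z: "z \<in> future"
  shows "lform w z < 0 \<longleftrightarrow> w$3 > 0" "lform w z > 0 \<longleftrightarrow> w$3 < 0" "lform w z = 0 \<longleftrightarrow> w = 0"
proof -
  have l: "\<bar>w$3\<bar> \<le> - 2 * z$3 * (sgn (w$3) * lform w z)" by (rule causal_lower[OF w z])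
  have u: "\<bar>lform w z\<bar> \<le> 2 * z$3 * \<bar>w$3\<bar>" by (rule causal_upper[OF w z])
  have z3: "0 < z$3" using future_bound(1)[OF z] by simp
  have p: "w$3 > 0 \<Longrightarrow> lform w z < 0" using l z3
    by (simp add: sgn_real_def) (smt (verit) mult_nonneg_nonneg)
  have n: "w$3 < 0 \<Longrightarrow> lform w z > 0" using l z3
    by (simp add: sgn_real_def) (smt (verit) mult_nonneg_nonpos)
  have 0: "w$3 = 0 \<Longrightarrow> lform w z = 0" using u by simp
  show "lform w z < 0 \<longleftrightarrow> w$3 > 0" "lform w z > 0 \<longleftrightarrow> w$3 < 0" using p n 0 by (metis less_asym linorder_neqE_linordered_idom order_less_irrefl)+
  have "w$3 = 0 \<Longrightarrow> w = 0" using w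
    by (simp add: lform_def vec_eq_iff forall_3) (metis add_cancel_right_left sum_squares_le_zero_iff)
  then show "lform w z = 0 \<longleftrightarrow> w = 0" using p n by (metis lform.zero_left linorder_neqE_linordered_idom order_less_irrefl)
qed

lemma causal_norm:
  assumes w: "lform w w \<le> 0" shows "norm w \<le> 2 * \<bar>w$3\<bar>"
proof -
  have "(norm w)\<^sup>2 \<le> (2 * \<bar>w$3\<bar>)\<^sup>2"
  proof -
    have "w$1 * w$1 + w$2 * w$2 \<le> w$3 * w$3" using w by (simp add: lform_def)
    then have "w$1 * w$1 + w$2 * w$2 + w$3 * w$3 \<le> 4 * (w$3 * w$3)" using zero_le_square[of "w$3"] by linarith
    then have "(w$1)\<^sup>2 + (w$2)\<^sup>2 + (w$3)\<^sup>2 \<le> 4 * (w$3)\<^sup>2" by (simp add: power2_eq_square)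
    then show ?thesis by (simp add: norm_sq_3 power_mult_distrib)
  qed
  then show ?thesis by (rule power2_le_imp_le) simp
qed

lemma future_lform_le:
  assumes z: "z \<in> future" and z': "z' \<in> future" shows "lform z z' \<le> -1"
proof -
  have q: "(z$1)\<^sup>2 + (z$2)\<^sup>2 \<le> (z$3)\<^sup>2 - 1" "(z'$1)\<^sup>2 + (z'$2)\<^sup>2 \<le> (z'$3)\<^sup>2 - 1"
    using assms by (auto simp: future_def lform_def power2_eq_square)
  have b: "z$3 \<ge> 1" "z'$3 \<ge> 1" using future_bound assms by auto
  have "z$3 * z'$3 \<ge> 1" using b mult_mono[of 1 "z$3" 1 "z'$3"] by simp
  have "((z$1)\<^sup>2 + (z$2)\<^sup>2) * ((z'$1)\<^sup>2 + (z'$2)\<^sup>2) - (z$1 * z'$1 + z$2 * z'$2)\<^sup>2 = (z$1*z'$2 - z$2*z'$1)\<^sup>2"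
    by (simp add: power2_eq_square algebra_simps)
  then have "(z$1 * z'$1 + z$2 * z'$2)\<^sup>2 \<le> ((z$1)\<^sup>2 + (z$2)\<^sup>2) * ((z'$1)\<^sup>2 + (z'$2)\<^sup>2)"
    using zero_le_power2[of "z$1*z'$2 - z$2*z'$1"] by linarith
  also have "\<dots> \<le> ((z$3)\<^sup>2 - 1) * ((z'$3)\<^sup>2 - 1)"
    using q b by (intro mult_mono) auto
  also have "\<dots> \<le> (z$3 * z'$3 - 1)\<^sup>2"
  proof -
    have "(z$3 * z'$3 - 1)\<^sup>2 - ((z$3)\<^sup>2 - 1) * ((z'$3)\<^sup>2 - 1) = (z$3 - z'$3)\<^sup>2"
      by (simp add: power2_eq_square algebra_simps)
    then show ?thesis using zero_le_power2[of "z$3 - z'$3"] by linarith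
  qed
  finally have "z$1 * z'$1 + z$2 * z'$2 \<le> z$3 * z'$3 - 1"
    by (rule power2_le_imp_le) (use \<open>z$3 * z'$3 \<ge> 1\<close> in simp)
  then show ?thesis by (simp add: lform_def)
qed

lemma convex_future: "convex future"
proof (rule convexI)
  fix x y :: "real^3" and u v :: real
  assume *: "x \<in> future" "y \<in> future" "0 \<le> u" "0 \<le> v" "u + v = 1"
  have a: "lform x x \<le> -1" "lform y y \<le> -1" "lform x y \<le> -1" "x$3 > 0" "y$3 > 0"
    using * future_lform_le[of x y] by (auto simp: future_def)
  have "lform (u *\<^sub>R x + v *\<^sub>R y) (u *\<^sub>R x + v *\<^sub>R y) =
      u\<^sup>2 * lform x x + 2 * u * v * lform x y + v\<^sup>2 * lform y y"
    by (simp add: lform_def power2_eq_square algebra_simps)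
  also have "\<dots> \<le> u\<^sup>2 * (-1) + 2 * u * v * (-1) + v\<^sup>2 * (-1)"
    using a * by (intro add_mono mult_left_mono) auto
  also have "\<dots> = - (u + v)\<^sup>2" by (simp add: power2_eq_square algebra_simps)
  finally have "lform (u *\<^sub>R x + v *\<^sub>R y) (u *\<^sub>R x + v *\<^sub>R y) \<le> -1" using * by simp
  moreover have "(u *\<^sub>R x + v *\<^sub>R y)$3 > 0"
    using a * by simp (smt (verit) mult_nonneg_nonneg mult_pos_pos)
  ultimately show "u *\<^sub>R x + v *\<^sub>R y \<in> future" by (simp add: future_def)
qed

definition hproj :: "real^3 \<Rightarrow> real^3" where
  "hproj z = z /\<^sub>R sqrt (- lform z z)"

lemma hseg_hproj: "hseg x y s = hproj ((1 - s) *\<^sub>R x + s *\<^sub>R y)"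
  by (simp add: hseg_def hproj_def Let_def)

lemma future_sqrt_ge1: "z \<in> future \<Longrightarrow> sqrt (- lform z z) \<ge> 1"
  by (simp add: future_def)

lemma hproj_hyp2: "z \<in> future \<Longrightarrow> hproj z \<in> hyp2"
proof -
  assume z: "z \<in> future"
  define a where "a = sqrt (- lform z z)"
  have a: "a \<ge> 1" "lform z z = - (a * a)" using future_sqrt_ge1[OF z] z by (auto simp: a_def future_def)
  then show ?thesis using z
    by (simp add: hproj_def hyp2_def future_def lform.scaleR_left lform.scaleR_right field_simps flip: a_def)
qed

lemma hproj_id: "z \<in> hyp2 \<Longrightarrow> hproj z = z"
  by (simp add: hproj_def hyp2_def)

lemma lform_hproj: "lform n (hproj z) = lform n z / sqrt (- lform z z)"
  by (simp add: hproj_def lform.scaleR_right field_simps)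

text \<open>The denominator is at least \<open>1\<close> on the convex hull of the hyperbolic plane, where the
  projection is therefore Lipschitz on bounded sets.\<close>

lemma hproj_lipschitz:
  assumes z: "z \<in> future" "norm z \<le> R" and w: "w \<in> future" "norm w \<le> R"
  shows "norm (hproj z - hproj w) \<le> (1 + R\<^sup>2) * norm (z - w)"
proof -
  define a where "a = sqrt (- lform z z)"
  define b where "b = sqrt (- lform w w)"
  have ab: "a \<ge> 1" "b \<ge> 1" using future_sqrt_ge1 z w by (auto simp: a_def b_def)
  have a2: "a * a = - lform z z" "b * b = - lform w w"
    using z w by (auto simp: a_def b_def future_def)
  have R: "R \<ge> 0" using z norm_ge_zero[of z] by linarith
  have "(b - a) * (b + a) = lform (z - w) (z + w)"
    using a2 by (simp add: algebra_simps lform.add_right lform.diff_left lform_commute[of w z])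
  then have "\<bar>b - a\<bar> * (b + a) = \<bar>lform (z - w) (z + w)\<bar>"
    using ab by (metis abs_mult abs_of_nonneg add_nonneg_nonneg order_trans zero_le_one)
  also have "\<dots> \<le> norm (z - w) * (2 * R)"
    using lform_le_norm[of "z - w" "z + w"] norm_triangle_ineq[of z w] z w
    by (smt (verit) mult_left_mono norm_ge_zero)
  finally have "\<bar>b - a\<bar> * (b + a) \<le> norm (z - w) * (2 * R)" .
  moreover have "\<bar>b - a\<bar> * 2 \<le> \<bar>b - a\<bar> * (b + a)" using ab by (intro mult_left_mono) auto
  ultimately have ba: "\<bar>b - a\<bar> \<le> norm (z - w) * R" by simp
  have "hproj z - hproj w = (z - w) /\<^sub>R a + ((b - a) / (a * b)) *\<^sub>R w"
  proof -
    have "(b - a) / (a * b) = inverse a - inverse b" using ab by (simp add: field_simps)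
    then show ?thesis
      by (simp only: hproj_def flip: a_def b_def) (simp add: scaleR_diff_left scaleR_diff_right)
  qed
  then have "norm (hproj z - hproj w) \<le> norm ((z - w) /\<^sub>R a) + norm (((b - a) / (a * b)) *\<^sub>R w)"
    using norm_triangle_ineq by metis
  also have "norm ((z - w) /\<^sub>R a) \<le> norm (z - w)"
    using ab mult_right_mono[of "inverse a" 1 "norm (z - w)"] by (simp add: inverse_le_1_iff)
  also have "norm (((b - a) / (a * b)) *\<^sub>R w) \<le> (norm (z - w) * R) * R"
  proof -
    have "\<bar>b - a\<bar> / (a * b) \<le> \<bar>b - a\<bar>"
    proof -
      have "1 \<le> a * b" using ab mult_mono[of 1 a 1 b] by simp
      then show ?thesis using divide_left_mono[of 1 "a * b" "\<bar>b - a\<bar>"] by simp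
    qed
    then have "\<bar>b - a\<bar> / (a * b) \<le> norm (z - w) * R" using ba by simp
    then have "\<bar>b - a\<bar> / (a * b) * norm w \<le> norm (z - w) * R * R"
      using w R by (intro mult_mono) auto
    then show ?thesis using ab by (simp add: abs_mult)
  qed
  finally show ?thesis by (simp add: power2_eq_square algebra_simps)
qed

section \<open>Geodesics and their normals\<close>

definition geo :: "real^3 \<Rightarrow> (real^3) set" where
  "geo n = {z\<in>hyp2. lform n z = 0}"

lemma geo_minus: "geo (- n) = geo n"
  by (simp add: geo_def lform.minus_left)

lemma is_ogeodD:
  assumes "is_ogeod l"
  shows "lform (fst l) (fst l) = -1" "lform (snd l) (snd l) = 1" "lform (fst l) (snd l) = 0"
    "lform (snd l) (fst l) = 0" "fst l \<in> hyp2" "fst l \<in> future"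
  using assms hyp2_future by (auto simp: is_ogeod_def hyp2_def lform_commute)

lemma rnormal_orth: "lform (rnormal l) (fst l) = 0" "lform (rnormal l) (snd l) = 0"
  by (simp_all add: lform_rnormal side_orth)

lemma gpoint_hyp2:
  assumes l: "is_ogeod l" shows "gpoint l s \<in> hyp2"
proof -
  note d = is_ogeodD[OF l]
  let ?z = "gpoint l s"
  have 1: "lform ?z ?z = -1"
    using cosh_square_eq[of s] d
    by (simp add: gpoint_def lform.add_left lform.add_right lform.scaleR_left lform.scaleR_right power2_eq_square)
  have "lform ?z (fst l) = - cosh s"
    using d by (simp add: gpoint_def lform.add_left lform.scaleR_left)
  then have "lform ?z (fst l) < 0" using cosh_real_pos[of s] by linarith
  then have "?z$3 > 0" using causal_sign(1)[of ?z "fst l"] 1 d by simp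
  then show ?thesis using 1 by (simp add: hyp2_def)
qed

text \<open>A point of the plane orthogonal to the normal is a combination \<open>a p + b u\<close> with \<open>a\<^sup>2 - b\<^sup>2 = 1\<close> and
  \<open>a > 0\<close>, so \<open>(a, b)\<close> are a hyperbolic cosine and sine.\<close>

lemma gset_eq_geo:
  assumes l: "is_ogeod l" shows "gset l = geo (rnormal l)"
proof
  note d = is_ogeodD[OF l]
  show "gset l \<subseteq> geo (rnormal l)"
    using gpoint_hyp2[OF l] rnormal_orth[of l]
    by (auto simp: gset_def geo_def gpoint_def lform.add_right lform.scaleR_right)
  show "geo (rnormal l) \<subseteq> gset l"
  proof
    fix z assume z: "z \<in> geo (rnormal l)"
    obtain p u where pu: "l = (p, u)" by force
    let ?N = "rnormal l"
    have "lform ?N ?N *\<^sub>R z - lform z ?N *\<^sub>R ?N =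
      (lform z u * lform p u - lform z p * lform u u) *\<^sub>R p +
      (lform z p * lform p u - lform z u * lform p p) *\<^sub>R u"
      unfolding pu by (simp add: vec_eq_iff forall_3 lform_def rnormal_def cross3_simps Let_def algebra_simps)
    then have zz: "z = (- lform z p) *\<^sub>R p + lform z u *\<^sub>R u"
      using z d lform_rnormal_self[OF l] by (simp add: geo_def pu lform_commute)
    have "lform z z = - (lform z p)\<^sup>2 + (lform z u)\<^sup>2"
      by (subst (2) zz) (simp add: lform.add_right lform.diff_right lform.scaleR_right lform.minus_right power2_eq_square)
    then have sq: "(- lform z p)\<^sup>2 = 1 + (lform z u)\<^sup>2" using z by (simp add: geo_def hyp2_def)
    have "lform z p \<le> -1" using future_lform_le z d hyp2_future by (auto simp: geo_def pu)
    define s where "s = arsinh (lform z u)"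
    have "sinh s = lform z u" by (simp add: s_def)
    moreover have "cosh s = - lform z p"
    proof -
      have "(cosh s)\<^sup>2 = (- lform z p)\<^sup>2" using sq \<open>sinh s = _\<close> by (simp add: cosh_square_eq)
      then show ?thesis using \<open>lform z p \<le> -1\<close> cosh_real_pos[of s] by (simp add: power2_eq_iff)
    qed
    ultimately show "z \<in> gset l" using zz by (auto simp: gset_def gpoint_def pu intro: range_eqI[of _ _ s])
  qed
qed

lemma rnormal_wedge:
  "rnormal (a *\<^sub>R p + b *\<^sub>R u, c *\<^sub>R p + d *\<^sub>R u) = (a * d - b * c) *\<^sub>R rnormal (p, u)"
  by (simp add: vec_eq_iff forall_3 rnormal_def cross3_simps Let_def algebra_simps)

lemma ogeod_reverse:
  assumes l: "is_ogeod l"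
  shows "is_ogeod (fst l, - snd l)" "rnormal (fst l, - snd l) = - rnormal l" "gset (fst l, - snd l) = gset l"
proof -
  show 1: "is_ogeod (fst l, - snd l)"
    using l by (simp add: is_ogeod_def lform.minus_left lform.minus_right)
  show 2: "rnormal (fst l, - snd l) = - rnormal l"
    using rnormal_wedge[of 1 "fst l" 0 "snd l" 0 "-1"] by simp
  show "gset (fst l, - snd l) = gset l"
    using gset_eq_geo[OF 1] gset_eq_geo[OF l] by (simp add: 2 geo_minus)
qed

lemma ogeod_rebase:
  assumes l: "is_ogeod l" and p: "p \<in> gset l"
  obtains u where "is_ogeod (p, u)" "rnormal (p, u) = rnormal l" "gset (p, u) = gset l"
proof -
  note d = is_ogeodD[OF l]
  obtain s where s: "p = gpoint l s" using p by (auto simp: gset_def)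
  define u where "u = sinh s *\<^sub>R fst l + cosh s *\<^sub>R snd l"
  have "p \<in> hyp2" using s gpoint_hyp2[OF l] by simp
  moreover have "lform u u = 1" "lform p u = 0"
    using cosh_square_eq[of s] d
    by (simp_all add: s gpoint_def u_def lform.add_left lform.add_right lform.scaleR_left lform.scaleR_right power2_eq_square)
  ultimately have 1: "is_ogeod (p, u)" by (simp add: is_ogeod_def)
  have "cosh s * cosh s - sinh s * sinh s = 1"
    using cosh_square_eq[of s] by (simp add: power2_eq_square)
  then have 2: "rnormal (p, u) = rnormal l"
    unfolding s gpoint_def u_def by (subst rnormal_wedge) simp
  have 3: "gset (p, u) = gset l" using gset_eq_geo[OF 1] gset_eq_geo[OF l] 2 by simp
  show thesis by (rule that[OF 1 2 3])
qed

text \<open>The vector orthogonal to \<open>n\<close> and \<open>m\<close> has square \<open>\<langle>n, m\<rangle>\<^sup>2 - 1 < 0\<close>; rescaled, it is a common point.\<close>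

lemma spacelike_pair_meet:
  assumes "lform n n = 1" "lform m m = 1" "\<bar>lform n m\<bar> < 1"
  obtains z where "z \<in> geo n" "z \<in> geo m"
proof -
  define v where "v = rnormal (n, m)"
  have "lform v v = (lform n m)^2 - lform n n * lform m m"
    unfolding v_def by (simp add: lform_def rnormal_def cross3_simps Let_def power2_eq_square algebra_simps)
  then have neg: "lform v v < 0" using assms by (simp add: abs_square_less_1)
  have o: "lform n v = 0" "lform m v = 0"
    using rnormal_orth[of "(n, m)"] by (simp_all add: v_def lform_commute)
  define a where "a = sqrt (- lform v v)"
  have a: "a > 0" "a * a = - lform v v" using neg by (auto simp: a_def)
  have v3: "v$3 \<noteq> 0"
  proof
    assume "v$3 = 0"
    then have "lform v v \<ge> 0" by (simp add: lform_def)
    then show False using neg by simp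
  qed
  define z where "z = (sgn (v$3) / a) *\<^sub>R v"
  have "sgn (v$3) * sgn (v$3) = 1" using v3 by (simp add: sgn_real_def)
  then have "lform z z = lform v v / (a * a)"
    by (simp add: z_def lform.scaleR_left lform.scaleR_right flip: mult.assoc)
  then have "lform z z = -1" using a neg by simp
  moreover have "z$3 > 0" using v3 a by (simp add: z_def sgn_real_def)
  ultimately have "z \<in> hyp2" by (simp add: hyp2_def)
  then show thesis using that[of z] o by (simp add: geo_def z_def lform.scaleR_right)
qed

text \<open>This bounds the normals of all leaves that pass through a bounded region.\<close>

lemma unit_orth_norm:
  assumes n: "lform n n = 1" "lform n z = 0" and z: "z \<in> future" shows "norm n \<le> 2 * z$3"
proof -
  have z3: "z$3 \<ge> 1" using future_bound(1)[OF z] .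
  have zz: "(z$1)\<^sup>2 + (z$2)\<^sup>2 \<le> (z$3)\<^sup>2 - 1"
    using z by (auto simp: future_def lform_def power2_eq_square)
  have nn: "(n$1)\<^sup>2 + (n$2)\<^sup>2 = 1 + (n$3)\<^sup>2" using n by (simp add: lform_def power2_eq_square)
  have nz: "n$3 * z$3 = n$1 * z$1 + n$2 * z$2" using n by (simp add: lform_def)
  have "(n$3)\<^sup>2 * (z$3)\<^sup>2 = (n$1 * z$1 + n$2 * z$2)\<^sup>2" by (simp flip: nz power_mult_distrib)
  also have "\<dots> \<le> ((n$1)\<^sup>2 + (n$2)\<^sup>2) * ((z$1)\<^sup>2 + (z$2)\<^sup>2)"
  proof -
    have "((n$1)\<^sup>2 + (n$2)\<^sup>2) * ((z$1)\<^sup>2 + (z$2)\<^sup>2) - (n$1 * z$1 + n$2 * z$2)\<^sup>2 = (n$1*z$2 - n$2*z$1)\<^sup>2"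
      by (simp add: power2_eq_square algebra_simps)
    then show ?thesis using zero_le_power2[of "n$1*z$2 - n$2*z$1"] by linarith
  qed
  also have "\<dots> \<le> (1 + (n$3)\<^sup>2) * ((z$3)\<^sup>2 - 1)"
    unfolding nn using zz by (intro mult_left_mono) auto
  finally have "(n$3)\<^sup>2 \<le> (z$3)\<^sup>2 - 1" by (simp add: algebra_simps)
  then have "(norm n)\<^sup>2 \<le> (2 * z$3)\<^sup>2"
  proof -
    have "(norm n)\<^sup>2 = 1 + 2 * (n$3)\<^sup>2" using nn by (simp add: norm_sq_3)
    moreover have "(2 * z$3)\<^sup>2 = 4 * (z$3)\<^sup>2" by (simp add: power_mult_distrib)
    ultimately show ?thesis using \<open>(n$3)\<^sup>2 \<le> (z$3)\<^sup>2 - 1\<close> zero_le_power2[of "z$3"] by linarith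
  qed
  then show ?thesis by (rule power2_le_imp_le) (use z3 in simp)
qed

text \<open>Each leaf contributes both of its unit normals.\<close>

definition normals :: "(real^3) set set \<Rightarrow> (real^3) set" where
  "normals \<L> = {rnormal l | l. is_ogeod l \<and> gset l \<in> \<L>}"

text \<open>No leaf contains both \<open>x\<close> and \<open>y\<close>; for \<open>x \<noteq> y\<close> this says that the segment is transverse.\<close>

definition no_common_leaf :: "(real^3) set set \<Rightarrow> real^3 \<Rightarrow> real^3 \<Rightarrow> bool" where
  "no_common_leaf \<L> x y \<longleftrightarrow> (\<forall>n\<in>normals \<L>. \<not> (lform n x = 0 \<and> lform n y = 0))"

text \<open>The normals of the leaves that meet \<open>[x, y]\<close>, oriented from \<open>x\<close> to \<open>y\<close>.\<close>

definition seps :: "(real^3) set set \<Rightarrow> real^3 \<Rightarrow> real^3 \<Rightarrow> (real^3) set" where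
  "seps \<L> x y = {n\<in>normals \<L>. lform n x \<le> 0 \<and> 0 \<le> lform n y}"

lemma no_common_leaf_commute: "no_common_leaf \<L> x y \<longleftrightarrow> no_common_leaf \<L> y x"
  by (auto simp: no_common_leaf_def)

lemma normals_unit: "n \<in> normals \<L> \<Longrightarrow> lform n n = 1"
  by (auto simp: normals_def lform_rnormal_self)

lemma normals_geo: "n \<in> normals \<L> \<Longrightarrow> geo n \<in> \<L>"
  by (auto simp: normals_def gset_eq_geo)

lemma normals_minus: "n \<in> normals \<L> \<Longrightarrow> - n \<in> normals \<L>"
proof -
  assume "n \<in> normals \<L>"
  then obtain l where l: "is_ogeod l" "gset l \<in> \<L>" "n = rnormal l" by (auto simp: normals_def)
  show ?thesis unfolding normals_def
    using ogeod_reverse[OF l(1)] l by (intro CollectI exI[of _ "(fst l, - snd l)"]) simp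
qed

locale geodesic_lam =
  fixes \<L> :: "(real^3) set set"
  assumes gl: "geodesic_lamination \<L>"
begin

lemma leaf_normals:
  assumes "k \<in> \<L>" obtains n where "n \<in> normals \<L>" "k = geo n"
proof -
  obtain l where l: "is_ogeod l" "k = gset l" using assms gl by (auto simp: geodesic_lamination_def)
  then have "rnormal l \<in> normals \<L>" using assms unfolding normals_def by (intro CollectI exI[of _ l]) simp
  then show thesis using that[of "rnormal l"] gset_eq_geo[OF l(1)] l(2) by simp
qed

lemma normals_iff: "n \<in> normals \<L> \<longleftrightarrow> lform n n = 1 \<and> geo n \<in> \<L>"
proof
  assume n: "lform n n = 1 \<and> geo n \<in> \<L>"
  then obtain l where l: "is_ogeod l" "geo n = gset l" using gl by (auto simp: geodesic_lamination_def)
  have "\<forall>z\<in>gset l. lform n z = 0" unfolding l(2)[symmetric] by (simp add: geo_def)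
  then have nc: "n = lform n (rnormal l) *\<^sub>R rnormal l"
    using orth_rnormal[OF l(1)] by (simp add: gset_orth)
  define c where "c = lform n (rnormal l)"
  have "lform n n = c * c * lform (rnormal l) (rnormal l)"
    by (subst (1 2) nc) (simp add: lform.scaleR_left lform.scaleR_right c_def)
  then have "c * c = 1" using n lform_rnormal_self[OF l(1)] by simp
  then have "c = 1 \<or> c = -1" by (simp add: square_eq_1_iff)
  moreover have "rnormal l \<in> normals \<L>" using l n unfolding normals_def by (intro CollectI exI[of _ l]) simp
  ultimately show "n \<in> normals \<L>" using nc normals_minus by (fastforce simp: c_def)
qed (auto simp: normals_unit normals_geo)

lemma lam_mem:
  assumes z: "z \<in> hyp2" shows "z \<in> \<Union>\<L> \<longleftrightarrow> (\<exists>n\<in>normals \<L>. lform n z = 0)"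
proof
  assume "z \<in> \<Union>\<L>"
  then obtain k where k: "k \<in> \<L>" "z \<in> k" by blast
  obtain n where "n \<in> normals \<L>" "k = geo n" using leaf_normals[OF k(1)] .
  then show "\<exists>n\<in>normals \<L>. lform n z = 0" using k by (auto simp: geo_def)
next
  assume "\<exists>n\<in>normals \<L>. lform n z = 0"
  then obtain n where n: "n \<in> normals \<L>" "lform n z = 0" by blast
  then have "z \<in> geo n" using z by (simp add: geo_def)
  then show "z \<in> \<Union>\<L>" using normals_geo[OF n(1)] by blast
qed

lemma normals_ge1:
  assumes n: "n \<in> normals \<L>" and m: "m \<in> normals \<L>" shows "\<bar>lform n m\<bar> \<ge> 1"
proof (rule ccontr)
  assume "\<not> ?thesis"
  then obtain z where z: "z \<in> geo n" "z \<in> geo m"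
    using spacelike_pair_meet[OF normals_unit[OF n] normals_unit[OF m]] by (auto simp: not_le)
  have "disjoint \<L>" using gl by (simp add: geodesic_lamination_def)
  then have "geo n = geo m"
    using disjointD[OF _ normals_geo[OF n] normals_geo[OF m]] z by blast
  obtain l where l: "is_ogeod l" "m = rnormal l" using m by (auto simp: normals_def)
  have "\<forall>z\<in>gset l. lform n z = 0"
    using \<open>geo n = geo m\<close> gset_eq_geo[OF l(1)] l(2) by (auto simp: geo_def)
  then have nc: "n = lform n m *\<^sub>R m"
    using orth_rnormal[OF l(1)] l(2) by (simp add: gset_orth)
  then have "lform n n = lform n m * lform n m"
    using lform.scaleR_right[of n "lform n m" m] by simp
  then have "lform n m = 1 \<or> lform n m = -1" using normals_unit[OF n] by (simp add: square_eq_1_iff)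
  then have "\<bar>lform n m\<bar> = 1" by auto
  then show False using \<open>\<not> 1 \<le> \<bar>lform n m\<bar>\<close> by simp
qed

text \<open>\<open>lform (n - m) (n - m) = 2 - 2 * lform n m\<close>, and similarly for the sum.\<close>

lemma normals_diff_causal:
  assumes n: "n \<in> normals \<L>" and m: "m \<in> normals \<L>"
  shows "lform (n - m) (n - m) \<le> 0 \<or> lform (n + m) (n + m) \<le> 0"
  using normals_ge1[OF n m] normals_unit[OF n] normals_unit[OF m]
  by (auto simp: lform.add_left lform.add_right lform.diff_left lform.diff_right lform_commute[of m n])

text \<open>A causal vector that is orthogonal to a point of the hyperbolic plane vanishes.\<close>

lemma normals_same_leaf:
  assumes n: "n \<in> normals \<L>" and m: "m \<in> normals \<L>" and z: "z \<in> future" "lform n z = 0" "lform m z = 0"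
  shows "m = n \<or> m = - n"
  using normals_diff_causal[OF n m] causal_sign(3)[of "n - m" z] causal_sign(3)[of "n + m" z] z
  by (auto simp: lform.add_left lform.diff_left add_eq_0_iff)

text \<open>Normals that are oriented alike cannot have a causal sum: the sum would be nonpositive at \<open>x\<close> and
  nonnegative at \<open>y\<close>, while a nonzero causal vector has one strict sign on the whole hyperbolic plane.\<close>

lemma seps_causal:
  assumes n: "n \<in> seps \<L> x y" and m: "m \<in> seps \<L> x y" and xy: "x \<in> future" "y \<in> future" "no_common_leaf \<L> x y"
  shows "lform (n - m) (n - m) \<le> 0"
proof (rule ccontr)
  have nm: "n \<in> normals \<L>" "m \<in> normals \<L>" using n m by (auto simp: seps_def)
  assume "\<not> ?thesis"
  then have c: "lform (n + m) (n + m) \<le> 0" using normals_diff_causal nm by blast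
  have "lform (n + m) x \<le> 0" "0 \<le> lform (n + m) y" using n m by (auto simp: seps_def lform.add_left)
  then have "n + m = 0"
    using causal_sign[OF c, of x] causal_sign[OF c, of y] xy by linarith
  then have "m = - n" by (simp add: add_eq_0_iff)
  then have "lform n x = 0" "lform n y = 0" using n m by (auto simp: seps_def lform.minus_left)
  then show False using xy nm by (auto simp: no_common_leaf_def)
qed

end

lemma cosh_ge: "1 + r\<^sup>2 / 2 \<le> cosh (r::real)"
proof -
  have "\<bar>r / 2\<bar> \<le> \<bar>sinh (r / 2)\<bar>" using real_le_abs_sinh[of "r/2"] by (simp add: sinh_field_def exp_minus)
  then have "(r / 2)\<^sup>2 \<le> (sinh (r / 2))\<^sup>2" by (simp only: abs_le_square_iff)
  moreover have "cosh r = 1 + 2 * (sinh (r / 2))\<^sup>2"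
    using cosh_double[of "r / 2"] cosh_square_eq[of "r / 2"] by simp
  ultimately show ?thesis by (simp add: power_divide)
qed

lemma abs_less_iff_sq: "0 < e \<Longrightarrow> \<bar>a\<bar> < e \<longleftrightarrow> a\<^sup>2 < e\<^sup>2" for a e :: real
  using abs_le_square_iff[of e a] by force

lemma one_less_sq: "a < -1 \<Longrightarrow> 1 < a\<^sup>2" for a :: real
  using abs_less_iff_sq[of 1 a] abs_le_square_iff[of a 1] by force

section \<open>Hyperbolic segments\<close>

definition cseg :: "real^3 \<Rightarrow> real^3 \<Rightarrow> real \<Rightarrow> real^3" where
  "cseg x y s = (1 - s) *\<^sub>R x + s *\<^sub>R y"

lemma hseg_cseg: "hseg x y s = hproj (cseg x y s)"
  by (simp add: hseg_hproj cseg_def)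

lemma cseg_future: "x \<in> future \<Longrightarrow> y \<in> future \<Longrightarrow> s \<in> {0..1} \<Longrightarrow> cseg x y s \<in> future"
  using convexD[OF convex_future, of x y "1 - s" s] by (simp add: cseg_def)

lemma hseg_hyp2: "x \<in> future \<Longrightarrow> y \<in> future \<Longrightarrow> s \<in> {0..1} \<Longrightarrow> hseg x y s \<in> hyp2"
  by (simp add: hseg_cseg hproj_hyp2 cseg_future)

lemma hseg_0: "x \<in> hyp2 \<Longrightarrow> hseg x y 0 = x" and hseg_1: "y \<in> hyp2 \<Longrightarrow> hseg x y 1 = y"
  by (simp_all add: hseg_cseg cseg_def hproj_id)

lemma hseg_reverse: "hseg y x s = hseg x y (1 - s)"
  by (simp add: hseg_cseg cseg_def add.commute)

lemma lform_cseg: "lform n (cseg x y s) = (1 - s) * lform n x + s * lform n y"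
  by (simp add: cseg_def lform.add_right lform.scaleR_right)

lemma sgn_lform_hproj: "z \<in> future \<Longrightarrow> sgn (lform n (hproj z)) = sgn (lform n z)"
  using future_sqrt_ge1[of z] by (auto simp: lform_hproj sgn_real_def zero_less_divide_iff divide_less_0_iff)

lemma lform_hproj_eq0: "z \<in> future \<Longrightarrow> lform n (hproj z) = 0 \<longleftrightarrow> lform n z = 0"
  using sgn_lform_hproj[of z n] by (metis sgn_0_0)

lemma future_coords_cseg:
  assumes "x \<in> future" "y \<in> future" "s \<in> {0..1}" shows "cseg x y s $ 3 \<le> x$3 + y$3"
proof -
  have "x$3 \<ge> 0" "y$3 \<ge> 0" using future_bound(1) assms by fastforce+
  then show ?thesis using assms mult_right_mono[of "1 - s" 1 "x$3"] mult_right_mono[of s 1 "y$3"]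
    by (simp add: cseg_def)
qed

lemma hyp2_lform_lt:
  assumes x: "x \<in> hyp2" and y: "y \<in> hyp2" and ne: "x \<noteq> y" shows "lform x y < -1"
proof (rule ccontr)
  assume "\<not> ?thesis"
  then have e: "lform x y = -1" using future_lform_le[of x y] hyp2_future x y by fastforce
  then have "lform (x - y) (x - y) = 0" "lform (x - y) x = 0"
    using x y by (simp_all add: lform.diff_left lform.diff_right lform_commute[of y x] hyp2_def)
  then have "x - y = 0" using causal_sign(3)[of "x - y" x] hyp2_future[OF x] by simp
  then show False using ne by simp
qed

text \<open>The Gram determinant of two points of the chord \<open>[x, y]\<close> is \<open>(s - t)\<^sup>2\<close> times that of \<open>x\<close> and \<open>y\<close>.\<close>

lemma lform_hseg_sq:
  assumes x: "x \<in> hyp2" and y: "y \<in> hyp2" and s: "s \<in> {0..1}" and t: "t \<in> {0..1}"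
  shows "(s - t)\<^sup>2 * ((lform x y)\<^sup>2 - 1) =
    ((lform (hseg x y s) (hseg x y t))\<^sup>2 - 1) * (lform (cseg x y s) (cseg x y s) * lform (cseg x y t) (cseg x y t))"
proof -
  define a where "a = sqrt (- lform (cseg x y s) (cseg x y s))"
  define b where "b = sqrt (- lform (cseg x y t) (cseg x y t))"
  have f: "cseg x y s \<in> future" "cseg x y t \<in> future" using cseg_future hyp2_future x y s t by auto
  have a1: "a \<ge> 1" "b \<ge> 1" using future_sqrt_ge1 f by (auto simp: a_def b_def)
  have aa: "lform (cseg x y s) (cseg x y s) = - (a*a)" "lform (cseg x y t) (cseg x y t) = - (b*b)"
    using f by (auto simp: a_def b_def future_def)
  have "lform (hseg x y s) (hseg x y t) = lform (cseg x y s) (cseg x y t) / (a * b)"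
    by (simp add: hseg_cseg hproj_def lform.scaleR_left lform.scaleR_right field_simps flip: a_def b_def)
  then have "((lform (hseg x y s) (hseg x y t))\<^sup>2 - 1) * ((a*a) * (b*b)) =
      (lform (cseg x y s) (cseg x y t))\<^sup>2 - (a*a) * (b*b)"
  proof -
    assume e: "lform (hseg x y s) (hseg x y t) = lform (cseg x y s) (cseg x y t) / (a * b)"
    then have "lform (hseg x y s) (hseg x y t) * (a * b) = lform (cseg x y s) (cseg x y t)" using a1 by simp
    then have "(lform (hseg x y s) (hseg x y t))\<^sup>2 * (a * b)\<^sup>2 = (lform (cseg x y s) (cseg x y t))\<^sup>2"
      by (metis power_mult_distrib)
    then show ?thesis by (simp add: power2_eq_square algebra_simps)
  qed
  also have "\<dots> = (lform (cseg x y s) (cseg x y t))\<^sup>2 - lform (cseg x y s) (cseg x y s) * lform (cseg x y t) (cseg x y t)"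
    by (simp add: aa)
  also have "\<dots> = (s - t)\<^sup>2 * ((lform x y)\<^sup>2 - lform x x * lform y y)"
  proof -
    have e: "lform (cseg x y s) (cseg x y t) = (1-s)*(1-t)*lform x x + ((1-s)*t+s*(1-t))*lform x y + s*t*lform y y" for s t
      unfolding cseg_def by (simp add: lform.add_left lform.add_right lform.scaleR_left lform.scaleR_right lform_commute[of y x])
        (simp add: algebra_simps)
    show ?thesis unfolding e by (simp add: power2_eq_square algebra_simps)
  qed
  finally show ?thesis using x y by (simp add: aa hyp2_def)
qed

text \<open>By \<open>lform_hseg_sq\<close>, points with different parameters have \<open>\<langle>a, b\<rangle>\<^sup>2 > 1\<close>, hence are different.\<close>

lemma hseg_inj:
  assumes x: "x \<in> hyp2" and y: "y \<in> hyp2" and ne: "x \<noteq> y" and s: "s \<in> {0..1}" and t: "t \<in> {0..1}"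
    and e: "hseg x y s = hseg x y t"
  shows "s = t"
proof -
  have "(lform (hseg x y s) (hseg x y t))\<^sup>2 = 1"
    using hseg_hyp2[of x y t] hyp2_future x y t by (simp add: e hyp2_def)
  then have "(s - t)\<^sup>2 * ((lform x y)\<^sup>2 - 1) = 0" using lform_hseg_sq[OF x y s t] by simp
  moreover have "(lform x y)\<^sup>2 > 1" using hyp2_lform_lt[OF x y ne] by (rule one_less_sq)
  ultimately show ?thesis by simp
qed

lemma norm_cseg: "s \<in> {0..1} \<Longrightarrow> norm (cseg x y s) \<le> norm x + norm y"
proof -
  assume s: "s \<in> {0..1}"
  have "norm (cseg x y s) \<le> norm ((1-s) *\<^sub>R x) + norm (s *\<^sub>R y)" unfolding cseg_def by (rule norm_triangle_ineq)
  also have "\<dots> \<le> norm x + norm y"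
    using s mult_right_mono[of "1 - s" 1 "norm x"] mult_right_mono[of s 1 "norm y"] by simp
  finally show ?thesis .
qed

lemma hseg_lipschitz:
  assumes x: "x \<in> hyp2" and y: "y \<in> hyp2"
  obtains C where "C > 0" "\<And>s t. s \<in> {0..1} \<Longrightarrow> t \<in> {0..1} \<Longrightarrow> norm (hseg x y s - hseg x y t) \<le> C * \<bar>s - t\<bar>"
proof
  let ?R = "norm x + norm y"
  let ?C = "(1 + ?R\<^sup>2) * (norm (y - x) + 1)"
  show "?C > 0" by (intro mult_pos_pos add_pos_nonneg add_nonneg_pos) auto
  fix s t :: real assume st: "s \<in> {0..1}" "t \<in> {0..1}"
  have "norm (hseg x y s - hseg x y t) \<le> (1 + ?R\<^sup>2) * norm (cseg x y s - cseg x y t)"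
    unfolding hseg_cseg using st x y hyp2_future by (intro hproj_lipschitz cseg_future norm_cseg) auto
  also have "cseg x y s - cseg x y t = (s - t) *\<^sub>R (y - x)" by (simp add: cseg_def algebra_simps)
  also have "norm \<dots> \<le> \<bar>s - t\<bar> * (norm (y - x) + 1)" by (simp add: distrib_left)
  then have "(1 + ?R\<^sup>2) * norm ((s - t) *\<^sub>R (y - x)) \<le> (1 + ?R\<^sup>2) * (\<bar>s - t\<bar> * (norm (y - x) + 1))"
    by (intro mult_left_mono) auto
  finally show "norm (hseg x y s - hseg x y t) \<le> ?C * \<bar>s - t\<bar>"
    by (simp only: mult_ac)
qed

section \<open>Hyperbolic distance\<close>

lemma hdist_commute: "hdist x y = hdist y x"
  by (simp add: hdist_def lform_commute)

lemma cosh_hdist: "x \<in> hyp2 \<Longrightarrow> y \<in> hyp2 \<Longrightarrow> cosh (hdist x y) = - lform x y"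
  using future_lform_le[of x y] hyp2_future by (fastforce simp: hdist_def cosh_arcosh_real)

lemma hdist_nonneg: "x \<in> hyp2 \<Longrightarrow> y \<in> hyp2 \<Longrightarrow> hdist x y \<ge> 0"
  using future_lform_le[of x y] hyp2_future by (fastforce simp: hdist_def)

lemma hdist_le:
  assumes x: "x \<in> hyp2" and y: "y \<in> hyp2" and c: "- lform x y \<le> cosh r" and r: "r \<ge> 0"
  shows "hdist x y \<le> r"
  using cosh_hdist[OF x y] hdist_nonneg[OF x y] c r by (metis cosh_real_nonneg_le_iff)

lemma hdist_le_norm:
  assumes x: "x \<in> hyp2" and y: "y \<in> hyp2" shows "hdist x y \<le> norm (x - y)"
proof (rule hdist_le[OF x y])
  have "lform (x - y) (x - y) = -2 - 2 * lform x y"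
    using x y by (simp add: lform.diff_left lform.diff_right lform_commute[of y x] hyp2_def)
  then have "- lform x y = 1 + lform (x - y) (x - y) / 2" by (simp add: field_simps)
  also have "\<dots> \<le> 1 + (norm (x - y))\<^sup>2 / 2"
    using lform_le_norm[of "x - y" "x - y"] by (simp add: power2_eq_square)
  also have "\<dots> \<le> cosh (norm (x - y))" by (rule cosh_ge)
  finally show "- lform x y \<le> cosh (norm (x - y))" .
qed simp

text \<open>With the components \<open>v\<close> and \<open>w\<close> of \<open>x\<close> and \<open>z\<close> orthogonal to \<open>y\<close>, this is the Cauchy-Schwarz inequality
  \<open>\<langle>v, w\<rangle> \<ge> - sinh (d x y) sinh (d y z)\<close> together with the addition theorem of \<open>cosh\<close>.\<close>

lemma hdist_triangle:
  assumes x: "x \<in> hyp2" and y: "y \<in> hyp2" and z: "z \<in> hyp2"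
  shows "hdist x z \<le> hdist x y + hdist y z"
proof (rule hdist_le[OF x z])
  define v where "v = x + lform x y *\<^sub>R y"
  define w where "w = z + lform y z *\<^sub>R y"
  have l: "lform x x = -1" "lform y y = -1" "lform z z = -1" using x y z by (auto simp: hyp2_def)
  have o: "lform y v = 0" "lform y w = 0"
    using l by (simp_all add: v_def w_def lform.add_right lform.scaleR_right lform_commute)
  have vv: "lform v v = (lform x y)\<^sup>2 - 1" "lform w w = (lform y z)\<^sup>2 - 1" "lform v w = lform x z + lform x y * lform y z"
    using l by (simp_all add: v_def w_def lform.add_right lform.add_left lform.scaleR_left lform.scaleR_right lform_commute power2_eq_square
      lform_commute[of y x] lform_commute[of z y] algebra_simps)
  have c: "cosh (hdist x y) = - lform x y" "cosh (hdist y z) = - lform y z" using cosh_hdist x y z by auto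
  have "(lform v w)\<^sup>2 \<le> lform v v * lform w w"
    by (rule lform_cauchy_schwarz_orth[OF _ o]) (simp add: l)
  also have "\<dots> = (sinh (hdist x y) * sinh (hdist y z))\<^sup>2"
    by (simp add: power_mult_distrib sinh_square_eq c vv)
  finally have "\<bar>lform v w\<bar> \<le> sinh (hdist x y) * sinh (hdist y z)"
    using hdist_nonneg x y z by (subst (asm) abs_le_square_iff[symmetric]) simp
  then show "- lform x z \<le> cosh (hdist x y + hdist y z)"
    using vv by (simp add: cosh_add c)
  show "hdist x y + hdist y z \<ge> 0" using hdist_nonneg x y z by simp
qed

text \<open>This is what converts the mesh of a subdivision, which is measured by the hyperbolic distance,
  into lengths of parameter intervals.\<close>

lemma hseg_param_close:
  assumes x: "x \<in> hyp2" and y: "y \<in> hyp2" and ne: "x \<noteq> y" and e: "e > 0"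
  obtains d where "d > 0"
    "\<And>s t. s \<in> {0..1} \<Longrightarrow> t \<in> {0..1} \<Longrightarrow> hdist (hseg x y s) (hseg x y t) < d \<Longrightarrow> \<bar>s - t\<bar> < e"
proof -
  define R where "R = (norm x + norm y)\<^sup>2 + 1"
  define q where "q = (lform x y)\<^sup>2 - 1"
  have q: "q > 0" using one_less_sq[OF hyp2_lform_lt[OF x y ne]] by (simp add: q_def)
  have R: "R > 0" by (simp add: R_def add_nonneg_pos)
  define c where "c = sqrt (1 + e\<^sup>2 * q / (R * R))"
  have c: "c > 1" "c\<^sup>2 = 1 + e\<^sup>2 * q / (R * R)" using q R e by (auto simp: c_def intro: add_nonneg_nonneg)
  show thesis
  proof
    show "arcosh c > 0" using c(1) by simp
    fix s t :: real assume s: "s \<in> {0..1}" and t: "t \<in> {0..1}" and d: "hdist (hseg x y s) (hseg x y t) < arcosh c"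
    let ?S = "cseg x y s" and ?T = "cseg x y t"
    have h: "hseg x y s \<in> hyp2" "hseg x y t \<in> hyp2" using hseg_hyp2 hyp2_future x y s t by auto
    have "cosh (hdist (hseg x y s) (hseg x y t)) < cosh (arcosh c)"
      using d hdist_nonneg[OF h] by (subst cosh_real_nonneg_less_iff) auto
    then have "- lform (hseg x y s) (hseg x y t) < c" using cosh_hdist[OF h] c by (simp add: cosh_arcosh_real)
    moreover have "- lform (hseg x y s) (hseg x y t) \<ge> 1" using future_lform_le h hyp2_future by fastforce
    ultimately have "(- lform (hseg x y s) (hseg x y t))\<^sup>2 < c\<^sup>2" by (intro power_strict_mono) auto
    then have l: "(lform (hseg x y s) (hseg x y t))\<^sup>2 - 1 < e\<^sup>2 * q / (R * R)" using c by simp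
    have b: "- lform (cseg x y s) (cseg x y s) < R" "- lform (cseg x y s) (cseg x y s) > 0" if "s \<in> {0..1}" for s :: real
    proof -
      let ?S = "cseg x y s"
      have "- lform ?S ?S \<le> norm ?S * norm ?S" using lform_le_norm[of ?S ?S] by simp
      also have "\<dots> \<le> (norm x + norm y)\<^sup>2"
        using norm_cseg[OF that, of x y] by (simp add: power2_eq_square mult_mono)
      finally show "- lform ?S ?S < R" by (simp add: R_def)
      show "- lform ?S ?S > 0" using cseg_future[of x y s] hyp2_future x y that by (auto simp: future_def)
    qed
    have "lform ?S ?S * lform ?T ?T = (- lform ?S ?S) * (- lform ?T ?T)" by simp
    also have "\<dots> \<le> R * R" using b[OF s] b[OF t] R by (intro mult_mono) auto
    finally have RR: "lform ?S ?S * lform ?T ?T \<le> R * R" .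
    have "(s - t)\<^sup>2 * q = ((lform (hseg x y s) (hseg x y t))\<^sup>2 - 1) * (lform ?S ?S * lform ?T ?T)"
      using lform_hseg_sq[OF x y s t] by (simp add: q_def)
    also have "\<dots> < e\<^sup>2 * q / (R * R) * (R * R)"
    proof -
      have "lform ?S ?S * lform ?T ?T > 0" using b[OF s] b[OF t] by (simp add: mult_neg_neg)
      then have "((lform (hseg x y s) (hseg x y t))\<^sup>2 - 1) * (lform ?S ?S * lform ?T ?T)
          < e\<^sup>2 * q / (R * R) * (lform ?S ?S * lform ?T ?T)"
        using l by (intro mult_strict_right_mono)
      also have "\<dots> \<le> e\<^sup>2 * q / (R * R) * (R * R)"
        using RR q by (intro mult_left_mono) auto
      finally show ?thesis .
    qed
    also have "\<dots> = e\<^sup>2 * q" using R by simp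
    finally have "(s - t)\<^sup>2 < e\<^sup>2" using q by simp
    then show "\<bar>s - t\<bar> < e" using e by (simp add: abs_less_iff_sq)
  qed
qed

section \<open>Transverse arcs\<close>

text \<open>The arc passes from one side of the geodesic with normal \<open>n\<close> to the other at the parameter \<open>u\<close> and
  meets it nowhere else in \<open>S\<close>. The sign \<open>\<sigma>\<close> makes this independent of the choice of the normal.\<close>

definition crosses :: "(real \<Rightarrow> real^3) \<Rightarrow> real^3 \<Rightarrow> real \<Rightarrow> real set \<Rightarrow> bool" where
  "crosses g n u S \<longleftrightarrow> (\<exists>\<sigma>. (\<sigma> = 1 \<or> \<sigma> = -1) \<and> (\<forall>w\<in>S. sgn (lform n (g w)) = \<sigma> * sgn (w - u)))"

lemma crosses_minus_aux:
  assumes "crosses g n u S" shows "crosses g (- n) u S"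
proof -
  obtain \<sigma> where \<sigma>: "\<sigma> = 1 \<or> \<sigma> = -1" "\<forall>w\<in>S. sgn (lform n (g w)) = \<sigma> * sgn (w - u)"
    using assms unfolding crosses_def by blast
  show ?thesis unfolding crosses_def
  proof (intro exI[of _ "- \<sigma>"] conjI ballI)
    show "- \<sigma> = 1 \<or> - \<sigma> = -1" using \<sigma>(1) by auto
    fix w assume "w \<in> S"
    then show "sgn (lform (- n) (g w)) = - \<sigma> * sgn (w - u)"
      using \<sigma>(2) by (simp only: lform.minus_left sgn_minus mult_minus_left)
  qed
qed

lemma crosses_minus: "crosses g (- n) u S \<longleftrightarrow> crosses g n u S"
  using crosses_minus_aux[of g n u S] crosses_minus_aux[of g "- n" u S] by (simp only: minus_minus) blast

lemma crosses_subset: "crosses g n u S \<Longrightarrow> T \<subseteq> S \<Longrightarrow> crosses g n u T"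
  unfolding crosses_def by blast

text \<open>Transversality in terms of normals instead of oriented leaves.\<close>

lemma (in geodesic_lam) transverse_arc_iff:
  "transverse_arc \<L> g \<longleftrightarrow> arc g \<and> path_image g \<subseteq> hyp2 \<and> hrectifiable g \<and>
     (\<forall>s\<in>{0..1}. \<exists>e>0. \<forall>n\<in>normals \<L>. \<forall>u\<in>{0..1} \<inter> ball s e. lform n (g u) = 0 \<longrightarrow>
        crosses g n u ({0..1} \<inter> ball s e))"
proof -
  have *: "(\<forall>k\<in>\<L>. \<forall>u\<in>B. g u \<in> k \<longrightarrow>
        (\<exists>l. is_ogeod l \<and> gset l = k \<and> (\<forall>w\<in>B. sgn (side l (g w)) = sgn (w - u)))) \<longleftrightarrow>
     (\<forall>n\<in>normals \<L>. \<forall>u\<in>B. lform n (g u) = 0 \<longrightarrow> crosses g n u B)" (is "?A \<longleftrightarrow> ?B")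
    if g: "path_image g \<subseteq> hyp2" and B: "B \<subseteq> {0..1}" for B
  proof
    assume A: ?A
    show ?B
    proof (intro ballI impI)
      fix n u assume n: "n \<in> normals \<L>" and u: "u \<in> B" and z: "lform n (g u) = 0"
      have gu: "g u \<in> hyp2" using g B u by (auto simp: path_image_def)
      then have "g u \<in> geo n" using z by (simp add: geo_def)
      then obtain l where l: "is_ogeod l" "gset l = geo n" "\<forall>w\<in>B. sgn (side l (g w)) = sgn (w - u)"
        using A normals_geo[OF n] u by blast
      have m: "rnormal l \<in> normals \<L>" using l normals_geo[OF n] unfolding normals_def by (intro CollectI exI[of _ l]) simp
      have "lform (rnormal l) (g u) = 0"
      proof -
        have "g u \<in> geo (rnormal l)" using \<open>g u \<in> geo n\<close> l(2) gset_eq_geo[OF l(1)] by simp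
        then show ?thesis by (simp add: geo_def)
      qed
      then have pm: "n = rnormal l \<or> n = - rnormal l"
        using normals_same_leaf[OF m n hyp2_future[OF gu]] z by blast
      have "crosses g (rnormal l) u B"
        unfolding crosses_def using l(3) by (intro exI[of _ "-1"]) (simp add: lform_rnormal sgn_minus)
      then show "crosses g n u B" using pm crosses_minus by auto
    qed
  next
    assume A: ?B
    show ?A
    proof (intro ballI impI)
      fix k u assume k: "k \<in> \<L>" and u: "u \<in> B" and z: "g u \<in> k"
      obtain n where n: "n \<in> normals \<L>" "k = geo n" using leaf_normals[OF k] .
      obtain l where l: "is_ogeod l" "n = rnormal l" using n(1) by (auto simp: normals_def)
      have "lform n (g u) = 0" using z n by (simp add: geo_def)
      then have "crosses g n u B" using A n(1) u by blast
      then obtain \<sigma> where \<sigma>: "\<sigma> = 1 \<or> \<sigma> = -1" "\<forall>w\<in>B. sgn (lform n (g w)) = \<sigma> * sgn (w - u)"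
        unfolding crosses_def by blast
      show "\<exists>l. is_ogeod l \<and> gset l = k \<and> (\<forall>w\<in>B. sgn (side l (g w)) = sgn (w - u))"
      proof (cases "\<sigma> = -1")
        case True
        have "side l (g w) = - lform n (g w)" for w by (simp add: l(2) lform_rnormal)
        then show ?thesis
          using l n gset_eq_geo[OF l(1)] \<sigma> True by (intro exI[of _ l]) (simp add: sgn_minus)
      next
        case False
        let ?l = "(fst l, - snd l)"
        have "side ?l (g w) = lform n (g w)" for w
          using lform_rnormal[of ?l "g w"] ogeod_reverse[OF l(1)] l(2) by (simp add: lform.minus_left)
        then show ?thesis
          using ogeod_reverse[OF l(1)] l n gset_eq_geo[OF l(1)] \<sigma> False by (intro exI[of _ ?l]) simp
      qed
    qed
  qed
  show ?thesis
  proof (cases "path_image g \<subseteq> hyp2")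
    case True
    show ?thesis unfolding transverse_arc_def using *[OF True, of "{0..1} \<inter> ball _ _"] by simp
  qed (simp add: transverse_arc_def)
qed

lemma (in geodesic_lam) transverse_arcI:
  assumes "arc g" "path_image g \<subseteq> hyp2" "hrectifiable g"
    and "\<And>n u. n \<in> normals \<L> \<Longrightarrow> u \<in> {0..1} \<Longrightarrow> lform n (g u) = 0 \<Longrightarrow> crosses g n u {0..1}"
  shows "transverse_arc \<L> g"
  unfolding transverse_arc_iff
proof (intro conjI ballI)
  fix s :: real
  show "\<exists>e>0. \<forall>n\<in>normals \<L>. \<forall>u\<in>{0..1} \<inter> ball s e. lform n (g u) = 0 \<longrightarrow>
      crosses g n u ({0..1} \<inter> ball s e)"
    using assms(4) crosses_subset[of g _ _ "{0..1}" "{0..1} \<inter> ball s 1"] by (intro exI[of _ 1]) auto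
qed (use assms in auto)

lemma hrectifiableI:
  assumes g: "\<And>s. s \<in> {0..1} \<Longrightarrow> g s \<in> hyp2"
    and h: "\<And>s t. 0 \<le> s \<Longrightarrow> s \<le> t \<Longrightarrow> t \<le> 1 \<Longrightarrow> norm (g s - g t) \<le> h t - h s"
  shows "hrectifiable g"
  unfolding hrectifiable_def
proof (intro exI[of _ "h 1 - h 0"] allI impI)
  fix n :: nat and s :: "nat \<Rightarrow> real"
  assume m: "mono_on {..n} s" and s: "s ` {..n} \<subseteq> {0..1}"
  have s01: "0 \<le> s i" "s i \<le> 1" if "i \<le> n" for i using s that by auto
  have h0: "h s \<le> h t" if "0 \<le> s" "s \<le> t" "t \<le> 1" for s t using h[OF that] norm_ge_zero[of "g s - g t"] by linarith
  have "(\<Sum>i<n. hdist (g (s i)) (g (s (Suc i)))) \<le> (\<Sum>i<n. h (s (Suc i)) - h (s i))"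
  proof (rule sum_mono)
    fix i assume i: "i \<in> {..<n}"
    then have i': "i \<le> n" "Suc i \<le> n" by auto
    have "hdist (g (s i)) (g (s (Suc i))) \<le> norm (g (s i) - g (s (Suc i)))"
      using s01 i' by (intro hdist_le_norm g) auto
    also have "\<dots> \<le> h (s (Suc i)) - h (s i)"
      using s01 i' mono_onD[OF m, of i "Suc i"] by (intro h) auto
    finally show "hdist (g (s i)) (g (s (Suc i))) \<le> h (s (Suc i)) - h (s i)" .
  qed
  also have "\<dots> = h (s n) - h (s 0)" by (rule sum_lessThan_telescope)
  also have "\<dots> \<le> h 1 - h 0" using h0[of 0 "s 0"] h0[of "s n" 1] s01 by auto
  finally show "(\<Sum>i<n. hdist (g (s i)) (g (s (Suc i)))) \<le> h 1 - h 0" .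
qed

lemma continuous_hseg:
  assumes x: "x \<in> hyp2" and y: "y \<in> hyp2" shows "continuous_on {0..1} (hseg x y)"
proof -
  obtain C where C: "C > 0" "\<And>s t. s \<in> {0..1} \<Longrightarrow> t \<in> {0..1} \<Longrightarrow> norm (hseg x y s - hseg x y t) \<le> C * \<bar>s - t\<bar>"
    by (rule hseg_lipschitz[OF x y]) blast
  have "C-lipschitz_on {0..1} (hseg x y)"
    using C by (intro lipschitz_onI) (auto simp: dist_norm)
  then show ?thesis by (rule lipschitz_on_continuous_on)
qed

lemma path_image_hseg: "path_image (hseg x y) = hseg x y ` {0..1}"
  by (simp add: path_image_def)

lemma hseg_image_hyp2: "x \<in> hyp2 \<Longrightarrow> y \<in> hyp2 \<Longrightarrow> path_image (hseg x y) \<subseteq> hyp2"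
  using hseg_hyp2 hyp2_future by (auto simp: path_image_hseg)

lemma sgn_lform_hseg:
  assumes "x \<in> hyp2" "y \<in> hyp2" "s \<in> {0..1}"
  shows "sgn (lform n (hseg x y s)) = sgn ((1 - s) * lform n x + s * lform n y)"
  using sgn_lform_hproj[OF cseg_future, of x y s n] assms hyp2_future by (simp add: hseg_cseg lform_cseg)

text \<open>The parameter of the point at which the chord from \<open>x\<close> to \<open>y\<close> meets the plane orthogonal to \<open>n\<close>.\<close>

definition cpar :: "real^3 \<Rightarrow> real^3 \<Rightarrow> real^3 \<Rightarrow> real" where
  "cpar x y n = lform n x / (lform n x - lform n y)"

lemma cpar_affine:
  assumes "lform n x \<noteq> lform n y"
  shows "(1 - s) * lform n x + s * lform n y = (lform n y - lform n x) * (s - cpar x y n)"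
  using assms by (simp add: cpar_def field_simps)

context geodesic_lam
begin

lemma seps_pos:
  assumes "no_common_leaf \<L> x y" "n \<in> seps \<L> x y" shows "lform n y - lform n x > 0"
  using assms by (auto simp: seps_def no_common_leaf_def)

lemma cpar_01:
  assumes "no_common_leaf \<L> x y" "n \<in> seps \<L> x y" shows "cpar x y n \<in> {0..1}"
  using seps_pos[OF assms] assms(2) by (auto simp: cpar_def seps_def divide_le_eq_1 zero_le_divide_iff divide_simps)

lemma sgn_seps_hseg:
  assumes xy: "x \<in> hyp2" "y \<in> hyp2" and n: "no_common_leaf \<L> x y" "n \<in> seps \<L> x y" and s: "s \<in> {0..1}"
  shows "sgn (lform n (hseg x y s)) = sgn (s - cpar x y n)"
proof -
  have p: "lform n y - lform n x > 0" by (rule seps_pos[OF n])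
  have "sgn (lform n (hseg x y s)) = sgn ((lform n y - lform n x) * (s - cpar x y n))"
    using sgn_lform_hseg[OF xy s] cpar_affine[of n x y s] p by simp
  then show ?thesis using p by (simp add: sgn_mult)
qed

lemma meets_seg_seps:
  assumes xy: "x \<in> hyp2" "y \<in> hyp2" and n: "n \<in> normals \<L>" and s: "s \<in> {0..1}" and z: "lform n (hseg x y s) = 0"
  shows "n \<in> seps \<L> x y \<or> - n \<in> seps \<L> x y"
proof -
  have "(1 - s) * lform n x + s * lform n y = 0" using sgn_lform_hseg[OF xy s, of n] z by (simp add: sgn_0_0)
  moreover have "0 \<le> s" "0 \<le> 1 - s" "0 < s \<or> 0 < 1 - s" using s by auto
  ultimately have "\<not> (lform n x > 0 \<and> lform n y > 0)" "\<not> (lform n x < 0 \<and> lform n y < 0)"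
    by (smt (verit) mult_nonneg_nonneg mult_pos_pos mult_nonneg_nonpos mult_pos_neg)+
  moreover have "lform n x \<le> 0 \<and> 0 \<le> lform n y \<or> lform n y \<le> 0 \<and> 0 \<le> lform n x"
    using calculation by linarith
  ultimately show ?thesis using n normals_minus[OF n] by (auto simp: seps_def lform.minus_left)
qed

lemma transverse_hseg:
  assumes xy: "x \<in> hyp2" "y \<in> hyp2" and ne: "x \<noteq> y" and n: "no_common_leaf \<L> x y"
  shows "transverse_arc \<L> (hseg x y)"
proof (rule transverse_arcI)
  show "arc (hseg x y)"
    using continuous_hseg[OF xy] hseg_inj[OF xy ne] by (simp add: arc_def path_def inj_on_def)
  show "path_image (hseg x y) \<subseteq> hyp2" by (rule hseg_image_hyp2[OF xy])
  obtain C where C: "C > 0" "\<And>s t. s \<in> {0..1} \<Longrightarrow> t \<in> {0..1} \<Longrightarrow> norm (hseg x y s - hseg x y t) \<le> C * \<bar>s - t\<bar>"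
    by (rule hseg_lipschitz[OF xy]) blast
  show "hrectifiable (hseg x y)"
  proof (rule hrectifiableI[where h="\<lambda>t. C * t"])
    show "hseg x y s \<in> hyp2" if "s \<in> {0..1}" for s using hseg_hyp2 xy hyp2_future that by blast
    show "norm (hseg x y s - hseg x y t) \<le> C * t - C * s" if "0 \<le> s" "s \<le> t" "t \<le> 1" for s t
      using C(2)[of s t] that by (simp add: algebra_simps)
  qed
  fix m u assume m: "m \<in> normals \<L>" and u: "u \<in> {0..1}" and z: "lform m (hseg x y u) = 0"
  have *: "crosses (hseg x y) m u {0..1}" if m: "m \<in> seps \<L> x y" and z: "lform m (hseg x y u) = 0" for m
  proof -
    have "u = cpar x y m" using sgn_seps_hseg[OF xy n m u] z by (simp add: sgn_0_0)
    then show ?thesis unfolding crosses_def using sgn_seps_hseg[OF xy n m] by (intro exI[of _ 1]) simp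
  qed
  show "crosses (hseg x y) m u {0..1}"
    using meets_seg_seps[OF xy m u z] *[of m] *[of "- m"] z crosses_minus by (auto simp: lform.minus_left)
qed

text \<open>If a leaf contains both endpoints, it contains the whole segment and cannot cross it at \<open>x\<close>.\<close>

lemma transverse_hseg_iff:
  assumes xy: "x \<in> hyp2" "y \<in> hyp2"
  shows "transverse_arc \<L> (hseg x y) \<longleftrightarrow> x \<noteq> y \<and> no_common_leaf \<L> x y"
proof
  assume t: "transverse_arc \<L> (hseg x y)"
  then have a: "arc (hseg x y)" by (simp add: transverse_arc_def)
  have "hseg x y 0 \<noteq> hseg x y 1" using a unfolding arc_def by (auto dest: inj_onD[where x=0 and y=1])
  then have "x \<noteq> y" using hseg_0 hseg_1 xy by auto
  moreover have "no_common_leaf \<L> x y" unfolding no_common_leaf_def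
  proof (intro ballI notI)
    fix n assume n: "n \<in> normals \<L>" and z: "lform n x = 0 \<and> lform n y = 0"
    have z': "lform n (hseg x y s) = 0" if "s \<in> {0..1}" for s
      using sgn_lform_hseg[OF xy that, of n] z by (simp add: sgn_0_0)
    have "(0::real) \<in> {0..1}" by simp
    then obtain e where e: "e > 0" "\<forall>n\<in>normals \<L>. \<forall>u\<in>{0..1} \<inter> ball 0 e. lform n (hseg x y u) = 0 \<longrightarrow>
        crosses (hseg x y) n u ({0..1} \<inter> ball 0 e)"
      using t unfolding transverse_arc_iff by blast
    have "0 \<in> {0..1::real} \<inter> ball 0 e" using e(1) by simp
    then have "crosses (hseg x y) n 0 ({0..1} \<inter> ball 0 e)" using e(2) n z' by auto
    then obtain \<sigma> where \<sigma>: "\<sigma> = 1 \<or> \<sigma> = -1" "\<forall>w\<in>{0..1} \<inter> ball 0 e. sgn (lform n (hseg x y w)) = \<sigma> * sgn (w - 0)"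
      unfolding crosses_def by blast
    define w where "w = min 1 (e / 2)"
    have w: "w \<in> {0..1} \<inter> ball 0 e" "w > 0" using e(1) by (auto simp: w_def dist_norm)
    then have "sgn (lform n (hseg x y w)) = \<sigma> * sgn (w - 0)" using \<sigma>(2) by blast
    then show False using \<sigma>(1) z'[of w] w by auto
  qed
  ultimately show "x \<noteq> y \<and> no_common_leaf \<L> x y" by simp
qed (use transverse_hseg[OF xy] in auto)

end

section \<open>Straight homotopies along leaves\<close>

text \<open>The extension is the supremum of the functions that have slope \<open>\<kappa>\<close> to the right and slope \<open>\<Lambda>\<close> to the
  left of a given point \<open>(a, b)\<close> and value \<open>b\<close> at \<open>a\<close>, as in McShane's extension theorem. Both bounds pass to the supremum.\<close>

lemma bilipschitz_extension:
  fixes P :: "(real \<times> real) set" and \<kappa> \<Lambda> :: real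
  assumes P: "P \<noteq> {}" "P \<subseteq> {0..1} \<times> {0..1}" and k: "0 < \<kappa>" "\<kappa> \<le> \<Lambda>"
    and bil: "\<And>a b a' b'. (a, b) \<in> P \<Longrightarrow> (a', b') \<in> P \<Longrightarrow> a \<le> a' \<Longrightarrow>
      \<kappa> * (a' - a) \<le> b' - b \<and> b' - b \<le> \<Lambda> * (a' - a)"
  obtains U where "\<And>a b. (a, b) \<in> P \<Longrightarrow> U a = b"
    "\<And>s t. s \<le> t \<Longrightarrow> \<kappa> * (t - s) \<le> U t - U s" "\<And>s t. s \<le> t \<Longrightarrow> U t - U s \<le> \<Lambda> * (t - s)"
proof -
  define f :: "real \<Rightarrow> real \<times> real \<Rightarrow> real" where
    "f t = (\<lambda>(a, b). b + (if a \<le> t then \<kappa> * (t - a) else \<Lambda> * (t - a)))" for t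
  define U where "U t = (SUP p\<in>P. f t p)" for t
  have bdd: "bdd_above (f t ` P)" for t
  proof (rule bdd_aboveI2)
    fix p assume "p \<in> P"
    moreover obtain a b where "p = (a, b)" by force
    ultimately have ab: "p = (a, b)" "0 \<le> a" "b \<le> 1" using P by auto
    have "(if a \<le> t then \<kappa> * (t - a) else \<Lambda> * (t - a)) \<le> \<kappa> * \<bar>t\<bar>"
    proof (cases "a \<le> t")
      case True
      then show ?thesis using k ab by (simp add: mult_left_mono)
    next
      case False
      then have "\<Lambda> * (t - a) \<le> 0" using k by (simp add: mult_nonneg_nonpos)
      also have "0 \<le> \<kappa> * \<bar>t\<bar>" using k by simp
      finally show ?thesis using False by simp
    qed
    then show "f t p \<le> 1 + \<kappa> * \<bar>t\<bar>" using ab by (simp add: f_def)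
  qed
  have step: "\<kappa> * (t - s) \<le> f t p - f s p \<and> f t p - f s p \<le> \<Lambda> * (t - s)" if st: "s \<le> t" for s t p
  proof -
    obtain a b where p: "p = (a, b)" by force
    consider "a \<le> s" | "s < a" "a \<le> t" | "t < a" by linarith
    then show ?thesis
    proof cases
      case 1
      then show ?thesis using st k mult_right_mono[of \<kappa> \<Lambda> "t - s"] by (simp add: p f_def algebra_simps)
    next
      case 2
      then have "\<kappa> * (t - a) \<le> \<Lambda> * (t - a)" "\<kappa> * (a - s) \<le> \<Lambda> * (a - s)"
        using k by (auto intro: mult_right_mono)
      then show ?thesis using 2 by (simp add: p f_def algebra_simps)
    next
      case 3
      then show ?thesis using st k mult_right_mono[of \<kappa> \<Lambda> "t - s"] by (simp add: p f_def algebra_simps)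
    qed
  qed
  show thesis
  proof (rule that)
    fix a b assume ab: "(a, b) \<in> P"
    show "U a = b" unfolding U_def
    proof (rule cSup_eq_maximum)
      show "b \<in> f a ` P" using ab by (force simp: f_def)
      fix y assume "y \<in> f a ` P"
      then obtain c d where cd: "(c, d) \<in> P" "y = f a (c, d)" by auto
      show "y \<le> b"
      proof (cases "c \<le> a")
        case True
        then show ?thesis using bil[OF cd(1) ab] cd(2) by (simp add: f_def)
      next
        case False
        then show ?thesis using bil[OF ab cd(1)] cd(2) by (simp add: f_def algebra_simps)
      qed
    qed
  next
    fix s t :: real assume st: "s \<le> t"
    have "U s \<le> U t - \<kappa> * (t - s)" unfolding U_def[of s]
    proof (rule cSUP_least[OF P(1)])
      fix p assume p: "p \<in> P"
      have "f t p \<le> U t" unfolding U_def by (rule cSUP_upper[OF p bdd])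
      then show "f s p \<le> U t - \<kappa> * (t - s)" using step[OF st, of p] by linarith
    qed
    then show "\<kappa> * (t - s) \<le> U t - U s" by linarith
    have "U t \<le> U s + \<Lambda> * (t - s)" unfolding U_def[of t]
    proof (rule cSUP_least[OF P(1)])
      fix p assume p: "p \<in> P"
      have "f s p \<le> U s" unfolding U_def by (rule cSUP_upper[OF p bdd])
      then show "f t p \<le> U s + \<Lambda> * (t - s)" using step[OF st, of p] by linarith
    qed
    then show "U t - U s \<le> \<Lambda> * (t - s)" by linarith
  qed
qed

context geodesic_lam
begin

lemma seps_bounded:
  assumes xy: "x \<in> hyp2" "y \<in> hyp2" and n: "no_common_leaf \<L> x y" "n \<in> seps \<L> x y"
  shows "norm n \<le> 2 * (x$3 + y$3)"
proof -
  let ?z = "cseg x y (cpar x y n)"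
  have f: "?z \<in> future" using cseg_future hyp2_future xy cpar_01[OF n] by blast
  have "lform n ?z = 0" using cpar_affine[of n x y "cpar x y n"] seps_pos[OF n] by (simp add: lform_cseg)
  then have "norm n \<le> 2 * ?z$3" using unit_orth_norm[OF _ _ f] normals_unit n by (auto simp: seps_def)
  then show ?thesis using future_coords_cseg[OF hyp2_future hyp2_future, of x y "cpar x y n"] xy cpar_01[OF n] by simp
qed

text \<open>Evaluating \<open>n\<close> at the point where \<open>m\<close> vanishes turns differences of crossing parameters into
  pairings of the causal vector \<open>n - m\<close>.\<close>

lemma cpar_diff:
  assumes n: "no_common_leaf \<L> x y" "n \<in> seps \<L> x y" and m: "m \<in> seps \<L> x y"
  shows "(cpar x y m - cpar x y n) * (lform n y - lform n x) = lform (n - m) (cseg x y (cpar x y m))"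
proof -
  have "lform m (cseg x y (cpar x y m)) = 0"
    using cpar_affine[of m x y "cpar x y m"] seps_pos[OF n(1) m] by (simp add: lform_cseg)
  moreover have "lform n (cseg x y (cpar x y m)) = (lform n y - lform n x) * (cpar x y m - cpar x y n)"
    using cpar_affine[of n x y "cpar x y m"] seps_pos[OF n] by (simp add: lform_cseg)
  ultimately show ?thesis by (simp add: lform.diff_left mult.commute)
qed

text \<open>By \<open>cpar_diff\<close> and \<open>causal_lower\<close>, the third coordinate of \<open>n - m\<close> is bounded by a multiple of the
  difference of the parameters; the norm of a causal vector is bounded by its third coordinate.\<close>

lemma normals_lipschitz:
  assumes xy: "x \<in> hyp2" "y \<in> hyp2" and np: "no_common_leaf \<L> x y"
  obtains C where "C > 0"
    "\<And>n m. n \<in> seps \<L> x y \<Longrightarrow> m \<in> seps \<L> x y \<Longrightarrow> norm (n - m) \<le> C * \<bar>cpar x y n - cpar x y m\<bar>"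
proof
  define Z where "Z = x$3 + y$3"
  have "x$3 \<ge> 1" "y$3 \<ge> 1" using future_bound(1) hyp2_future xy by auto
  then have Z: "Z > 0" by (simp add: Z_def)
  let ?C = "4 * Z * (2 * Z * (norm (y - x) + 1))"
  show "?C > 0" using Z by (intro mult_pos_pos add_nonneg_pos) auto
  fix n m assume n: "n \<in> seps \<L> x y" and m: "m \<in> seps \<L> x y"
  let ?z = "cseg x y (cpar x y m)"
  have c: "lform (n - m) (n - m) \<le> 0" using seps_causal[OF n m] hyp2_future xy np by blast
  have f: "?z \<in> future" using cseg_future hyp2_future xy cpar_01[OF np m] by blast
  have z3: "?z$3 \<le> Z" "?z$3 > 0"
    using future_coords_cseg[OF hyp2_future hyp2_future, of x y "cpar x y m"] xy cpar_01[OF np m] future_bound(1)[OF f] by (auto simp: Z_def)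
  have "norm (n - m) \<le> 2 * \<bar>(n - m)$3\<bar>" by (rule causal_norm[OF c])
  also have "\<bar>(n - m)$3\<bar> \<le> - 2 * ?z$3 * (sgn ((n-m)$3) * lform (n - m) ?z)" by (rule causal_lower[OF c f])
  also have "\<dots> \<le> 2 * ?z$3 * \<bar>lform (n - m) ?z\<bar>"
  proof -
    have "- (sgn ((n-m)$3) * lform (n - m) ?z) \<le> \<bar>lform (n - m) ?z\<bar>"
      by (auto simp: sgn_real_def)
    then have "2 * ?z$3 * (- (sgn ((n-m)$3) * lform (n - m) ?z)) \<le> 2 * ?z$3 * \<bar>lform (n - m) ?z\<bar>"
      using z3 by (intro mult_left_mono) auto
    then show ?thesis by (simp only: mult_minus_left mult_minus_right)
  qed
  also have "\<bar>lform (n - m) ?z\<bar> = \<bar>cpar x y n - cpar x y m\<bar> * \<bar>lform n y - lform n x\<bar>"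
    using cpar_diff[OF np n m] by (metis abs_minus_commute abs_mult)
  also have "\<bar>lform n y - lform n x\<bar> = \<bar>lform n (y - x)\<bar>" by (simp add: lform.diff_right)
  also have "2 * ?z$3 * (\<bar>cpar x y n - cpar x y m\<bar> * \<bar>lform n (y - x)\<bar>) \<le>
      2 * Z * (\<bar>cpar x y n - cpar x y m\<bar> * (2 * Z * (norm (y - x) + 1)))"
  proof -
    have "\<bar>lform n (y - x)\<bar> \<le> norm n * norm (y - x)" by (rule lform_le_norm)
    also have "\<dots> \<le> 2 * Z * (norm (y - x) + 1)"
      using seps_bounded[OF xy np n] Z by (intro mult_mono) (auto simp: Z_def)
    finally show ?thesis using z3 Z by (intro mult_mono) auto
  qed
  finally show "norm (n - m) \<le> ?C * \<bar>cpar x y n - cpar x y m\<bar>" by (simp add: algebra_simps)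
qed

text \<open>If \<open>y\<close> lies on a leaf that does not contain \<open>x\<close>, the crossing parameter is a bilipschitz function of
  the third coordinate of the normal, because \<open>lform n y - lform n x\<close> is bounded away from \<open>0\<close>: it is
  positive at the leaf through \<open>y\<close>, and every other normal differs from that one by a causal vector whose
  size is controlled by \<open>lform n y\<close>. The third coordinate of \<open>n\<close> is independent of the endpoint of the segment,
  so crossing parameters on two segments from \<open>x\<close> to the same leaf are bilipschitz functions of each other. The
  last estimate does the same for the pair of the starting point and a leaf.\<close>

lemma cpar_bounds:
  assumes xy: "x \<in> hyp2" "y \<in> hyp2" and n0: "n0 \<in> normals \<L>" "lform n0 x < 0" "lform n0 y = 0" and np: "no_common_leaf \<L> x y"
  obtains A B where "A > 0" "B > 0"
    "\<And>n m. n \<in> seps \<L> x y \<Longrightarrow> m \<in> seps \<L> x y \<Longrightarrow> n$3 \<le> m$3 \<Longrightarrow>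
       A * (m$3 - n$3) \<le> cpar x y m - cpar x y n \<and> cpar x y m - cpar x y n \<le> B * (m$3 - n$3)"
    "\<And>n. n \<in> seps \<L> x y \<Longrightarrow> A * (- lform n x) \<le> cpar x y n \<and> cpar x y n \<le> B * (- lform n x)"
proof -
  define Z where "Z = x$3 + y$3"
  have x3: "x$3 \<ge> 1" "y$3 \<ge> 1" using future_bound(1) hyp2_future xy by auto
  then have Z: "Z \<ge> 2" "Z \<ge> x$3" "Z \<ge> y$3" by (auto simp: Z_def)
  define D where "D = 2 * Z * (norm (y - x) + 1)"
  define d where "d = - lform n0 x / (1 + 4 * Z * Z)"
  have "D > 0" using Z by (auto simp: D_def intro!: mult_pos_pos add_nonneg_pos)
  have den: "1 + 4 * Z * Z > 0" using Z by (intro add_pos_nonneg) auto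
  have "d > 0" unfolding d_def using n0 den by (intro divide_pos_pos) auto
  have f: "x \<in> future" "y \<in> future" using hyp2_future xy by auto
  have n0S: "n0 \<in> seps \<L> x y" using n0 by (simp add: seps_def)
  have up: "lform n y - lform n x \<le> D" if n: "n \<in> seps \<L> x y" for n
  proof -
    have "lform n y - lform n x \<le> norm n * norm (y - x)"
      using lform_le_norm[of n "y - x"] by (simp add: lform.diff_right)
    also have "\<dots> \<le> D" unfolding D_def
      using seps_bounded[OF xy np n] Z by (intro mult_mono) (auto simp: Z_def)
    finally show ?thesis .
  qed
  have lo: "d \<le> lform n y - lform n x" if n: "n \<in> seps \<L> x y" for n
  proof -
    have c: "lform (n - n0) (n - n0) \<le> 0" using seps_causal[OF n n0S f np] .
    have h: "lform (n - n0) y = lform n y" "lform n y \<ge> 0" "lform n x \<le> 0" using n n0 by (auto simp: lform.diff_left seps_def)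
    have "\<bar>lform (n - n0) x\<bar> \<le> 2 * x$3 * \<bar>(n - n0)$3\<bar>" by (rule causal_upper[OF c f(1)])
    also have "\<bar>(n - n0)$3\<bar> \<le> 2 * y$3 * lform n y"
    proof -
      have "- sgn ((n - n0)$3) * lform n y \<le> lform n y" using h by (auto simp: sgn_real_def)
      then have "2 * y$3 * (- sgn ((n - n0)$3) * lform n y) \<le> 2 * y$3 * lform n y"
        using x3 by (intro mult_left_mono) auto
      then have "- 2 * y$3 * (sgn ((n - n0)$3) * lform n y) \<le> 2 * y$3 * lform n y"
        by (simp only: mult_minus_left mult_minus_right mult.assoc)
      then show ?thesis using causal_lower[OF c f(2)] unfolding h(1) by linarith
    qed
    also have "2 * x$3 * (2 * y$3 * lform n y) \<le> 2 * Z * (2 * Z * lform n y)"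
      using x3 Z h by (intro mult_mono) auto
    finally have "- lform n x \<ge> - lform n0 x - 4 * Z * Z * lform n y" using x3 by (simp add: lform.diff_left)
    moreover have "4 * Z * Z * lform n y \<le> 4 * Z * Z * (lform n y - lform n x)"
      using h Z by (intro mult_left_mono) auto
    ultimately have "(1 + 4 * Z * Z) * (lform n y - lform n x) \<ge> - lform n0 x"
      using h by (simp add: distrib_right)
    then show ?thesis using den unfolding d_def by (simp only: pos_divide_le_eq mult.commute)
  qed
  define A where "A = min (1 / (2 * Z * D)) (1 / D)"
  define B where "B = max (2 * Z / d) (1 / d)"
  show thesis
  proof
    show "A > 0" "B > 0" using Z \<open>D > 0\<close> \<open>d > 0\<close> by (auto simp: A_def B_def less_max_iff_disj)
    fix n assume n: "n \<in> seps \<L> x y"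
    have a: "- lform n x \<ge> 0" using n by (simp add: seps_def)
    have e: "cpar x y n = - lform n x / (lform n y - lform n x)"
      using seps_pos[OF np n] by (simp add: cpar_def field_simps)
    have "A * (- lform n x) \<le> (1 / D) * (- lform n x)" using a by (intro mult_right_mono) (auto simp: A_def)
    also have "\<dots> \<le> cpar x y n"
    proof -
      have "- lform n x / D \<le> - lform n x / (lform n y - lform n x)"
        using a up[OF n] seps_pos[OF np n] \<open>D > 0\<close> by (intro divide_left_mono mult_pos_pos) auto
      then show ?thesis unfolding e by simp
    qed
    finally have 1: "A * (- lform n x) \<le> cpar x y n" .
    have "cpar x y n \<le> (1 / d) * (- lform n x)" unfolding e
      using a lo[OF n] seps_pos[OF np n] \<open>d > 0\<close> divide_left_mono[of d "lform n y - lform n x" "- lform n x"] by simp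
    also have "\<dots> \<le> B * (- lform n x)" using a by (intro mult_right_mono) (auto simp: B_def)
    finally show "A * (- lform n x) \<le> cpar x y n \<and> cpar x y n \<le> B * (- lform n x)" using 1 by simp
  next
    fix n m assume n: "n \<in> seps \<L> x y" and m: "m \<in> seps \<L> x y" and nm: "n$3 \<le> m$3"
    let ?z = "cseg x y (cpar x y m)"
    define \<delta> where "\<delta> = cpar x y m - cpar x y n"
    define E where "E = lform n y - lform n x"
    have E: "d \<le> E" "E \<le> D" using lo[OF n] up[OF n] by (auto simp: E_def)
    have c: "lform (n - m) (n - m) \<le> 0" using seps_causal[OF n m f np] .
    have fz: "?z \<in> future" using cseg_future f cpar_01[OF np m] by blast
    have z3: "?z$3 \<le> Z" "?z$3 > 0"
      using future_coords_cseg[OF f, of "cpar x y m"] cpar_01[OF np m] future_bound(1)[OF fz] by (auto simp: Z_def)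
    have eq: "\<delta> * E = lform (n - m) ?z" using cpar_diff[OF np n m] by (simp add: \<delta>_def E_def)
    have l: "m$3 - n$3 \<le> 2 * ?z$3 * (\<delta> * E)"
      using causal_lower[OF c fz] causal_upper[OF c fz] nm unfolding eq
      by (cases "n$3 = m$3") (auto simp: sgn_real_def)
    have u: "\<delta> * E \<le> 2 * ?z$3 * (m$3 - n$3)"
      using causal_upper[OF c fz] nm unfolding eq by auto
    have dE: "\<delta> * E \<ge> 0"
    proof (rule ccontr)
      assume "\<not> ?thesis"
      then have "2 * ?z$3 * (\<delta> * E) < 0" using z3(2) mult_pos_neg[of "2 * ?z$3" "\<delta> * E"] by linarith
      then show False using l nm by linarith
    qed
    then have d0: "\<delta> \<ge> 0" using E \<open>d > 0\<close> by (simp add: zero_le_mult_iff)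
    have "2 * ?z$3 * (\<delta> * E) \<le> 2 * Z * (\<delta> * D)" using z3 dE d0 E Z \<open>d > 0\<close> by (intro mult_mono) auto
    then have "m$3 - n$3 \<le> 2 * Z * (\<delta> * D)" using l by linarith
    then have "(m$3 - n$3) / (2 * Z * D) \<le> \<delta>" using Z \<open>D > 0\<close> by (simp add: pos_divide_le_eq mult_ac)
    moreover have "A * (m$3 - n$3) \<le> (1 / (2 * Z * D)) * (m$3 - n$3)"
      using nm by (intro mult_right_mono) (auto simp: A_def)
    ultimately have 1: "A * (m$3 - n$3) \<le> \<delta>" by simp
    have "\<delta> * d \<le> \<delta> * E" using E d0 by (intro mult_left_mono)
    also have "\<dots> \<le> 2 * Z * (m$3 - n$3)"
      using u z3 nm mult_right_mono[of "2 * ?z$3" "2 * Z" "m$3 - n$3"] by simp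
    finally have "\<delta> \<le> (2 * Z / d) * (m$3 - n$3)" using \<open>d > 0\<close> by (simp add: pos_le_divide_eq)
    also have "\<dots> \<le> B * (m$3 - n$3)" using nm by (intro mult_right_mono) (auto simp: B_def)
    finally show "A * (m$3 - n$3) \<le> cpar x y m - cpar x y n \<and> cpar x y m - cpar x y n \<le> B * (m$3 - n$3)"
      using 1 by (simp add: \<delta>_def)
  qed
qed


text \<open>A leaf lies on one side of each other leaf.\<close>

lemma sgn_lform_leaf:
  assumes n0: "n0 \<in> normals \<L>" and n: "n \<in> normals \<L>" and p: "p \<in> future" "lform n0 p = 0" and q: "q \<in> future" "lform n0 q = 0"
  shows "sgn (lform n p) = sgn (lform n q)"
proof -
  obtain w where w: "lform w w \<le> 0" "w = n - n0 \<or> w = n + n0" using normals_diff_causal[OF n n0] by blast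
  then have "lform w p = lform n p" "lform w q = lform n q" using p q by (auto simp: lform.add_left lform.diff_left)
  then show ?thesis using causal_sign[OF w(1) p(1)] causal_sign[OF w(1) q(1)] by (auto simp: sgn_real_def)
qed

lemma leaf_no_common_leaf:
  assumes n0: "n0 \<in> normals \<L>" and x: "lform n0 x < 0" and p: "p \<in> future" "lform n0 p = 0"
  shows "no_common_leaf \<L> x p"
  unfolding no_common_leaf_def
proof (intro ballI notI)
  fix n assume n: "n \<in> normals \<L>" and z: "lform n x = 0 \<and> lform n p = 0"
  then have "n0 = n \<or> n0 = - n" using normals_same_leaf[OF n n0 p(1)] p(2) by blast
  then show False using x z by (auto simp: lform.minus_left)
qed

lemma seps_leaf_eq:
  assumes n0: "n0 \<in> normals \<L>" and p: "p \<in> future" "lform n0 p = 0" and q: "q \<in> future" "lform n0 q = 0"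
  shows "seps \<L> x q = seps \<L> x p"
proof -
  have "0 \<le> lform n p \<longleftrightarrow> 0 \<le> lform n q" if "n \<in> normals \<L>" for n
    using sgn_lform_leaf[OF n0 that p q] by (auto simp: sgn_real_def split: if_splits)
  then show ?thesis unfolding seps_def by blast
qed

text \<open>A leaf between \<open>x\<close> and the leaf of \<open>p\<close> and \<open>q\<close> meets \<open>[x, p]\<close> at the parameter \<open>a n\<close> and \<open>[x, q]\<close> at \<open>b n\<close>.
  The map \<open>a n \<mapsto> b n\<close> is bilipschitz by \<open>cpar_bounds\<close> and extends to a homeomorphism \<open>U\<close> of the unit interval.
  Joining the point of \<open>[x, p]\<close> with parameter \<open>t\<close> to the point of \<open>[x, q]\<close> with parameter \<open>U t\<close> by a straight
  line gives the homotopy. Along it the sign of \<open>lform n\<close> is that of \<open>t - a n\<close>, because a convex combination of two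
  numbers of that sign has that sign: so points stay on their leaf, and no arc of the family touches a leaf
  without crossing it. A merely continuous \<open>U\<close> would not do, because the arcs must be rectifiable.\<close>

lemma leaf_homotopy:
  assumes n0: "n0 \<in> normals \<L>" "lform n0 x < 0" "lform n0 p = 0" "lform n0 q = 0"
    and hyp: "x \<in> hyp2" "p \<in> hyp2" "q \<in> hyp2"
  obtains H where "transverse_homotopy \<L> H" "\<forall>t\<in>{0..1}. H 0 t = hseg x p t"
    "path_image (H 1) = path_image (hseg x q)"
    "\<forall>t\<in>{0..1}. \<forall>n\<in>normals \<L>. lform n (H 0 t) = 0 \<longleftrightarrow> lform n (H 1 t) = 0"
proof -
  have f: "x \<in> future" "p \<in> future" "q \<in> future" using hyp hyp2_future by auto
  have np: "no_common_leaf \<L> x p" "no_common_leaf \<L> x q"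
    using leaf_no_common_leaf[OF n0(1,2) f(2) n0(3)] leaf_no_common_leaf[OF n0(1,2) f(3) n0(4)] by auto
  have sg: "sgn (lform n p) = sgn (lform n q)" if "n \<in> normals \<L>" for n
    by (rule sgn_lform_leaf[OF n0(1) that f(2) n0(3) f(3) n0(4)])
  have Sq: "seps \<L> x q = seps \<L> x p"
    by (rule seps_leaf_eq[OF n0(1) f(2) n0(3) f(3) n0(4)])
  define S where "S = seps \<L> x p"
  define a where "a = cpar x p"
  define b where "b = cpar x q"
  have n0S: "n0 \<in> S" using n0 by (simp add: S_def seps_def)
  obtain A B where AB: "A > 0" "B > 0"
    "\<And>n m. n \<in> S \<Longrightarrow> m \<in> S \<Longrightarrow> n$3 \<le> m$3 \<Longrightarrow> A * (m$3 - n$3) \<le> a m - a n \<and> a m - a n \<le> B * (m$3 - n$3)"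
    "\<And>n. n \<in> S \<Longrightarrow> A * (- lform n x) \<le> a n \<and> a n \<le> B * (- lform n x)"
    unfolding S_def a_def by (rule cpar_bounds[OF hyp(1,2) n0(1,2,3) np(1)]) blast
  obtain A' B' where AB': "A' > 0" "B' > 0"
    "\<And>n m. n \<in> S \<Longrightarrow> m \<in> S \<Longrightarrow> n$3 \<le> m$3 \<Longrightarrow> A' * (m$3 - n$3) \<le> b m - b n \<and> b m - b n \<le> B' * (m$3 - n$3)"
    "\<And>n. n \<in> S \<Longrightarrow> A' * (- lform n x) \<le> b n \<and> b n \<le> B' * (- lform n x)"
    unfolding S_def b_def Sq[symmetric] by (rule cpar_bounds[OF hyp(1,3) n0(1,2,4) np(2)]) blast
  define \<kappa> where "\<kappa> = A' / B"
  define \<Lambda> where "\<Lambda> = B' / A"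
  have k0: "\<kappa> > 0" "\<Lambda> > 0" using AB AB' by (auto simp: \<kappa>_def \<Lambda>_def)
  have conv: "\<kappa> * u \<le> v \<and> v \<le> \<Lambda> * u" if "A * h \<le> u" "u \<le> B * h" "A' * h \<le> v" "v \<le> B' * h" for u v h
  proof -
    have "A' * (u / B) \<le> A' * h" using that AB AB' by (intro mult_left_mono) (auto simp: pos_divide_le_eq mult.commute)
    moreover have "B' * h \<le> B' * (u / A)" using that AB AB' by (intro mult_left_mono) (auto simp: pos_le_divide_eq mult.commute)
    ultimately show ?thesis using that by (simp add: \<kappa>_def \<Lambda>_def)
  qed
  \<comment> \<open>The pair \<open>(0, 0)\<close> makes \<open>U\<close> fix the starting point; the pair of \<open>n0\<close> is \<open>(1, 1)\<close>.\<close>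
  define P where "P = insert (0, 0) ((\<lambda>n. (a n, b n)) ` S)"
  have a01: "a n \<in> {0..1}" "b n \<in> {0..1}" if "n \<in> S" for n
    using cpar_01[OF np(1)] cpar_01[OF np(2)] that Sq by (auto simp: S_def a_def b_def)
  have ab1: "a n0 = 1" "b n0 = 1" using n0 by (auto simp: a_def b_def cpar_def)
  have PP: "P \<noteq> {}" "P \<subseteq> {0..1} \<times> {0..1}" using a01 by (auto simp: P_def)
  have lin: "\<kappa> * (a m - a n) \<le> b m - b n \<and> b m - b n \<le> \<Lambda> * (a m - a n)" if "n \<in> S" "m \<in> S" "a n \<le> a m" for n m
  proof (cases "n$3 \<le> m$3")
    case True
    then show ?thesis using AB(3)[of n m] AB'(3)[of n m] that by (intro conv[of "m$3 - n$3"]) auto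
  next
    case False
    then have "A * (n$3 - m$3) \<le> a n - a m" using AB(3)[of m n] that by auto
    moreover have "A * (n$3 - m$3) > 0" using False AB(1) by simp
    ultimately show ?thesis using that by simp
  qed
  have lin0: "\<kappa> * a n \<le> b n \<and> b n \<le> \<Lambda> * a n" if "n \<in> S" for n
    using AB(4)[OF that] AB'(4)[OF that] by (intro conv[of "- lform n x"]) auto
  have kL: "\<kappa> \<le> \<Lambda>" using lin0[OF n0S] ab1 by simp
  have bil: "\<kappa> * (u' - u) \<le> v' - v \<and> v' - v \<le> \<Lambda> * (u' - u)" if uv: "(u, v) \<in> P" "(u', v') \<in> P" "u \<le> u'" for u v u' v'
  proof -
    consider "u = 0" "v = 0" "u' = 0" "v' = 0" | n where "u = 0" "v = 0" "n \<in> S" "u' = a n" "v' = b n"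
      | n where "u' = 0" "v' = 0" "n \<in> S" "u = a n" "v = b n"
      | n m where "n \<in> S" "u = a n" "v = b n" "m \<in> S" "u' = a m" "v' = b m"
      using uv(1,2) unfolding P_def by blast
    then show ?thesis
    proof cases
      case (3 n)
      then have "a n = 0" using uv(3) a01[of n] by auto
      then show ?thesis using 3 lin0[of n] by simp
    qed (use lin lin0 uv(3) in auto)
  qed
  obtain U where U: "\<And>u v. (u, v) \<in> P \<Longrightarrow> U u = v"
    "\<And>s t. s \<le> t \<Longrightarrow> \<kappa> * (t - s) \<le> U t - U s" "\<And>s t. s \<le> t \<Longrightarrow> U t - U s \<le> \<Lambda> * (t - s)"
    by (rule bilipschitz_extension[OF PP k0(1) kL bil]) blast+
  have Un: "U (a n) = b n" if "n \<in> S" for n using U(1) that by (simp add: P_def)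
  have U01: "U 0 = 0" "U 1 = 1" using U(1)[of 0 0] Un[OF n0S] ab1 by (auto simp: P_def)
  have Um: "U s < U t" if "s < t" for s t using U(2)[of s t] k0(1) that by (smt (verit) mult_pos_pos)
  have Uin: "U t \<in> {0..1}" if "t \<in> {0..1}" for t
    using U01 Um[of 0 t] Um[of t 1] that by (cases "t = 0"; cases "t = 1") auto
  have Usgn: "sgn (U t - U s) = sgn (t - s)" for s t
    using Um[of s t] Um[of t s] by (cases s t rule: linorder_cases) auto
  have Uc: "continuous_on {0..1} U"
  proof -
    have "\<bar>U s - U t\<bar> \<le> \<Lambda> * \<bar>s - t\<bar>" for s t
      using U(3)[of s t] U(3)[of t s] Um[of s t] Um[of t s] by (cases s t rule: linorder_cases) auto
    then have "\<Lambda>-lipschitz_on {0..1} U"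
      using k0 by (intro lipschitz_onI) (auto simp: dist_real_def)
    then show ?thesis by (rule lipschitz_on_continuous_on)
  qed
  define v where "v s t = (1 - s) *\<^sub>R cseg x p t + s *\<^sub>R cseg x q (U t)" for s t
  define H where "H s t = hproj (v s t)" for s t
  have vf: "v s t \<in> future" if "s \<in> {0..1}" "t \<in> {0..1}" for s t
    using that Uin[OF that(2)] f convexD[OF convex_future cseg_future[OF f(1,2) that(2)] cseg_future[OF f(1,3) Uin[OF that(2)]], of "1 - s" s]
    by (simp add: v_def)
  have Hh: "H s t \<in> hyp2" if "s \<in> {0..1}" "t \<in> {0..1}" for s t
    using hproj_hyp2[OF vf[OF that]] by (simp add: H_def)
  have sgH: "sgn (lform n (H s t)) = sgn (t - a n)" if n: "n \<in> S" and st: "s \<in> {0..1}" "t \<in> {0..1}" for n s t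
  proof -
    have nS: "n \<in> seps \<L> x p" "n \<in> seps \<L> x q" using n Sq by (auto simp: S_def)
    define D where "D = lform n p - lform n x"
    define E where "E = lform n q - lform n x"
    have DE: "D > 0" "E > 0" using seps_pos[OF np(1) nS(1)] seps_pos[OF np(2) nS(2)] by (auto simp: D_def E_def)
    have "lform n (v s t) = (1 - s) * (D * (t - a n)) + s * (E * (U t - b n))"
      using cpar_affine[of n x p t] cpar_affine[of n x q "U t"] DE
      by (simp add: v_def lform.add_right lform.scaleR_right lform_cseg D_def E_def a_def b_def)
    also have "b n = U (a n)" using Un[OF n] by simp
    finally have e: "lform n (v s t) = (1 - s) * (D * (t - a n)) + s * (E * (U t - U (a n)))" .
    have "sgn (lform n (v s t)) = sgn (t - a n)"
    proof -
      consider "t = a n" | "t < a n" | "t > a n" by linarith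
      then show ?thesis
      proof cases
        case 2
        then have "D * (t - a n) < 0" "E * (U t - U (a n)) < 0" using DE Um[of t "a n"] by (auto simp: mult_pos_neg)
        then have "lform n (v s t) < 0" unfolding e using st convex_bound_lt[of "D * (t - a n)" 0 "E * (U t - U (a n))" "1 - s" s] by simp
        then show ?thesis using 2 by simp
      next
        case 3
        then have "- (D * (t - a n)) < 0" "- (E * (U t - U (a n))) < 0" using DE Um[of "a n" t] by auto
        then have "- lform n (v s t) < 0" unfolding e using st convex_bound_lt[of "- (D * (t - a n))" 0 "- (E * (U t - U (a n)))" "1 - s" s] by simp
        then show ?thesis using 3 by simp
      next
        case 1
        then show ?thesis using e by simp
      qed
    qed
    then show ?thesis using sgn_lform_hproj[OF vf[OF st], of n] by (simp add: H_def)
  qed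
  have inS: "n \<in> S \<or> - n \<in> S" if n: "n \<in> normals \<L>" and st: "s \<in> {0..1}" "t \<in> {0..1}" and z: "lform n (H s t) = 0" for n s t
  proof -
    have *: "n \<in> S" if n: "n \<in> normals \<L>" and pos: "lform n p > 0" and z: "lform n (H s t) = 0" for n
    proof -
      have q: "lform n q > 0" using sg[OF n] pos by (auto simp: sgn_real_def split: if_splits)
      have "lform n x \<le> 0"
      proof (rule ccontr)
        assume "\<not> ?thesis"
        then have x: "- lform n x < 0" by simp
        have "- lform n (cseg x p t) < 0" "- lform n (cseg x q (U t)) < 0"
          using convex_bound_lt[OF x, of "- lform n p" "1 - t" t] convex_bound_lt[OF x, of "- lform n q" "1 - U t" "U t"]
            pos q st Uin[OF st(2)] by (auto simp: lform_cseg)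
        then have "- lform n (v s t) < 0"
          using convex_bound_lt[of "- lform n (cseg x p t)" 0 "- lform n (cseg x q (U t))" "1 - s" s] st
          by (simp add: v_def lform.add_right lform.scaleR_right)
        then show False using z lform_hproj_eq0[OF vf[OF st], of n] by (simp add: H_def)
      qed
      then show ?thesis using n pos by (simp add: S_def seps_def)
    qed
    consider "lform n p > 0" | "lform n p < 0" | "lform n p = 0" by linarith
    then show ?thesis
    proof cases
      case 3
      then have "n0 = n \<or> n0 = - n" using normals_same_leaf[OF n n0(1) f(2)] n0(3) by blast
      then show ?thesis using n0S by auto
    qed (use *[OF n] *[OF normals_minus[OF n]] z in \<open>auto simp: lform.minus_left\<close>)
  qed
  define R where "R = norm x + norm p + norm q"
  have nv: "norm (v s t) \<le> R + R" if "s \<in> {0..1}" "t \<in> {0..1}" for s t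
  proof -
    have "norm (v s t) \<le> norm ((1 - s) *\<^sub>R cseg x p t) + norm (s *\<^sub>R cseg x q (U t))" unfolding v_def by (rule norm_triangle_ineq)
    also have "\<dots> \<le> R + R"
    proof (rule add_mono)
      have "norm (cseg x p t) \<le> R" "norm (cseg x q (U t)) \<le> R"
        using norm_cseg[OF that(2), of x p] norm_cseg[OF Uin[OF that(2)], of x q]
        by (auto simp: R_def intro: order_trans)
      then show "norm ((1 - s) *\<^sub>R cseg x p t) \<le> R" "norm (s *\<^sub>R cseg x q (U t)) \<le> R"
        using that mult_mono[of "1 - s" 1 "norm (cseg x p t)" R] mult_mono[of s 1 "norm (cseg x q (U t))" R] by auto
    qed
    finally show ?thesis .
  qed
  define M where "M = (1 + (R + R)\<^sup>2) * (norm (p - x) + \<Lambda> * norm (q - x))"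
  have lipH: "norm (H s t - H s t') \<le> M * t' - M * t" if s: "s \<in> {0..1}" and t: "0 \<le> t" "t \<le> t'" "t' \<le> 1" for s t t'
  proof -
    have tt: "t \<in> {0..1}" "t' \<in> {0..1}" using t by auto
    have "norm (H s t - H s t') \<le> (1 + (R + R)\<^sup>2) * norm (v s t - v s t')"
      unfolding H_def using hproj_lipschitz vf nv s tt by blast
    also have "v s t - v s t' = ((1 - s) * (t - t')) *\<^sub>R (p - x) + (s * (U t - U t')) *\<^sub>R (q - x)"
      by (simp add: v_def cseg_def algebra_simps)
    also have "norm \<dots> \<le> norm (((1 - s) * (t - t')) *\<^sub>R (p - x)) + norm ((s * (U t - U t')) *\<^sub>R (q - x))" by (rule norm_triangle_ineq)
    also have "norm (((1 - s) * (t - t')) *\<^sub>R (p - x)) \<le> (t' - t) * norm (p - x)"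
      using s t mult_right_mono[of "1 - s" 1 "t' - t"] by (simp add: abs_mult mult_right_mono)
    also have "norm ((s * (U t - U t')) *\<^sub>R (q - x)) \<le> (\<Lambda> * (t' - t)) * norm (q - x)"
    proof -
      have "\<bar>U t - U t'\<bar> \<le> \<Lambda> * (t' - t)" using U(3)[OF t(2)] U(2)[OF t(2)] k0 t by (smt (verit) mult_nonneg_nonneg)
      then have "s * \<bar>U t - U t'\<bar> \<le> 1 * (\<Lambda> * (t' - t))" using s by (intro mult_mono) auto
      then show ?thesis using s by (simp add: abs_mult mult_right_mono)
    qed
    finally have "norm (H s t - H s t') \<le> (1 + (R + R)\<^sup>2) * ((t' - t) * norm (p - x) + \<Lambda> * (t' - t) * norm (q - x))"
      by (simp add: mult_left_mono)
    also have "\<dots> = M * t' - M * t" by (simp add: M_def algebra_simps)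
    finally show ?thesis .
  qed
  have Hcont: "continuous_on ({0..1} \<times> {0..1}) (\<lambda>(s, t). H s t)"
  proof -
    have c: "continuous_on ({0..1} \<times> {0..1}) (\<lambda>z. v (fst z) (snd z))"
      unfolding v_def cseg_def
      by (intro continuous_intros continuous_on_compose2[OF Uc]) auto
    have n0': "sqrt (- lform (v (fst z) (snd z)) (v (fst z) (snd z))) \<noteq> 0" if "z \<in> {0..1} \<times> {0..1}" for z
      using future_sqrt_ge1[OF vf[of "fst z" "snd z"]] that by force
    have "continuous_on ({0..1} \<times> {0..1}) (\<lambda>z. H (fst z) (snd z))"
      unfolding H_def hproj_def using n0'
      by (intro continuous_intros lform.continuous_on c) auto
    then show ?thesis by (simp add: case_prod_unfold)
  qed
  have Hinj: "t = t'" if s: "s \<in> {0..1}" and t: "t \<in> {0..1}" "t' \<in> {0..1}" and e: "H s t = H s t'" for s t t'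
  proof -
    have False if lt: "t < t'" and t: "t \<in> {0..1}" "t' \<in> {0..1}" and e: "H s t = H s t'" for t t'
    proof -
      define r where "r = sqrt (- lform (v s t) (v s t))"
      define r' where "r' = sqrt (- lform (v s t') (v s t'))"
      have r: "r \<ge> 1" "r' \<ge> 1" using future_sqrt_ge1[OF vf] s t by (auto simp: r_def r'_def)
      \<comment> \<open>If two points of an arc of the family agree, their affine representatives are proportional.
        Comparing the values of \<open>n0\<close>, which depend on \<open>w\<close> only, gives a ratio \<open>l \<ge> 1\<close>. Then the remaining
        coefficients of \<open>p\<close> and \<open>q\<close> are negative, but their combination vanishes.\<close>
      define l where "l = r / r'"
      have l0: "l > 0" using r by (simp add: l_def)
      have "v s t /\<^sub>R r = v s t' /\<^sub>R r'" using e by (simp add: H_def hproj_def r_def r'_def)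
      then have "r *\<^sub>R (v s t /\<^sub>R r) = r *\<^sub>R (v s t' /\<^sub>R r')" by simp
      then have vv: "v s t = l *\<^sub>R v s t'" using r by (simp add: l_def divide_inverse)
      define w where "w t = (1 - s) * t + s * U t" for t
      have wl: "w t < w t'"
        using lt Um[OF lt] s unfolding w_def by (cases "s = 0") (auto intro!: add_le_less_mono mult_left_mono)
      have nv: "lform n0 (v s t) = (1 - w t) * lform n0 x" for t
        by (simp add: v_def w_def lform.add_right lform.scaleR_right lform_cseg n0) (simp add: algebra_simps)
      have "(1 - w t) * lform n0 x = l * ((1 - w t') * lform n0 x)"
      proof -
        have "lform n0 (v s t) = l * lform n0 (v s t')" by (simp add: vv lform.scaleR_right)
        then show ?thesis unfolding nv .
      qed
      then have wt: "1 - w t = l * (1 - w t')" using n0(2) by auto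
      have "w t' \<le> 1" using s t Uin[OF t(2)] convex_bound_le[of t' 1 "U t'" "1 - s" s] by (simp add: w_def)
      have l1: "l \<ge> 1"
      proof (rule ccontr)
        assume "\<not> l \<ge> 1"
        then have "l * (1 - w t') \<le> 1 * (1 - w t')" using \<open>w t' \<le> 1\<close> by (intro mult_right_mono) auto
        then show False using wt wl by simp
      qed
      have id: "v s t - l *\<^sub>R v s t' = ((1 - w t) - l * (1 - w t')) *\<^sub>R x + ((1 - s) * (t - l * t')) *\<^sub>R p + (s * (U t - l * U t')) *\<^sub>R q"
        by (simp add: v_def w_def cseg_def algebra_simps)
      then have "((1 - s) * (t - l * t')) *\<^sub>R p + (s * (U t - l * U t')) *\<^sub>R q = 0" using vv wt by simp
      then have z: "(1 - s) * ((t - l * t') * p$3) + s * ((U t - l * U t') * q$3) = 0"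
        by (simp add: vec_eq_iff forall_3 mult.assoc)
      have "1 * t' \<le> l * t'" "1 * U t' \<le> l * U t'"
        using t Uin[OF t(2)] mult_right_mono[OF l1, of t'] mult_right_mono[OF l1, of "U t'"] by auto
      then have "t - l * t' < 0" "U t - l * U t' < 0" using lt Um[OF lt] by linarith+
      moreover have "p$3 > 0" "q$3 > 0" using hyp by (auto simp: hyp2_def)
      ultimately have "(t - l * t') * p$3 < 0" "(U t - l * U t') * q$3 < 0" by (auto simp: mult_neg_pos)
      then show False using z s convex_bound_lt[of "(t - l * t') * p$3" 0 "(U t - l * U t') * q$3" "1 - s" s] by simp
    qed
    from this[of t t'] this[of t' t] t e show ?thesis by (metis linorder_neqE_linordered_idom)
  qed
  have Htrans: "transverse_arc \<L> (H s)" if s: "s \<in> {0..1}" for s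
  proof (rule transverse_arcI)
    have "continuous_on {0..1} (\<lambda>t. (\<lambda>(s, t). H s t) (s, t))"
      using s by (intro continuous_on_compose2[OF Hcont] continuous_intros) auto
    then show "arc (H s)"
      using Hinj[OF s] by (simp add: arc_def path_def inj_on_def)
    show "path_image (H s) \<subseteq> hyp2" using Hh[OF s] by (auto simp: path_image_def)
    show "hrectifiable (H s)"
      by (rule hrectifiableI[where h="\<lambda>t. M * t"]) (use Hh[OF s] lipH[OF s] in auto)
    fix n u assume n: "n \<in> normals \<L>" and u: "u \<in> {0..1}" and z: "lform n (H s u) = 0"
    have *: "crosses (H s) n u {0..1}" if n: "n \<in> S" and z: "lform n (H s u) = 0" for n
    proof -
      have "u = a n" using sgH[OF n s u] z by (simp add: sgn_0_0)
      then show ?thesis unfolding crosses_def using sgH[OF n s] by (intro exI[of _ 1]) simp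
    qed
    show "crosses (H s) n u {0..1}"
      using inS[OF n s u z] *[of n] *[of "- n"] z crosses_minus by (auto simp: lform.minus_left)
  qed
  have same: "lform n (H s' t) = 0" if n: "n \<in> normals \<L>" and st: "s \<in> {0..1}" "s' \<in> {0..1}" "t \<in> {0..1}" and z: "lform n (H s t) = 0" for n s s' t
  proof -
    have *: "lform n (H s' t) = 0" if n: "n \<in> S" and z: "lform n (H s t) = 0" for n
      using sgH[OF n st(1,3)] sgH[OF n st(2,3)] z by (simp add: sgn_0_0)
    show ?thesis using inS[OF n st(1,3) z] *[of n] *[of "- n"] z by (auto simp: lform.minus_left)
  qed
  show thesis
  proof (rule that)
    show "transverse_homotopy \<L> H" unfolding transverse_homotopy_def
    proof (intro conjI ballI)
      fix t :: real assume t: "t \<in> {0..1}"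
      show "(\<exists>k\<in>\<L>. \<forall>s\<in>{0..1}. H s t \<in> k) \<or> (\<forall>s\<in>{0..1}. H s t \<notin> \<Union> \<L>)"
      proof (cases "\<forall>s\<in>{0..1}. H s t \<notin> \<Union> \<L>")
        case False
        then obtain s where s: "s \<in> {0..1}" "H s t \<in> \<Union> \<L>" by blast
        then obtain n where n: "n \<in> normals \<L>" "lform n (H s t) = 0" using lam_mem[OF Hh[OF s(1) t]] by blast
        have "\<forall>s\<in>{0..1}. H s t \<in> geo n" using same[OF n(1) s(1) _ t n(2)] Hh t by (auto simp: geo_def)
        then show ?thesis using normals_geo[OF n(1)] by blast
      qed simp
    qed (use Hcont Htrans in auto)
    show "\<forall>t\<in>{0..1}. H 0 t = hseg x p t" by (simp add: H_def v_def hseg_cseg)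
    have "U ` {0..1} = {0..1}"
    proof
      show "{0..1} \<subseteq> U ` {0..1}"
      proof
        fix y :: real assume "y \<in> {0..1}"
        then show "y \<in> U ` {0..1}" using IVT'[of U 0 y 1] Uc U01 by force
      qed
    qed (use Uin in auto)
    moreover have "H 1 t = hseg x q (U t)" for t by (simp add: H_def v_def hseg_cseg)
    then have "H 1 ` {0..1} = hseg x q ` (U ` {0..1})" by (simp add: image_image)
    ultimately show "path_image (H 1) = path_image (hseg x q)" by (simp add: path_image_def)
    show "\<forall>t\<in>{0..1}. \<forall>n\<in>normals \<L>. lform n (H 0 t) = 0 \<longleftrightarrow> lform n (H 1 t) = 0"
      using same[of _ 0 1] same[of _ 1 0] by auto
  qed
qed

end

section \<open>The transverse measure on segments\<close>

lemma integral_null_measure: "integral\<^sup>L (null_measure M) f = (0::'a::{banach, second_countable_topology})"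
  by (rule integral_eq_zero_AE) (auto simp: eventually_ae_filter null_sets_def intro!: exI[of _ "space M"])

text \<open>A second countable space is covered off the support by countably many null open sets.\<close>

lemma null_off_msupport:
  fixes M :: "'a::second_countable_topology measure"
  assumes k: "space M = k" "sets M = sets (restrict_space borel k)"
  shows "AE p in M. p \<in> msupport M"
proof -
  define F where "F = {U. open U \<and> emeasure M (U \<inter> k) = 0}"
  obtain F' where F': "F' \<subseteq> F" "countable F'" "\<Union>F' = \<Union>F"
    using Lindelof[of F] by (auto simp: F_def)
  have m: "U \<inter> k \<in> sets M" if "open U" for U
    using that by (auto simp: k sets_restrict_space)
  have "(\<Union>U\<in>F'. U \<inter> k) \<in> null_sets M"
    using F' m by (intro null_sets_UN') (auto simp: F_def null_sets_def)
  moreover have "{p\<in>space M. p \<notin> msupport M} \<subseteq> (\<Union>U\<in>F'. U \<inter> k)"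
  proof
    fix p assume "p \<in> {p\<in>space M. p \<notin> msupport M}"
    then obtain U where "open U" "p \<in> U" "emeasure M (U \<inter> k) = 0" "p \<in> k" by (auto simp: msupport_def k)
    then have "p \<in> \<Union>F" "p \<in> k" by (auto simp: F_def)
    then show "p \<in> (\<Union>U\<in>F'. U \<inter> k)" using F'(3) by blast
  qed
  ultimately show ?thesis unfolding eventually_ae_filter by blast
qed

locale meas_lam =
  fixes lam :: mlam
  assumes ml: "measured_lamination lam"
begin

sublocale geodesic_lam "leaves lam"
  using ml by unfold_locales (simp add: measured_lamination_def)

abbreviation "\<L> \<equiv> leaves lam"

lemma tmeas_arc:
  assumes g: "transverse_arc \<L> g"
  shows "space (tmeas lam (path_image g)) = path_image g"
    "sets (tmeas lam (path_image g)) = sets (restrict_space borel (path_image g))"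
    "emeasure (tmeas lam (path_image g)) (path_image g) < \<infinity>"
    "msupport (tmeas lam (path_image g)) \<subseteq> path_image g \<inter> lamset lam"
  using ml g unfolding measured_lamination_def Let_def by blast+

lemma tmeas_subarc:
  "transverse_arc \<L> g \<Longrightarrow> transverse_arc \<L> h \<Longrightarrow> path_image h \<subseteq> path_image g \<Longrightarrow>
     tmeas lam (path_image h) = restrict_space (tmeas lam (path_image g)) (path_image h)"
  using ml unfolding measured_lamination_def by blast

lemma tmeas_homotopy:
  "transverse_homotopy \<L> H \<Longrightarrow> T \<in> sets borel \<Longrightarrow> T \<subseteq> {0..1} \<Longrightarrow>
     emeasure (tmeas lam (path_image (H 0))) (H 0 ` T) = emeasure (tmeas lam (path_image (H 1))) (H 1 ` T)"
  using ml unfolding measured_lamination_def by blast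

lemma path_image_arc_borel: "transverse_arc \<L> g \<Longrightarrow> path_image g \<in> sets borel"
  by (intro borel_compact compact_path_image) (auto simp: transverse_arc_def arc_def)

lemma tmeas_sets_iff:
  assumes "transverse_arc \<L> g"
  shows "A \<in> sets (tmeas lam (path_image g)) \<longleftrightarrow> A \<in> sets borel \<and> A \<subseteq> path_image g"
  using path_image_arc_borel[OF assms] by (auto simp: tmeas_arc(2)[OF assms] sets_restrict_space_iff)

lemma finite_tmeas: "transverse_arc \<L> g \<Longrightarrow> finite_measure (tmeas lam (path_image g))"
  using tmeas_arc(1)[of g] tmeas_arc(3)[of g] by (intro finite_measureI) (simp add: less_top)

lemma tmeas_AE: "transverse_arc \<L> g \<Longrightarrow> AE p in tmeas lam (path_image g). p \<in> lamset lam"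
proof -
  assume g: "transverse_arc \<L> g"
  show ?thesis
    by (rule eventually_mono[OF null_off_msupport[OF tmeas_arc(1,2)[OF g]]]) (use tmeas_arc(4)[OF g] in blast)
qed

abbreviation tseg :: "real^3 \<Rightarrow> real^3 \<Rightarrow> bool" where
  "tseg x y \<equiv> transverse_arc \<L> (hseg x y)"

abbreviation segm :: "real^3 \<Rightarrow> real^3 \<Rightarrow> (real^3) measure" where
  "segm \<equiv> seg_measure lam"

lemma segm_t: "tseg x y \<Longrightarrow> segm x y = tmeas lam (path_image (hseg x y))"
  by (simp add: seg_measure_def)

lemma segm_n: "\<not> tseg x y \<Longrightarrow> segm x y = null_measure borel"
  by (simp add: seg_measure_def)

lemma finite_segm: "finite_measure (segm x y)"
  by (cases "tseg x y") (auto simp: segm_t segm_n finite_tmeas intro!: finite_measureI)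

lemma segm_AE: "AE p in segm x y. p \<in> lamset lam"
proof (cases "tseg x y")
  case True
  show ?thesis using tmeas_AE[OF True] by (simp only: segm_t[OF True])
next
  case False
  then show ?thesis by (auto simp: segm_n eventually_ae_filter null_sets_def intro!: exI[of _ UNIV])
qed

lemma lamset_iff: "z \<in> hyp2 \<Longrightarrow> z \<in> lamset lam \<longleftrightarrow> (\<exists>n\<in>normals \<L>. lform n z = 0)"
  unfolding lamset_def by (rule lam_mem)

lemma lam_seg_seps:
  assumes xy: "x \<in> hyp2" "y \<in> hyp2" and r: "r \<in> path_image (hseg x y)" "r \<in> lamset lam"
  obtains n where "n \<in> seps \<L> x y" "lform n r = 0"
proof -
  obtain s where s: "s \<in> {0..1}" "r = hseg x y s" using r by (auto simp: path_image_def)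
  have "r \<in> hyp2" using hseg_image_hyp2[OF xy] r by blast
  then obtain n where n: "n \<in> normals \<L>" "lform n r = 0" using r(2) lamset_iff by blast
  then have "n \<in> seps \<L> x y \<or> - n \<in> seps \<L> x y" using meets_seg_seps[OF xy n(1) s(1)] s(2) by simp
  then show thesis using that[of n] that[of "- n"] n by (auto simp: lform.minus_left)
qed

text \<open>At a point of a leaf the two unit normals of the leaf are the only candidates, and only one of them
  points from \<open>x\<close> to \<open>y\<close>.\<close>

lemma dirvec_eq:
  assumes np: "no_common_leaf \<L> x y" and n: "n \<in> seps \<L> x y" and p: "p \<in> hyp2" "lform n p = 0"
  shows "dirvec lam x y p = n"
proof -
  have nn: "n \<in> normals \<L>" using n by (simp add: seps_def)
  have pL: "p \<in> lamset lam" using lamset_iff[OF p(1)] nn p(2) by blast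
  have "is_dirvec lam x y p v \<longleftrightarrow> v = n" for v
  proof
    assume "v = n"
    moreover have "lform n u = 0" if u: "is_ogeod (p, u)" "gset (p, u) \<in> \<L>" for u
    proof -
      have r: "rnormal (p, u) \<in> normals \<L>" using u unfolding normals_def by (intro CollectI exI[of _ "(p, u)"]) simp
      have "n = rnormal (p, u) \<or> n = - rnormal (p, u)"
        using normals_same_leaf[OF r nn hyp2_future[OF p(1)]] rnormal_orth(1)[of "(p, u)"] p(2) by simp
      then show ?thesis using rnormal_orth(2)[of "(p, u)"] by (auto simp: lform.minus_left)
    qed
    ultimately show "is_dirvec lam x y p v"
      unfolding is_dirvec_def using p normals_unit[OF nn] n by (auto simp: seps_def)
  next
    assume v: "is_dirvec lam x y p v"
    obtain l where l: "is_ogeod l" "gset l \<in> \<L>" "n = rnormal l" using nn by (auto simp: normals_def)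
    have "p \<in> gset l" using p l gset_eq_geo[OF l(1)] by (simp add: geo_def)
    then obtain u where u: "is_ogeod (p, u)" "rnormal (p, u) = n" "gset (p, u) = gset l"
      using ogeod_rebase[OF l(1)] l(3) by metis
    have vp: "lform v p = 0" "lform v v = 1" "lform v u = 0" "lform v x \<le> 0" "0 \<le> lform v y"
      using v u l(2) unfolding is_dirvec_def by auto
    have vn: "v = lform v n *\<^sub>R n" using orth_rnormal[OF u(1), of v] vp u(2) by simp
    have "lform v v = lform v n * lform v n"
      using lform.scaleR_right[of v "lform v n" n] vn by simp
    then have "lform v n = 1 \<or> lform v n = -1" using vp(2) by (simp add: square_eq_1_iff)
    then show "v = n"
    proof
      assume "lform v n = -1"
      then have "v = - n" using vn by simp
      then have "lform n x = 0" "lform n y = 0" using vp n by (auto simp: seps_def lform.minus_left)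
      then show ?thesis using np nn by (auto simp: no_common_leaf_def)
    qed (use vn in simp)
  qed
  then have "(THE v. is_dirvec lam x y p v) = n" by (intro the_equality) auto
  then show ?thesis using pL by (simp add: dirvec_def)
qed

lemma dirvec_seg:
  assumes xy: "x \<in> hyp2" "y \<in> hyp2" and t: "tseg x y" and r: "r \<in> path_image (hseg x y)" "r \<in> lamset lam"
  shows "dirvec lam x y r \<in> seps \<L> x y" "lform (dirvec lam x y r) r = 0"
    "r = hseg x y (cpar x y (dirvec lam x y r))"
proof -
  have np: "no_common_leaf \<L> x y" using t transverse_hseg_iff[OF xy] by simp
  obtain n where n: "n \<in> seps \<L> x y" "lform n r = 0" using lam_seg_seps[OF xy r] .
  have "r \<in> hyp2" using hseg_image_hyp2[OF xy] r by blast
  then have d: "dirvec lam x y r = n" by (rule dirvec_eq[OF np n(1) _ n(2)])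
  show "dirvec lam x y r \<in> seps \<L> x y" "lform (dirvec lam x y r) r = 0" using n d by auto
  obtain s where s: "s \<in> {0..1}" "r = hseg x y s" using r by (auto simp: path_image_def)
  then have "s = cpar x y n" using sgn_seps_hseg[OF xy np n(1) s(1)] n(2) by (simp add: sgn_0_0)
  then show "r = hseg x y (cpar x y (dirvec lam x y r))" using d s by simp
qed

lemma dirvec_off: "r \<notin> lamset lam \<Longrightarrow> dirvec lam x y r = 0"
  by (simp add: dirvec_def)

lemma lamset_closed:
  obtains T where "closed T" "lamset lam = hyp2 \<inter> T"
  using gl unfolding geodesic_lamination_def closedin_closed lamset_def by auto

text \<open>By \<open>normals_lipschitz\<close> the direction is a Lipschitz function of the parameter, and on the compact segment
  the parameter is a continuous function of the point.\<close>

lemma dirvec_continuous: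
  assumes xy: "x \<in> hyp2" "y \<in> hyp2" and t: "tseg x y"
  shows "continuous_on (path_image (hseg x y) \<inter> lamset lam) (dirvec lam x y)"
proof -
  have np: "no_common_leaf \<L> x y" using t transverse_hseg_iff[OF xy] by simp
  let ?k = "path_image (hseg x y)"
  obtain h where h: "homeomorphism {0..1} ?k (hseg x y) h"
    using homeomorphism_arc t unfolding transverse_arc_def by blast
  have hc: "continuous_on ?k h" "\<And>s. s \<in> {0..1} \<Longrightarrow> h (hseg x y s) = s"
    using h by (auto simp: homeomorphism_def)
  obtain C where C: "C > 0"
    "\<And>n m. n \<in> seps \<L> x y \<Longrightarrow> m \<in> seps \<L> x y \<Longrightarrow> norm (n - m) \<le> C * \<bar>cpar x y n - cpar x y m\<bar>"
    by (rule normals_lipschitz[OF xy np]) blast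
  have hd: "h r = cpar x y (dirvec lam x y r)" if "r \<in> ?k" "r \<in> lamset lam" for r
    using dirvec_seg[OF xy t that] hc(2) cpar_01[OF np] by metis
  show ?thesis
  proof (rule continuous_onI)
    fix r and e :: real assume r: "r \<in> ?k \<inter> lamset lam" and e: "e > 0"
    have "continuous_on (?k \<inter> lamset lam) h" using hc(1) by (rule continuous_on_subset) auto
    moreover have "e / C > 0" using e C(1) by simp
    ultimately obtain d where d: "d > 0" "\<And>q. q \<in> ?k \<inter> lamset lam \<Longrightarrow> dist q r < d \<Longrightarrow> dist (h q) (h r) \<le> e / C"
      using r unfolding continuous_on_iff by (meson less_imp_le)
    show "\<exists>d>0. \<forall>q\<in>?k \<inter> lamset lam. dist q r < d \<longrightarrow> dist (dirvec lam x y q) (dirvec lam x y r) \<le> e"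
    proof (intro exI[of _ d] conjI ballI impI)
      fix q assume q: "q \<in> ?k \<inter> lamset lam" "dist q r < d"
      have "norm (dirvec lam x y q - dirvec lam x y r) \<le> C * \<bar>h q - h r\<bar>"
        using C(2)[of "dirvec lam x y q" "dirvec lam x y r"] dirvec_seg(1)[OF xy t] hd r q by auto
      also have "\<dots> \<le> C * (e / C)"
        using d(2)[OF q] C(1) by (intro mult_left_mono) (auto simp: dist_real_def)
      finally show "dist (dirvec lam x y q) (dirvec lam x y r) \<le> e" using C(1) by (simp add: dist_norm)
    qed (use d in auto)
  qed
qed

lemma seg_lam_borel:
  assumes xy: "x \<in> hyp2" "y \<in> hyp2" and t: "tseg x y"
  shows "path_image (hseg x y) \<inter> lamset lam \<in> sets borel"
proof -
  obtain T where T: "closed T" "lamset lam = hyp2 \<inter> T" by (rule lamset_closed)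
  have "path_image (hseg x y) \<inter> lamset lam = path_image (hseg x y) \<inter> T"
    using hseg_image_hyp2[OF xy] T by auto
  then show ?thesis using path_image_arc_borel[OF t] T(1) by auto
qed

lemma dirvec_measurable:
  assumes xy: "x \<in> hyp2" "y \<in> hyp2" and t: "tseg x y"
  shows "dirvec lam x y \<in> borel_measurable (segm x y)"
proof -
  let ?k = "path_image (hseg x y)"
  let ?A = "?k \<inter> lamset lam"
  have "(\<lambda>p. if p \<in> ?A then dirvec lam x y p else 0) \<in> borel_measurable borel"
    using seg_lam_borel[OF xy t] dirvec_continuous[OF xy t] by (intro borel_measurable_continuous_on_if) auto
  then have "(\<lambda>p. if p \<in> ?A then dirvec lam x y p else 0) \<in> borel_measurable (restrict_space borel ?k)"
    by (rule measurable_restrict_space1)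
  also have "?this \<longleftrightarrow> dirvec lam x y \<in> borel_measurable (restrict_space borel ?k)"
    by (rule measurable_cong) (auto simp: dirvec_off space_restrict_space)
  finally show ?thesis
    unfolding segm_t[OF t] measurable_cong_sets[OF tmeas_arc(2)[OF t] refl] .
qed

lemma dirvec_bounded:
  assumes xy: "x \<in> hyp2" "y \<in> hyp2" and t: "tseg x y" and r: "r \<in> path_image (hseg x y)"
  shows "norm (dirvec lam x y r) \<le> 2 * (x$3 + y$3)"
proof (cases "r \<in> lamset lam")
  case True
  then show ?thesis using seps_bounded[OF xy] transverse_hseg_iff[OF xy] t dirvec_seg(1)[OF xy t r] by blast
next
  case False
  have "x$3 > 0" "y$3 > 0" using xy by (auto simp: hyp2_def)
  then show ?thesis using dirvec_off[OF False] by simp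
qed

lemma space_segm: "tseg x y \<Longrightarrow> space (segm x y) = path_image (hseg x y)"
  by (simp add: segm_t tmeas_arc)

lemma dirvec_integrable:
  assumes xy: "x \<in> hyp2" "y \<in> hyp2" and t: "tseg x y"
  shows "integrable (segm x y) (dirvec lam x y)"
proof -
  interpret finite_measure "segm x y" by (rule finite_segm)
  show ?thesis
    using dirvec_bounded[OF xy t] dirvec_measurable[OF xy t] space_segm[OF t]
    by (intro integrable_const_bound[where B="2 * (x$3 + y$3)"]) (auto intro!: AE_I2)
qed

text \<open>The points of \<open>[x, y]\<close> that lie on leaves with normal in \<open>E\<close>. Describing parts of a segment by the normals
  of the leaves allows comparing different segments.\<close>

definition lamE :: "real^3 \<Rightarrow> real^3 \<Rightarrow> (real^3) set \<Rightarrow> (real^3) set" where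
  "lamE x y E = {r \<in> path_image (hseg x y) \<inter> lamset lam. dirvec lam x y r \<in> E}"

lemma lamE_sets:
  assumes xy: "x \<in> hyp2" "y \<in> hyp2" and t: "tseg x y" and E: "E \<in> sets borel"
  shows "lamE x y E \<in> sets (segm x y)"
proof -
  have "lamE x y E = (dirvec lam x y -` E \<inter> space (segm x y)) \<inter> (path_image (hseg x y) \<inter> lamset lam)"
    by (auto simp: lamE_def space_segm[OF t])
  moreover have "path_image (hseg x y) \<inter> lamset lam \<in> sets (segm x y)"
    using seg_lam_borel[OF xy t] by (simp add: segm_t[OF t] tmeas_sets_iff[OF t])
  ultimately show ?thesis using measurable_sets[OF dirvec_measurable[OF xy t] E] by simp
qed

text \<open>Along the homotopy \<open>leaf_homotopy\<close> the leaf through a point, hence its normal, does not change. So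
  it matches the two sets, and the measures of matching sets agree.\<close>

lemma leaf_transport:
  assumes n0: "n0 \<in> normals \<L>" "lform n0 x < 0" "lform n0 p = 0" "lform n0 q = 0"
    and hyp: "x \<in> hyp2" "p \<in> hyp2" "q \<in> hyp2" and E: "E \<in> sets borel"
  shows "emeasure (segm x p) (lamE x p E) = emeasure (segm x q) (lamE x q E)"
proof -
  have f: "x \<in> future" "p \<in> future" "q \<in> future" using hyp hyp2_future by auto
  have np: "no_common_leaf \<L> x p" "no_common_leaf \<L> x q"
    using leaf_no_common_leaf[OF n0(1,2) f(2) n0(3)] leaf_no_common_leaf[OF n0(1,2) f(3) n0(4)] by auto
  have ne: "x \<noteq> p" "x \<noteq> q" using n0 by auto
  have t: "tseg x p" "tseg x q" using transverse_hseg[OF hyp(1,2) ne(1) np(1)] transverse_hseg[OF hyp(1,3) ne(2) np(2)] .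
  have Sq: "seps \<L> x q = seps \<L> x p" by (rule seps_leaf_eq[OF n0(1) f(2) n0(3) f(3) n0(4)])
  obtain H where H: "transverse_homotopy \<L> H" "\<forall>t\<in>{0..1}. H 0 t = hseg x p t"
    "path_image (H 1) = path_image (hseg x q)"
    "\<forall>t\<in>{0..1}. \<forall>n\<in>normals \<L>. lform n (H 0 t) = 0 \<longleftrightarrow> lform n (H 1 t) = 0"
    by (rule leaf_homotopy[OF n0 hyp]) blast
  have H0: "path_image (H 0) = path_image (hseg x p)" using H(2) by (auto simp: path_image_def image_def)
  have Hh: "H 0 t \<in> hyp2" "H 1 t \<in> hyp2" if "t \<in> {0..1}" for t
    using H0 H(3) hseg_image_hyp2 hyp that unfolding path_image_def by blast+
  have inL: "H 0 t \<in> lamset lam \<longleftrightarrow> H 1 t \<in> lamset lam" if "t \<in> {0..1}" for t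
    using H(4) lamset_iff[OF Hh(1)[OF that]] lamset_iff[OF Hh(2)[OF that]] that by auto
  have dv: "dirvec lam x p (H 0 t) = dirvec lam x q (H 1 t)" if tt: "t \<in> {0..1}" and L: "H 0 t \<in> lamset lam" for t
  proof -
    have "H 0 t \<in> path_image (hseg x p)" using tt H0 by (auto simp: path_image_def)
    then obtain n where n: "n \<in> seps \<L> x p" "lform n (H 0 t) = 0" using lam_seg_seps[OF hyp(1,2) _ L] by blast
    then have n1: "lform n (H 1 t) = 0" using H(4) tt by (auto simp: seps_def)
    show ?thesis
      using dirvec_eq[OF np(1) n(1) Hh(1)[OF tt] n(2)] dirvec_eq[OF np(2) _ Hh(2)[OF tt] n1] n Sq by simp
  qed
  define T where "T = {t\<in>{0..1}. H 0 t \<in> lamE x p E}"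
  have "T \<subseteq> {0..1}" by (auto simp: T_def)
  have T: "T \<in> sets borel"
  proof -
    have "lamE x p E \<in> sets borel"
      using lamE_sets[OF hyp(1,2) t(1) E] by (simp add: segm_t[OF t(1)] tmeas_sets_iff[OF t(1)])
    moreover have "hseg x p \<in> measurable (restrict_space borel {0..1}) borel"
      by (rule borel_measurable_continuous_on_restrict[OF continuous_hseg[OF hyp(1,2)]])
    ultimately have "hseg x p -` lamE x p E \<inter> space (restrict_space borel {0..1}) \<in> sets (restrict_space borel {0..1})"
      by (intro measurable_sets)
    moreover have "hseg x p -` lamE x p E \<inter> space (restrict_space borel {0..1}) = T"
      using H(2) by (auto simp: T_def space_restrict_space)
    ultimately show ?thesis by (auto simp: sets_restrict_space_iff)
  qed
  have "H 0 ` T = lamE x p E"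
  proof
    show "lamE x p E \<subseteq> H 0 ` T"
    proof
      fix r assume r: "r \<in> lamE x p E"
      then have "r \<in> path_image (H 0)" using H0 by (simp add: lamE_def)
      then obtain t where "t \<in> {0..1}" "r = H 0 t" by (auto simp: path_image_def)
      then show "r \<in> H 0 ` T" using r by (auto simp: T_def)
    qed
  qed (auto simp: T_def)
  moreover have "H 1 ` T = lamE x q E"
  proof
    show "H 1 ` T \<subseteq> lamE x q E"
    proof
      fix r assume "r \<in> H 1 ` T"
      then obtain t where t: "t \<in> T" "r = H 1 t" by blast
      then have "t \<in> {0..1}" "H 0 t \<in> lamset lam" "dirvec lam x p (H 0 t) \<in> E" by (auto simp: T_def lamE_def)
      then show "r \<in> lamE x q E"
        using inL[of t] dv[of t] t(2) H(3) by (auto simp: lamE_def path_image_def)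
    qed
    show "lamE x q E \<subseteq> H 1 ` T"
    proof
      fix r assume r: "r \<in> lamE x q E"
      then have "r \<in> path_image (H 1)" "r \<in> lamset lam" "dirvec lam x q r \<in> E" using H(3) by (auto simp: lamE_def)
      then obtain t where t: "t \<in> {0..1}" "r = H 1 t" by (auto simp: path_image_def)
      have "H 0 t \<in> path_image (H 0)" using t(1) by (auto simp: path_image_def)
      then have "H 0 t \<in> path_image (hseg x p)" by (simp only: H0)
      then have "t \<in> T" using t \<open>r \<in> lamset lam\<close> \<open>dirvec lam x q r \<in> E\<close> inL[OF t(1)] dv[OF t(1)]
        by (simp add: T_def lamE_def)
      then show "r \<in> H 1 ` T" using t by blast
    qed
  qed
  ultimately show ?thesis
    using tmeas_homotopy[OF H(1) T] \<open>T \<subseteq> {0..1}\<close> by (simp add: H0 H(3) segm_t t)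
qed

end

section \<open>Initial segments\<close>

lemma hproj_scale: "c > 0 \<Longrightarrow> hproj (c *\<^sub>R z) = hproj z"
proof -
  assume c: "c > 0"
  have "- lform (c *\<^sub>R z) (c *\<^sub>R z) = c\<^sup>2 * (- lform z z)"
    by (simp add: lform.scaleR_left lform.scaleR_right power2_eq_square)
  then have "sqrt (- lform (c *\<^sub>R z) (c *\<^sub>R z)) = c * sqrt (- lform z z)"
    unfolding \<open>- lform (c *\<^sub>R z) (c *\<^sub>R z) = c\<^sup>2 * (- lform z z)\<close> real_sqrt_mult using c by simp
  then show ?thesis using c by (simp add: hproj_def)
qed

text \<open>The initial part of a segment is a segment, up to a projective change of the parameter.\<close>

lemma hproj_comb:
  assumes "a \<ge> 0" "b \<ge> 0" "a + b > 0"
  shows "hproj (a *\<^sub>R x + b *\<^sub>R y) = hseg x y (b / (a + b))"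
proof -
  have "a *\<^sub>R x + b *\<^sub>R y = (a + b) *\<^sub>R cseg x y (b / (a + b))"
  proof -
    have "(a + b) * (b / (a + b)) = b" "(a + b) * (1 - b / (a + b)) = a"
      using assms(3) by (simp_all add: right_diff_distrib)
    then show ?thesis by (simp add: cseg_def scaleR_add_right)
  qed
  then show ?thesis using hproj_scale[OF assms(3)] by (simp add: hseg_cseg)
qed

lemma hseg_initial:
  assumes xy: "x \<in> hyp2" "y \<in> hyp2" and s0: "0 < s0" "s0 \<le> 1"
  shows "hseg x (hseg x y s0) ` {0..1} = hseg x y ` {0..s0}"
proof -
  define p where "p = hseg x y s0"
  define \<rho> where "\<rho> = sqrt (- lform (cseg x y s0) (cseg x y s0))"
  have "cseg x y s0 \<in> future" using cseg_future hyp2_future xy s0 by simp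
  then have \<rho>: "\<rho> \<ge> 1" using future_sqrt_ge1 by (simp add: \<rho>_def)
  have p: "\<rho> *\<^sub>R p = cseg x y s0" using \<rho> by (simp add: p_def hseg_cseg hproj_def flip: \<rho>_def)
  have p': "p = ((1 - s0) / \<rho>) *\<^sub>R x + (s0 / \<rho>) *\<^sub>R y"
  proof -
    have "p = (1 / \<rho>) *\<^sub>R (\<rho> *\<^sub>R p)" using \<rho> by simp
    also have "\<dots> = ((1 - s0) / \<rho>) *\<^sub>R x + (s0 / \<rho>) *\<^sub>R y" unfolding p by (simp add: cseg_def scaleR_add_right)
    finally show ?thesis .
  qed
  have y': "y = (\<rho> / s0) *\<^sub>R p - ((1 - s0) / s0) *\<^sub>R x"
  proof -
    have "(\<rho> / s0) *\<^sub>R p = (1 / s0) *\<^sub>R (\<rho> *\<^sub>R p)" by simp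
    also have "\<dots> = ((1 - s0) / s0) *\<^sub>R x + y" unfolding p using s0 by (simp add: cseg_def scaleR_add_right)
    finally show ?thesis by simp
  qed
  show ?thesis unfolding p_def[symmetric]
  proof
    show "hseg x p ` {0..1} \<subseteq> hseg x y ` {0..s0}"
    proof
      fix r assume "r \<in> hseg x p ` {0..1}"
      then obtain s where s: "0 \<le> s" "s \<le> 1" "r = hseg x p s" by auto
      define a where "a = 1 - s + s * ((1 - s0) / \<rho>)"
      define b where "b = s * (s0 / \<rho>)"
      have ab: "a \<ge> 0" "b \<ge> 0" using s s0 \<rho> by (auto simp: a_def b_def)
      have sum: "a + b = 1 - s + s / \<rho>" using \<rho> by (simp add: a_def b_def field_simps)
      have "s / \<rho> > 0 \<or> 1 - s > 0" "s / \<rho> \<ge> 0" "1 - s \<ge> 0" using s \<rho> by (auto simp: zero_less_divide_iff)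
      then have pos: "a + b > 0" unfolding sum by linarith
      have "cseg x p s = a *\<^sub>R x + b *\<^sub>R y" unfolding cseg_def a_def b_def
        by (subst p') (simp add: scaleR_add_right scaleR_add_left)
      then have "r = hseg x y (b / (a + b))" using hproj_comb[OF ab pos] s by (simp add: hseg_cseg)
      moreover have "s0 * (a + b) = s0 * (1 - s) + s0 * (s / \<rho>)" by (simp only: sum distrib_left)
      then have "s0 * (a + b) - b = s0 * (1 - s)" by (simp add: b_def mult.commute)
      then have "b \<le> s0 * (a + b)" using s s0 mult_nonneg_nonneg[of s0 "1 - s"] by linarith
      then have "b / (a + b) \<in> {0..s0}" using ab pos by (auto simp: pos_divide_le_eq)
      ultimately show "r \<in> hseg x y ` {0..s0}" by blast
    qed
    show "hseg x y ` {0..s0} \<subseteq> hseg x p ` {0..1}"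
    proof
      fix r assume "r \<in> hseg x y ` {0..s0}"
      then obtain s where s: "0 \<le> s" "s \<le> s0" "r = hseg x y s" by auto
      define a where "a = 1 - s / s0"
      define b where "b = s * (\<rho> / s0)"
      have ab: "a \<ge> 0" "b \<ge> 0" using s s0 \<rho> by (auto simp: a_def b_def)
      have "s * 1 \<le> s * \<rho>" using \<rho> s by (intro mult_left_mono) auto
      then have "s * 1 / s0 \<le> s * \<rho> / s0" using s0 by (intro divide_right_mono) auto
      then have "s / s0 \<le> b" by (simp add: b_def)
      then have "a + b \<ge> 1" by (simp add: a_def)
      have "s * ((1 - s0) / s0) = s / s0 - s" using s0 by (simp add: right_diff_distrib diff_divide_distrib)
      then have "(1 - s) - s * ((1 - s0) / s0) = a" by (simp add: a_def)
      then have "cseg x y s = a *\<^sub>R x + b *\<^sub>R p" unfolding cseg_def b_def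
        by (subst y') (simp add: scaleR_diff_right flip: scaleR_diff_left)
      then have "r = hseg x p (b / (a + b))" using hproj_comb[OF ab] \<open>a + b \<ge> 1\<close> s by (simp add: hseg_cseg)
      moreover have "b / (a + b) \<in> {0..1}" using ab \<open>a + b \<ge> 1\<close> by auto
      ultimately show "r \<in> hseg x p ` {0..1}" by blast
    qed
  qed
qed

section \<open>The translation cocycle\<close>

context meas_lam
begin

text \<open>The order of the leaves along a segment does not depend on the segment.\<close>

lemma cpar_le_iff:
  assumes xy: "x \<in> hyp2" "y \<in> hyp2" and np: "no_common_leaf \<L> x y" and n: "n \<in> seps \<L> x y" and m: "m \<in> seps \<L> x y"
  shows "cpar x y n \<le> cpar x y m \<longleftrightarrow> n$3 \<le> m$3"
proof -
  let ?z = "cseg x y (cpar x y m)"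
  have f: "?z \<in> future" using cseg_future hyp2_future xy cpar_01[OF np m] by blast
  have c: "lform (n - m) (n - m) \<le> 0" using seps_causal[OF n m] hyp2_future xy np by blast
  have "cpar x y m < cpar x y n \<longleftrightarrow> (cpar x y m - cpar x y n) * (lform n y - lform n x) < 0"
    using seps_pos[OF np n] by (simp add: mult_less_0_iff)
  also have "\<dots> \<longleftrightarrow> m$3 < n$3"
    unfolding cpar_diff[OF np n m] causal_sign(1)[OF c f] by simp
  finally show ?thesis by linarith
qed

lemma separated_tseg:
  assumes n0: "n0 \<in> normals \<L>" "lform n0 x < 0" "lform n0 y > 0" and xy: "x \<in> hyp2" "y \<in> hyp2"
  shows "tseg x y" "no_common_leaf \<L> x y" "n0 \<in> seps \<L> x y"
proof -
  show np: "no_common_leaf \<L> x y" unfolding no_common_leaf_def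
  proof (intro ballI notI)
    fix n assume n: "n \<in> normals \<L>" and z: "lform n x = 0 \<and> lform n y = 0"
    obtain w where w: "lform w w \<le> 0" "w = n0 - n \<or> w = n0 + n" using normals_diff_causal[OF n0(1) n] by blast
    have "lform w x < 0" "lform w y > 0" using w(2) z n0 by (auto simp: lform.add_left lform.diff_left)
    then show False using causal_sign[OF w(1) hyp2_future[OF xy(1)]] causal_sign[OF w(1) hyp2_future[OF xy(2)]] by linarith
  qed
  have "x \<noteq> y" using n0 by auto
  then show "tseg x y" using transverse_hseg[OF xy _ np] by simp
  show "n0 \<in> seps \<L> x y" using n0 by (simp add: seps_def)
qed

lemma seg_initial:
  assumes xy: "x \<in> hyp2" "y \<in> hyp2" and t: "tseg x y" and s0: "0 < s0" "s0 \<le> 1"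
  defines "p \<equiv> hseg x y s0"
  shows "p \<in> hyp2" "tseg x p" "path_image (hseg x p) = hseg x y ` {0..s0}"
    "segm x p = restrict_space (segm x y) (path_image (hseg x p))"
    "\<And>r. r \<in> path_image (hseg x p) \<Longrightarrow> r \<in> lamset lam \<Longrightarrow>
       dirvec lam x p r = dirvec lam x y r \<and> cpar x y (dirvec lam x y r) \<le> s0"
proof -
  have np: "no_common_leaf \<L> x y" and ne: "x \<noteq> y" using t transverse_hseg_iff[OF xy] by auto
  show p: "p \<in> hyp2" using hseg_hyp2 hyp2_future xy s0 by (simp add: p_def)
  have sg: "sgn (lform n p) = sgn (s0 - cpar x y n)" if "n \<in> seps \<L> x y" for n
    using sgn_seps_hseg[OF xy np that] s0 by (simp add: p_def)
  have xp: "x \<noteq> p" using hseg_inj[OF xy ne, of 0 s0] hseg_0[OF xy(1)] s0 by (auto simp: p_def)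
  have np': "no_common_leaf \<L> x p" unfolding no_common_leaf_def
  proof (intro ballI notI)
    fix n assume n: "n \<in> normals \<L>" and z: "lform n x = 0 \<and> lform n p = 0"
    have "(1 - s0) * lform n x + s0 * lform n y = 0"
      using sgn_lform_hseg[OF xy, of s0 n] s0 z by (simp add: p_def sgn_0_0)
    then have "lform n y = 0" using z s0 by simp
    then show False using np n z by (auto simp: no_common_leaf_def)
  qed
  show t': "tseg x p" by (rule transverse_hseg[OF xy(1) p xp np'])
  show im: "path_image (hseg x p) = hseg x y ` {0..s0}"
    using hseg_initial[OF xy s0] by (simp add: path_image_def p_def)
  have "hseg x y ` {0..s0} \<subseteq> hseg x y ` {0..1}" using s0 by (intro image_mono) auto
  then have sub: "path_image (hseg x p) \<subseteq> path_image (hseg x y)" by (simp only: im) (simp add: path_image_def)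
  show "segm x p = restrict_space (segm x y) (path_image (hseg x p))"
    using tmeas_subarc[OF t t' sub] by (simp add: segm_t t t')
  fix r assume r: "r \<in> path_image (hseg x p)" "r \<in> lamset lam"
  obtain s where s: "0 \<le> s" "s \<le> s0" "r = hseg x y s" using r(1) im by auto
  have rh: "r \<in> hyp2" using r(1) hseg_image_hyp2[OF xy(1) p] by blast
  have r': "r \<in> path_image (hseg x y)" using sub r by blast
  note d = dirvec_seg[OF xy t r' r(2)]
  have "cpar x y (dirvec lam x y r) = s"
    using hseg_inj[OF xy ne, of "cpar x y (dirvec lam x y r)" s] cpar_01[OF np d(1)] d(3) s s0 by auto
  then have c: "cpar x y (dirvec lam x y r) \<le> s0" using s by simp
  then have "lform (dirvec lam x y r) p \<ge> 0" using sg[OF d(1)] by (auto simp: sgn_real_def split: if_splits)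
  then have "dirvec lam x y r \<in> seps \<L> x p" using d(1) by (simp add: seps_def)
  then show "dirvec lam x p r = dirvec lam x y r \<and> cpar x y (dirvec lam x y r) \<le> s0"
    using dirvec_eq[OF np' _ rh d(2)] c by simp
qed

text \<open>The leaves up to \<open>n0\<close> are those that meet the initial segment ending on the leaf \<open>n0\<close>.\<close>

lemma initial_mass:
  assumes n0: "n0 \<in> normals \<L>" "lform n0 x < 0" "lform n0 y > 0" and xy: "x \<in> hyp2" "y \<in> hyp2" and E: "E \<in> sets borel"
  obtains p where "p \<in> hyp2" "lform n0 p = 0"
    "emeasure (segm x p) (lamE x p E) = emeasure (segm x y) (lamE x y (E \<inter> {n. n$3 \<le> n0$3}))"
proof -
  note s = separated_tseg[OF n0 xy]
  define c where "c = cpar x y n0"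
  define p where "p = hseg x y c"
  have c: "c \<in> {0..1}" using cpar_01[OF s(2,3)] by (simp add: c_def)
  have "c \<noteq> 0" using n0 by (simp add: c_def cpar_def)
  then have c': "0 < c" "c \<le> 1" using c by auto
  note i = seg_initial[OF xy s(1) c', folded p_def]
  have "lform n0 p = 0" using sgn_seps_hseg[OF xy s(2,3) c] by (simp add: p_def c_def sgn_0_0)
  have "hseg x y ` {0..c} \<subseteq> hseg x y ` {0..1}" using c' by (intro image_mono) auto
  then have sub: "path_image (hseg x p) \<subseteq> path_image (hseg x y)" by (simp only: i(3)) (simp add: path_image_def)
  have eq: "lamE x p E = lamE x y (E \<inter> {n. n$3 \<le> n0$3})"
  proof
    show "lamE x p E \<subseteq> lamE x y (E \<inter> {n. n$3 \<le> n0$3})"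
    proof
      fix r assume "r \<in> lamE x p E"
      then have r: "r \<in> path_image (hseg x p)" "r \<in> lamset lam" "dirvec lam x p r \<in> E" by (auto simp: lamE_def)
      have r': "r \<in> path_image (hseg x y)" using sub r by blast
      have "dirvec lam x y r \<in> seps \<L> x y" by (rule dirvec_seg(1)[OF xy s(1) r' r(2)])
      then have "dirvec lam x y r $ 3 \<le> n0$3"
        using i(5)[OF r(1,2)] cpar_le_iff[OF xy s(2) _ s(3)] by (simp add: c_def)
      then show "r \<in> lamE x y (E \<inter> {n. n$3 \<le> n0$3})" using i(5)[OF r(1,2)] r r' by (simp add: lamE_def)
    qed
    show "lamE x y (E \<inter> {n. n$3 \<le> n0$3}) \<subseteq> lamE x p E"
    proof
      fix r assume "r \<in> lamE x y (E \<inter> {n. n$3 \<le> n0$3})"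
      then have r: "r \<in> path_image (hseg x y)" "r \<in> lamset lam" "dirvec lam x y r \<in> E" "dirvec lam x y r $ 3 \<le> n0$3"
        by (auto simp: lamE_def)
      note d = dirvec_seg[OF xy s(1) r(1,2)]
      have "cpar x y (dirvec lam x y r) \<le> c" using cpar_le_iff[OF xy s(2) d(1) s(3)] r(4) by (simp add: c_def)
      then have "cpar x y (dirvec lam x y r) \<in> {0..c}" using cpar_01[OF s(2) d(1)] by auto
      then have r': "r \<in> path_image (hseg x p)" unfolding i(3) using d(3) by blast
      then show "r \<in> lamE x p E" using i(5)[OF r' r(2)] r by (simp add: lamE_def)
    qed
  qed
  have "emeasure (segm x p) (lamE x p E) = emeasure (segm x y) (lamE x p E)"
    unfolding i(4)
  proof (rule emeasure_restrict_space)
    show "path_image (hseg x p) \<inter> space (segm x y) \<in> sets (segm x y)"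
      using path_image_arc_borel[OF i(2)] sub
      by (simp add: segm_t[OF s(1)] tmeas_sets_iff[OF s(1)] tmeas_arc(1)[OF s(1)] Int_absorb2)
  qed (auto simp: lamE_def)
  then show thesis using that[of p] i(1) \<open>lform n0 p = 0\<close> eq by simp
qed

lemma corner_empty:
  assumes xy: "x \<in> hyp2" "y \<in> hyp2"
    and N: "\<And>n. n \<in> normals \<L> \<Longrightarrow> n \<notin> E" and t: "tseg x y"
  shows "lamE x y E = {}"
proof -
  have False if "r \<in> lamE x y E" for r
  proof -
    have "r \<in> path_image (hseg x y)" "r \<in> lamset lam" "dirvec lam x y r \<in> E" using that by (auto simp: lamE_def)
    then show False using dirvec_seg(1)[OF xy t] N by (auto simp: seps_def)
  qed
  then show ?thesis by auto
qed

text \<open>If a leaf \<open>n0\<close> cuts off the corner \<open>x\<close>, the segments from \<open>x\<close> to \<open>y\<close> and to \<open>z\<close> can be cut at \<open>n0\<close>, and the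
  parts have the same measure by \<open>leaf_transport\<close>. If the leaves that cut off the corner have a last element,
  that one contains the claim. Otherwise they are exhausted by initial parts, and the measures converge.\<close>

lemma corner:
  assumes hyp: "x \<in> hyp2" "y \<in> hyp2" "z \<in> hyp2" and E: "E \<in> sets borel"
    and sub: "E \<subseteq> {n. lform n x < 0 \<and> 0 < lform n y \<and> 0 < lform n z}"
  shows "emeasure (segm x y) (lamE x y E) = emeasure (segm x z) (lamE x z E)"
proof -
  define N where "N = {n\<in>normals \<L>. lform n x < 0 \<and> 0 < lform n y \<and> 0 < lform n z}"
  have key: "emeasure (segm x y) (lamE x y (E \<inter> {n. n$3 \<le> n0$3})) = emeasure (segm x z) (lamE x z (E \<inter> {n. n$3 \<le> n0$3}))"
    if n0: "n0 \<in> N" and E: "E \<in> sets borel" for n0 E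
  proof -
    have n: "n0 \<in> normals \<L>" "lform n0 x < 0" "lform n0 y > 0" "lform n0 z > 0" using n0 by (auto simp: N_def)
    obtain p where p: "p \<in> hyp2" "lform n0 p = 0"
      "emeasure (segm x p) (lamE x p E) = emeasure (segm x y) (lamE x y (E \<inter> {n. n$3 \<le> n0$3}))"
      by (rule initial_mass[OF n(1,2,3) hyp(1,2) E])
    obtain q where q: "q \<in> hyp2" "lform n0 q = 0"
      "emeasure (segm x q) (lamE x q E) = emeasure (segm x z) (lamE x z (E \<inter> {n. n$3 \<le> n0$3}))"
      by (rule initial_mass[OF n(1,2,4) hyp(1,3) E])
    show ?thesis using leaf_transport[OF n(1,2) p(2) q(2) hyp(1) p(1) q(1) E] p(3) q(3) by simp
  qed
  show ?thesis
  proof (cases "N = {}")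
    case True
    then have no: "\<And>n. n \<in> normals \<L> \<Longrightarrow> n \<notin> E" using sub by (auto simp: N_def)
    have "emeasure (segm x w) (lamE x w E) = 0" if "w \<in> hyp2" for w
      using corner_empty[OF hyp(1) that no] by (cases "tseg x w") (auto simp: segm_n)
    then show ?thesis using hyp by simp
  next
    case False
    then obtain n1 where n1: "n1 \<in> N" by blast
    then have n1': "n1 \<in> normals \<L>" "lform n1 x < 0" "lform n1 y > 0" "lform n1 z > 0" by (auto simp: N_def)
    note ty = separated_tseg[OF n1'(1,2,3) hyp(1,2)]
    note tz = separated_tseg[OF n1'(1,2,4) hyp(1,3)]
    have dN: "dirvec lam x w r \<in> N" if "r \<in> lamE x w E" "tseg x w" "w \<in> hyp2" for w r
      using that dirvec_seg(1)[OF hyp(1) that(3,2), of r] sub by (auto simp: lamE_def N_def seps_def)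
    show ?thesis
    proof (cases "\<exists>m\<in>N. \<forall>n\<in>N. n$3 \<le> m$3")
      case True
      then obtain m where m: "m \<in> N" "\<forall>n\<in>N. n$3 \<le> m$3" by blast
      have "lamE x w E = lamE x w (E \<inter> {n. n$3 \<le> m$3})" if "tseg x w" "w \<in> hyp2" for w
        using dN[OF _ that] m(2) by (auto simp: lamE_def)
      then show ?thesis using key[OF m(1) E] ty tz hyp by simp
    next
      case False
      \<comment> \<open>Thresholds \<open>\<theta> i < s\<close> instead of a sequence of leaves: each lies below some leaf of \<open>N\<close>, and no
        leaf of \<open>N\<close> attains \<open>s\<close>, so they exhaust \<open>N\<close>.\<close>
      define s where "s = (SUP n\<in>N. n$3)"
      have bdd: "bdd_above ((\<lambda>n. n$3) ` N)"
      proof (rule bdd_aboveI2)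
        fix n assume "n \<in> N"
        then have "n \<in> seps \<L> x y" by (simp add: N_def seps_def)
        then show "n$3 \<le> 2 * (x$3 + y$3)"
          using seps_bounded[OF hyp(1,2) ty(2)] component_le_norm_cart[of n 3] by fastforce
      qed
      have lt: "n$3 < s" if n: "n \<in> N" for n
      proof -
        obtain m where m: "m \<in> N" "n$3 < m$3" using False n by (meson not_le)
        then show ?thesis using cSUP_upper[OF m(1) bdd] by (simp add: s_def)
      qed
      define \<theta> where "\<theta> i = s - 1 / real (Suc i)" for i
      define F where "F i = E \<inter> {n. n$3 \<le> \<theta> i}" for i
      have Fb: "F i \<in> sets borel" for i
      proof -
        have "closed {n::real^3. n$3 \<le> \<theta> i}" by (intro closed_Collect_le continuous_intros)
        then show ?thesis using E by (simp add: F_def)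
      qed
      have Fi: "emeasure (segm x y) (lamE x y (F i)) = emeasure (segm x z) (lamE x z (F i))" for i
      proof -
        have "\<theta> i < s" by (simp add: \<theta>_def)
        then obtain n where n: "n \<in> N" "\<theta> i < n$3" using less_cSUP_iff[OF _ bdd] n1 by (auto simp: s_def)
        have "F i \<inter> {m. m$3 \<le> n$3} = F i" using n(2) by (auto simp: F_def)
        then show ?thesis using key[OF n(1) Fb[of i]] by simp
      qed
      have mono: "\<theta> i \<le> \<theta> j" if "i \<le> j" for i j using that by (simp add: \<theta>_def frac_le)
      have lim: "emeasure (segm x w) (lamE x w E) = (SUP i. emeasure (segm x w) (lamE x w (F i)))"
        if w: "tseg x w" "w \<in> hyp2" for w
      proof -
        have "lamE x w E = (\<Union>i. lamE x w (F i))"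
        proof
          show "lamE x w E \<subseteq> (\<Union>i. lamE x w (F i))"
          proof
            fix r assume r: "r \<in> lamE x w E"
            then have "s - dirvec lam x w r $ 3 > 0" using lt[OF dN[OF r w]] by simp
            then obtain i where "1 / real (Suc i) < s - dirvec lam x w r $ 3" using nat_approx_posE by blast
            then have "r \<in> lamE x w (F i)" using r by (auto simp: lamE_def F_def \<theta>_def)
            then show "r \<in> (\<Union>i. lamE x w (F i))" by blast
          qed
        qed (auto simp: lamE_def F_def)
        moreover have "incseq (\<lambda>i. lamE x w (F i))"
          using mono by (fastforce simp: incseq_def lamE_def F_def)
        moreover have "range (\<lambda>i. lamE x w (F i)) \<subseteq> sets (segm x w)"
          using lamE_sets[OF hyp(1) w(2,1) Fb] by blast
        ultimately show ?thesis by (simp add: SUP_emeasure_incseq)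
      qed
      show ?thesis using lim[OF ty(1) hyp(2)] lim[OF tz(1) hyp(3)] Fi by simp
    qed
  qed
qed

text \<open>The part of the integral of the normal field that is contributed by the leaves with normal in \<open>E\<close>.\<close>

definition Jint :: "real^3 \<Rightarrow> real^3 \<Rightarrow> (real^3) set \<Rightarrow> real^3" where
  "Jint x y E = (\<integral>r. indicator E (dirvec lam x y r) *\<^sub>R dirvec lam x y r \<partial>segm x y)"

text \<open>Both sides are integrals of the identity over \<open>E\<close> with respect to the distribution of the normal,
  and \<open>corner\<close> says that the two distributions agree on \<open>E\<close>.\<close>

lemma Jint_corner:
  assumes hyp: "x \<in> hyp2" "y \<in> hyp2" "z \<in> hyp2" and E: "E \<in> sets borel"
    and sub: "E \<subseteq> {n. lform n x < 0 \<and> 0 < lform n y \<and> 0 < lform n z}"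
  shows "Jint x y E = Jint x z E"
proof (cases "\<exists>n\<in>normals \<L>. n \<in> E")
  case True
  then obtain n where n: "n \<in> normals \<L>" "lform n x < 0" "lform n y > 0" "lform n z > 0" using sub by auto
  have ty: "tseg x y" by (rule separated_tseg(1)[OF n(1,2,3) hyp(1,2)])
  have tz: "tseg x z" by (rule separated_tseg(1)[OF n(1,2,4) hyp(1,3)])
  define \<nu> where "\<nu> w = distr (segm x w) borel (dirvec lam x w)" for w
  have J: "Jint x w E = integral\<^sup>L (restrict_space (\<nu> w) E) (\<lambda>v. v)" if w: "tseg x w" "w \<in> hyp2" for w
  proof -
    have "integral\<^sup>L (\<nu> w) (\<lambda>v. indicator E v *\<^sub>R v) = Jint x w E"
      unfolding \<nu>_def Jint_def using E dirvec_measurable[OF hyp(1) w(2,1)] by (intro integral_distr) auto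
    moreover have "integral\<^sup>L (restrict_space (\<nu> w) E) (\<lambda>v. v) = integral\<^sup>L (\<nu> w) (\<lambda>v. indicator E v *\<^sub>R v)"
      using E by (intro integral_restrict_space) (simp add: \<nu>_def)
    ultimately show ?thesis by simp
  qed
  have em: "emeasure (restrict_space (\<nu> w) E) A = emeasure (segm x w) (lamE x w A)"
    if w: "tseg x w" "w \<in> hyp2" and A: "A \<in> sets borel" "A \<subseteq> E" for w A
  proof -
    have "0 \<notin> A" using A sub by (auto simp: lform.zero_left)
    then have "r \<in> lamset lam" if "dirvec lam x w r \<in> A" for r
      using dirvec_off[of r x w] that by (cases "r \<in> lamset lam") auto
    then have "dirvec lam x w -` A \<inter> space (segm x w) = lamE x w A"
      by (auto simp: lamE_def space_segm[OF w(1)])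
    moreover have "emeasure (restrict_space (\<nu> w) E) A = emeasure (\<nu> w) A"
      using E A by (intro emeasure_restrict_space) (auto simp: \<nu>_def)
    ultimately show ?thesis
      using A dirvec_measurable[OF hyp(1) w(2,1)] by (simp add: \<nu>_def emeasure_distr)
  qed
  have "restrict_space (\<nu> y) E = restrict_space (\<nu> z) E"
  proof (rule measure_eqI)
    show "sets (restrict_space (\<nu> y) E) = sets (restrict_space (\<nu> z) E)"
      by (simp add: \<nu>_def sets_restrict_space)
    fix A assume "A \<in> sets (restrict_space (\<nu> y) E)"
    then have A: "A \<in> sets borel" "A \<subseteq> E" using E by (auto simp: \<nu>_def sets_restrict_space)
    show "emeasure (restrict_space (\<nu> y) E) A = emeasure (restrict_space (\<nu> z) E) A"
      using em[OF ty hyp(2) A] em[OF tz hyp(3) A] corner[OF hyp A(1)] A(2) sub by simp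
  qed
  then show ?thesis using J[OF ty hyp(2)] J[OF tz hyp(3)] by simp
next
  case False
  have "Jint x w E = 0" if w: "w \<in> hyp2" for w
  proof (cases "tseg x w")
    case True
    have "Jint x w E = integral\<^sup>L (segm x w) (\<lambda>r. 0)" unfolding Jint_def
    proof (rule Bochner_Integration.integral_cong)
      fix r assume r: "r \<in> space (segm x w)"
      show "indicator E (dirvec lam x w r) *\<^sub>R dirvec lam x w r = 0"
      proof (cases "r \<in> lamset lam")
        case True
        then show ?thesis using r \<open>tseg x w\<close> dirvec_seg(1)[OF hyp(1) w \<open>tseg x w\<close>, of r] False
          by (auto simp: space_segm seps_def)
      qed (simp add: dirvec_off)
    qed simp
    then show ?thesis by simp
  next
    case False
    then show ?thesis by (simp add: Jint_def segm_n integral_null_measure)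
  qed
  then show ?thesis using hyp by simp
qed

lemma tseg_commute:
  assumes "x \<in> hyp2" "y \<in> hyp2" shows "tseg y x \<longleftrightarrow> tseg x y"
  using transverse_hseg_iff assms no_common_leaf_commute by metis

lemma path_image_hseg_commute: "path_image (hseg y x) = path_image (hseg x y)"
proof -
  have "hseg y x = hseg x y \<circ> (\<lambda>s. 1 - s)"
    by (rule ext) (simp only: o_def hseg_reverse[of y x])
  then have "hseg y x ` {0..1} = hseg x y ` ((\<lambda>s. 1 - s) ` {0..1})" by (simp only: image_comp)
  then show ?thesis by (simp add: path_image_def)
qed

lemma segm_commute:
  assumes "x \<in> hyp2" "y \<in> hyp2" shows "segm y x = segm x y"
  by (simp add: seg_measure_def tseg_commute[OF assms] path_image_hseg_commute)

lemma dirvec_commute: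
  assumes xy: "x \<in> hyp2" "y \<in> hyp2" and t: "tseg x y" and r: "r \<in> path_image (hseg x y)"
  shows "dirvec lam y x r = - dirvec lam x y r"
proof (cases "r \<in> lamset lam")
  case True
  note d = dirvec_seg[OF xy t r True]
  have "- dirvec lam x y r \<in> seps \<L> y x" using d(1) normals_minus by (auto simp: seps_def lform.minus_left)
  moreover have "no_common_leaf \<L> y x" using transverse_hseg_iff[OF xy] t no_common_leaf_commute by blast
  moreover have "r \<in> hyp2" using r hseg_image_hyp2[OF xy] by blast
  ultimately show ?thesis using dirvec_eq[of y x "- dirvec lam x y r" r] d(2) by (simp add: lform.minus_left)
qed (simp add: dirvec_off)

lemma Jint_commute:
  assumes xy: "x \<in> hyp2" "y \<in> hyp2"
  shows "Jint y x (uminus ` E) = - Jint x y E"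
proof (cases "tseg x y")
  case True
  have "Jint y x (uminus ` E) = (\<integral>r. - (indicator E (dirvec lam x y r) *\<^sub>R dirvec lam x y r) \<partial>segm x y)"
    unfolding Jint_def segm_commute[OF xy]
  proof (rule Bochner_Integration.integral_cong)
    fix r assume "r \<in> space (segm x y)"
    then have "dirvec lam y x r = - dirvec lam x y r" using dirvec_commute[OF xy True] by (simp add: space_segm[OF True])
    then show "indicator (uminus ` E) (dirvec lam y x r) *\<^sub>R dirvec lam y x r =
        - (indicator E (dirvec lam x y r) *\<^sub>R dirvec lam x y r)"
      by (auto simp: indicator_def)
  qed simp
  then show ?thesis by (simp add: Jint_def)
next
  case False
  then show ?thesis using tseg_commute[OF xy] by (simp add: Jint_def segm_n integral_null_measure)
qed

text \<open>The translation cocycle for arbitrary endpoints: \<open>tau lam x \<gamma>\<close> is its value on \<open>x\<close> and \<open>\<gamma> x\<close>.\<close>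

definition transl :: "real^3 \<Rightarrow> real^3 \<Rightarrow> real^3" where
  "transl x y = integral\<^sup>L (segm x y) (dirvec lam x y)"

text \<open>A leaf through a point without weight carries no atom, and it meets the segment at most once.\<close>

lemma unweighted_null:
  assumes xy: "x \<in> hyp2" "y \<in> hyp2" and t: "tseg x y" and w: "w \<in> hyp2 - weighted_part lam"
  shows "AE r in segm x y. r \<in> lamset lam \<longrightarrow> lform (dirvec lam x y r) w \<noteq> 0"
proof -
  have np: "no_common_leaf \<L> x y" using t transverse_hseg_iff[OF xy] by simp
  let ?B = "{r \<in> path_image (hseg x y) \<inter> lamset lam. lform (dirvec lam x y r) w = 0}"
  have uniq: "r = q" if r: "r \<in> ?B" and q: "q \<in> ?B" for r q
  proof -
    note dr = dirvec_seg[OF xy t, of r] and dq = dirvec_seg[OF xy t, of q]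
    have n: "dirvec lam x y r \<in> seps \<L> x y" "dirvec lam x y q \<in> seps \<L> x y" using dr(1) dq(1) r q by auto
    have "dirvec lam x y q = dirvec lam x y r \<or> dirvec lam x y q = - dirvec lam x y r"
      using normals_same_leaf[of "dirvec lam x y r" "dirvec lam x y q" w] n r q w hyp2_future by (auto simp: seps_def)
    moreover have "dirvec lam x y q \<noteq> - dirvec lam x y r"
    proof
      assume "dirvec lam x y q = - dirvec lam x y r"
      then show False using seps_pos[OF np n(1)] seps_pos[OF np n(2)] by (simp add: lform.minus_left)
    qed
    ultimately have e: "dirvec lam x y q = dirvec lam x y r" by blast
    have "r = hseg x y (cpar x y (dirvec lam x y r))" using dr(3) r by blast
    also have "\<dots> = hseg x y (cpar x y (dirvec lam x y q))" by (simp only: e)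
    also have "\<dots> = q" using dq(3) q by (intro sym[of q]) blast
    finally show ?thesis .
  qed
  have null: "emeasure (segm x y) {r} = 0" if r: "r \<in> ?B" for r
  proof (rule ccontr)
    assume "\<not> ?thesis"
    then have pos: "emeasure (tmeas lam (path_image (hseg x y))) {r} > 0" by (simp add: segm_t[OF t] zero_less_iff_neq_zero)
    define n where "n = dirvec lam x y r"
    have n: "n \<in> normals \<L>" "lform n r = 0" using dirvec_seg[OF xy t, of r] r by (auto simp: n_def seps_def)
    have "r \<in> hyp2" using r hseg_image_hyp2[OF xy] by blast
    then have "r \<in> geo n \<inter> path_image (hseg x y)" using n r by (simp add: geo_def)
    moreover have "w \<in> geo n" using r w by (simp add: geo_def n_def)
    ultimately have "w \<in> weighted_part lam"
      unfolding weighted_part_def using normals_geo[OF n(1)] t pos by blast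
    then show False using w by simp
  qed
  have "?B \<in> null_sets (segm x y)"
  proof (cases "?B = {}")
    case False
    then obtain r where r: "r \<in> ?B" by blast
    then have "?B = {r}" using uniq by blast
    moreover have "{r} \<in> sets (segm x y)" using r by (simp add: segm_t[OF t] tmeas_sets_iff[OF t])
    ultimately show ?thesis using null[OF r] by (simp add: null_sets_def)
  next
    case True
    show ?thesis unfolding True by simp
  qed
  then show ?thesis unfolding eventually_ae_filter
    by (rule bexI[rotated]) (auto simp: space_segm[OF t])
qed

text \<open>Almost every leaf misses the three points; one that separates \<open>x\<close> from \<open>y\<close> has \<open>z\<close> on one of its sides.\<close>

lemma transl_split:
  assumes hyp: "x \<in> hyp2 - weighted_part lam" "y \<in> hyp2 - weighted_part lam" "z \<in> hyp2 - weighted_part lam"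
  shows "transl x y = Jint x y {n. lform n x < 0 \<and> 0 < lform n y \<and> 0 < lform n z} +
     Jint x y {n. lform n x < 0 \<and> 0 < lform n y \<and> lform n z < 0}"
proof (cases "tseg x y")
  case True
  have xy: "x \<in> hyp2" "y \<in> hyp2" using hyp by auto
  let ?E = "{n. lform n x < 0 \<and> 0 < lform n y \<and> 0 < lform n z}"
  let ?F = "{n. lform n x < 0 \<and> 0 < lform n y \<and> lform n z < 0}"
  let ?d = "dirvec lam x y"
  interpret finite_measure "segm x y" by (rule finite_segm)
  have b: "?E \<in> sets borel" "?F \<in> sets borel"
  proof -
    have "open ?E" "open ?F" by (intro open_Collect_conj open_Collect_less lform.continuous_on continuous_intros)+
    then show "?E \<in> sets borel" "?F \<in> sets borel" by auto
  qed
  have int: "integrable (segm x y) (\<lambda>r. indicator E (?d r) *\<^sub>R ?d r)" if E: "E \<in> sets borel" for E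
  proof (rule integrable_const_bound[where B="2 * (x$3 + y$3)"])
    note [measurable] = dirvec_measurable[OF xy True]
    show "(\<lambda>r. indicator E (?d r) *\<^sub>R ?d r) \<in> borel_measurable (segm x y)" using E by measurable
    have "norm (indicator E (?d r) *\<^sub>R ?d r) \<le> 2 * (x$3 + y$3)" if "r \<in> space (segm x y)" for r
    proof -
      have "norm (indicator E (?d r) *\<^sub>R ?d r) \<le> norm (?d r)" by (auto simp: indicator_def)
      also have "\<dots> \<le> 2 * (x$3 + y$3)" using dirvec_bounded[OF xy True] that by (simp add: space_segm[OF True])
      finally show ?thesis .
    qed
    then show "AE r in segm x y. norm (indicator E (?d r) *\<^sub>R ?d r) \<le> 2 * (x$3 + y$3)" by (intro AE_I2)
  qed
  have "transl x y = (\<integral>r. indicator ?E (?d r) *\<^sub>R ?d r + indicator ?F (?d r) *\<^sub>R ?d r \<partial>segm x y)"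
    unfolding transl_def
  proof (rule integral_cong_AE)
    show "?d \<in> borel_measurable (segm x y)" by (rule dirvec_measurable[OF xy True])
    show "(\<lambda>r. indicator ?E (?d r) *\<^sub>R ?d r + indicator ?F (?d r) *\<^sub>R ?d r) \<in> borel_measurable (segm x y)"
      using int[OF b(1)] int[OF b(2)] by auto
    show "AE r in segm x y. ?d r = indicator ?E (?d r) *\<^sub>R ?d r + indicator ?F (?d r) *\<^sub>R ?d r"
      using AE_space segm_AE unweighted_null[OF xy True hyp(1)] unweighted_null[OF xy True hyp(2)] unweighted_null[OF xy True hyp(3)]
    proof eventually_elim
      case (elim r)
      have "?d r \<in> seps \<L> x y" using dirvec_seg(1)[OF xy True, of r] elim by (simp add: space_segm[OF True])
      then show ?case using elim by (auto simp: seps_def indicator_def)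
    qed
  qed
  also have "\<dots> = Jint x y ?E + Jint x y ?F"
    unfolding Jint_def using int[OF b(1)] int[OF b(2)] by (rule Bochner_Integration.integral_add)
  finally show ?thesis .
next
  case False
  then show ?thesis by (simp add: transl_def Jint_def segm_n integral_null_measure)
qed

text \<open>Each side of the triangle is split according to the vertex that a leaf cuts off. The contribution of the
  leaves that cut off a given vertex is the same on the two sides that meet there, by \<open>Jint_corner\<close>. On the
  three sides oriented as stated, the contributions of the vertex \<open>y\<close> cancel.\<close>

lemma transl_additive:
  assumes hyp: "x \<in> hyp2 - weighted_part lam" "y \<in> hyp2 - weighted_part lam" "z \<in> hyp2 - weighted_part lam"
  shows "transl x z = transl x y + transl y z"
proof -
  have h: "x \<in> hyp2" "y \<in> hyp2" "z \<in> hyp2" using hyp by auto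
  define X where "X = {n. lform n x < 0 \<and> 0 < lform n y \<and> 0 < lform n z}"
  define Y where "Y = {n. lform n y < 0 \<and> 0 < lform n x \<and> 0 < lform n z}"
  define Z where "Z = {n. lform n z < 0 \<and> 0 < lform n x \<and> 0 < lform n y}"
  have b: "X \<in> sets borel" "Y \<in> sets borel" "Z \<in> sets borel"
  proof -
    have "open X" "open Y" "open Z" unfolding X_def Y_def Z_def
      by (intro open_Collect_conj open_Collect_less lform.continuous_on continuous_intros)+
    then show "X \<in> sets borel" "Y \<in> sets borel" "Z \<in> sets borel" by auto
  qed
  have m: "uminus ` A = {n. - n \<in> A}" for A :: "(real^3) set"
  proof
    show "{n. - n \<in> A} \<subseteq> uminus ` A"
    proof
      fix n assume "n \<in> {n. - n \<in> A}"
      then show "n \<in> uminus ` A" using imageI[of "- n" A uminus] by simp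
    qed
  qed auto
  have mY: "uminus ` Y = {n. lform n x < 0 \<and> 0 < lform n y \<and> lform n z < 0}"
    unfolding m Y_def by (rule Collect_cong) (auto simp: lform.minus_left)
  have mZ': "uminus ` Z = {n. lform n x < 0 \<and> 0 < lform n z \<and> lform n y < 0}"
    unfolding m Z_def by (rule Collect_cong) (auto simp: lform.minus_left)
  have mZ'': "uminus ` Z = {n. lform n y < 0 \<and> 0 < lform n z \<and> lform n x < 0}"
    unfolding m Z_def by (rule Collect_cong) (auto simp: lform.minus_left)
  have X': "X = {n. lform n x < 0 \<and> 0 < lform n z \<and> 0 < lform n y}"
    unfolding X_def by (rule Collect_cong) blast
  have Y': "Y = {n. lform n y < 0 \<and> 0 < lform n z \<and> 0 < lform n x}"
    unfolding Y_def by (rule Collect_cong) blast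
  have 1: "transl x z = Jint x z X + Jint x z (uminus ` Z)"
    unfolding mZ' X' by (rule transl_split[OF hyp(1) hyp(3) hyp(2)])
  have 2: "transl x y = Jint x y X + Jint x y (uminus ` Y)"
    unfolding mY X_def by (rule transl_split[OF hyp(1) hyp(2) hyp(3)])
  have 3: "transl y z = Jint y z Y + Jint y z (uminus ` Z)"
    unfolding mZ'' Y' by (rule transl_split[OF hyp(2) hyp(3) hyp(1)])
  have X: "Jint x z X = Jint x y X" by (rule Jint_corner[OF h(1,3,2) b(1)]) (auto simp: X_def)
  have "Jint y x Y = Jint y z Y" by (rule Jint_corner[OF h(2,1,3) b(2)]) (auto simp: Y_def)
  moreover have "uminus ` uminus ` A = A" for A :: "(real^3) set" by (simp add: image_image)
  ultimately have Y: "Jint y z Y = - Jint x y (uminus ` Y)" using Jint_commute[OF h(1,2), of "uminus ` Y"] by simp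
  have "Jint z x Z = Jint z y Z" by (rule Jint_corner[OF h(3,1,2) b(3)]) (auto simp: Z_def)
  then have Z: "Jint x z (uminus ` Z) = Jint y z (uminus ` Z)"
    using Jint_commute[OF h(3,1), of Z] Jint_commute[OF h(3,2), of Z] by simp
  show ?thesis unfolding 1 2 3 X Y Z by simp
qed

end

section \<open>Atoms\<close>

definition hlen :: "(real \<Rightarrow> real^3) \<Rightarrow> (nat \<Rightarrow> real) \<Rightarrow> nat \<Rightarrow> real" where
  "hlen g s n = (\<Sum>i<n. hdist (g (s i)) (g (s (Suc i))))"

lemma hrectifiable_iff:
  "hrectifiable g \<longleftrightarrow> (\<exists>C. \<forall>n s. mono_on {..n} s \<longrightarrow> s ` {..n} \<subseteq> {0..1} \<longrightarrow> hlen g s n \<le> C)"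
  unfolding hrectifiable_def hlen_def by blast

lemma hrectifiable_subpath:
  assumes g: "hrectifiable g" and ab: "a \<in> {0..1}" "b \<in> {0..1}"
  shows "hrectifiable (subpath a b g)"
proof -
  obtain C where C: "\<And>n s. mono_on {..n} s \<Longrightarrow> s ` {..n} \<subseteq> {0..1} \<Longrightarrow> hlen g s n \<le> C"
    using g unfolding hrectifiable_iff by blast
  have "hlen (subpath a b g) s n \<le> C" if m: "mono_on {..n} s" and s: "s ` {..n} \<subseteq> {0..1}" for n s
  proof -
    define f where "f t = (b - a) * t + a" for t :: real
    have f01: "f t \<in> {0..1}" if "t \<in> {0..1}" for t
      using convex_bound_le[of a 1 b "1 - t" t] convex_bound_le[of "-a" 0 "-b" "1 - t" t] ab that
      by (auto simp: f_def algebra_simps)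
    have sub: "hlen (subpath a b g) s n = hlen g (f \<circ> s) n" by (simp add: hlen_def subpath_def f_def)
    show ?thesis
    proof (cases "a \<le> b")
      case True
      have "mono_on {..n} (f \<circ> s)"
        using m True by (auto simp: mono_on_def f_def intro!: mult_left_mono)
      moreover have "(f \<circ> s) ` {..n} \<subseteq> {0..1}"
      proof -
        have "f (s i) \<in> {0..1}" if "i \<le> n" for i by (rule f01) (use s that in \<open>auto simp: image_subset_iff\<close>)
        then show ?thesis by auto
      qed
      ultimately show ?thesis unfolding sub by (rule C)
    next
      case False
      define s' where "s' i = f (s (n - i))" for i
      have "mono_on {..n} s'"
        using m False by (auto simp: mono_on_def s'_def f_def intro!: mult_left_mono_neg)
      moreover have "s' ` {..n} \<subseteq> {0..1}"
      proof -
        have "s' i \<in> {0..1}" if "i \<le> n" for i unfolding s'_def by (rule f01) (use s in \<open>auto simp: image_subset_iff\<close>)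
        then show ?thesis by auto
      qed
      ultimately have "hlen g s' n \<le> C" by (rule C)
      moreover have "hlen g s' n = hlen g (f \<circ> s) n"
      proof -
        have "hlen g s' n = (\<Sum>i<n. hdist (g (s' (n - Suc i))) (g (s' (Suc (n - Suc i)))))"
          unfolding hlen_def by (rule sum.nat_diff_reindex[symmetric])
        also have "\<dots> = hlen g (f \<circ> s) n" unfolding hlen_def
        proof (rule sum.cong)
          fix i assume "i \<in> {..<n}"
          then have "s' (n - Suc i) = f (s (Suc i))" "s' (Suc (n - Suc i)) = f (s i)" by (auto simp: s'_def Suc_diff_Suc)
          then show "hdist (g (s' (n - Suc i))) (g (s' (Suc (n - Suc i)))) = hdist (g ((f \<circ> s) i)) (g ((f \<circ> s) (Suc i)))"
            by (simp add: hdist_commute)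
        qed simp
        finally show ?thesis .
      qed
      ultimately show ?thesis unfolding sub by simp
    qed
  qed
  then show ?thesis unfolding hrectifiable_iff by blast
qed

lemma hrectifiable_join:
  assumes g: "hrectifiable g" "path_image g \<subseteq> hyp2" and h: "hrectifiable h" "path_image h \<subseteq> hyp2"
    and e: "pathfinish g = pathstart h"
  shows "hrectifiable (g +++ h)"
proof -
  obtain C where C: "\<And>n s. mono_on {..n} s \<Longrightarrow> s ` {..n} \<subseteq> {0..1} \<Longrightarrow> hlen g s n \<le> C"
    using g(1) unfolding hrectifiable_iff by blast
  obtain D where D: "\<And>n s. mono_on {..n} s \<Longrightarrow> s ` {..n} \<subseteq> {0..1} \<Longrightarrow> hlen h s n \<le> D"
    using h(1) unfolding hrectifiable_iff by blast
  have gh: "g t \<in> hyp2" "h t \<in> hyp2" if "t \<in> {0..1}" for t using g(2) h(2) that by (auto simp: path_image_def)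
  define a where "a t = min (2 * t) 1" for t :: real
  define b where "b t = max (2 * t - 1) 0" for t :: real
  have ab: "a t \<in> {0..1}" "b t \<in> {0..1}" if "t \<in> {0..1}" for t using that by (auto simp: a_def b_def)
  have am: "a s \<le> a t" "b s \<le> b t" if "s \<le> t" for s t using that by (auto simp: a_def b_def)
  have e': "g 1 = h 0" using e by (simp add: pathfinish_def pathstart_def)
  have self: "hdist z z = 0" if "z \<in> hyp2" for z using hdist_le_norm[OF that that] hdist_nonneg[OF that that] by simp
  have J: "(g +++ h) t = (if t \<le> 1/2 then g (a t) else h (b t))" for t
    by (auto simp: joinpaths_def a_def b_def)
  have step: "hdist ((g +++ h) s) ((g +++ h) t) \<le> hdist (g (a s)) (g (a t)) + hdist (h (b s)) (h (b t))"
    if st: "s \<le> t" "s \<in> {0..1}" "t \<in> {0..1}" for s t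
  proof -
    have n: "hdist (g (a s)) (g (a t)) \<ge> 0" "hdist (h (b s)) (h (b t)) \<ge> 0" using hdist_nonneg gh ab st by auto
    consider "t \<le> 1/2" | "1/2 < s" | "s \<le> 1/2" "1/2 < t" by linarith
    then show ?thesis
    proof cases
      case 3
      then have "a t = 1" "b s = 0" by (auto simp: a_def b_def)
      then show ?thesis using 3 hdist_triangle[of "g (a s)" "g 1" "h (b t)"] gh ab st e' by (simp add: J)
    qed (use st n in \<open>auto simp: J\<close>)
  qed
  have "hlen (g +++ h) s n \<le> C + D" if m: "mono_on {..n} s" and s: "s ` {..n} \<subseteq> {0..1}" for n s
  proof -
    have "hlen (g +++ h) s n \<le> hlen g (a \<circ> s) n + hlen h (b \<circ> s) n"
      unfolding hlen_def sum.distrib[symmetric]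
    proof (rule sum_mono)
      fix i assume "i \<in> {..<n}"
      then have i: "i \<in> {..n}" "Suc i \<in> {..n}" by auto
      have "s i \<le> s (Suc i)" using mono_onD[OF m i] by simp
      moreover have "s i \<in> {0..1}" "s (Suc i) \<in> {0..1}" using s i by blast+
      ultimately show "hdist ((g +++ h) (s i)) ((g +++ h) (s (Suc i))) \<le>
          hdist (g ((a \<circ> s) i)) (g ((a \<circ> s) (Suc i))) + hdist (h ((b \<circ> s) i)) (h ((b \<circ> s) (Suc i)))"
        using step by simp
    qed
    also have "hlen g (a \<circ> s) n \<le> C"
    proof (rule C)
      show "mono_on {..n} (a \<circ> s)" using m am unfolding mono_on_def by simp
    qed (use s ab in \<open>auto simp: image_subset_iff\<close>)
    also have "hlen h (b \<circ> s) n \<le> D"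
    proof (rule D)
      show "mono_on {..n} (b \<circ> s)" using m am unfolding mono_on_def by simp
    qed (use s ab in \<open>auto simp: image_subset_iff\<close>)
    finally show ?thesis by simp
  qed
  then show ?thesis unfolding hrectifiable_iff by blast
qed

lemma sgn_nonvanishing:
  fixes f :: "real \<Rightarrow> real"
  assumes c: "continuous_on {0..1} f" and nz: "\<And>t. t \<in> {0..1} \<Longrightarrow> f t \<noteq> 0" and t: "t \<in> {0..1}"
  shows "sgn (f t) = sgn (f 1)"
proof (rule ccontr)
  assume ne: "sgn (f t) \<noteq> sgn (f 1)"
  have c': "continuous_on {t..1} f" using c by (rule continuous_on_subset) (use t in auto)
  have "f t < 0 \<and> f 1 > 0 \<or> f t > 0 \<and> f 1 < 0" using ne nz[of t] nz[of 1] t by (auto simp: sgn_real_def split: if_splits)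
  then have "\<exists>x. t \<le> x \<and> x \<le> 1 \<and> f x = 0"
    using IVT'[of f t 0 1] IVT2'[of f 1 0 t] c' t by auto
  then show False using nz t by auto
qed

context meas_lam
begin

text \<open>An initial or final piece of a short transverse arc through a leaf approaches the leaf from one side.\<close>

lemma half_arc:
  assumes g: "transverse_arc \<L> g" and u: "u \<in> {0..1}" and n: "n \<in> normals \<L>" "lform n (g u) = 0"
  obtains h \<sigma> where "transverse_arc \<L> h" "path_image h \<subseteq> path_image g" "h 1 = g u"
    "\<sigma> = 1 \<or> \<sigma> = -1" "\<forall>t\<in>{0..<1}. sgn (lform n (h t)) = \<sigma>"
    "\<forall>m\<in>normals \<L>. \<forall>v\<in>{0..1}. lform m (h v) = 0 \<longrightarrow> crosses h m v {0..1}"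
proof -
  have ga: "arc g" "path_image g \<subseteq> hyp2" "hrectifiable g" using g by (auto simp: transverse_arc_def)
  obtain e where e: "e > 0" "\<forall>m\<in>normals \<L>. \<forall>v\<in>{0..1} \<inter> ball u e. lform m (g v) = 0 \<longrightarrow>
        crosses g m v ({0..1} \<inter> ball u e)"
    using g u unfolding transverse_arc_iff by blast
  \<comment> \<open>The piece from \<open>u'\<close> to \<open>u\<close> lies to the left of \<open>u\<close>, or to the right if \<open>u = 0\<close>.\<close>
  define u' where "u' = (if u > 0 then max 0 (u - e / 2) else min 1 (e / 2))"
  have u': "u' \<in> {0..1}" "u' \<noteq> u" "\<bar>u' - u\<bar> < e" using u e(1) by (auto simp: u'_def)
  define f where "f t = (u - u') * t + u'" for t
  define h where "h = subpath u' u g"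
  have hf: "h t = g (f t)" for t by (simp add: h_def subpath_def f_def)
  have fB: "f t \<in> {0..1} \<inter> ball u e" if t: "t \<in> {0..1}" for t
  proof -
    have "f t \<le> 1" "- f t \<le> 0"
      using convex_bound_le[of u' 1 u "1 - t" t] convex_bound_le[of "-u'" 0 "-u" "1 - t" t] u u' t
      by (auto simp: f_def algebra_simps)
    moreover have "u - f t = (1 - t) * (u - u')" by (simp add: f_def algebra_simps)
    then have "\<bar>u - f t\<bar> \<le> \<bar>u - u'\<bar>" using t by (simp add: abs_mult mult_left_le_one_le)
    then have "\<bar>u - f t\<bar> < e" using u' by simp
    ultimately show ?thesis by (simp add: dist_real_def)
  qed
  have cr: "crosses h m v {0..1}" if m: "m \<in> normals \<L>" and v: "v \<in> {0..1}" and z: "lform m (h v) = 0" for m v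
  proof -
    have "crosses g m (f v) ({0..1} \<inter> ball u e)" using e(2) m fB[OF v] z by (simp add: hf)
    then obtain \<sigma> where \<sigma>: "\<sigma> = 1 \<or> \<sigma> = -1" "\<forall>w\<in>{0..1} \<inter> ball u e. sgn (lform m (g w)) = \<sigma> * sgn (w - f v)"
      unfolding crosses_def by blast
    have "sgn (lform m (h w)) = (\<sigma> * sgn (u - u')) * sgn (w - v)" if "w \<in> {0..1}" for w
    proof -
      have "sgn (lform m (h w)) = \<sigma> * sgn (f w - f v)" using \<sigma>(2) fB[OF that] by (simp add: hf)
      also have "f w - f v = (u - u') * (w - v)" by (simp add: f_def algebra_simps)
      finally show ?thesis by (simp add: sgn_mult)
    qed
    moreover have "\<sigma> * sgn (u - u') = 1 \<or> \<sigma> * sgn (u - u') = -1" using \<sigma>(1) u' by (auto simp: sgn_real_def)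
    ultimately show ?thesis unfolding crosses_def by blast
  qed
  have img: "path_image h \<subseteq> path_image g" unfolding h_def by (rule path_image_subpath_subset) (use u u' in auto)
  have t: "transverse_arc \<L> h"
  proof (rule transverse_arcI)
    show "arc h" unfolding h_def using ga(1) u u' by (intro arc_subpath_arc) auto
    show "path_image h \<subseteq> hyp2" using img ga by blast
    show "hrectifiable h" unfolding h_def by (rule hrectifiable_subpath[OF ga(3) u'(1) u])
  qed (rule cr)
  have h1: "h 1 = g u" by (simp add: hf f_def)
  have "crosses h n 1 {0..1}" by (rule cr) (use n h1 in auto)
  then obtain \<sigma> where \<sigma>: "\<sigma> = 1 \<or> \<sigma> = -1" "\<forall>w\<in>{0..1}. sgn (lform n (h w)) = \<sigma> * sgn (w - 1)"
    unfolding crosses_def by blast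
  show thesis
  proof (rule that[OF t img h1, of "- \<sigma>"])
    show "- \<sigma> = 1 \<or> - \<sigma> = -1" using \<sigma> by auto
    show "\<forall>t\<in>{0..<1}. sgn (lform n (h t)) = - \<sigma>" using \<sigma>(2) by simp
    show "\<forall>m\<in>normals \<L>. \<forall>v\<in>{0..1}. lform m (h v) = 0 \<longrightarrow> crosses h m v {0..1}" using cr by blast
  qed
qed

lemma tseg_off_leaf:
  assumes n: "n \<in> normals \<L>" "lform n p = 0" "lform n w \<noteq> 0" and h: "p \<in> hyp2" "w \<in> hyp2"
  shows "tseg w p" "no_common_leaf \<L> w p" "tseg p w"
proof -
  have "no_common_leaf \<L> w p" if "lform n w < 0" "n \<in> normals \<L>" "lform n p = 0" for n
    by (rule leaf_no_common_leaf[OF that(2,1) hyp2_future[OF h(1)] that(3)])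
  from this[of n] this[of "- n"] show np: "no_common_leaf \<L> w p"
    using n normals_minus[OF n(1)] by (cases "lform n w < 0") (auto simp: lform.minus_left)
  have "w \<noteq> p" using n by auto
  then show "tseg w p" using transverse_hseg[OF h(2,1) _ np] by simp
  then show "tseg p w" using tseg_commute[OF h(2,1)] by simp
qed

text \<open>An arc that reaches a leaf from one side can be continued by a geodesic segment on the other side. A
  leaf that meets the arc before its end does not meet the segment, and conversely, because the leaf \<open>n\<close> separates them.
  Hence every leaf is met and crossed only once.\<close>

lemma arc_concat:
  assumes t: "transverse_arc \<L> h" and \<sigma>: "\<sigma> = 1 \<or> \<sigma> = -1" and n: "n \<in> normals \<L>" "lform n (h 1) = 0"
    and sg: "\<And>t. t \<in> {0..<1} \<Longrightarrow> sgn (lform n (h t)) = \<sigma>"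
    and cr: "\<And>m v. m \<in> normals \<L> \<Longrightarrow> v \<in> {0..1} \<Longrightarrow> lform m (h v) = 0 \<Longrightarrow> crosses h m v {0..1}"
    and w: "w \<in> hyp2" "sgn (lform n w) = - \<sigma>"
  shows "transverse_arc \<L> (h +++ hseg (h 1) w)"
proof -
  define p where "p = h 1"
  define q where "q = hseg p w"
  define j where "j = h +++ q"
  have ha: "arc h" "path_image h \<subseteq> hyp2" "hrectifiable h" using t by (auto simp: transverse_arc_def)
  have hh: "h t \<in> hyp2" if "t \<in> {0..1}" for t using ha(2) that by (auto simp: path_image_def)
  have p: "p \<in> hyp2" "lform n p = 0" using hh[of 1] n by (auto simp: p_def)
  have nw: "lform n w \<noteq> 0" using w(2) \<sigma> by auto
  have tq: "tseg p w" by (rule tseg_off_leaf(3)[OF n(1) p(2) nw p(1) w(1)])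
  have qa: "arc q" "path_image q \<subseteq> hyp2" "hrectifiable q" using tq by (auto simp: transverse_arc_def q_def)
  have q0: "q 0 = p" using hseg_0[OF p(1)] by (simp add: q_def)
  have qs: "sgn (lform m (q t)) = sgn ((1 - t) * lform m p + t * lform m w)" if "t \<in> {0..1}" for m t
    unfolding q_def by (rule sgn_lform_hseg[OF p(1) w(1) that])
  have qn: "sgn (lform n (q t)) = - \<sigma>" if "t \<in> {0<..1}" for t
    using qs[of t n] that p(2) w(2) by (simp add: sgn_mult)
  have qh: "q t \<in> hyp2" if "t \<in> {0..1}" for t using qa(2) that by (auto simp: path_image_def)
  have jl: "j t = h (2 * t)" if "t \<le> 1/2" for t using that by (simp add: j_def joinpaths_def)
  have jr: "j t = q (2 * t - 1)" if "1/2 \<le> t" for t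
  proof (cases "t = 1/2")
    case True
    show ?thesis unfolding True using q0 by (simp add: j_def joinpaths_def p_def)
  next
    case False
    then show ?thesis using that by (simp add: j_def joinpaths_def)
  qed
  have jcr: "crosses j m v {0..1}" if m: "m \<in> normals \<L>" and v: "v \<in> {0..1}" and z: "lform m (j v) = 0" for m v
  proof -
    consider "v < 1/2" | "v = 1/2" | "v > 1/2" by linarith
    then show ?thesis
    proof cases
      case 1
      have v2: "2 * v \<in> {0..1}" "2 * v \<in> {0..<1}" using 1 v by auto
      have zh: "lform m (h (2 * v)) = 0" using z jl 1 by simp
      obtain \<epsilon> where \<epsilon>: "\<epsilon> = 1 \<or> \<epsilon> = -1" "\<forall>t\<in>{0..1}. sgn (lform m (h t)) = \<epsilon> * sgn (t - 2 * v)"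
        using cr[OF m v2(1) zh] unfolding crosses_def by blast
      have nz: "lform m (q t) \<noteq> 0" if "t \<in> {0..1}" for t
      proof
        assume "lform m (q t) = 0"
        then have "sgn (lform n (q t)) = sgn (lform n (h (2 * v)))"
          using sgn_lform_leaf[OF m n(1) hyp2_future[OF qh[OF that]] _ hyp2_future[OF hh[OF v2(1)]] zh] by simp
        then have "sgn (lform n (q t)) = \<sigma>" using sg[OF v2(2)] by simp
        then show False using qn[of t] q0 p(2) \<sigma> that by (cases "t = 0") auto
      qed
      have "continuous_on {0..1} (\<lambda>t. lform m (q t))"
        using qa(1) by (intro lform.continuous_on continuous_intros) (auto simp: arc_def path_def)
      then have cst: "sgn (lform m (q t)) = sgn (lform m (q 1))" if "t \<in> {0..1}" for t
        using sgn_nonvanishing[of "\<lambda>t. lform m (q t)"] nz that by blast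
      have "sgn (lform m p) = \<epsilon>" using \<epsilon>(2) 1 by (simp add: p_def)
      then have qe: "sgn (lform m (q t)) = \<epsilon>" if "t \<in> {0..1}" for t using cst[OF that] cst[of 0] q0 by simp
      have "sgn (lform m (j t)) = \<epsilon> * sgn (t - v)" if t: "t \<in> {0..1}" for t
      proof (cases "t \<le> 1/2")
        case True
        then have "sgn (lform m (j t)) = \<epsilon> * sgn (2 * t - 2 * v)" using \<epsilon>(2) t by (simp add: jl)
        also have "sgn (2 * t - 2 * v) = sgn (t - v)" by (auto simp: sgn_real_def)
        finally show ?thesis .
      next
        case False
        then show ?thesis using qe[of "2 * t - 1"] t 1 by (simp add: jr)
      qed
      then show ?thesis unfolding crosses_def using \<epsilon>(1) by blast
    next
      case 2
      have "lform m p = 0" using z jl[of "1/2"] unfolding 2 by (simp add: p_def)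
      then have mn: "m = n \<or> m = - n" using normals_same_leaf[OF n(1) m hyp2_future[OF p(1)] p(2)] by simp
      have "sgn (lform n (j t)) = - \<sigma> * sgn (t - v)" if t: "t \<in> {0..1}" for t
      proof -
        consider "t < 1/2" | "t = 1/2" | "t > 1/2" by linarith
        then show ?thesis
        proof cases
          case 1
          then show ?thesis using sg[of "2 * t"] t 2 by (simp add: jl)
        next
          case 3
          then show ?thesis using qn[of "2 * t - 1"] t 2 by (simp add: jr)
        next
          case t2: 2
          show ?thesis using n jl[of "1/2"] unfolding t2 2 by simp
        qed
      qed
      moreover have "- \<sigma> = 1 \<or> - \<sigma> = -1" using \<sigma> by auto
      ultimately have "crosses j n v {0..1}" unfolding crosses_def by blast
      then show ?thesis using mn crosses_minus by auto
    next
      case 3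
      define v0 where "v0 = 2 * v - 1"
      have v0: "v0 \<in> {0<..1}" "v0 \<in> {0..1}" using 3 v by (auto simp: v0_def)
      have zq: "lform m (q v0) = 0" using z jr[of v] 3 by (simp add: v0_def)
      have nz: "lform m (h t) \<noteq> 0" if "t \<in> {0..1}" for t
      proof
        assume "lform m (h t) = 0"
        then have "sgn (lform n (h t)) = sgn (lform n (q v0))"
          using sgn_lform_leaf[OF m n(1) hyp2_future[OF hh[OF that]] _ hyp2_future[OF qh[OF v0(2)]] zq] by simp
        then have "sgn (lform n (h t)) = - \<sigma>" using qn[OF v0(1)] by simp
        then show False using sg[of t] n \<sigma> that by (cases "t = 1") auto
      qed
      have "continuous_on {0..1} (\<lambda>t. lform m (h t))"
        using ha(1) by (intro lform.continuous_on continuous_intros) (auto simp: arc_def path_def)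
      then have cst: "sgn (lform m (h t)) = sgn (lform m p)" if "t \<in> {0..1}" for t
        unfolding p_def by (rule sgn_nonvanishing[OF _ nz that])
      define a where "a = lform m p"
      define b where "b = lform m w"
      have a: "a \<noteq> 0" using nz[of 1] by (simp add: a_def p_def)
      have "(1 - v0) * a + v0 * b = 0" using qs[OF v0(2), of m] zq by (simp add: a_def b_def sgn_0_0)
      then have av: "a = v0 * (a - b)" by (simp add: algebra_simps)
      have sa: "sgn a = sgn (a - b)"
        using arg_cong[OF av, of sgn] v0(1) by (simp add: sgn_mult)
      have qe: "sgn (lform m (q t)) = - sgn a * sgn (t - v0)" if t: "t \<in> {0..1}" for t
      proof -
        have "(1 - t) * a + t * b = - ((a - b) * (t - v0))" using av by (simp add: algebra_simps)
        then show ?thesis using qs[OF t, of m] sa by (simp add: a_def b_def sgn_mult sgn_minus)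
      qed
      have "sgn (lform m (j t)) = - sgn a * sgn (t - v)" if t: "t \<in> {0..1}" for t
      proof (cases "t \<le> 1/2")
        case True
        then show ?thesis using cst[of "2 * t"] t 3 by (simp add: jl a_def)
      next
        case False
        then have "sgn (lform m (j t)) = - sgn a * sgn (2 * t - 1 - v0)" using qe[of "2 * t - 1"] t by (simp add: jr)
        also have "sgn (2 * t - 1 - v0) = sgn (t - v)" by (auto simp: sgn_real_def v0_def)
        finally show ?thesis .
      qed
      moreover have "- sgn a = 1 \<or> - sgn a = -1" using a by (auto simp: sgn_real_def)
      ultimately show ?thesis unfolding crosses_def by blast
    qed
  qed
  have e: "pathfinish h = pathstart q" using q0 by (simp add: pathfinish_def pathstart_def p_def)
  have "transverse_arc \<L> j"
  proof (rule transverse_arcI)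
    have "path_image h \<inter> path_image q \<subseteq> {pathstart q}"
    proof
      fix z assume "z \<in> path_image h \<inter> path_image q"
      then obtain s t where st: "s \<in> {0..1}" "z = h s" "t \<in> {0..1}" "z = q t" by (auto simp: path_image_def)
      have "t = 0"
      proof (rule ccontr)
        assume "t \<noteq> 0"
        then have "sgn (lform n z) = - \<sigma>" using qn[of t] st by auto
        moreover have "sgn (lform n z) = \<sigma> \<or> sgn (lform n z) = 0" using sg[of s] st n by (cases "s = 1") auto
        ultimately show False using \<sigma> by auto
      qed
      then show "z \<in> {pathstart q}" using st by (simp add: pathstart_def)
    qed
    then show "arc j" unfolding j_def by (rule arc_join[OF ha(1) qa(1) e])
    show "path_image j \<subseteq> hyp2" unfolding j_def using path_image_join[OF e] ha qa by auto
    show "hrectifiable j" unfolding j_def by (rule hrectifiable_join[OF ha(3,2) qa(3,2) e])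
  qed (rule jcr)
  then show ?thesis by (simp add: j_def q_def p_def)
qed

lemma subarc_atom:
  assumes g: "transverse_arc \<L> g" and h: "transverse_arc \<L> h" and sub: "path_image h \<subseteq> path_image g" and p: "p \<in> path_image h"
  shows "emeasure (tmeas lam (path_image h)) {p} = emeasure (tmeas lam (path_image g)) {p}"
  unfolding tmeas_subarc[OF g h sub]
proof (rule emeasure_restrict_space)
  show "path_image h \<inter> space (tmeas lam (path_image g)) \<in> sets (tmeas lam (path_image g))"
    using path_image_arc_borel[OF h] sub by (simp add: tmeas_arc(1)[OF g] tmeas_sets_iff[OF g] Int_absorb2)
qed (use p in auto)

text \<open>On a segment that ends on a leaf, the point on this leaf is the only one with its normal. So
  \<open>leaf_transport\<close> applies to atoms.\<close>

lemma leaf_atom: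
  assumes n: "n \<in> normals \<L>" "lform n x < 0" "lform n p = 0" and h: "x \<in> hyp2" "p \<in> hyp2"
  shows "lamE x p {n} = {p}"
proof -
  have t: "tseg x p" "no_common_leaf \<L> x p" using tseg_off_leaf[OF n(1,3) _ h(2,1)] n by auto
  have ns: "n \<in> seps \<L> x p" using n by (simp add: seps_def)
  have pin: "p \<in> path_image (hseg x p)" using hseg_1[OF h(2), of x] by (auto simp: path_image_def intro: image_eqI[of _ _ 1])
  show ?thesis
  proof
    show "{p} \<subseteq> lamE x p {n}"
      using pin lamset_iff[OF h(2)] n dirvec_eq[OF t(2) ns h(2) n(3)] by (auto simp: lamE_def)
    show "lamE x p {n} \<subseteq> {p}"
    proof
      fix r assume "r \<in> lamE x p {n}"
      then have r: "r \<in> path_image (hseg x p)" "r \<in> lamset lam" "dirvec lam x p r = n" by (auto simp: lamE_def)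
      have "r = hseg x p (cpar x p n)" using dirvec_seg(3)[OF h t(1) r(1,2)] unfolding r(3) .
      also have "cpar x p n = 1" using n by (simp add: cpar_def)
      finally show "r \<in> {p}" using hseg_1[OF h(2)] by simp
    qed
  qed
qed

text \<open>By definition the leaf has an atom \<open>p\<close> on some transverse arc, possibly at an endpoint. A piece of the arc
  that ends at \<open>p\<close> is continued by a geodesic segment from \<open>p\<close> to whichever of \<open>x\<close> and \<open>y\<close> is on the other side of
  the leaf; by the compatibility with subarcs this segment has the atom. Along the leaf the atom is
  transported to the segment from the same endpoint to the given point \<open>r\<close>, and from there to \<open>[x, y]\<close>.\<close>

lemma weighted_atom:
  assumes xy: "x \<in> hyp2" "y \<in> hyp2" and t: "tseg x y" and s: "0 < s" "s < 1"
    and w: "hseg x y s \<in> weighted_part lam"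
  shows "emeasure (segm x y) {hseg x y s} > 0"
proof -
  define r where "r = hseg x y s"
  have s01: "s \<in> {0..1}" "1 - s \<in> {0..1}" using s by auto
  have np: "no_common_leaf \<L> x y" using t transverse_hseg_iff[OF xy] by simp
  obtain k g p where k: "k \<in> \<L>" "r \<in> k" and g: "transverse_arc \<L> g"
    and p: "p \<in> k" "p \<in> path_image g" "emeasure (tmeas lam (path_image g)) {p} > 0"
    using w unfolding weighted_part_def r_def by blast
  obtain n' where n': "n' \<in> normals \<L>" "k = geo n'" by (rule leaf_normals[OF k(1)])
  have "lform n' (hseg x y s) = 0" using k(2) n'(2) by (simp add: geo_def r_def)
  then obtain n where n: "n \<in> seps \<L> x y" "k = geo n"
    using meets_seg_seps[OF xy n'(1) s01(1)] n'(2) geo_minus by blast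
  have nn: "n \<in> normals \<L>" using n by (simp add: seps_def)
  have r: "r \<in> hyp2" "lform n r = 0" using k(2) n by (auto simp: geo_def)
  have ph: "p \<in> hyp2" "lform n p = 0" using p(1) n by (auto simp: geo_def)
  have "cpar x y n = s" using sgn_seps_hseg[OF xy np n(1) s01(1)] r(2) by (simp add: r_def sgn_0_0)
  then have sx: "lform n x < 0" "lform n y > 0"
  proof -
    have "lform n x \<noteq> 0" using \<open>cpar x y n = s\<close> s by (auto simp: cpar_def)
    moreover have "lform n y \<noteq> 0" using \<open>cpar x y n = s\<close> s \<open>lform n x \<noteq> 0\<close> by (auto simp: cpar_def)
    ultimately show "lform n x < 0" "lform n y > 0" using n(1) by (auto simp: seps_def)
  qed
  obtain u where u: "u \<in> {0..1}" "p = g u" using p(2) by (auto simp: path_image_def)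
  have gz: "lform n (g u) = 0" using ph(2) u(2) by simp
  obtain h \<sigma> where h: "transverse_arc \<L> h" "path_image h \<subseteq> path_image g" "h 1 = g u"
    "\<sigma> = 1 \<or> \<sigma> = -1" and h5: "\<forall>t\<in>{0..<1}. sgn (lform n (h t)) = \<sigma>"
    and h6: "\<forall>m\<in>normals \<L>. \<forall>v\<in>{0..1}. lform m (h v) = 0 \<longrightarrow> crosses h m v {0..1}"
    by (rule half_arc[OF g u(1) nn gz])
  have h1: "h 1 = p" using h(3) u(2) by simp
  have h1p: "p \<in> path_image h" using imageI[of 1 "{0..1}" h] h1 by (simp add: path_image_def)
  have one: "emeasure (segm z r) {r} > 0" if z: "z \<in> hyp2" "sgn (lform n z) = - \<sigma>" for z
  proof -
    have j: "transverse_arc \<L> (h +++ hseg p z)"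
    proof -
      have "transverse_arc \<L> (h +++ hseg (h 1) z)"
      proof (rule arc_concat[OF h(1,4) nn _ _ _ z])
        show "lform n (h 1) = 0" using h1 ph by simp
        show "sgn (lform n (h t)) = \<sigma>" if "t \<in> {0..<1}" for t using h5 that by blast
        show "crosses h m v {0..1}" if "m \<in> normals \<L>" "v \<in> {0..1}" "lform m (h v) = 0" for m v using h6 that by blast
      qed
      then show ?thesis by (simp only: h1)
    qed
    have nz: "lform n z \<noteq> 0" using z h(4) by auto
    have tz: "tseg p z" "tseg z p" using tseg_off_leaf[OF nn ph(2) nz ph(1) z(1)] by auto
    have e: "pathfinish h = pathstart (hseg p z)" using hseg_0[OF ph(1)] h1 by (simp add: pathfinish_def pathstart_def)
    have im: "path_image (h +++ hseg p z) = path_image h \<union> path_image (hseg p z)" by (rule path_image_join[OF e])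
    have pq: "p \<in> path_image (hseg p z)" using hseg_0[OF ph(1), of z] by (auto simp: path_image_def intro: image_eqI[of _ _ 0])
    have "emeasure (segm p z) {p} = emeasure (tmeas lam (path_image h)) {p}"
      using subarc_atom[OF j tz(1) _ pq] subarc_atom[OF j h(1) _ h1p] im by (simp add: segm_t[OF tz(1)])
    also have "\<dots> = emeasure (tmeas lam (path_image g)) {p}" by (rule subarc_atom[OF g h(1,2) h1p])
    finally have pos: "emeasure (segm z p) {p} > 0" using p(3) segm_commute[OF z(1) ph(1)] by simp
    define m where "m = (if lform n z < 0 then n else - n)"
    have m: "m \<in> normals \<L>" "lform m z < 0" "lform m p = 0" "lform m r = 0"
      using nn normals_minus[OF nn] nz ph r by (auto simp: m_def lform.minus_left)
    have "emeasure (segm z p) (lamE z p {m}) = emeasure (segm z r) (lamE z r {m})"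
      by (rule leaf_transport[OF m z(1) ph(1) r(1)]) simp
    then show ?thesis
      using pos leaf_atom[OF m(1,2,3) z(1) ph(1)] leaf_atom[OF m(1,2,4) z(1) r(1)] by simp
  qed
  have end_atom: "emeasure (segm a b) {r} > 0" if ab: "a \<in> hyp2" "b \<in> hyp2" "tseg a b" and u: "0 < u" "u \<le> 1" "r = hseg a b u"
    and pos: "emeasure (segm a r) {r} > 0" for a b u
  proof -
    note i = seg_initial[OF ab u(1,2), folded u(3)]
    have ra: "r \<in> path_image (hseg a r)" using hseg_1[OF r(1), of a] by (auto simp: path_image_def intro: image_eqI[of _ _ 1])
    have "hseg a b ` {0..u} \<subseteq> hseg a b ` {0..1}" using u by (intro image_mono) auto
    then have sub: "path_image (hseg a r) \<subseteq> path_image (hseg a b)" by (simp only: i(3)) (simp add: path_image_def)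
    show ?thesis using subarc_atom[OF ab(3) i(2) sub ra] pos by (simp add: segm_t[OF ab(3)] segm_t[OF i(2)])
  qed
  have "emeasure (segm x y) {r} > 0"
  proof (cases "\<sigma> = 1")
    case True
    show ?thesis
      by (rule end_atom[OF xy t s(1) less_imp_le[OF s(2)] r_def one[OF xy(1)]]) (use sx True in simp)
  next
    case False
    then have "sgn (lform n y) = - \<sigma>" using h(4) sx by simp
    then have pos: "emeasure (segm y r) {r} > 0" by (rule one[OF xy(2)])
    have rr: "r = hseg y x (1 - s)" unfolding hseg_reverse[of y x] by (simp add: r_def)
    have "tseg y x" using tseg_commute[OF xy] t by simp
    then have "emeasure (segm y x) {r} > 0"
      by (rule end_atom[OF xy(2,1) _ _ _ rr pos]) (use s in auto)
    then show ?thesis by (simp only: segm_commute[OF xy])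
  qed
  then show ?thesis by (simp add: r_def)
qed

end

section \<open>Subdivisions\<close>

context meas_lam
begin

lemma unweighted_point:
  assumes xy: "x \<in> hyp2" "y \<in> hyp2" and t: "tseg x y" and r: "r \<in> path_image (hseg x y)" "r \<notin> weighted_part lam"
  shows "{r} \<in> null_sets (segm x y)"
proof -
  have rs: "{r} \<in> sets (segm x y)" using r by (simp add: segm_t[OF t] tmeas_sets_iff[OF t])
  have "emeasure (segm x y) {r} = 0"
  proof (cases "r \<in> lamset lam")
    case True
    then obtain k where k: "k \<in> \<L>" "r \<in> k" by (auto simp: lamset_def)
    show ?thesis
    proof (rule ccontr)
      assume "\<not> ?thesis"
      then have "emeasure (tmeas lam (path_image (hseg x y))) {r} > 0" by (simp add: segm_t[OF t] zero_less_iff_neq_zero)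
      then have "r \<in> weighted_part lam" unfolding weighted_part_def using k t r(1) by blast
      then show False using r by simp
    qed
  next
    case False
    obtain N where N: "{p \<in> space (segm x y). p \<notin> lamset lam} \<subseteq> N" "emeasure (segm x y) N = 0" "N \<in> sets (segm x y)"
      using segm_AE by (rule AE_E)
    have "{r} \<subseteq> N" using N(1) False r(1) by (auto simp: space_segm[OF t])
    then show ?thesis using emeasure_mono[OF _ N(3), of "{r}"] N(2) by simp
  qed
  then show ?thesis using rs by (simp add: null_sets_def)
qed

text \<open>A finite measure has countably many atoms, so by \<open>weighted_atom\<close> only countably many points of a
  transverse segment are weighted.\<close>

lemma avoid_weighted:
  assumes x: "x \<in> hyp2 - weighted_part lam" and y: "y \<in> hyp2 - weighted_part lam" and ab: "0 \<le> a" "a < b" "b \<le> 1"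
  obtains s where "a < s" "s < b" "hseg x y s \<notin> weighted_part lam"
proof -
  have xy: "x \<in> hyp2" "y \<in> hyp2" using x y by auto
  have "\<exists>s\<in>{a<..<b}. hseg x y s \<notin> weighted_part lam"
  proof (cases "tseg x y")
    case True
    have ne: "x \<noteq> y" using True transverse_hseg_iff[OF xy] by simp
    define B where "B = {s\<in>{a<..<b}. hseg x y s \<in> weighted_part lam}"
    interpret finite_measure "segm x y" by (rule finite_segm)
    have "hseg x y ` B \<subseteq> {r. measure (segm x y) {r} \<noteq> 0}"
    proof
      fix r assume "r \<in> hseg x y ` B"
      then obtain s where s': "s \<in> B" "r = hseg x y s" by blast
      then have s: "0 < s" "s < 1" "hseg x y s \<in> weighted_part lam" "r = hseg x y s" using ab by (auto simp: B_def)
      have "emeasure (segm x y) {r} > 0" using weighted_atom[OF xy True s(1,2,3)] s(4) by simp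
      then show "r \<in> {r. measure (segm x y) {r} \<noteq> 0}" by (auto simp: emeasure_eq_measure)
    qed
    then have "countable (hseg x y ` B)" using countable_support countable_subset by blast
    moreover have "inj_on (hseg x y) B"
      using ab hseg_inj[OF xy ne] by (auto simp: inj_on_def B_def)
    ultimately have "countable B" using countable_image_inj_on by blast
    then have "B \<noteq> {a<..<b}" using uncountable_open_interval[of a b] ab by auto
    then show ?thesis by (auto simp: B_def)
  next
    case False
    have "hseg x y s \<notin> weighted_part lam" if s: "s \<in> {0..1}" for s
    proof (cases "x = y")
      case True
      then show ?thesis using x by (simp add: hseg_cseg cseg_def hproj_id algebra_simps)
    next
      case ne: False
      then obtain n where n: "n \<in> normals \<L>" "lform n x = 0" "lform n y = 0"
        using False transverse_hseg_iff[OF xy] by (auto simp: no_common_leaf_def)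
      have rh: "hseg x y s \<in> hyp2" using hseg_hyp2 hyp2_future xy s by blast
      have rn: "lform n (hseg x y s) = 0" using sgn_lform_hseg[OF xy s, of n] n by (simp add: sgn_0_0)
      show ?thesis
      proof
        assume "hseg x y s \<in> weighted_part lam"
        then obtain k where k: "k \<in> \<L>" "hseg x y s \<in> k" "k \<subseteq> weighted_part lam" unfolding weighted_part_def by blast
        obtain m where m: "m \<in> normals \<L>" "k = geo m" by (rule leaf_normals[OF k(1)])
        have "lform m (hseg x y s) = 0" using k m by (simp add: geo_def)
        then have "m = n \<or> m = - n" using normals_same_leaf[OF n(1) m(1) hyp2_future[OF rh] rn] by simp
        then have "x \<in> k" using n(2) xy m by (auto simp: geo_def lform.minus_left)
        then show False using k x by blast
      qed
    qed
    moreover have "(a + b) / 2 \<in> {a<..<b}" "(a + b) / 2 \<in> {0..1}" using ab by auto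
    ultimately show ?thesis by blast
  qed
  then show thesis using that by auto
qed

text \<open>The cumulative mass. Since the points of a subdivision carry no mass, the mass of a cell is an increment of this
  function, and no convention about endpoints of cells matters.\<close>

definition cmass :: "real^3 \<Rightarrow> real^3 \<Rightarrow> real \<Rightarrow> real" where
  "cmass x y u = measure (segm x y) (hseg x y ` {0..u})"

lemma hseg_cell_sets:
  assumes xy: "x \<in> hyp2" "y \<in> hyp2" and t: "tseg x y" and ab: "0 \<le> a" "b \<le> 1"
  shows "hseg x y ` {a..b} \<in> sets (segm x y)"
proof -
  have "continuous_on {a..b} (hseg x y)" using continuous_hseg[OF xy] by (rule continuous_on_subset) (use ab in auto)
  then have "hseg x y ` {a..b} \<in> sets borel" by (intro borel_compact compact_continuous_image) auto
  moreover have "hseg x y ` {a..b} \<subseteq> path_image (hseg x y)" unfolding path_image_def using ab by (intro image_mono) auto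
  ultimately show ?thesis by (simp add: segm_t[OF t] tmeas_sets_iff[OF t])
qed

lemma seg_mass_eq:
  assumes x: "x \<in> hyp2 - weighted_part lam" and y: "y \<in> hyp2 - weighted_part lam" and ab: "0 \<le> a" "b \<le> 1"
  shows "seg_mass lam x y (hseg x y ` {a..b}) = measure (segm x y) (hseg x y ` {a..b})"
proof (cases "tseg x y")
  case True
  have xy: "x \<in> hyp2" "y \<in> hyp2" using x y by auto
  let ?c = "hseg x y ` {a..b}"
  have "x \<in> path_image (hseg x y)" "y \<in> path_image (hseg x y)"
    using hseg_0[OF xy(1), of y] hseg_1[OF xy(2), of x] by (auto simp: path_image_def intro: image_eqI[of _ _ 0] image_eqI[of _ _ 1])
  then have "{x} \<in> null_sets (segm x y)" "{y} \<in> null_sets (segm x y)" using unweighted_point[OF xy True] x y by auto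
  then have "{x} \<union> {y} \<in> null_sets (segm x y)" by (rule null_sets.Un)
  then have n: "{x, y} \<in> null_sets (segm x y)" by (simp add: insert_is_Un[of x "{y}"])
  have c: "?c \<in> sets (segm x y)" by (rule hseg_cell_sets[OF xy True ab])
  have "?c \<inter> {x, y} \<in> null_sets (segm x y)" using n c by (rule null_set_Int1)
  then have "measure (segm x y) (?c \<inter> {x, y}) = 0" by (simp add: measure_def null_sets_def)
  then show ?thesis unfolding seg_mass_def using measure_Diff_null_set[OF c n] by simp
next
  case False
  then show ?thesis by (simp add: seg_mass_def segm_n measure_def)
qed

lemma cmass_props:
  assumes x: "x \<in> hyp2 - weighted_part lam" and y: "y \<in> hyp2 - weighted_part lam"
  shows "mono_on {0..1} (cmass x y)" "cmass x y 0 = 0"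
proof -
  have xy: "x \<in> hyp2" "y \<in> hyp2" using x y by auto
  interpret finite_measure "segm x y" by (rule finite_segm)
  show "mono_on {0..1} (cmass x y)"
  proof (rule mono_onI)
    fix a b :: real assume ab: "a \<in> {0..1}" "b \<in> {0..1}" "a \<le> b"
    show "cmass x y a \<le> cmass x y b"
    proof (cases "tseg x y")
      case True
      show ?thesis unfolding cmass_def
        by (rule finite_measure_mono[OF image_mono hseg_cell_sets[OF xy True]]) (use ab in auto)
    qed (simp add: cmass_def segm_n measure_def)
  qed
  show "cmass x y 0 = 0"
  proof (cases "tseg x y")
    case True
    have "x \<in> path_image (hseg x y)" using hseg_0[OF xy(1), of y] by (auto simp: path_image_def intro: image_eqI[of _ _ 0])
    then have "{x} \<in> null_sets (segm x y)" using unweighted_point[OF xy True] x by auto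
    then show ?thesis using hseg_0[OF xy(1)] by (simp add: cmass_def measure_def null_sets_def)
  qed (simp add: cmass_def segm_n measure_def)
qed

lemma cell_split:
  assumes xy: "x \<in> hyp2" "y \<in> hyp2" and t: "tseg x y" and ab: "0 \<le> a" "a \<le> b" "b \<le> 1"
    and a: "hseg x y a \<notin> weighted_part lam"
  shows "hseg x y ` {a<..b} \<in> sets (segm x y)" "measure (segm x y) (hseg x y ` {a<..b}) = cmass x y b - cmass x y a"
    "measure (segm x y) (hseg x y ` {a..b}) = cmass x y b - cmass x y a"
    "hseg x y ` {0..b} = hseg x y ` {0..a} \<union> hseg x y ` {a<..b}" "hseg x y ` {0..a} \<inter> hseg x y ` {a<..b} = {}"
proof -
  interpret finite_measure "segm x y" by (rule finite_segm)
  have ne: "x \<noteq> y" using t transverse_hseg_iff[OF xy] by simp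
  have inj: "inj_on (hseg x y) {0..1}" using hseg_inj[OF xy ne] by (auto simp: inj_on_def)
  have e: "hseg x y ` {a<..b} = hseg x y ` {a..b} - {hseg x y a}"
  proof -
    have "{a<..b} = {a..b} - {a}" by auto
    then have "hseg x y ` {a<..b} = hseg x y ` ({a..b} - {a})" by (simp only:)
    also have "\<dots> = hseg x y ` {a..b} - hseg x y ` {a}"
      by (rule inj_on_image_set_diff[OF inj]) (use ab in auto)
    finally show ?thesis by (simp only: image_insert image_empty)
  qed
  have "hseg x y a \<in> path_image (hseg x y)" using ab by (auto simp: path_image_def)
  then have n: "{hseg x y a} \<in> null_sets (segm x y)" by (rule unweighted_point[OF xy t _ a])
  have c: "hseg x y ` {a..b} \<in> sets (segm x y)" by (rule hseg_cell_sets[OF xy t ab(1,3)])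
  have c0: "hseg x y ` {0..a} \<in> sets (segm x y)" by (rule hseg_cell_sets[OF xy t]) (use ab in auto)
  show m: "hseg x y ` {a<..b} \<in> sets (segm x y)" unfolding e using c n by auto
  have "{0..b} = {0..a} \<union> {a<..b}" using ab by auto
  then show un: "hseg x y ` {0..b} = hseg x y ` {0..a} \<union> hseg x y ` {a<..b}" by (simp only: image_Un)
  have "hseg x y ` {0..a} \<inter> hseg x y ` {a<..b} = hseg x y ` ({0..a} \<inter> {a<..b})"
    by (rule inj_on_image_Int[OF inj, symmetric]) (use ab in auto)
  also have "{0..a} \<inter> {a<..b} = {}" by auto
  finally show dis: "hseg x y ` {0..a} \<inter> hseg x y ` {a<..b} = {}" by simp
  show me: "measure (segm x y) (hseg x y ` {a<..b}) = cmass x y b - cmass x y a"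
    using finite_measure_Union[OF c0 m dis] by (simp add: cmass_def un)
  have "measure (segm x y) (hseg x y ` {a<..b}) = measure (segm x y) (hseg x y ` {a..b})"
    unfolding e by (rule measure_Diff_null_set[OF c n])
  then show "measure (segm x y) (hseg x y ` {a..b}) = cmass x y b - cmass x y a" using me by simp
qed

lemma subdivD:
  assumes x: "x \<in> hyp2 - weighted_part lam" and y: "y \<in> hyp2 - weighted_part lam" and s: "is_subdiv lam x y (r, s, l)"
  shows "r > 0" "s 0 = 0" "s r = 1" "\<And>j. j < r \<Longrightarrow> s j < s (Suc j)" "\<And>j. j \<le> r \<Longrightarrow> s j \<in> {0..1}"
    "\<And>j. j \<le> r \<Longrightarrow> hseg x y (s j) \<notin> weighted_part lam"
    "\<And>j. j < r \<Longrightarrow> seg_mass lam x y (cell x y s j) = cmass x y (s (Suc j)) - cmass x y (s j)"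
    "\<And>j. j < r \<Longrightarrow> cmass x y (s j) < cmass x y (s (Suc j)) \<Longrightarrow>
       is_ogeod (l j) \<and> rnormal (l j) \<in> seps \<L> x y \<and> cpar x y (rnormal (l j)) \<in> {s j..s (Suc j)}"
proof -
  have xy: "x \<in> hyp2" "y \<in> hyp2" using x y by auto
  show b: "r > 0" "s 0 = 0" "s r = 1" and inc: "\<And>j. j < r \<Longrightarrow> s j < s (Suc j)"
    using s by (auto simp: is_subdiv_def)
  have m: "s i \<le> s j" if "i \<le> j" "j \<le> r" for i j
    using that
  proof (induction j)
    case (Suc j)
    show ?case
    proof (cases "i = Suc j")
      case False
      then have "s i \<le> s j" using Suc by simp
      also have "s j < s (Suc j)" using inc Suc.prems by simp
      finally show ?thesis by simp
    qed simp
  qed simp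
  show s01: "\<And>j. j \<le> r \<Longrightarrow> s j \<in> {0..1}" using m[of 0] m[of _ r] b by auto
  show uw: "\<And>j. j \<le> r \<Longrightarrow> hseg x y (s j) \<notin> weighted_part lam"
  proof -
    fix j assume "j \<le> r"
    then consider "j = 0" | "j = r" | "0 < j" "j < r" by linarith
    then show "hseg x y (s j) \<notin> weighted_part lam"
    proof cases
      case 1
      then show ?thesis using b hseg_0[OF xy(1)] x by simp
    next
      case 2
      then show ?thesis using b hseg_1[OF xy(2)] y by simp
    next
      case 3
      then show ?thesis using s by (auto simp: is_subdiv_def)
    qed
  qed
  show ms: "\<And>j. j < r \<Longrightarrow> seg_mass lam x y (cell x y s j) = cmass x y (s (Suc j)) - cmass x y (s j)"
  proof -
    fix j assume j: "j < r"
    have d: "0 \<le> s j" "s j \<le> s (Suc j)" "s (Suc j) \<le> 1" using s01[of j] s01[of "Suc j"] inc[OF j] j by auto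
    have "seg_mass lam x y (cell x y s j) = measure (segm x y) (hseg x y ` {s j..s (Suc j)})"
      unfolding cell_def by (rule seg_mass_eq[OF x y d(1,3)])
    also have "\<dots> = cmass x y (s (Suc j)) - cmass x y (s j)"
    proof (cases "tseg x y")
      case True
      show ?thesis by (rule cell_split(3)[OF xy True d uw]) (use j in auto)
    qed (simp add: cmass_def segm_n measure_def)
    finally show "seg_mass lam x y (cell x y s j) = cmass x y (s (Suc j)) - cmass x y (s j)" .
  qed
  fix j assume j: "j < r" and pos: "cmass x y (s j) < cmass x y (s (Suc j))"
  have t: "tseg x y" using pos by (cases "tseg x y") (auto simp: cmass_def segm_n measure_def)
  have np: "no_common_leaf \<L> x y" using t transverse_hseg_iff[OF xy] by simp
  have L: "is_ogeod (l j)" "gset (l j) \<in> \<L>" "gset (l j) \<inter> cell x y s j \<noteq> {}" "side (l j) x \<ge> 0" "side (l j) y \<le> 0"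
    using s j pos ms[OF j] by (auto simp: is_subdiv_def)
  have n: "rnormal (l j) \<in> seps \<L> x y"
  proof -
    have "rnormal (l j) \<in> normals \<L>" unfolding normals_def using L by (intro CollectI exI[of _ "l j"]) simp
    then show ?thesis using L(4,5) by (simp add: seps_def lform_rnormal)
  qed
  obtain u where u: "u \<in> {s j..s (Suc j)}" "hseg x y u \<in> gset (l j)" using L(3) unfolding cell_def by blast
  have u01: "u \<in> {0..1}" using u s01[of j] s01[of "Suc j"] j by auto
  have "lform (rnormal (l j)) (hseg x y u) = 0" using u(2) gset_eq_geo[OF L(1)] by (simp add: geo_def)
  then have "u = cpar x y (rnormal (l j))" using sgn_seps_hseg[OF xy np n u01] by (simp add: sgn_0_0)
  then show "is_ogeod (l j) \<and> rnormal (l j) \<in> seps \<L> x y \<and> cpar x y (rnormal (l j)) \<in> {s j..s (Suc j)}"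
    using L(1) n u(1) by simp
qed

text \<open>Around each point of an equidistant subdivision there is a point without weight. A cell of positive mass
  meets the lamination, because the measure is concentrated there; so a leaf can be chosen.\<close>

lemma ex_subdiv:
  assumes x: "x \<in> hyp2 - weighted_part lam" and y: "y \<in> hyp2 - weighted_part lam" and d: "\<delta> > 0"
  obtains \<sigma> where "is_subdiv lam x y \<sigma>" "mesh x y \<sigma> < \<delta>"
proof -
  have xy: "x \<in> hyp2" "y \<in> hyp2" using x y by auto
  obtain C where C: "C > 0" "\<And>s t. s \<in> {0..1} \<Longrightarrow> t \<in> {0..1} \<Longrightarrow> norm (hseg x y s - hseg x y t) \<le> C * \<bar>s - t\<bar>"
    by (rule hseg_lipschitz[OF xy]) blast
  obtain r' :: nat where r': "2 * C / \<delta> < real r'" using reals_Archimedean2 by blast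
  define r where "r = Suc r'"
  have r: "r > 0" "C * (2 / real r) < \<delta>"
  proof -
    have "2 * C / \<delta> < real r" using r' by (simp add: r_def)
    then show "C * (2 / real r) < \<delta>" using d by (simp add: r_def field_simps)
  qed (simp add: r_def)
  \<comment> \<open>Points of the subdivision are chosen between consecutive half-integer multiples of \<open>1 / r\<close>; two
    consecutive ones then differ by less than \<open>2 / r\<close>.\<close>
  define a where "a j = (2 * real j - 1) / (2 * real r)" for j
  have aj: "a j < a (Suc j)" "a (Suc j) - a j = 1 / real r" for j
    using r(1) by (auto simp: a_def divide_strict_right_mono diff_divide_distrib[symmetric])
  have a0: "a 0 < 0" "1 < a (Suc r)" using r(1) by (auto simp: a_def)
  have apos: "0 \<le> a j" if "0 < j" for j using that r(1) by (auto simp: a_def)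
  have ale: "a (Suc j) \<le> 1" if "j < r" for j using that r(1) by (auto simp: a_def divide_le_eq_1)
  have "\<exists>u. 0 < j \<and> j < r \<longrightarrow> a j < u \<and> u < a (Suc j) \<and> hseg x y u \<notin> weighted_part lam" for j
  proof (cases "0 < j \<and> j < r")
    case True
    then obtain u where "a j < u" "u < a (Suc j)" "hseg x y u \<notin> weighted_part lam"
      using avoid_weighted[OF x y apos[of j] aj(1)[of j] ale[of j]] by blast
    then show ?thesis by blast
  next
    case False
    then show ?thesis by blast
  qed
  then obtain v where v: "\<And>j. 0 < j \<Longrightarrow> j < r \<Longrightarrow> a j < v j \<and> v j < a (Suc j) \<and> hseg x y (v j) \<notin> weighted_part lam"
    by metis
  define s where "s j = (if j = 0 then 0 else if j < r then v j else 1)" for j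
  have sj: "a j < s j \<and> s j < a (Suc j)" if "j \<le> r" for j
  proof -
    consider "j = 0" | "0 < j" "j < r" | "j = r" using \<open>j \<le> r\<close> by linarith
    then show ?thesis
    proof cases
      case 1
      have "0 < a (Suc 0)" using r(1) by (simp add: a_def)
      then show ?thesis using 1 a0 by (simp add: s_def)
    next
      case 3
      have "a r < 1" using r(1) by (simp add: a_def)
      then show ?thesis using 3 a0 r(1) by (simp add: s_def)
    qed (use v in \<open>auto simp: s_def\<close>)
  qed
  have inc: "s j < s (Suc j)" if "j < r" for j using sj[of j] sj[of "Suc j"] that by simp
  have s01: "s j \<in> {0..1}" if "j \<le> r" for j
  proof -
    consider "j = 0" | "0 < j" "j < r" | "j = r" using \<open>j \<le> r\<close> by linarith
    then show ?thesis
    proof cases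
      case 2
      then show ?thesis using sj[of j] apos[of j] ale[of j] by auto
    qed (auto simp: s_def)
  qed
  have "\<exists>l. seg_mass lam x y (cell x y s j) > 0 \<longrightarrow> is_ogeod l \<and> gset l \<in> \<L> \<and> gset l \<inter> cell x y s j \<noteq> {} \<and>
      side l x \<ge> 0 \<and> side l y \<le> 0" if j: "j < r" for j
  proof (cases "seg_mass lam x y (cell x y s j) > 0")
    case True
    have d01: "0 \<le> s j" "s (Suc j) \<le> 1" using s01[of j] s01[of "Suc j"] j by auto
    have pos: "measure (segm x y) (hseg x y ` {s j..s (Suc j)}) > 0"
      using True seg_mass_eq[OF x y d01] by (simp add: cell_def)
    have t: "tseg x y" using pos by (cases "tseg x y") (auto simp: segm_n measure_def)
    obtain N where N: "{p \<in> space (segm x y). p \<notin> lamset lam} \<subseteq> N" "emeasure (segm x y) N = 0" "N \<in> sets (segm x y)"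
      using segm_AE by (rule AE_E)
    have "\<exists>u\<in>{s j..s (Suc j)}. hseg x y u \<in> lamset lam"
    proof (rule ccontr)
      assume no: "\<not> ?thesis"
      have "hseg x y ` {s j..s (Suc j)} \<subseteq> path_image (hseg x y)" unfolding path_image_def using d01 by (intro image_mono) auto
      then have "hseg x y ` {s j..s (Suc j)} \<subseteq> N" using no N(1) by (auto simp: space_segm[OF t])
      then have "emeasure (segm x y) (hseg x y ` {s j..s (Suc j)}) \<le> emeasure (segm x y) N" by (rule emeasure_mono[OF _ N(3)])
      then show False using N(2) pos by (simp add: measure_def)
    qed
    then obtain u where u: "u \<in> {s j..s (Suc j)}" "hseg x y u \<in> lamset lam" by blast
    have "hseg x y u \<in> path_image (hseg x y)" using u d01 by (auto simp: path_image_def)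
    then obtain n where n: "n \<in> seps \<L> x y" "lform n (hseg x y u) = 0" using lam_seg_seps[OF xy _ u(2)] by blast
    obtain l where l: "is_ogeod l" "gset l \<in> \<L>" "n = rnormal l" using n(1) by (auto simp: seps_def normals_def)
    have "hseg x y u \<in> hyp2" using hseg_hyp2 hyp2_future xy u(1) d01 by auto
    then have "hseg x y u \<in> gset l" using n l gset_eq_geo[OF l(1)] by (simp add: geo_def)
    then have "gset l \<inter> cell x y s j \<noteq> {}" using u(1) unfolding cell_def by blast
    moreover have "side l x \<ge> 0" "side l y \<le> 0" using n(1) lform_rnormal[of l] l(3) by (auto simp: seps_def)
    ultimately show ?thesis using l by blast
  qed blast
  then obtain l where l: "\<And>j. j < r \<Longrightarrow> seg_mass lam x y (cell x y s j) > 0 \<Longrightarrow> is_ogeod (l j) \<and> gset (l j) \<in> \<L> \<and>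
      gset (l j) \<inter> cell x y s j \<noteq> {} \<and> side (l j) x \<ge> 0 \<and> side (l j) y \<le> 0"
    by metis
  have sub: "is_subdiv lam x y (r, s, l)"
    unfolding is_subdiv_def using r inc l v by (auto simp: s_def)
  have "hdist (hseg x y (s j)) (hseg x y (s (Suc j))) < \<delta>" if j: "j < r" for j
  proof -
    have h: "hseg x y (s j) \<in> hyp2" "hseg x y (s (Suc j)) \<in> hyp2" using hseg_hyp2 hyp2_future xy s01 j by auto
    have "hdist (hseg x y (s j)) (hseg x y (s (Suc j))) \<le> norm (hseg x y (s j) - hseg x y (s (Suc j)))" by (rule hdist_le_norm[OF h])
    also have "\<dots> \<le> C * \<bar>s j - s (Suc j)\<bar>" using C(2) s01 j by simp
    also have "\<bar>s j - s (Suc j)\<bar> \<le> 2 / real r"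
      using sj[of j] sj[of "Suc j"] j aj(2)[of j] aj(2)[of "Suc j"] inc[OF j] by simp
    then have "C * \<bar>s j - s (Suc j)\<bar> \<le> C * (2 / real r)" using C(1) by (intro mult_left_mono) auto
    also have "\<dots> < \<delta>" by (rule r(2))
    finally show ?thesis .
  qed
  then have "Max ((\<lambda>j. hdist (hseg x y (s j)) (hseg x y (s (Suc j)))) ` {..<r}) < \<delta>"
    using r(1) by (subst Max_less_iff) (auto simp: lessThan_empty_iff)
  then have "mesh x y (r, s, l) < \<delta>" by (simp add: mesh_def)
  then show thesis using that sub by blast
qed

lemma eventually_mesh:
  "eventually P (mesh_filter lam x y) \<longleftrightarrow> (\<exists>\<delta>>0. \<forall>\<sigma>. is_subdiv lam x y \<sigma> \<longrightarrow> mesh x y \<sigma> < \<delta> \<longrightarrow> P \<sigma>)"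
proof -
  have "eventually P (mesh_filter lam x y) \<longleftrightarrow>
      (\<exists>\<delta>\<in>{0<..}. eventually P (principal {\<sigma>. is_subdiv lam x y \<sigma> \<and> mesh x y \<sigma> < \<delta>}))"
    unfolding mesh_filter_def
  proof (rule eventually_INF_base)
    fix a b :: real assume "a \<in> {0<..}" "b \<in> {0<..}"
    then show "\<exists>c\<in>{0<..}. principal {\<sigma>. is_subdiv lam x y \<sigma> \<and> mesh x y \<sigma> < c} \<le>
        inf (principal {\<sigma>. is_subdiv lam x y \<sigma> \<and> mesh x y \<sigma> < a}) (principal {\<sigma>. is_subdiv lam x y \<sigma> \<and> mesh x y \<sigma> < b})"
      by (intro bexI[of _ "min a b"]) auto
  qed (auto intro: exI[of _ 1])
  then show ?thesis by (simp only: eventually_principal mem_Collect_eq greaterThan_iff Bex_def) blast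
qed

lemma mesh_filter_nontrivial:
  assumes x: "x \<in> hyp2 - weighted_part lam" and y: "y \<in> hyp2 - weighted_part lam"
  shows "mesh_filter lam x y \<noteq> bot"
proof
  assume "mesh_filter lam x y = bot"
  then have "eventually (\<lambda>_. False) (mesh_filter lam x y)" by simp
  then show False unfolding eventually_mesh using ex_subdiv[OF x y] by metis
qed

lemma mesh_close:
  assumes x: "x \<in> hyp2" and y: "y \<in> hyp2" and ne: "x \<noteq> y" and e: "\<epsilon> > 0"
  obtains d where "d > 0" "\<forall>r s l. is_subdiv lam x y (r, s, l) \<longrightarrow> (\<forall>j\<le>r. s j \<in> {0..1}) \<longrightarrow> mesh x y (r, s, l) < d \<longrightarrow>
    (\<forall>j<r. s (Suc j) - s j < \<epsilon>)"
proof -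
  obtain d where d: "d > 0" "\<And>s t. s \<in> {0..1} \<Longrightarrow> t \<in> {0..1} \<Longrightarrow> hdist (hseg x y s) (hseg x y t) < d \<Longrightarrow> \<bar>s - t\<bar> < \<epsilon>"
    by (rule hseg_param_close[OF x y ne e]) blast
  have "s (Suc j) - s j < \<epsilon>" if sub: "is_subdiv lam x y (r, s, l)" and s01: "\<forall>j\<le>r. s j \<in> {0..1}"
    and m: "mesh x y (r, s, l) < d" and j: "j < r" for r s l j
  proof -
    have "hdist (hseg x y (s j)) (hseg x y (s (Suc j))) \<le> mesh x y (r, s, l)"
      unfolding mesh_def using j by (auto intro!: Max_ge)
    then have "\<bar>s j - s (Suc j)\<bar> < \<epsilon>" using d(2)[of "s j" "s (Suc j)"] s01 j m by simp
    then show ?thesis by simp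
  qed
  then show thesis using that d(1) by blast
qed

end

section \<open>Ordered products of rotations\<close>

text \<open>The Euclidean norm of matrices is submultiplicative.\<close>

lemma norm_matrix_mult: "norm (A ** B) \<le> norm A * norm (B :: complex^2^2)"
proof -
  have sc: "norm (c *s v) = norm c * norm v" for c :: complex and v :: "complex^2"
    by (simp add: norm_vec_def norm_mult L2_set_right_distrib)
  have row: "norm (row1 $ 1 *s B $ 1 + row1 $ 2 *s B $ 2) \<le> norm row1 * norm B" for row1 :: "complex^2"
  proof -
    have "norm (row1 $ 1 *s B $ 1 + row1 $ 2 *s B $ 2) \<le> norm (row1 $ 1 *s B $ 1) + norm (row1 $ 2 *s B $ 2)"
      by (rule norm_triangle_ineq)
    also have "\<dots> = norm (row1 $ 1) * norm (B $ 1) + norm (row1 $ 2) * norm (B $ 2)"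
      by (simp add: sc)
    also have "\<dots> \<le> sqrt ((norm (row1 $ 1))\<^sup>2 + (norm (row1 $ 2))\<^sup>2) * sqrt ((norm (B $ 1))\<^sup>2 + (norm (B $ 2))\<^sup>2)"
    proof -
      have "(norm (row1 $ 1) * norm (B $ 1) + norm (row1 $ 2) * norm (B $ 2))\<^sup>2 \<le>
          ((norm (row1 $ 1))\<^sup>2 + (norm (row1 $ 2))\<^sup>2) * ((norm (B $ 1))\<^sup>2 + (norm (B $ 2))\<^sup>2)"
        using zero_le_power2[of "norm (row1 $ 1) * norm (B $ 2) - norm (row1 $ 2) * norm (B $ 1)"]
        by (simp add: power2_eq_square algebra_simps)
      then show ?thesis by (metis real_le_rsqrt real_sqrt_mult)
    qed
    also have "\<dots> = norm row1 * norm B" by (simp add: norm_vec_def L2_set_def sum_2)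
    finally show ?thesis .
  qed
  have AB: "(A ** B) $ i = A $ i $ 1 *s B $ 1 + A $ i $ 2 *s B $ 2" for i
    by (simp add: vec_eq_iff matrix_matrix_mult_def sum_2)
  have "norm (A ** B) = L2_set (\<lambda>i. norm ((A ** B) $ i)) UNIV" by (simp add: norm_vec_def)
  also have "\<dots> \<le> L2_set (\<lambda>i. norm (A $ i) * norm B) UNIV"
    unfolding AB by (rule L2_set_mono) (use row in auto)
  also have "\<dots> = norm A * norm B" by (simp add: norm_vec_def L2_set_left_distrib)
  finally show ?thesis .
qed

lemma matrix_mult_scaleR: "(a *\<^sub>R A) ** B = a *\<^sub>R (A ** (B :: complex^2^2))" "A ** (a *\<^sub>R B) = a *\<^sub>R (A ** (B :: complex^2^2))"
  by (simp_all add: vec_eq_iff forall_2 matrix_matrix_mult_def sum_2 scaleR_add_right)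

lemma mmult_distrib:
  fixes A B C :: "complex^2^2"
  shows "(A + B) ** C = A ** C + B ** C" "C ** (A + B) = C ** A + C ** B"
    "(A - B) ** C = A ** C - B ** C" "C ** (A - B) = C ** A - C ** B"
  by (simp_all add: vec_eq_iff forall_2 matrix_matrix_mult_def sum_2 algebra_simps)

lemma norm_mat1: "norm (mat 1 :: complex^2^2) \<le> 2"
proof -
  have "norm (mat 1 :: complex^2^2) = sqrt 2"
    by (simp add: norm_vec_def L2_set_def sum_2 mat_def)
  also have "\<dots> \<le> 2" by (rule real_le_lsqrt) auto
  finally show ?thesis .
qed

text \<open>This is \<open>exp (\<theta> Z)\<close> if \<open>Z ** Z = - mat 1\<close>.\<close>

definition rot :: "complex^2^2 \<Rightarrow> real \<Rightarrow> complex^2^2" where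
  "rot Z \<theta> = cos \<theta> *\<^sub>R mat 1 + sin \<theta> *\<^sub>R Z"

lemma rot_0: "rot Z 0 = mat 1"
  by (simp add: rot_def)

lemma rot_add:
  assumes "Z ** Z = - mat 1" shows "rot Z (a + b) = rot Z a ** rot Z b"
proof -
  have "rot Z a ** rot Z b = (cos a * cos b) *\<^sub>R mat 1 + (cos a * sin b + sin a * cos b) *\<^sub>R Z + (sin a * sin b) *\<^sub>R (Z ** Z)"
    by (simp add: rot_def mmult_distrib matrix_mult_scaleR scaleR_add_left scaleR_add_right mult_ac)
  then show ?thesis by (simp add: assms rot_def cos_add sin_add scaleR_add_left scaleR_diff_left algebra_simps)
qed

lemma sin_le_self: "\<bar>sin x - x\<bar> \<le> x\<^sup>2 / 2" for x :: real
  using Maclaurin_sin_bound[of x 2] by (simp add: numeral_2_eq_2 sin_coeff_def)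

lemma one_minus_cos_le: "1 - cos x \<le> x\<^sup>2 / 2" for x :: real
proof -
  have "cos x = 1 - 2 * (sin (x / 2))\<^sup>2" using cos_double_sin[of "x / 2"] by simp
  moreover have "(sin (x / 2))\<^sup>2 \<le> (x / 2)\<^sup>2" using abs_sin_x_le_abs_x[of "x / 2"] by (simp only: abs_le_square_iff)
  ultimately show ?thesis by (simp add: power_divide)
qed

lemma exp_ge_quadratic: "0 \<le> c \<Longrightarrow> c\<^sup>2 / 2 \<le> exp c - 1 - c" for c :: real
  using exp_lower_Taylor_quadratic[of c] by simp

text \<open>The remainder is written as \<open>exp c - 1 - c\<close>, with \<open>c\<close> a multiple of the angle, because in this form
  it is inherited by products.\<close>

lemma rot_first_order:
  assumes Z: "norm Z \<le> B" and t: "0 \<le> \<theta>"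
  shows "norm (rot Z \<theta> - mat 1 - \<theta> *\<^sub>R Z) \<le> exp ((2 + B) * \<theta>) - 1 - (2 + B) * \<theta>"
proof -
  have B: "B \<ge> 0" using Z norm_ge_zero order_trans by blast
  have "rot Z \<theta> - mat 1 - \<theta> *\<^sub>R Z = (cos \<theta> - 1) *\<^sub>R mat 1 + (sin \<theta> - \<theta>) *\<^sub>R Z"
    by (simp add: rot_def algebra_simps)
  also have "norm \<dots> \<le> \<bar>cos \<theta> - 1\<bar> * norm (mat 1 :: complex^2^2) + \<bar>sin \<theta> - \<theta>\<bar> * norm Z"
    by (rule order_trans[OF norm_triangle_ineq]) simp
  also have "\<dots> \<le> (\<theta>\<^sup>2 / 2) * 2 + (\<theta>\<^sup>2 / 2) * B"
    using one_minus_cos_le[of \<theta>] cos_le_one[of \<theta>] sin_le_self[of \<theta>] norm_mat1 Z by (intro add_mono mult_mono) auto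
  also have "\<dots> = (2 + B) * \<theta>\<^sup>2 / 2" by (simp add: algebra_simps)
  also have "\<dots> \<le> ((2 + B) * \<theta>)\<^sup>2 / 2"
  proof -
    have "(2 + B) * 1 \<le> (2 + B) * (2 + B)" using B by (intro mult_left_mono) auto
    then show ?thesis by (simp add: power_mult_distrib power2_eq_square[of "2 + B"] mult_right_mono)
  qed
  also have "\<dots> \<le> exp ((2 + B) * \<theta>) - 1 - (2 + B) * \<theta>" using B t by (intro exp_ge_quadratic) simp
  finally show ?thesis .
qed

text \<open>In the formal expansion of \<open>\<Prod> (1 + (f j - 1))\<close> every term is bounded by the corresponding term of the
  expansion of \<open>\<Prod> exp (c j)\<close>; the terms of order \<open>0\<close> and \<open>1\<close> are removed on both sides. The second part
  is needed in the induction.\<close>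

lemma ordprod_first_order:
  fixes f :: "nat \<Rightarrow> complex^2^2"
  assumes c: "\<And>j. j < r \<Longrightarrow> 0 \<le> c j" and a: "\<And>j. j < r \<Longrightarrow> norm (a j) \<le> c j"
    and f: "\<And>j. j < r \<Longrightarrow> norm (f j - mat 1 - a j) \<le> exp (c j) - 1 - c j"
  shows "norm (ordprod f r - mat 1 - (\<Sum>j<r. a j)) \<le> exp (\<Sum>j<r. c j) - 1 - (\<Sum>j<r. c j) \<and>
    norm (ordprod f r - mat 1) \<le> exp (\<Sum>j<r. c j) - 1"
  using assms
proof (induction r)
  case (Suc r)
  define P where "P = ordprod f r"
  define C where "C = (\<Sum>j<r. c j)"
  define S where "S = (\<Sum>j<r. a j)"
  have IH: "norm (P - mat 1 - S) \<le> exp C - 1 - C" "norm (P - mat 1) \<le> exp C - 1"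
    using Suc by (auto simp: P_def C_def S_def)
  have fr: "norm (f r - mat 1 - a r) \<le> exp (c r) - 1 - c r" "norm (a r) \<le> c r" "0 \<le> c r" using Suc by auto
  have "norm (f r - mat 1) \<le> norm (f r - mat 1 - a r) + norm (a r)" using norm_triangle_ineq[of "f r - mat 1 - a r" "a r"] by simp
  then have f1: "norm (f r - mat 1) \<le> exp (c r) - 1" using fr by linarith
  have "norm ((P - mat 1) ** (f r - mat 1)) \<le> norm (P - mat 1) * norm (f r - mat 1)" by (rule norm_matrix_mult)
  also have "\<dots> \<le> (exp C - 1) * (exp (c r) - 1)" using IH(2) f1 order_trans[OF norm_ge_zero IH(2)] by (intro mult_mono) auto
  finally have q: "norm ((P - mat 1) ** (f r - mat 1)) \<le> (exp C - 1) * (exp (c r) - 1)" .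
  have "P ** f r - mat 1 - (S + a r) = (P - mat 1) ** (f r - mat 1) + (P - mat 1 - S) + (f r - mat 1 - a r)"
    by (simp add: mmult_distrib algebra_simps)
  also have "norm \<dots> \<le> (exp C - 1) * (exp (c r) - 1) + (exp C - 1 - C) + (exp (c r) - 1 - c r)"
    using q IH(1) fr(1) by (intro order_trans[OF norm_triangle_ineq] add_mono) auto
  also have "\<dots> = exp (C + c r) - 1 - (C + c r)" by (simp add: exp_add algebra_simps)
  finally have 1: "norm (P ** f r - mat 1 - (S + a r)) \<le> exp (C + c r) - 1 - (C + c r)" .
  have "P ** f r - mat 1 = (P - mat 1) ** (f r - mat 1) + (P - mat 1) + (f r - mat 1)"
    by (simp add: mmult_distrib algebra_simps)
  also have "norm \<dots> \<le> (exp C - 1) * (exp (c r) - 1) + (exp C - 1) + (exp (c r) - 1)"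
    using q IH(2) f1 by (intro order_trans[OF norm_triangle_ineq] add_mono) auto
  also have "\<dots> = exp (C + c r) - 1" by (simp add: exp_add algebra_simps)
  finally show ?case using 1 by (simp add: P_def C_def S_def)
qed simp

lemma ordprod_ones:
  assumes "i < r" "\<And>j. i < j \<Longrightarrow> j < r \<Longrightarrow> f j = mat 1"
  shows "ordprod f r = ordprod f i ** f i"
  using assms
proof (induction r)
  case (Suc r)
  then show ?case by (cases "i = r") auto
qed simp

lemma ordprod_cong:
  assumes "\<And>j. j < r \<Longrightarrow> f j = g j" shows "ordprod f r = ordprod g r"
  using assms by (induction r) auto

text \<open>The part of the product that belongs to \<open>[0, u]\<close>: the factor of the cell \<open>[s j, s (Suc j)]\<close> is cut off
  at \<open>u\<close>. It extends the product to a function of a real variable, so that products over different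
  subdivisions can be compared.\<close>

definition cutprod :: "(real \<Rightarrow> real) \<Rightarrow> (nat \<Rightarrow> real) \<Rightarrow> (nat \<Rightarrow> complex^2^2) \<Rightarrow> nat \<Rightarrow> real \<Rightarrow> complex^2^2" where
  "cutprod G s Z r u = ordprod (\<lambda>j. rot (Z j) (G (max (s j) (min u (s (Suc j)))) - G (s j))) r"

definition incr :: "(nat \<Rightarrow> real) \<Rightarrow> nat \<Rightarrow> bool" where
  "incr s r \<longleftrightarrow> (\<forall>j<r. s j < s (Suc j))"

lemma incr_mono: "incr s r \<Longrightarrow> i \<le> j \<Longrightarrow> j \<le> r \<Longrightarrow> s i \<le> s j"
proof (induction j)
  case (Suc j)
  show ?case
  proof (cases "i = Suc j")
    case False
    then have "s i \<le> s j" using Suc by simp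
    also have "s j \<le> s (Suc j)" using Suc.prems by (simp add: incr_def less_imp_le)
    finally show ?thesis .
  qed simp
qed simp

lemma cutprod_step:
  assumes s: "incr s r" and i: "i < r" and vu: "s i \<le> v" "v \<le> u" "u \<le> s (Suc i)" and Z: "Z i ** Z i = - mat 1"
  shows "cutprod G s Z r u = cutprod G s Z r v ** rot (Z i) (G u - G v)"
proof -
  have W: "cutprod G s Z r w = ordprod (\<lambda>j. rot (Z j) (G (s (Suc j)) - G (s j))) i ** rot (Z i) (G w - G (s i))"
    if w: "s i \<le> w" "w \<le> s (Suc i)" for w
  proof -
    let ?f = "\<lambda>j. rot (Z j) (G (max (s j) (min w (s (Suc j)))) - G (s j))"
    have "?f j = mat 1" if j: "i < j" "j < r" for j
    proof -
      have "w \<le> s j" using incr_mono[OF s, of "Suc i" j] w j by simp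
      then have "max (s j) (min w (s (Suc j))) = s j" by simp
      then show ?thesis by (simp add: rot_0)
    qed
    then have "cutprod G s Z r w = ordprod ?f i ** ?f i" unfolding cutprod_def using i by (rule ordprod_ones[rotated]) auto
    moreover have "ordprod ?f i = ordprod (\<lambda>j. rot (Z j) (G (s (Suc j)) - G (s j))) i"
    proof (rule ordprod_cong)
      fix j assume j: "j < i"
      have "s (Suc j) \<le> w" "s j \<le> s (Suc j)" using incr_mono[OF s, of "Suc j" i] incr_mono[OF s, of j "Suc j"] w j i by auto
      then show "?f j = rot (Z j) (G (s (Suc j)) - G (s j))" by (simp add: max_absorb2 min_absorb2)
    qed
    moreover have "?f i = rot (Z i) (G w - G (s i))" using w by (simp add: max_absorb2 min_absorb1)
    ultimately show ?thesis by simp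
  qed
  have "cutprod G s Z r u = ordprod (\<lambda>j. rot (Z j) (G (s (Suc j)) - G (s j))) i ** rot (Z i) ((G v - G (s i)) + (G u - G v))"
    using W[of u] vu by simp
  also have "\<dots> = cutprod G s Z r v ** rot (Z i) (G u - G v)"
    unfolding rot_add[OF Z] using W[of v] vu by (simp add: matrix_mul_assoc)
  finally show ?thesis .
qed

lemma cutprod_start:
  assumes s: "incr s r" shows "cutprod G s Z r (s 0) = mat 1"
proof -
  have "cutprod G s Z r (s 0) = ordprod (\<lambda>j. mat 1) r" unfolding cutprod_def
  proof (rule ordprod_cong)
    fix j assume "j < r"
    then have "s 0 \<le> s j" using incr_mono[OF s, of 0 j] by simp
    then have "max (s j) (min (s 0) (s (Suc j))) = s j" by simp
    then show "rot (Z j) (G (max (s j) (min (s 0) (s (Suc j)))) - G (s j)) = mat 1" by (simp add: rot_0)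
  qed
  also have "\<dots> = mat 1" by (induction r) auto
  finally show ?thesis .
qed

lemma cutprod_end:
  assumes s: "incr s r" shows "cutprod G s Z r (s r) = ordprod (\<lambda>j. rot (Z j) (G (s (Suc j)) - G (s j))) r"
  unfolding cutprod_def
proof (rule ordprod_cong)
  fix j assume "j < r"
  then have "s (Suc j) \<le> s r" "s j \<le> s (Suc j)" using incr_mono[OF s, of "Suc j" r] incr_mono[OF s, of j "Suc j"] by auto
  then show "rot (Z j) (G (max (s j) (min (s r) (s (Suc j)))) - G (s j)) = rot (Z j) (G (s (Suc j)) - G (s j))"
    by (simp add: max_absorb2 min_absorb2)
qed

lemma rot_bound:
  assumes Z: "norm Z \<le> B" and t: "0 \<le> \<theta>" shows "norm (rot Z \<theta> - mat 1) \<le> exp ((2 + B) * \<theta>) - 1"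
proof -
  have "norm (rot Z \<theta> - mat 1) \<le> norm (rot Z \<theta> - mat 1 - \<theta> *\<^sub>R Z) + norm (\<theta> *\<^sub>R Z)"
    using norm_triangle_ineq[of "rot Z \<theta> - mat 1 - \<theta> *\<^sub>R Z" "\<theta> *\<^sub>R Z"] by simp
  also have "norm (\<theta> *\<^sub>R Z) \<le> B * \<theta>" using mult_right_mono[OF Z t] t by (simp add: mult.commute)
  also have "norm (rot Z \<theta> - mat 1 - \<theta> *\<^sub>R Z) \<le> exp ((2 + B) * \<theta>) - 1 - (2 + B) * \<theta>" by (rule rot_first_order[OF Z t])
  finally show ?thesis using t by (simp add: algebra_simps)
qed

text \<open>Between consecutive points \<open>v < u\<close> of the common refinement both partial products are multiplied by a
  rotation by \<open>G u - G v\<close>, with generators that differ by at most \<open>\<omega>\<close>. The difference therefore grows at most like the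
  solution of \<open>D' = (2 + B) D + L \<omega>\<close> with respect to \<open>G\<close>, where \<open>L\<close> bounds the products; \<open>bnd\<close> is a supersolution
  of this equation. The bound tends to \<open>0\<close> with \<open>\<omega>\<close>, whatever the numbers of cells. Cells without mass have factor \<open>1\<close>,
  and nothing is known about their generators.\<close>

lemma cutprod_compare:
  fixes G :: "real \<Rightarrow> real"
  assumes s: "incr s r" "s 0 = 0" "s r = 1" and s': "incr s' r'" "s' 0 = 0" "s' r' = 1"
    and G: "mono_on {0..1} G" "G 0 = 0"
    and Z: "\<And>i. i < r \<Longrightarrow> G (s i) < G (s (Suc i)) \<Longrightarrow> Z i ** Z i = - mat 1 \<and> norm (Z i) \<le> B"
    and Z': "\<And>i. i < r' \<Longrightarrow> G (s' i) < G (s' (Suc i)) \<Longrightarrow> Z' i ** Z' i = - mat 1 \<and> norm (Z' i) \<le> B"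
    and close: "\<And>i j. i < r \<Longrightarrow> j < r' \<Longrightarrow> G (s i) < G (s (Suc i)) \<Longrightarrow> G (s' j) < G (s' (Suc j)) \<Longrightarrow>
      s i \<le> s' (Suc j) \<Longrightarrow> s' j \<le> s (Suc i) \<Longrightarrow> norm (Z i - Z' j) \<le> \<omega>"
    and B: "B \<ge> 0" and w: "\<omega> \<ge> 0"
  shows "norm (ordprod (\<lambda>j. rot (Z j) (G (s (Suc j)) - G (s j))) r - ordprod (\<lambda>j. rot (Z' j) (G (s' (Suc j)) - G (s' j))) r')
    \<le> (exp ((2 + B) * G 1) + 2) * \<omega> * G 1 * exp ((2 + B) * G 1)"
proof -
  define W where "W = cutprod G s Z r"
  define W' where "W' = cutprod G s' Z' r'"
  define L where "L = exp ((2 + B) * G 1) + 2"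
  have sin: "s i \<in> {0..1}" if "i \<le> r" for i using incr_mono[OF s(1), of 0 i] incr_mono[OF s(1), of i r] s that by simp
  have sin': "s' i \<in> {0..1}" if "i \<le> r'" for i using incr_mono[OF s'(1), of 0 i] incr_mono[OF s'(1), of i r'] s' that by simp
  have Gm: "G a \<le> G b" if "a \<le> b" "a \<in> {0..1}" "b \<in> {0..1}" for a b using mono_onD[OF G(1)] that by blast
  have step: "cutprod G s Z r u = cutprod G s Z r v ** rot (Z i) (G u - G v) \<and> (G v < G u \<longrightarrow> Z i ** Z i = - mat 1 \<and> norm (Z i) \<le> B)"
    if s: "incr s r" "\<And>i. i \<le> r \<Longrightarrow> s i \<in> {0..1}" and Z: "\<forall>i<r. G (s i) < G (s (Suc i)) \<longrightarrow> Z i ** Z i = - mat 1 \<and> norm (Z i) \<le> B"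
      and i: "i < r" and vu: "s i \<le> v" "v \<le> u" "u \<le> s (Suc i)" for s r Z i v u
  proof (cases "G (s i) < G (s (Suc i))")
    case True
    then show ?thesis using cutprod_step[OF s(1) i vu] Z i by blast
  next
    case False
    have d: "s i \<in> {0..1}" "s (Suc i) \<in> {0..1}" using s(2) i by auto
    have "G (s i) \<le> G v" "G v \<le> G u" "G u \<le> G (s (Suc i))" using Gm[of "s i" v] Gm[of v u] Gm[of u "s (Suc i)"] d vu by auto
    then have e: "G (s i) = G v" "G u = G v" "G (s (Suc i)) = G v" using False by auto
    have "cutprod G s Z r u = cutprod G s Z r v" unfolding cutprod_def
    proof (rule ordprod_cong)
      fix j assume j: "j < r"
      show "rot (Z j) (G (max (s j) (min u (s (Suc j)))) - G (s j)) = rot (Z j) (G (max (s j) (min v (s (Suc j)))) - G (s j))"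
      proof (cases "j = i")
        case True
        then show ?thesis using vu e by (simp add: max_absorb2 min_absorb1)
      next
        case False
        then consider "j < i" | "i < j" by linarith
        then show ?thesis
        proof cases
          case 1
          then have "s (Suc j) \<le> s i" using incr_mono[OF s(1), of "Suc j" i] i by simp
          then show ?thesis using vu by (simp add: min_absorb2)
        next
          case 2
          then have "s (Suc i) \<le> s j" using incr_mono[OF s(1), of "Suc i" j] j by simp
          then show ?thesis using vu by simp
        qed
      qed
    qed
    then show ?thesis using e by (simp add: rot_0)
  qed
  have Zo: "\<forall>i<r. G (s i) < G (s (Suc i)) \<longrightarrow> Z i ** Z i = - mat 1 \<and> norm (Z i) \<le> B" using Z by blast
  have Zo': "\<forall>i<r'. G (s' i) < G (s' (Suc i)) \<longrightarrow> Z' i ** Z' i = - mat 1 \<and> norm (Z' i) \<le> B" using Z' by blast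
  have Wb: "norm (W' u) \<le> L" if u: "u \<in> {0..1}" for u
  proof -
    define c where "c j = (2 + B) * (G (s' (Suc j)) - G (s' j))" for j
    define f where "f j = rot (Z' j) (G (max (s' j) (min u (s' (Suc j)))) - G (s' j))" for j
    have c: "0 \<le> c j" "norm (f j - mat 1) \<le> exp (c j) - 1" if j: "j < r'" for j
    proof -
      have d: "s' j \<in> {0..1}" "s' (Suc j) \<in> {0..1}" "s' j \<le> s' (Suc j)" using sin' j incr_mono[OF s'(1), of j "Suc j"] by auto
      let ?m = "max (s' j) (min u (s' (Suc j)))"
      have m: "?m \<in> {0..1}" "s' j \<le> ?m" "?m \<le> s' (Suc j)" using d u by auto
      have g: "G (s' j) \<le> G ?m" "G ?m \<le> G (s' (Suc j))" using Gm d m by blast+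
      then show "0 \<le> c j" using B by (simp add: c_def)
      show "norm (f j - mat 1) \<le> exp (c j) - 1"
      proof (cases "G (s' j) < G (s' (Suc j))")
        case True
        have "norm (f j - mat 1) \<le> exp ((2 + B) * (G ?m - G (s' j))) - 1"
          unfolding f_def using Z'[OF j True] g by (intro rot_bound) auto
        also have "\<dots> \<le> exp (c j) - 1" using g B by (simp add: c_def mult_left_mono)
        finally show ?thesis .
      next
        case False
        then have "G ?m = G (s' j)" using g by simp
        then show ?thesis using \<open>0 \<le> c j\<close> by (simp add: f_def rot_0)
      qed
    qed
    have "norm (ordprod f r' - mat 1) \<le> exp (\<Sum>j<r'. c j) - 1"
    proof -
      have "norm (ordprod f n - mat 1) \<le> exp (\<Sum>j<n. c j) - 1" if "n \<le> r'" for n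
        using that
      proof (induction n)
        case (Suc n)
        have IH: "norm (ordprod f n - mat 1) \<le> exp (\<Sum>j<n. c j) - 1" using Suc by simp
        have fn: "norm (f n - mat 1) \<le> exp (c n) - 1" using c Suc by simp
        have "ordprod f n ** f n - mat 1 = (ordprod f n - mat 1) ** (f n - mat 1) + (ordprod f n - mat 1) + (f n - mat 1)"
          by (simp add: mmult_distrib algebra_simps)
        also have "norm \<dots> \<le> norm (ordprod f n - mat 1) * norm (f n - mat 1) + norm (ordprod f n - mat 1) + norm (f n - mat 1)"
          by (intro order_trans[OF norm_triangle_ineq] add_mono norm_matrix_mult) auto
        also have "\<dots> \<le> (exp (\<Sum>j<n. c j) - 1) * (exp (c n) - 1) + (exp (\<Sum>j<n. c j) - 1) + (exp (c n) - 1)"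
          using IH fn order_trans[OF norm_ge_zero IH] by (intro add_mono mult_mono) auto
        also have "\<dots> = exp (\<Sum>j<Suc n. c j) - 1" by (simp add: exp_add algebra_simps)
        finally show ?case by simp
      qed simp
      then show ?thesis by simp
    qed
    also have "(\<Sum>j<r'. c j) = (2 + B) * G 1"
    proof -
      have "(\<Sum>j<r'. c j) = (2 + B) * (\<Sum>j<r'. G (s' (Suc j)) - G (s' j))" by (simp add: c_def sum_distrib_left)
      also have "(\<Sum>j<r'. G (s' (Suc j)) - G (s' j)) = G (s' r') - G (s' 0)" by (rule sum_lessThan_telescope)
      finally show ?thesis using s' G by simp
    qed
    finally have "norm (W' u - mat 1) \<le> exp ((2 + B) * G 1) - 1" by (simp add: W'_def cutprod_def f_def[abs_def])
    moreover have "norm (W' u) \<le> norm (W' u - mat 1) + norm (mat 1 :: complex^2^2)" using norm_triangle_ineq[of "W' u - mat 1" "mat 1"] by simp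
    ultimately show ?thesis using norm_mat1 by (simp add: L_def)
  qed
  define bnd where "bnd u = L * \<omega> * G u * exp ((2 + B) * G u)" for u
  have L0: "L \<ge> 0" by (simp add: L_def add_nonneg_nonneg)
  \<comment> \<open>The points of the common refinement are the numbers \<open>min (s i) (s' j)\<close>; induction on \<open>i + j\<close> avoids
    enumerating them.\<close>
  have main: "norm (W (min (s i) (s' j)) - W' (min (s i) (s' j))) \<le> bnd (min (s i) (s' j))"
    if "i \<le> r" "j \<le> r'" "i + j = N" for i j N
    using that
  proof (induction N arbitrary: i j rule: less_induct)
    case (less N)
    have base: ?case if "i = 0 \<or> j = 0"
    proof -
      have "min (s i) (s' j) = 0" using that sin[OF less.prems(1)] sin'[OF less.prems(2)] s s' by auto
      then show ?thesis using cutprod_start[OF s(1), of G Z] cutprod_start[OF s'(1), of G Z'] s s' G by (simp add: W_def W'_def bnd_def)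
    qed
    show ?case
    proof (cases "i = 0 \<or> j = 0")
      case False
      then obtain a b where ab: "i = Suc a" "j = Suc b" by (meson not0_implies_Suc)
      have IH1: "norm (W (min (s a) (s' j)) - W' (min (s a) (s' j))) \<le> bnd (min (s a) (s' j))"
        by (rule less.IH[of "a + j"]) (use less.prems ab in auto)
      have IH2: "norm (W (min (s i) (s' b)) - W' (min (s i) (s' b))) \<le> bnd (min (s i) (s' b))"
        by (rule less.IH[of "i + b"]) (use less.prems ab in auto)
      have ar: "a < r" "b < r'" using less.prems ab by auto
      have sl: "s a \<le> s i" "s' b \<le> s' j" using incr_mono[OF s(1), of a i] incr_mono[OF s'(1), of b j] ab less.prems by auto
      consider "s a \<ge> s' j" | "s' b \<ge> s i" | "s a < s' j" "s' b < s i" by linarith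
      then show ?thesis
      proof cases
        case 1
        then have "min (s a) (s' j) = min (s i) (s' j)" using sl by simp
        then show ?thesis using IH1 by simp
      next
        case 2
        then have "min (s i) (s' b) = min (s i) (s' j)" using sl by simp
        then show ?thesis using IH2 by simp
      next
        case 3
        define u where "u = min (s i) (s' j)"
        define v where "v = max (s a) (s' b)"
        have vu: "v \<le> u" "s a \<le> v" "s' b \<le> v" "u \<le> s (Suc a)" "u \<le> s' (Suc b)" using 3 sl ab by (auto simp: u_def v_def)
        have D: "norm (W v - W' v) \<le> bnd v"
        proof (cases "s a \<ge> s' b")
          case True
          then have "v = min (s a) (s' j)" using 3 by (simp add: v_def)
          then show ?thesis using IH1 by simp
        next
          case False
          then have "v = min (s i) (s' b)" using 3 by (simp add: v_def)
          then show ?thesis using IH2 by simp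
        qed
        have uv01: "u \<in> {0..1}" "v \<in> {0..1}" using sin[of i] sin[of a] sin'[of j] sin'[of b] less.prems ab by (auto simp: u_def v_def)
        define \<delta> where "\<delta> = G u - G v"
        have d0: "\<delta> \<ge> 0" using Gm[OF vu(1)] uv01 by (simp add: \<delta>_def)
        have Wu: "W u = W v ** rot (Z a) \<delta>" "\<delta> > 0 \<longrightarrow> Z a ** Z a = - mat 1 \<and> norm (Z a) \<le> B"
          using step[OF s(1) sin Zo ar(1) vu(2,1,4)] by (auto simp: W_def \<delta>_def)
        have Wu': "W' u = W' v ** rot (Z' b) \<delta>" "\<delta> > 0 \<longrightarrow> Z' b ** Z' b = - mat 1 \<and> norm (Z' b) \<le> B"
          using step[OF s'(1) sin' Zo' ar(2) vu(3,1,5)] by (auto simp: W'_def \<delta>_def)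
        have "norm (W u - W' u) \<le> bnd u"
        proof (cases "\<delta> = 0")
          case True
          then have "G u = G v" by (simp add: \<delta>_def)
          then show ?thesis using D True Wu(1) Wu'(1) by (simp add: rot_0 bnd_def)
        next
          case False
          then have dp: "\<delta> > 0" using d0 by simp
          have Za: "norm (Z a) \<le> B" using Wu(2) dp by simp
          have G1: "G (s a) \<le> G v" "G u \<le> G (s (Suc a))" "G (s' b) \<le> G v" "G u \<le> G (s' (Suc b))"
            using Gm vu uv01 sin[of a] sin[of "Suc a"] sin'[of b] sin'[of "Suc b"] ar by auto
          then have cl: "norm (Z a - Z' b) \<le> \<omega>" using dp 3 ab vu ar by (intro close) (auto simp: \<delta>_def)
          have rr: "rot (Z a) \<delta> - rot (Z' b) \<delta> = sin \<delta> *\<^sub>R (Z a - Z' b)" by (simp add: rot_def algebra_simps)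
          have "W u - W' u = (W v - W' v) ** rot (Z a) \<delta> + W' v ** (rot (Z a) \<delta> - rot (Z' b) \<delta>)"
            unfolding Wu(1) Wu'(1) by (simp add: mmult_distrib)
          also have "(W v - W' v) ** rot (Z a) \<delta> = (W v - W' v) + (W v - W' v) ** (rot (Z a) \<delta> - mat 1)"
            by (simp add: mmult_distrib)
          finally have "norm (W u - W' u) \<le> norm (W v - W' v) + norm ((W v - W' v) ** (rot (Z a) \<delta> - mat 1)) + norm (W' v ** (rot (Z a) \<delta> - rot (Z' b) \<delta>))"
            by (metis (no_types, lifting) norm_triangle_ineq norm_triangle_mono order_refl)
          also have "norm ((W v - W' v) ** (rot (Z a) \<delta> - mat 1)) \<le> norm (W v - W' v) * (exp ((2 + B) * \<delta>) - 1)"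
            using rot_bound[OF Za d0] by (intro order_trans[OF norm_matrix_mult] mult_left_mono) auto
          also have "norm (W' v ** (rot (Z a) \<delta> - rot (Z' b) \<delta>)) \<le> L * (\<delta> * \<omega>)"
          proof -
            have "norm (rot (Z a) \<delta> - rot (Z' b) \<delta>) \<le> \<delta> * \<omega>"
              unfolding rr using abs_sin_x_le_abs_x[of \<delta>] d0 cl by (simp add: mult_mono)
            then show ?thesis using Wb[OF uv01(2)] L0 by (intro order_trans[OF norm_matrix_mult] mult_mono) auto
          qed
          finally have "norm (W u - W' u) \<le> norm (W v - W' v) * exp ((2 + B) * \<delta>) + L * (\<delta> * \<omega>)" by (simp add: algebra_simps)
          also have "\<dots> \<le> bnd v * exp ((2 + B) * \<delta>) + L * \<omega> * \<delta> * exp ((2 + B) * G u)"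
          proof (rule add_mono)
            show "norm (W v - W' v) * exp ((2 + B) * \<delta>) \<le> bnd v * exp ((2 + B) * \<delta>)" using D by simp
            have "G u \<ge> 0" using Gm[of 0 u] uv01 G by simp
            then have "1 \<le> exp ((2 + B) * G u)" using B by simp
            then have "(L * \<omega> * \<delta>) * 1 \<le> (L * \<omega> * \<delta>) * exp ((2 + B) * G u)" using L0 w d0 by (intro mult_left_mono) auto
            then show "L * (\<delta> * \<omega>) \<le> L * \<omega> * \<delta> * exp ((2 + B) * G u)" by (simp add: mult_ac)
          qed
          also have "\<dots> = bnd u"
          proof -
            have "exp ((2 + B) * G v) * exp ((2 + B) * \<delta>) = exp ((2 + B) * G u)" by (simp add: \<delta>_def algebra_simps flip: exp_add)
            then have "bnd v * exp ((2 + B) * \<delta>) = L * \<omega> * G v * exp ((2 + B) * G u)" by (simp add: bnd_def mult.assoc)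
            then show ?thesis by (simp add: bnd_def \<delta>_def algebra_simps)
          qed
          finally show ?thesis .
        qed
        then show ?thesis by (simp add: u_def)
      qed
    qed (use base in auto)
  qed
  have "norm (W 1 - W' 1) \<le> bnd 1" using main[of r r' "r + r'"] s s' by simp
  then show ?thesis using cutprod_end[OF s(1), of G Z] cutprod_end[OF s'(1), of G Z'] s s'
    by (simp add: W_def W'_def bnd_def L_def)
qed

section \<open>The bending cocycle\<close>

lemma cmult_nth: "cmult c A $ i $ j = c * A $ i $ j"
  by (simp add: cmult_def map_matrix_def)

lemma cmat_nth: "cmat A $ i $ j = of_real (A $ i $ j)"
  by (simp add: cmat_def map_matrix_def)

lemma cmat_mult: "cmat (A ** B) = cmat A ** cmat B"
  by (simp add: vec_eq_iff cmat_nth matrix_matrix_mult_def)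

text \<open>The element \<open>\<i> X\<close> of \<open>sl(2, \<complex>)\<close> for the element \<open>X\<close> of \<open>sl(2, \<real>)\<close> that corresponds to \<open>v\<close>.\<close>

definition Phi :: "real^3 \<Rightarrow> complex^2^2" where
  "Phi v = cmult \<i> (cmat (vec_sl2 v))"

lemma bounded_linear_Phi: "bounded_linear Phi"
proof -
  have "linear Phi"
    by (rule linearI) (simp_all add: Phi_def vec_eq_iff cmult_nth cmat_nth linear_add[OF linear_vec_sl2] linear_scale[OF linear_vec_sl2] algebra_simps scaleR_conv_of_real[where 'a=complex])
  then show ?thesis by (simp add: linear_conv_bounded_linear)
qed

lemma Phi_square:
  assumes "lform v v = 1" shows "Phi v ** Phi v = - mat 1"
proof -
  have "cmat (vec_sl2 v) ** cmat (vec_sl2 v) = cmat (vec_sl2 v ** vec_sl2 v)" by (simp only: cmat_mult)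
  also have "\<dots> = mat 1" by (simp add: vec_sl2_square assms vec_eq_iff cmat_nth mat_def)
  finally have "cmat (vec_sl2 v) ** cmat (vec_sl2 v) = mat 1" .
  moreover have "Phi v ** Phi v = - (cmat (vec_sl2 v) ** cmat (vec_sl2 v))"
    by (simp add: vec_eq_iff forall_2 Phi_def cmult_nth matrix_matrix_mult_def sum_2 algebra_simps)
  ultimately show ?thesis by simp
qed

lemma det_rot_Phi:
  assumes "lform v v = 1" shows "det (rot (Phi v) \<theta>) = 1"
proof -
  define X where "X = vec_sl2 v"
  have X: "X $ 2 $ 2 = - X $ 1 $ 1" "X $ 1 $ 1 * X $ 1 $ 1 + X $ 1 $ 2 * X $ 2 $ 1 = 1"
    using assms by (simp_all add: X_def vec_sl2_def lform_def algebra_simps)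
  have "det (rot (Phi v) \<theta>) = (of_real (cos \<theta>))\<^sup>2 + (of_real (sin \<theta>))\<^sup>2 * of_real (X $ 1 $ 1 * X $ 1 $ 1 + X $ 1 $ 2 * X $ 2 $ 1)"
    by (simp add: det_2 rot_def Phi_def cmult_nth cmat_nth mat_def scaleR_conv_of_real[where 'a=complex] power2_eq_square X(1) algebra_simps flip: X_def)
  also have "\<dots> = of_real ((cos \<theta>)\<^sup>2 + (sin \<theta>)\<^sup>2)" unfolding X(2) of_real_add of_real_power of_real_1 mult_1_right ..
  finally show ?thesis by (simp only: sin_cos_squared_add2 of_real_1)
qed

lemma det_ordprod:
  assumes "\<And>j. j < r \<Longrightarrow> det (f j) = 1" shows "det (ordprod f r) = 1"
  using assms by (induction r) (simp_all add: det_mul)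

text \<open>\<open>(1 + X) / 2\<close> and \<open>(1 - X) / 2\<close> are complementary projections, on which \<open>X\<close> acts by \<open>1\<close> and \<open>- 1\<close>.\<close>

lemma mexp_involution_complex:
  fixes X :: "complex^2^2"
  assumes X: "X ** X = mat 1"
  shows "mexp (cmult z X) = cmult ((exp z + exp (- z)) / 2) (mat 1) + cmult ((exp z - exp (- z)) / 2) X"
proof -
  let ?P = "cmult (1/2) (mat 1 + X)" and ?Q = "cmult (1/2) (mat 1 - X)"
  have pw: "(((**) (cmult z X)) ^^ n) (mat 1) = cmult (z ^ n) ?P + cmult ((- z) ^ n) ?Q" for n
  proof (induction n)
    case 0 show ?case by (simp add: vec_eq_iff cmult_nth field_simps)
  next
    case (Suc n)
    have "cmult z X ** (cmult a ?P + cmult b ?Q) =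
        cmult (z * (a - b) / 2) (X ** X) + cmult (z * (a + b) / 2) X" for a b
      by (simp add: vec_eq_iff forall_2 cmult_nth matrix_matrix_mult_def sum_2 mat_def field_simps)
    then have "cmult z X ** (cmult a ?P + cmult b ?Q) = cmult (z * a) ?P + cmult (- z * b) ?Q" for a b
      by (simp add: X) (simp add: vec_eq_iff cmult_nth field_simps)
    then show ?case using Suc by simp
  qed
  have bl: "bounded_linear (\<lambda>c. cmult c A)" for A
  proof -
    have "linear (\<lambda>c. cmult c A)"
      by (rule linearI) (simp_all add: vec_eq_iff cmult_nth distrib_right)
    then show ?thesis by (simp add: linear_conv_bounded_linear)
  qed
  have "(\<lambda>n. cmult (z ^ n /\<^sub>R fact n) ?P + cmult ((- z) ^ n /\<^sub>R fact n) ?Q) sums (cmult (exp z) ?P + cmult (exp (- z)) ?Q)"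
    by (intro sums_add bounded_linear.sums[OF bl] exp_converges)
  moreover have "(\<lambda>n. cmult (z ^ n /\<^sub>R fact n) ?P + cmult ((- z) ^ n /\<^sub>R fact n) ?Q) =
      (\<lambda>n. (((**) (cmult z X)) ^^ n) (mat 1) /\<^sub>R fact n)"
    unfolding pw by (simp add: fun_eq_iff vec_eq_iff cmult_nth scaleR_conv_of_real[where 'a=complex] algebra_simps)
  ultimately have "mexp (cmult z X) = cmult (exp z) ?P + cmult (exp (- z)) ?Q"
    unfolding mexp_def by (simp add: sums_iff)
  also have "\<dots> = cmult ((exp z + exp (- z)) / 2) (mat 1) + cmult ((exp z - exp (- z)) / 2) X"
    by (simp add: vec_eq_iff cmult_nth field_simps)
  finally show ?thesis .
qed

lemma mexp_rot:
  assumes v: "lform v v = 1"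
  shows "mexp (cmult (\<i> * of_real m / 2) (cmat (vec_sl2 v))) = rot (Phi v) (m / 2)"
proof -
  have sq: "cmat (vec_sl2 v) ** cmat (vec_sl2 v) = mat 1"
  proof -
    have "cmat (vec_sl2 v) ** cmat (vec_sl2 v) = cmat (vec_sl2 v ** vec_sl2 v)" by (simp only: cmat_mult)
    also have "\<dots> = mat 1" by (simp add: vec_sl2_square v vec_eq_iff cmat_nth mat_def)
    finally show ?thesis .
  qed
  define \<theta> where "\<theta> = m / 2"
  have z: "\<i> * of_real m / 2 = \<i> * of_real \<theta>" by (simp add: \<theta>_def)
  have e: "(exp (\<i> * of_real \<theta>) + exp (- (\<i> * of_real \<theta>))) / 2 = of_real (cos \<theta>)"
    "(exp (\<i> * of_real \<theta>) - exp (- (\<i> * of_real \<theta>))) / 2 = \<i> * of_real (sin \<theta>)"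
  proof -
    have "exp (\<i> * of_real \<theta>) = cis \<theta>" "exp (- (\<i> * of_real \<theta>)) = cis (- \<theta>)"
      by (simp_all add: cis_conv_exp)
    then show "(exp (\<i> * of_real \<theta>) + exp (- (\<i> * of_real \<theta>))) / 2 = of_real (cos \<theta>)"
      "(exp (\<i> * of_real \<theta>) - exp (- (\<i> * of_real \<theta>))) / 2 = \<i> * of_real (sin \<theta>)"
      by (simp_all add: complex_eq_iff)
  qed
  show ?thesis unfolding z mexp_involution_complex[OF sq] e
    by (simp add: rot_def Phi_def vec_eq_iff cmult_nth scaleR_conv_of_real[where 'a=complex] mat_def flip: \<theta>_def)
qed

lemma mexp_cmult_0: "mexp (cmult 0 X) = mat 1"
proof -
  have "(((**) (cmult 0 X)) ^^ n) (mat 1) = (if n = 0 then mat 1 else 0)" for n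
  proof (induction n)
    case (Suc n)
    have "cmult 0 X ** A = 0" for A by (simp add: vec_eq_iff cmult_nth matrix_matrix_mult_def)
    then show ?case by simp
  qed simp
  then have "mexp (cmult 0 X) = (\<Sum>n. if n = 0 then mat 1 else 0)" unfolding mexp_def by (intro suminf_cong) simp
  also have "\<dots> = mat 1" using suminf_finite[of "{0}" "\<lambda>n. if n = 0 then mat 1 else 0"] by simp
  finally show ?thesis .
qed

lemma measure_scale_measure:
  "0 \<le> t \<Longrightarrow> measure (scale_measure (ennreal t) M) A = t * measure M A"
  by (simp add: measure_def emeasure_scale_measure enn2real_mult)

lemma scale_lam_simps: "leaves (scale_lam t lam) = leaves lam"
  "tmeas (scale_lam t lam) k = scale_measure (ennreal t) (tmeas lam k)"
  by (simp_all add: scale_lam_def)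

lemma measure_null_measure': "measure (null_measure M) A = 0"
  by (simp add: measure_def)

lemma seg_mass_scale:
  assumes "0 \<le> t" shows "seg_mass (scale_lam t lam) x y c = t * seg_mass lam x y c"
proof -
  have "measure (seg_measure (scale_lam t lam) x y) A = t * measure (seg_measure lam x y) A" for A
    using measure_scale_measure[OF assms, of "tmeas lam (path_image (hseg x y))" A]
    unfolding seg_measure_def scale_lam_simps by (simp add: measure_null_measure')
  then show ?thesis by (simp add: seg_mass_def algebra_simps)
qed

lemma weighted_part_scale:
  assumes "0 < t" shows "weighted_part (scale_lam t lam) = weighted_part lam"
  using assms by (simp add: weighted_part_def scale_lam_simps ennreal_zero_less_mult_iff)

lemma mesh_filter_scale:
  assumes t: "0 < t" shows "mesh_filter (scale_lam t lam) x y = mesh_filter lam x y"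
proof -
  have "is_subdiv (scale_lam t lam) x y = is_subdiv lam x y"
    using t by (simp add: is_subdiv_def weighted_part_scale scale_lam_simps seg_mass_scale fun_eq_iff zero_less_mult_iff)
  then show ?thesis by (simp add: mesh_filter_def)
qed

context meas_lam
begin

lemma mesh_filter_scale_nontrivial:
  assumes x: "x \<in> hyp2 - weighted_part lam" and y: "y \<in> hyp2 - weighted_part lam" and t: "0 \<le> t"
  shows "mesh_filter (scale_lam t lam) x y \<noteq> bot"
proof (cases "t = 0")
  case False
  then show ?thesis using mesh_filter_nontrivial[OF x y] mesh_filter_scale[of t] t by simp
next
  case True
  have "is_subdiv (scale_lam t lam) x y \<sigma>" if "is_subdiv lam x y \<sigma>" for \<sigma>
    using that by (auto simp: is_subdiv_def True weighted_part_def scale_lam_simps seg_mass_scale)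
  then have "mesh_filter lam x y \<le> mesh_filter (scale_lam t lam) x y"
    unfolding mesh_filter_def by (intro INF_mono) (auto intro: bexI[rotated])
  then show ?thesis using mesh_filter_nontrivial[OF x y] bot.extremum_uniqueI by metis
qed

text \<open>For \<open>t = 0\<close> the lamination \<open>t\<lambda>\<close> has no weighted part and its filter of subdivisions differs from that of
  \<open>\<lambda>\<close>; this case and that of a segment inside a leaf are treated separately.\<close>

lemma bend_prod_trivial:
  assumes "t = 0 \<or> \<not> tseg x y" and t: "t \<ge> 0"
  shows "bend_prod (scale_lam t lam) x y \<sigma> = mat 1"
proof -
  obtain r s l where \<sigma>: "\<sigma> = (r, s, l)" by (metis prod_cases3)
  have "seg_mass (scale_lam t lam) x y c = 0" for c
  proof (cases "t = 0")
    case True then show ?thesis using seg_mass_scale[of 0] by simp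
  next
    case False
    then have "seg_mass lam x y c = 0" using assms by (simp add: seg_mass_def segm_n measure_def)
    then show ?thesis by (simp add: seg_mass_scale[OF t])
  qed
  then have "bend_prod (scale_lam t lam) x y \<sigma> = ordprod (\<lambda>j. mat 1) r"
    by (simp add: \<sigma> bend_prod_def mexp_cmult_0)
  also have "\<dots> = mat 1" by (induction r) auto
  finally show ?thesis .
qed

text \<open>On each cell the normal of the chosen leaf differs from the normals of the leaves through the points of
  the cell by at most \<open>C * \<eta>\<close>.\<close>

lemma riemann_sum:
  assumes x: "x \<in> hyp2 - weighted_part lam" and y: "y \<in> hyp2 - weighted_part lam" and t: "tseg x y"
    and C: "\<And>n m. n \<in> seps \<L> x y \<Longrightarrow> m \<in> seps \<L> x y \<Longrightarrow> norm (n - m) \<le> C * \<bar>cpar x y n - cpar x y m\<bar>" "C > 0"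
    and sub: "is_subdiv lam x y (r, s, l)" and fine: "\<And>j. j < r \<Longrightarrow> s (Suc j) - s j \<le> \<eta>"
  shows "norm ((\<Sum>j<r. (cmass x y (s (Suc j)) - cmass x y (s j)) *\<^sub>R rnormal (l j)) - transl x y) \<le> C * \<eta> * cmass x y 1"
proof -
  have xy: "x \<in> hyp2" "y \<in> hyp2" using x y by auto
  have np: "no_common_leaf \<L> x y" using t transverse_hseg_iff[OF xy] by simp
  have ne: "x \<noteq> y" using t transverse_hseg_iff[OF xy] by simp
  note D = subdivD[OF x y sub]
  let ?d = "dirvec lam x y"
  let ?M = "segm x y"
  interpret finite_measure ?M by (rule finite_segm)
  define R where "R = 2 * (x$3 + y$3)"
  have int: "integrable ?M (\<lambda>r. indicator A r *\<^sub>R ?d r)" if "A \<in> sets ?M" for A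
    using integrable_mult_indicator[OF that dirvec_integrable[OF xy t]] .
  define I where "I u = (\<integral>r. indicator (hseg x y ` {0..u}) r *\<^sub>R ?d r \<partial>?M)" for u
  have "I 0 = 0"
  proof -
    have "x \<in> path_image (hseg x y)" using hseg_0[OF xy(1), of y] by (auto simp: path_image_def intro: image_eqI[of _ _ 0])
    then have n: "{x} \<in> null_sets ?M" using unweighted_point[OF xy t] x by auto
    have "AE r in ?M. indicator (hseg x y ` {0..0}) r *\<^sub>R ?d r = 0"
      using AE_not_in[OF n] by (rule eventually_mono) (simp add: hseg_0[OF xy(1)])
    then show ?thesis unfolding I_def by (rule integral_eq_zero_AE)
  qed
  have "I 1 = transl x y" unfolding I_def transl_def
    by (rule Bochner_Integration.integral_cong) (auto simp: space_segm[OF t] path_image_def)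
  have step: "norm ((cmass x y (s (Suc j)) - cmass x y (s j)) *\<^sub>R rnormal (l j) - (I (s (Suc j)) - I (s j)))
      \<le> C * \<eta> * (cmass x y (s (Suc j)) - cmass x y (s j))" if j: "j < r" for j
  proof -
    define E where "E = hseg x y ` {s j<..s (Suc j)}"
    define m where "m = cmass x y (s (Suc j)) - cmass x y (s j)"
    have d: "0 \<le> s j" "s j \<le> s (Suc j)" "s (Suc j) \<le> 1" using D(5)[of j] D(5)[of "Suc j"] D(4)[OF j] j by auto
    have uw: "hseg x y (s j) \<notin> weighted_part lam" using D(6) j by simp
    note cs = cell_split[OF xy t d uw, folded E_def m_def]
    have c0: "hseg x y ` {0..s j} \<in> sets ?M" by (rule hseg_cell_sets[OF xy t]) (use d in auto)
    have "indicator (hseg x y ` {0..s (Suc j)}) r *\<^sub>R ?d r = indicator (hseg x y ` {0..s j}) r *\<^sub>R ?d r + indicator E r *\<^sub>R ?d r" for r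
      using cs(5) unfolding cs(4) by (auto simp: indicator_def)
    then have "I (s (Suc j)) = I (s j) + (\<integral>r. indicator E r *\<^sub>R ?d r \<partial>?M)"
      unfolding I_def using int[OF c0] int[OF cs(1)] by simp
    then have e: "m *\<^sub>R rnormal (l j) - (I (s (Suc j)) - I (s j)) = m *\<^sub>R rnormal (l j) - (\<integral>r. indicator E r *\<^sub>R ?d r \<partial>?M)" by simp
    have m0: "m \<ge> 0" using cs(2) measure_nonneg[of ?M E] by simp
    have e0: "0 \<le> \<eta>" using fine[OF j] d by simp
    show ?thesis
    proof (cases "m > 0")
      case False
      then have "m = 0" using m0 by simp
      then have "E \<in> null_sets ?M" using cs(1,2) by (simp add: null_sets_def emeasure_eq_measure)
      then have "AE r in ?M. indicator E r *\<^sub>R ?d r = 0"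
        using AE_not_in[of E ?M] by (auto elim!: eventually_mono)
      then have "(\<integral>r. indicator E r *\<^sub>R ?d r \<partial>?M) = 0" by (rule integral_eq_zero_AE)
      then show ?thesis using e \<open>m = 0\<close> by (simp flip: m_def)
    next
      case True
      define n where "n = rnormal (l j)"
      have n: "n \<in> seps \<L> x y" "cpar x y n \<in> {s j..s (Suc j)}" using D(8)[OF j] True by (auto simp: n_def m_def)
      have i1: "integrable ?M (\<lambda>r. indicator E r *\<^sub>R n)" using cs(1) by (simp add: emeasure_eq_measure less_top[symmetric])
      have "(\<integral>r. indicator E r *\<^sub>R n \<partial>?M) = measure ?M E *\<^sub>R n"
        using cs(1) sets.sets_into_space[OF cs(1)]
        by (subst integral_scaleR_left) (simp_all add: emeasure_eq_measure less_top[symmetric] Int_absorb2)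
      then have "(\<integral>r. indicator E r *\<^sub>R n \<partial>?M) = m *\<^sub>R n" by (simp only: cs(2))
      then have "m *\<^sub>R n - (\<integral>r. indicator E r *\<^sub>R ?d r \<partial>?M) = (\<integral>r. indicator E r *\<^sub>R n - indicator E r *\<^sub>R ?d r \<partial>?M)"
        using i1 int[OF cs(1)] by simp
      also have "norm \<dots> \<le> (\<integral>r. norm (indicator E r *\<^sub>R n - indicator E r *\<^sub>R ?d r) \<partial>?M)" by (rule integral_norm_bound)
      also have "\<dots> \<le> (\<integral>r. indicator E r * (C * \<eta>) \<partial>?M)"
      proof (rule integral_mono_AE)
        show "integrable ?M (\<lambda>r. norm (indicator E r *\<^sub>R n - indicator E r *\<^sub>R ?d r))" using i1 int[OF cs(1)] by simp
        show "integrable ?M (\<lambda>r. indicator E r * (C * \<eta>))" using cs(1) by (simp add: emeasure_eq_measure less_top[symmetric])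
        show "AE r in ?M. norm (indicator E r *\<^sub>R n - indicator E r *\<^sub>R ?d r) \<le> indicator E r * (C * \<eta>)"
          using AE_space segm_AE
        proof eventually_elim
          case (elim r)
          show ?case
          proof (cases "r \<in> E")
            case True
            have rp: "r \<in> path_image (hseg x y)" using elim by (simp add: space_segm[OF t])
            note dr = dirvec_seg[OF xy t rp elim(2)]
            obtain u where u: "s j < u" "u \<le> s (Suc j)" "r = hseg x y u" using True by (auto simp: E_def)
            have "cpar x y (?d r) = u"
              using hseg_inj[OF xy ne, of "cpar x y (?d r)" u] cpar_01[OF np dr(1)] dr(3) u d by auto
            then have "\<bar>cpar x y n - cpar x y (?d r)\<bar> \<le> \<eta>" using n(2) u fine[OF j] by auto
            then have "C * \<bar>cpar x y n - cpar x y (?d r)\<bar> \<le> C * \<eta>" using C(2) by simp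
            then have "norm (n - ?d r) \<le> C * \<eta>" using C(1)[OF n(1) dr(1)] by linarith
            then show ?thesis using True by simp
          qed simp
        qed
      qed
      also have "\<dots> = C * \<eta> * m" using cs(1,2) sets.sets_into_space[OF cs(1)]
        by (subst Bochner_Integration.integral_mult_left) (simp_all add: emeasure_eq_measure less_top[symmetric] Int_absorb2)
      finally show ?thesis unfolding m_def[symmetric] e n_def .
    qed
  qed
  have tel: "(\<Sum>j<r. I (s (Suc j)) - I (s j)) = transl x y"
    using \<open>I 0 = 0\<close> \<open>I 1 = transl x y\<close> D(2,3) sum_lessThan_telescope[of "\<lambda>j. I (s j)" r] by simp
  have telc: "(\<Sum>j<r. cmass x y (s (Suc j)) - cmass x y (s j)) = cmass x y 1"
    using cmass_props(2)[OF x y] D(2,3) sum_lessThan_telescope[of "\<lambda>j. cmass x y (s j)" r] by simp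
  have "norm ((\<Sum>j<r. (cmass x y (s (Suc j)) - cmass x y (s j)) *\<^sub>R rnormal (l j)) - transl x y) =
      norm (\<Sum>j<r. (cmass x y (s (Suc j)) - cmass x y (s j)) *\<^sub>R rnormal (l j) - (I (s (Suc j)) - I (s j)))"
    by (simp add: sum_subtractf[of _ "\<lambda>j. I (s (Suc j)) - I (s j)"] tel)
  also have "\<dots> \<le> (\<Sum>j<r. C * \<eta> * (cmass x y (s (Suc j)) - cmass x y (s j)))"
    by (rule order_trans[OF norm_sum sum_mono]) (use step in simp)
  also have "\<dots> = C * \<eta> * cmass x y 1" by (simp add: telc flip: sum_distrib_left)
  finally show ?thesis .
qed

end

section \<open>First cohomology of a module\<close>

text \<open>The action is defined on the whole type, but only its restriction to \<open>V\<close> is required to be additive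
  and multiplicative.\<close>

locale gmodule = group G for G :: "'g monoid" (structure) +
  fixes a :: "'g \<Rightarrow> 'v \<Rightarrow> 'v::ab_group_add" and V :: "'v set"
  assumes zero_V: "0 \<in> V" and add_V: "u \<in> V \<Longrightarrow> v \<in> V \<Longrightarrow> u + v \<in> V" and uminus_V: "u \<in> V \<Longrightarrow> - u \<in> V"
    and act_V: "g \<in> carrier G \<Longrightarrow> u \<in> V \<Longrightarrow> a g u \<in> V"
    and act_add: "g \<in> carrier G \<Longrightarrow> u \<in> V \<Longrightarrow> v \<in> V \<Longrightarrow> a g (u + v) = a g u + a g v"
    and act_mult: "g \<in> carrier G \<Longrightarrow> h \<in> carrier G \<Longrightarrow> u \<in> V \<Longrightarrow> a (g \<otimes> h) u = a g (a h u)"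
begin

lemma act_0: "g \<in> carrier G \<Longrightarrow> a g 0 = 0"
  using act_add[of g 0 0] zero_V by simp

lemma act_uminus: "g \<in> carrier G \<Longrightarrow> u \<in> V \<Longrightarrow> a g (- u) = - a g u"
  using act_add[of g "- u" u] uminus_V act_0 by (simp add: eq_neg_iff_add_eq_0)

lemma diff_V: "u \<in> V \<Longrightarrow> v \<in> V \<Longrightarrow> u - v \<in> V"
  using add_V[of u "- v"] uminus_V by simp

lemma act_diff: "g \<in> carrier G \<Longrightarrow> u \<in> V \<Longrightarrow> v \<in> V \<Longrightarrow> a g (u - v) = a g u - a g v"
  using act_add[of g u "- v"] uminus_V act_uminus by simp

lemma Z1_carrier: "c \<in> carrier (Z1 G a V) \<longleftrightarrow> c \<in> carrier G \<rightarrow>\<^sub>E V \<and>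
    (\<forall>g\<in>carrier G. \<forall>h\<in>carrier G. c (g \<otimes> h) = c g + a g (c h))"
  by (simp add: Z1_def)

lemma Z1_mult: "c \<otimes>\<^bsub>Z1 G a V\<^esub> d = (\<lambda>g\<in>carrier G. c g + d g)"
  by (simp add: Z1_def)

lemma Z1_V: "c \<in> carrier (Z1 G a V) \<Longrightarrow> g \<in> carrier G \<Longrightarrow> c g \<in> V"
  by (auto simp: Z1_carrier PiE_iff)

lemma Z1_add:
  assumes "c \<in> carrier (Z1 G a V)" "d \<in> carrier (Z1 G a V)"
  shows "(\<lambda>g\<in>carrier G. c g + d g) \<in> carrier (Z1 G a V)"
  using assms Z1_V[OF assms(1)] Z1_V[OF assms(2)]
  by (auto simp: Z1_carrier add_V act_add add_ac)

lemma Z1_comm_group: "comm_group (Z1 G a V)"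
proof (rule comm_groupI)
  show "x \<otimes>\<^bsub>Z1 G a V\<^esub> y \<in> carrier (Z1 G a V)" if "x \<in> carrier (Z1 G a V)" "y \<in> carrier (Z1 G a V)" for x y
    using Z1_add[OF that] by (simp add: Z1_mult)
  show "\<one>\<^bsub>Z1 G a V\<^esub> \<in> carrier (Z1 G a V)"
    using zero_V act_0 by (auto simp: Z1_def)
  show "x \<otimes>\<^bsub>Z1 G a V\<^esub> y \<otimes>\<^bsub>Z1 G a V\<^esub> z = x \<otimes>\<^bsub>Z1 G a V\<^esub> (y \<otimes>\<^bsub>Z1 G a V\<^esub> z)" for x y z
    by (auto simp: Z1_mult add.assoc)
  show "x \<otimes>\<^bsub>Z1 G a V\<^esub> y = y \<otimes>\<^bsub>Z1 G a V\<^esub> x" for x y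
    by (auto simp: Z1_mult add.commute)
  show "\<one>\<^bsub>Z1 G a V\<^esub> \<otimes>\<^bsub>Z1 G a V\<^esub> x = x" if x: "x \<in> carrier (Z1 G a V)" for x
  proof -
    have "x \<in> extensional (carrier G)" using x by (auto simp: Z1_carrier PiE_def)
    then have "(\<lambda>g\<in>carrier G. x g) = x" by (rule extensional_restrict)
    moreover have "\<one>\<^bsub>Z1 G a V\<^esub> \<otimes>\<^bsub>Z1 G a V\<^esub> x = (\<lambda>g\<in>carrier G. x g)" by (auto simp: Z1_def)
    ultimately show ?thesis by simp
  qed
  show "\<exists>y\<in>carrier (Z1 G a V). y \<otimes>\<^bsub>Z1 G a V\<^esub> x = \<one>\<^bsub>Z1 G a V\<^esub>" if x: "x \<in> carrier (Z1 G a V)" for x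
  proof
    show "(\<lambda>g\<in>carrier G. - x g) \<in> carrier (Z1 G a V)"
      using x Z1_V[OF x] by (auto simp: Z1_carrier uminus_V act_uminus)
    show "(\<lambda>g\<in>carrier G. - x g) \<otimes>\<^bsub>Z1 G a V\<^esub> x = \<one>\<^bsub>Z1 G a V\<^esub>" by (auto simp: Z1_def)
  qed
qed

lemma B1_subgroup: "subgroup (B1 G a V) (Z1 G a V)"
proof -
  interpret Z: comm_group "Z1 G a V" by (rule Z1_comm_group)
  have mem: "(\<lambda>g\<in>carrier G. a g v - v) \<in> carrier (Z1 G a V)" if "v \<in> V" for v
    using that by (auto simp: Z1_carrier diff_V act_V act_mult act_diff)
  show ?thesis
  proof (rule Z.subgroupI)
    show "B1 G a V \<subseteq> carrier (Z1 G a V)" using mem by (auto simp: B1_def)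
    show "B1 G a V \<noteq> {}" using zero_V by (auto simp: B1_def)
    fix x assume "x \<in> B1 G a V"
    then obtain v where v: "v \<in> V" "x = (\<lambda>g\<in>carrier G. a g v - v)" by (auto simp: B1_def)
    have m: "(\<lambda>g\<in>carrier G. a g (- v) - (- v)) \<in> B1 G a V" unfolding B1_def by (rule imageI[OF uminus_V[OF v(1)]])
    have "(\<lambda>g\<in>carrier G. a g (- v) - (- v)) \<otimes>\<^bsub>Z1 G a V\<^esub> x = \<one>\<^bsub>Z1 G a V\<^esub>"
      using v act_uminus by (auto simp: Z1_def)
    then have "inv\<^bsub>Z1 G a V\<^esub> x = (\<lambda>g\<in>carrier G. a g (- v) - (- v))"
      using Z.inv_equality[OF _ _ mem[OF uminus_V[OF v(1)]]] mem[OF v(1)] v(2) by auto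
    then show "inv\<^bsub>Z1 G a V\<^esub> x \<in> B1 G a V" using m by simp
  next
    fix x y assume "x \<in> B1 G a V" "y \<in> B1 G a V"
    then obtain v w where vw: "v \<in> V" "x = (\<lambda>g\<in>carrier G. a g v - v)" "w \<in> V" "y = (\<lambda>g\<in>carrier G. a g w - w)"
      by (auto simp: B1_def)
    have "x \<otimes>\<^bsub>Z1 G a V\<^esub> y = (\<lambda>g\<in>carrier G. a g (v + w) - (v + w))"
      using vw act_add by (auto simp: Z1_mult)
    then show "x \<otimes>\<^bsub>Z1 G a V\<^esub> y \<in> B1 G a V" unfolding B1_def using add_V[OF vw(1,3)] by (intro image_eqI)
  qed
qed

lemma B1_normal: "B1 G a V \<lhd> Z1 G a V"
proof -
  interpret Z: comm_group "Z1 G a V" by (rule Z1_comm_group)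
  show ?thesis by (rule Z.subgroup_imp_normal[OF B1_subgroup])
qed

lemma H1_carrier: "carrier (H1 G a V) = H1_class G a V ` carrier (Z1 G a V)"
  by (simp add: H1_def carrier_FactGroup H1_class_def[abs_def])

lemma H1_mult:
  assumes "c \<in> carrier (Z1 G a V)" "d \<in> carrier (Z1 G a V)"
  shows "H1_class G a V c \<otimes>\<^bsub>H1 G a V\<^esub> H1_class G a V d = H1_class G a V (\<lambda>g\<in>carrier G. c g + d g)"
  using normal.rcos_sum[OF B1_normal assms] by (simp add: H1_def H1_class_def Z1_mult)

lemma H1_class_mem:
  assumes c: "c \<in> carrier (Z1 G a V)"
  shows "d \<in> H1_class G a V c \<longleftrightarrow> d \<in> carrier (Z1 G a V) \<and> (\<exists>v\<in>V. \<forall>g\<in>carrier G. d g = a g v - v + c g)"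
proof
  interpret Z: comm_group "Z1 G a V" by (rule Z1_comm_group)
  assume "d \<in> H1_class G a V c"
  then obtain b where b: "b \<in> B1 G a V" "d = b \<otimes>\<^bsub>Z1 G a V\<^esub> c" by (auto simp: H1_class_def r_coset_def)
  then have "d \<in> carrier (Z1 G a V)" using subgroup.mem_carrier[OF B1_subgroup] c by simp
  moreover have "\<exists>v\<in>V. \<forall>g\<in>carrier G. d g = a g v - v + c g" using b by (auto simp: B1_def Z1_mult)
  ultimately show "d \<in> carrier (Z1 G a V) \<and> (\<exists>v\<in>V. \<forall>g\<in>carrier G. d g = a g v - v + c g)" by simp
next
  assume d: "d \<in> carrier (Z1 G a V) \<and> (\<exists>v\<in>V. \<forall>g\<in>carrier G. d g = a g v - v + c g)"
  then obtain v where v: "v \<in> V" "\<forall>g\<in>carrier G. d g = a g v - v + c g" by blast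
  have "d \<in> extensional (carrier G)" using d by (auto simp: Z1_carrier PiE_def)
  then have "d = (\<lambda>g\<in>carrier G. a g v - v) \<otimes>\<^bsub>Z1 G a V\<^esub> c"
    using v(2) by (auto simp: Z1_mult extensional_def)
  then show "d \<in> H1_class G a V c" using v(1) by (auto simp: H1_class_def r_coset_def B1_def)
qed

lemma H1_class_eq_iff:
  assumes c: "c \<in> carrier (Z1 G a V)" and d: "d \<in> carrier (Z1 G a V)"
  shows "H1_class G a V c = H1_class G a V d \<longleftrightarrow> (\<exists>v\<in>V. \<forall>g\<in>carrier G. c g = a g v - v + d g)"
proof
  assume e: "H1_class G a V c = H1_class G a V d"
  have "c \<in> H1_class G a V c" using c zero_V act_0 by (auto simp: H1_class_mem intro!: bexI[of _ 0])
  then show "\<exists>v\<in>V. \<forall>g\<in>carrier G. c g = a g v - v + d g" unfolding e H1_class_mem[OF d] by blast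
next
  interpret Z: comm_group "Z1 G a V" by (rule Z1_comm_group)
  assume "\<exists>v\<in>V. \<forall>g\<in>carrier G. c g = a g v - v + d g"
  then have "c \<in> H1_class G a V d" using c H1_class_mem[OF d] by blast
  then show "H1_class G a V c = H1_class G a V d"
    unfolding H1_class_def using Z.repr_independence[OF _ d B1_subgroup] by simp
qed

end

text \<open>Composition with an equivariant map sends cocycles that differ by the coboundary of \<open>v\<close> to cocycles
  that differ by the coboundary of \<open>f v\<close>; so the union in the definition of \<open>H1_map\<close> is over equal sets.\<close>

lemma H1_map_class:
  assumes "gmodule G a V" "gmodule G b W"
    and f: "\<And>v. v \<in> V \<Longrightarrow> f v \<in> W" "\<And>u v. u \<in> V \<Longrightarrow> v \<in> V \<Longrightarrow> f (u + v) = f u + f v"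
      "\<And>g v. g \<in> carrier G \<Longrightarrow> v \<in> V \<Longrightarrow> f (a g v) = b g (f v)"
    and c: "c \<in> carrier (Z1 G a V)"
  shows "(\<lambda>g\<in>carrier G. f (c g)) \<in> carrier (Z1 G b W)"
    "H1_map G b W f (H1_class G a V c) = H1_class G b W (\<lambda>g\<in>carrier G. f (c g))"
proof -
  interpret A: gmodule G a V by fact
  interpret B: gmodule G b W by fact
  have fZ: "(\<lambda>g\<in>carrier G. f (d g)) \<in> carrier (Z1 G b W)" if d: "d \<in> carrier (Z1 G a V)" for d
    using d A.Z1_V[OF d] f A.act_V by (auto simp: A.Z1_carrier B.Z1_carrier)
  show "(\<lambda>g\<in>carrier G. f (c g)) \<in> carrier (Z1 G b W)" by (rule fZ[OF c])
  have fd: "f (u - v) = f u - f v" if "u \<in> V" "v \<in> V" for u v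
    using f(2)[OF A.diff_V[OF that] that(2)] by simp
  have "H1_class G b W (\<lambda>g\<in>carrier G. f (d g)) = H1_class G b W (\<lambda>g\<in>carrier G. f (c g))"
    if d: "d \<in> H1_class G a V c" for d
  proof -
    obtain v where v: "d \<in> carrier (Z1 G a V)" "v \<in> V" "\<forall>g\<in>carrier G. d g = a g v - v + c g"
      using d A.H1_class_mem[OF c] by blast
    have "f (d g) = b g (f v) - f v + f (c g)" if g: "g \<in> carrier G" for g
    proof -
      have "f (d g) = f (a g v - v + c g)" using v(3) g by simp
      also have "\<dots> = f (a g v - v) + f (c g)"
        by (rule f(2)[OF A.diff_V[OF A.act_V[OF g v(2)] v(2)] A.Z1_V[OF c g]])
      also have "f (a g v - v) = b g (f v) - f v"
        unfolding fd[OF A.act_V[OF g v(2)] v(2)] f(3)[OF g v(2)] ..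
      finally show ?thesis .
    qed
    then show ?thesis unfolding B.H1_class_eq_iff[OF fZ[OF v(1)] fZ[OF c]]
      by (intro bexI[OF _ f(1)[OF v(2)]]) simp
  qed
  moreover have "c \<in> H1_class G a V c" using c A.zero_V A.act_0 by (auto simp: A.H1_class_mem intro!: bexI[of _ 0])
  ultimately show "H1_map G b W f (H1_class G a V c) = H1_class G b W (\<lambda>g\<in>carrier G. f (c g))"
    unfolding H1_map_def by (intro SUP_eq_const) (rule ex_in_conv[THEN iffD1], rule exI)
qed

text \<open>If the module \<open>W\<close> is the direct sum of the images of \<open>f\<close> and \<open>i\<close>, every cocycle and every coboundary has
  unique components, which are again cocycles and coboundaries.\<close>

lemma H1_complexification:
  fixes f i :: "'v::ab_group_add \<Rightarrow> 'w::ab_group_add" and G :: "'g monoid"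
  assumes A: "gmodule G a V" and B: "gmodule G b W"
    and f: "\<And>v. v \<in> V \<Longrightarrow> f v \<in> W" "\<And>u v. u \<in> V \<Longrightarrow> v \<in> V \<Longrightarrow> f (u + v) = f u + f v"
      "\<And>g v. g \<in> carrier G \<Longrightarrow> v \<in> V \<Longrightarrow> f (a g v) = b g (f v)"
    and i: "\<And>v. v \<in> V \<Longrightarrow> i v \<in> W" "\<And>u v. u \<in> V \<Longrightarrow> v \<in> V \<Longrightarrow> i (u + v) = i u + i v"
      "\<And>g v. g \<in> carrier G \<Longrightarrow> v \<in> V \<Longrightarrow> i (a g v) = b g (i v)"
    and surj: "\<And>w. w \<in> W \<Longrightarrow> \<exists>u\<in>V. \<exists>v\<in>V. w = f u + i v"
    and inj: "\<And>u v u' v'. u \<in> V \<Longrightarrow> v \<in> V \<Longrightarrow> u' \<in> V \<Longrightarrow> v' \<in> V \<Longrightarrow> f u + i v = f u' + i v' \<Longrightarrow> u = u' \<and> v = v'"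
  shows "(\<lambda>(h, k). H1_map G b W f h \<otimes>\<^bsub>H1 G b W\<^esub> H1_map G b W i k) \<in>
    iso (H1 G a V \<times>\<times> H1 G a V) (H1 G b W)"
proof -
  interpret A: gmodule G a V by fact
  interpret B: gmodule G b W by fact
  let ?cl = "H1_class G a V" and ?CL = "H1_class G b W"
  define cb where "cb c d = (\<lambda>g\<in>carrier G. f (c g) + i (d g))" for c d :: "'g \<Rightarrow> 'v"
  define \<Psi> where "\<Psi> = (\<lambda>(h, k). H1_map G b W f h \<otimes>\<^bsub>H1 G b W\<^esub> H1_map G b W i k)"
  have mf: "(\<lambda>g\<in>carrier G. f (c g)) \<in> carrier (Z1 G b W)"
      "H1_map G b W f (?cl c) = ?CL (\<lambda>g\<in>carrier G. f (c g))"
    and mi: "(\<lambda>g\<in>carrier G. i (c g)) \<in> carrier (Z1 G b W)"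
      "H1_map G b W i (?cl c) = ?CL (\<lambda>g\<in>carrier G. i (c g))" if c: "c \<in> carrier (Z1 G a V)" for c
    by (rule H1_map_class(1)[where f=f, OF A B f(1) f(2) f(3) c] H1_map_class(2)[where f=f, OF A B f(1) f(2) f(3) c]
      H1_map_class(1)[where f=i, OF A B i(1) i(2) i(3) c] H1_map_class(2)[where f=i, OF A B i(1) i(2) i(3) c]; assumption)+
  have eqr: "(\<lambda>g\<in>carrier G. (\<lambda>g\<in>carrier G. f (c g)) g + (\<lambda>g\<in>carrier G. i (d g)) g) = cb c d" for c d
    by (auto simp: cb_def)
  have cbZ: "cb c d \<in> carrier (Z1 G b W)" if "c \<in> carrier (Z1 G a V)" "d \<in> carrier (Z1 G a V)" for c d
    using B.Z1_add[OF mf(1)[OF that(1)] mi(1)[OF that(2)]] unfolding eqr .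
  have \<Psi>: "\<Psi> (?cl c, ?cl d) = ?CL (cb c d)" if cd: "c \<in> carrier (Z1 G a V)" "d \<in> carrier (Z1 G a V)" for c d
    using B.H1_mult[OF mf(1)[OF cd(1)] mi(1)[OF cd(2)]] unfolding eqr
    by (simp add: \<Psi>_def mf(2)[OF cd(1)] mi(2)[OF cd(2)])
  have carr: "carrier (H1 G a V \<times>\<times> H1 G a V) = carrier (H1 G a V) \<times> carrier (H1 G a V)" by (simp add: DirProd_def)
  have ex: "\<exists>c\<in>carrier (Z1 G a V). \<exists>d\<in>carrier (Z1 G a V). x = (?cl c, ?cl d)"
    if "x \<in> carrier (H1 G a V \<times>\<times> H1 G a V)" for x
    using that unfolding carr A.H1_carrier by blast
  have hom: "\<Psi> \<in> hom (H1 G a V \<times>\<times> H1 G a V) (H1 G b W)"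
  proof (rule homI)
    fix x assume "x \<in> carrier (H1 G a V \<times>\<times> H1 G a V)"
    then obtain c d where z: "c \<in> carrier (Z1 G a V)" "d \<in> carrier (Z1 G a V)" "x = (?cl c, ?cl d)"
      using ex by blast
    show "\<Psi> x \<in> carrier (H1 G b W)"
      unfolding z(3) \<Psi>[OF z(1,2)] B.H1_carrier by (rule imageI[OF cbZ[OF z(1,2)]])
  next
    fix x y assume "x \<in> carrier (H1 G a V \<times>\<times> H1 G a V)" "y \<in> carrier (H1 G a V \<times>\<times> H1 G a V)"
    then obtain c d c' d' where z: "c \<in> carrier (Z1 G a V)" "d \<in> carrier (Z1 G a V)" "x = (?cl c, ?cl d)"
       "c' \<in> carrier (Z1 G a V)" "d' \<in> carrier (Z1 G a V)" "y = (?cl c', ?cl d')"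
      using ex by meson
    have "x \<otimes>\<^bsub>H1 G a V \<times>\<times> H1 G a V\<^esub> y = (?cl (\<lambda>g\<in>carrier G. c g + c' g), ?cl (\<lambda>g\<in>carrier G. d g + d' g))"
      unfolding z(3,6) DirProd_def by (simp add: A.H1_mult[OF z(1,4)] A.H1_mult[OF z(2,5)])
    then have "\<Psi> (x \<otimes>\<^bsub>H1 G a V \<times>\<times> H1 G a V\<^esub> y) = ?CL (cb (\<lambda>g\<in>carrier G. c g + c' g) (\<lambda>g\<in>carrier G. d g + d' g))"
      using \<Psi>[OF A.Z1_add[OF z(1,4)] A.Z1_add[OF z(2,5)]] by simp
    also have "cb (\<lambda>g\<in>carrier G. c g + c' g) (\<lambda>g\<in>carrier G. d g + d' g) = (\<lambda>g\<in>carrier G. cb c d g + cb c' d' g)"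
    proof
      fix g
      show "cb (\<lambda>g\<in>carrier G. c g + c' g) (\<lambda>g\<in>carrier G. d g + d' g) g = (\<lambda>g\<in>carrier G. cb c d g + cb c' d' g) g"
        using f(2)[OF A.Z1_V[OF z(1)] A.Z1_V[OF z(4)], of g g] i(2)[OF A.Z1_V[OF z(2)] A.Z1_V[OF z(5)], of g g]
        by (auto simp: cb_def)
    qed
    also have "?CL \<dots> = \<Psi> x \<otimes>\<^bsub>H1 G b W\<^esub> \<Psi> y"
      unfolding z(3,6) \<Psi>[OF z(1,2)] \<Psi>[OF z(4,5)]
      by (rule B.H1_mult[OF cbZ[OF z(1,2)] cbZ[OF z(4,5)], symmetric])
    finally show "\<Psi> (x \<otimes>\<^bsub>H1 G a V \<times>\<times> H1 G a V\<^esub> y) = \<Psi> x \<otimes>\<^bsub>H1 G b W\<^esub> \<Psi> y" .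
  qed
  have "inj_on \<Psi> (carrier (H1 G a V \<times>\<times> H1 G a V))"
  proof (rule inj_onI)
    fix x y assume "x \<in> carrier (H1 G a V \<times>\<times> H1 G a V)" "y \<in> carrier (H1 G a V \<times>\<times> H1 G a V)" and e: "\<Psi> x = \<Psi> y"
    then obtain c d c' d' where z: "c \<in> carrier (Z1 G a V)" "d \<in> carrier (Z1 G a V)" "x = (?cl c, ?cl d)"
       "c' \<in> carrier (Z1 G a V)" "d' \<in> carrier (Z1 G a V)" "y = (?cl c', ?cl d')"
      using ex by meson
    have "?CL (cb c d) = ?CL (cb c' d')"
      using e unfolding z(3,6) \<Psi>[OF z(1,2)] \<Psi>[OF z(4,5)] .
    then obtain w where w: "w \<in> W" "\<forall>g\<in>carrier G. cb c d g = b g w - w + cb c' d' g"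
      using B.H1_class_eq_iff[OF cbZ[OF z(1,2)] cbZ[OF z(4,5)]] by blast
    obtain u v where uv: "u \<in> V" "v \<in> V" "w = f u + i v" using surj[OF w(1)] by blast
    have "c g = a g u - u + c' g \<and> d g = a g v - v + d' g" if g: "g \<in> carrier G" for g
    proof -
      have Vs: "c g \<in> V" "d g \<in> V" "c' g \<in> V" "d' g \<in> V" "a g u \<in> V" "a g v \<in> V" "a g u - u \<in> V" "a g v - v \<in> V"
        using z A.Z1_V g uv A.act_V A.diff_V by auto
      have fd: "f (a g u - u) = b g (f u) - f u" "i (a g v - v) = b g (i v) - i v"
        using f(2)[OF Vs(7) uv(1)] f(3)[OF g uv(1)] i(2)[OF Vs(8) uv(2)] i(3)[OF g uv(2)] by auto
      have bw: "b g (f u + i v) = b g (f u) + b g (i v)" by (rule B.act_add[OF g f(1)[OF uv(1)] i(1)[OF uv(2)]])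
      have "f (c g) + i (d g) = (b g (f u) + b g (i v)) - (f u + i v) + (f (c' g) + i (d' g))"
        using w(2) g bw unfolding uv(3) by (simp add: cb_def)
      also have "\<dots> = f (a g u - u + c' g) + i (a g v - v + d' g)"
        unfolding f(2)[OF Vs(7,3)] i(2)[OF Vs(8,4)] fd by (simp add: algebra_simps)
      finally have "f (c g) + i (d g) = f (a g u - u + c' g) + i (a g v - v + d' g)" .
      then show ?thesis by (rule inj[rotated -1]) (use Vs A.add_V in auto)
    qed
    then have "?cl c = ?cl c'" "?cl d = ?cl d'"
      using A.H1_class_eq_iff[OF z(1,4)] A.H1_class_eq_iff[OF z(2,5)] uv by blast+
    then show "x = y" unfolding z(3,6) by simp
  qed
  moreover have "\<Psi> ` carrier (H1 G a V \<times>\<times> H1 G a V) = carrier (H1 G b W)"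
  proof
    show "\<Psi> ` carrier (H1 G a V \<times>\<times> H1 G a V) \<subseteq> carrier (H1 G b W)" using hom by (auto simp: hom_def)
    show "carrier (H1 G b W) \<subseteq> \<Psi> ` carrier (H1 G a V \<times>\<times> H1 G a V)"
    proof
      fix h assume "h \<in> carrier (H1 G b W)"
      then obtain e where e: "e \<in> carrier (Z1 G b W)" "h = ?CL e" by (auto simp: B.H1_carrier)
      have "\<forall>g\<in>carrier G. \<exists>p. fst p \<in> V \<and> snd p \<in> V \<and> e g = f (fst p) + i (snd p)"
        using surj B.Z1_V[OF e(1)] by fastforce
      then obtain p where p: "\<forall>g\<in>carrier G. fst (p g) \<in> V \<and> snd (p g) \<in> V \<and> e g = f (fst (p g)) + i (snd (p g))" by metis
      define c where "c = (\<lambda>g\<in>carrier G. fst (p g))"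
      define d where "d = (\<lambda>g\<in>carrier G. snd (p g))"
      have cdV: "c g \<in> V" "d g \<in> V" "e g = f (c g) + i (d g)" if "g \<in> carrier G" for g using p that by (auto simp: c_def d_def)
      have "c (g \<otimes>\<^bsub>G\<^esub> k) = c g + a g (c k) \<and> d (g \<otimes>\<^bsub>G\<^esub> k) = d g + a g (d k)"
        if g: "g \<in> carrier G" and k: "k \<in> carrier G" for g k
      proof -
        have gk: "g \<otimes>\<^bsub>G\<^esub> k \<in> carrier G" using g k by simp
        have "e (g \<otimes>\<^bsub>G\<^esub> k) = e g + b g (e k)" using e(1) g k by (simp add: B.Z1_carrier)
        then have "f (c (g \<otimes>\<^bsub>G\<^esub> k)) + i (d (g \<otimes>\<^bsub>G\<^esub> k)) = f (c g) + i (d g) + b g (f (c k) + i (d k))"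
          using cdV[OF gk] cdV[OF g] cdV[OF k] by simp
        also have "\<dots> = f (c g + a g (c k)) + i (d g + a g (d k))"
          using B.act_add[OF g f(1)[OF cdV(1)[OF k]] i(1)[OF cdV(2)[OF k]]] f(3)[OF g cdV(1)[OF k]] i(3)[OF g cdV(2)[OF k]]
            f(2)[OF cdV(1)[OF g] A.act_V[OF g cdV(1)[OF k]]] i(2)[OF cdV(2)[OF g] A.act_V[OF g cdV(2)[OF k]]]
          by (simp add: algebra_simps)
        finally show ?thesis by (rule inj[rotated -1]) (use cdV g k gk A.add_V A.act_V in auto)
      qed
      then have cd: "c \<in> carrier (Z1 G a V)" "d \<in> carrier (Z1 G a V)"
        using cdV by (auto simp: A.Z1_carrier c_def d_def)
      have "e \<in> extensional (carrier G)" using e(1) by (auto simp: B.Z1_carrier PiE_def)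
      then have "e = cb c d" using cdV(3) by (auto simp: cb_def extensional_def)
      then have h: "h = \<Psi> (?cl c, ?cl d)" using e(2) \<Psi>[OF cd] by simp
      have "(?cl c, ?cl d) \<in> carrier (H1 G a V \<times>\<times> H1 G a V)"
        unfolding carr A.H1_carrier using cd by blast
      then show "h \<in> \<Psi> ` carrier (H1 G a V \<times>\<times> H1 G a V)" unfolding h by (rule imageI)
    qed
  qed
  ultimately show ?thesis using hom unfolding \<Psi>_def[symmetric] iso_def bij_betw_def by blast
qed

section \<open>The groups PSL(2)\<close>

lemma SL2_group: "group (SL2 :: ('a::field^2^2) monoid)"
proof (rule groupI)
  fix A :: "'a^2^2" assume "A \<in> carrier SL2"
  then have A: "det A = 1" by (simp add: SL2_def)
  let ?B = "vector [vector [A$2$2, - A$1$2], vector [- A$2$1, A$1$1]] :: 'a^2^2"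
  have "?B ** A = mat 1" "det ?B = 1" using A by (simp_all add: mat2 algebra_simps)
  then show "\<exists>B\<in>carrier SL2. B \<otimes>\<^bsub>SL2\<^esub> A = \<one>\<^bsub>SL2\<^esub>" by (auto simp: SL2_def)
qed (auto simp: SL2_def det_mul matrix_mul_assoc)

lemma center_normal: "{mat 1, - mat 1} \<lhd> (SL2 :: ('a::field^2^2) monoid)"
proof -
  interpret group "SL2 :: ('a^2^2) monoid" by (rule SL2_group)
  have m: "- mat 1 ** A = - A" "A ** - mat 1 = - A" for A :: "'a^2^2"
    by (simp_all add: vec_eq_iff forall_2 matrix_matrix_mult_def sum_2 mat_def)
  have d: "det (- mat 1 :: 'a^2^2) = 1" by (simp add: mat2)
  have inv: "inv\<^bsub>SL2\<^esub> (- mat 1 :: 'a^2^2) = - mat 1"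
    by (rule inv_equality) (simp_all add: SL2_def m d)
  have one: "inv\<^bsub>SL2\<^esub> (mat 1 :: 'a^2^2) = mat 1" using inv_one by (simp add: SL2_def)
  have sg: "subgroup {mat 1, - mat 1 :: 'a^2^2} SL2"
    by (rule subgroupI) (auto simp: SL2_def m d inv[unfolded SL2_def] one[unfolded SL2_def])
  show ?thesis
    by (rule normalI[OF sg]) (auto simp: r_coset_def l_coset_def SL2_def m)
qed

lemma PSL2_group: "group (PSL2 :: ('a::field^2^2) set monoid)"
  unfolding PSL2_def by (rule normal.factorgroup_is_group[OF center_normal])

lemma psl_mult: "det A = 1 \<Longrightarrow> det B = 1 \<Longrightarrow> psl A \<otimes>\<^bsub>PSL2\<^esub> psl B = psl (A ** B)"
  using normal.rcos_sum[OF center_normal, of A B] by (simp add: PSL2_def psl_def SL2_def)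

lemma PSL2_cases:
  assumes "g \<in> carrier PSL2" obtains A where "det A = 1" "g = psl A"
  using assms by (auto simp: carrier_PSL2)

lemma psl_carrier: "det A = 1 \<Longrightarrow> psl A \<in> carrier PSL2"
  by (auto simp: carrier_PSL2)

lemma psl_one: "\<one>\<^bsub>PSL2\<^esub> = psl (mat 1)"
  by (simp add: PSL2_def psl_eq)

lemma matrix_inv_mult_2:
  fixes A B :: "'a::field^2^2"
  assumes "det A = 1" "det B = 1" shows "matrix_inv (A ** B) = matrix_inv B ** matrix_inv A"
proof -
  have "det (A ** B) = 1" using assms by (simp add: det_mul)
  then show ?thesis using assms
    by (simp add: matrix_inv_2) (simp add: vec_eq_iff forall_2 matrix_matrix_mult_def sum_2 algebra_simps)
qed

lemma Ad_mult:
  assumes "g \<in> carrier PSL2" "h \<in> carrier PSL2" shows "Ad (g \<otimes>\<^bsub>PSL2\<^esub> h) X = Ad g (Ad h X)"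
proof -
  obtain A where A: "det A = 1" "g = psl A" using assms(1) by (rule PSL2_cases)
  obtain B where B: "det B = 1" "h = psl B" using assms(2) by (rule PSL2_cases)
  have "det (A ** B) = 1" using A B by (simp add: det_mul)
  then show ?thesis using A B by (simp add: psl_mult Ad_psl matrix_inv_mult_2 matrix_mul_assoc)
qed

lemma Ad_add:
  assumes "g \<in> carrier PSL2" shows "Ad g (X + Y) = Ad g X + Ad g Y"
proof -
  obtain A where A: "det A = 1" "g = psl A" using assms by (rule PSL2_cases)
  show ?thesis unfolding A(2) Ad_psl[OF A(1)]
    by (simp add: vec_eq_iff forall_2 matrix_matrix_mult_def sum_2 algebra_simps)
qed

lemma Ad_sl2:
  assumes "g \<in> carrier PSL2" "X \<in> sl2" shows "Ad g X \<in> sl2"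
proof -
  obtain A where A: "det A = 1" "g = psl A" using assms(1) by (rule PSL2_cases)
  have d: "A$1$1 * A$2$2 = 1 + A$1$2 * A$2$1" using A(1) by (simp add: det_2 algebra_simps)
  have "trace (A ** X ** matrix_inv A) = (A$1$1 * A$2$2 - A$1$2 * A$2$1) * trace X"
    unfolding matrix_inv_2[OF A(1)] by (simp add: mat2 algebra_simps)
  then show ?thesis using assms(2) unfolding A(2) Ad_psl[OF A(1)] sl2_def by simp
qed

lemma pact_mult:
  assumes "g \<in> carrier PSL2" "h \<in> carrier PSL2" shows "pact (g \<otimes>\<^bsub>PSL2\<^esub> h) v = pact g (pact h v)"
proof -
  have gh: "g \<otimes>\<^bsub>PSL2\<^esub> h \<in> carrier PSL2" by (rule monoid.m_closed[OF group.is_monoid[OF PSL2_group] assms])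
  have "vec_sl2 (pact (g \<otimes>\<^bsub>PSL2\<^esub> h) v) = vec_sl2 (pact g (pact h v))"
    by (simp add: vec_sl2_equivariant[OF gh] vec_sl2_equivariant[OF assms(1)] vec_sl2_equivariant[OF assms(2)] Ad_mult[OF assms])
  then show ?thesis by (simp add: vec_sl2_inj)
qed

lemma pact_one: "pact \<one>\<^bsub>PSL2\<^esub> v = v"
  by (simp add: psl_one pact_psl mact_def transpose_mat) (simp add: symm_def unsymm_def vec_eq_iff forall_3)

lemma linear_pact: "linear (pact g)"
  by (rule linearI) (simp_all add: pact_def mact_def symm_def unsymm_def mat2 algebra_simps add_divide_distrib diff_divide_distrib)

lemma lform_pact:
  assumes "g \<in> carrier PSL2" shows "lform (pact g v) (pact g w) = lform v w"
proof -
  obtain A where A: "det A = 1" "g = psl A" using assms by (rule PSL2_cases)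
  have inv: "matrix_inv A ** A = mat 1" using A(1) by (simp add: matrix_inv_2 mat2 algebra_simps)
  have "lform (pact g v) (pact g w) = trace (Ad g (vec_sl2 v) ** Ad g (vec_sl2 w)) / 2"
    by (simp add: vec_sl2_equivariant[OF assms] flip: vec_sl2_trace)
  also have "Ad g (vec_sl2 v) ** Ad g (vec_sl2 w) = A ** vec_sl2 v ** (matrix_inv A ** A) ** vec_sl2 w ** matrix_inv A"
    unfolding A(2) Ad_psl[OF A(1)] by (simp only: matrix_mul_assoc)
  also have "\<dots> = A ** (vec_sl2 v ** vec_sl2 w ** matrix_inv A)" unfolding inv by (simp add: matrix_mul_assoc)
  also have "trace \<dots> = trace (vec_sl2 v ** vec_sl2 w ** matrix_inv A ** A)" by (rule trace_mul_sym)
  also have "\<dots> = trace (vec_sl2 v ** vec_sl2 w ** (matrix_inv A ** A))" by (simp only: matrix_mul_assoc)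
  finally show ?thesis by (simp add: inv vec_sl2_trace)
qed

text \<open>The third coordinate of the image is a sum of two values of the quadratic form
  \<open>(v$3 + v$2) a\<^sup>2 + 2 v$1 a b + (v$3 - v$2) b\<^sup>2\<close>, which is positive since its determinant is \<open>- lform v v\<close>.\<close>

lemma pact_hyp2:
  assumes "g \<in> carrier PSL2" "v \<in> hyp2" shows "pact g v \<in> hyp2"
proof -
  obtain A where A: "det A = 1" "g = psl A" using assms(1) by (rule PSL2_cases)
  have l: "lform (pact g v) (pact g v) = -1" using lform_pact[OF assms(1)] assms(2) by (simp add: hyp2_def)
  have v: "(v$3)\<^sup>2 = 1 + (v$1)\<^sup>2 + (v$2)\<^sup>2" "v$3 > 0" using assms(2) by (auto simp: hyp2_def lform_def power2_eq_square)
  have "\<bar>v$2\<bar> < v$3"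
  proof (rule power2_less_imp_less)
    show "\<bar>v$2\<bar>\<^sup>2 < (v$3)\<^sup>2" unfolding power2_abs v(1) using zero_le_power2[of "v$1"] by linarith
  qed (use v(2) in simp)
  then have p: "v$3 + v$2 > 0" by simp
  define Q where "Q a b = (v$3 + v$2) * a\<^sup>2 + 2 * v$1 * a * b + (v$3 - v$2) * b\<^sup>2" for a b
  have "(v$3 + v$2) * Q a b = ((v$3 + v$2) * a + v$1 * b)\<^sup>2 + ((v$3)\<^sup>2 - (v$1)\<^sup>2 - (v$2)\<^sup>2) * b\<^sup>2" for a b
    by (simp add: Q_def power2_eq_square algebra_simps)
  then have "(v$3 + v$2) * Q a b \<ge> 0" for a b using v(1) by simp
  then have Q: "Q a b \<ge> 0" for a b using p by (simp add: zero_le_mult_iff)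
  have "pact g v $ 3 = (Q (A$1$1) (A$1$2) + Q (A$2$1) (A$2$2)) / 2"
    unfolding A(2) pact_psl by (simp add: mact_def symm_def unsymm_def mat2 Q_def power2_eq_square algebra_simps)
  moreover have "(Q (A$1$1) (A$1$2) + Q (A$2$1) (A$2$2)) / 2 \<ge> 0"
    by (intro divide_nonneg_pos add_nonneg_nonneg Q) simp
  ultimately have "pact g v $ 3 \<ge> 0" by simp
  moreover have "pact g v $ 3 \<noteq> 0"
  proof
    assume "pact g v $ 3 = 0"
    then have "lform (pact g v) (pact g v) \<ge> 0" by (simp add: lform_def)
    then show False using l by simp
  qed
  ultimately show ?thesis using l by (simp add: hyp2_def)
qed

lemma cmat_det: "det (cmat A) = of_real (det A)"
  by (simp add: det_2 cmat_def map_matrix_def)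

lemma cpsl_psl: "cpsl (psl A) = psl (cmat A)"
proof -
  have "cmat (- A) = - cmat A" by (simp add: cmat_def map_matrix_def vec_eq_iff)
  then show ?thesis by (simp add: cpsl_def psl_eq)
qed

lemma cpsl_carrier: "g \<in> carrier PSL2 \<Longrightarrow> cpsl g \<in> carrier PSL2"
  by (elim PSL2_cases) (simp add: cpsl_psl psl_carrier cmat_det)

lemma cpsl_mult:
  assumes "g \<in> carrier PSL2" "h \<in> carrier PSL2" shows "cpsl (g \<otimes>\<^bsub>PSL2\<^esub> h) = cpsl g \<otimes>\<^bsub>PSL2\<^esub> cpsl h"
proof -
  obtain A where A: "det A = 1" "g = psl A" using assms(1) by (rule PSL2_cases)
  obtain B where B: "det B = 1" "h = psl B" using assms(2) by (rule PSL2_cases)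
  show ?thesis using A B by (simp add: psl_mult cpsl_psl cmat_det cmat_mult)
qed

lemma cAd_cmat:
  assumes "g \<in> carrier PSL2" shows "cAd g (cmat X) = cmat (Ad g X)"
proof -
  obtain A where A: "det A = 1" "g = psl A" using assms by (rule PSL2_cases)
  have "matrix_inv (cmat A) = cmat (matrix_inv A)"
    using A(1) by (simp add: matrix_inv_2 cmat_det) (simp add: cmat_def map_matrix_def vec_eq_iff forall_2)
  then show ?thesis using A by (simp add: cpsl_psl Ad_psl cmat_det cmat_mult)
qed

lemma Ad_cmult:
  assumes "g \<in> carrier PSL2" shows "Ad g (cmult c X) = cmult c (Ad g X)"
proof -
  obtain A where A: "det A = 1" "g = psl A" using assms by (rule PSL2_cases)
  show ?thesis unfolding A(2) Ad_psl[OF A(1)]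
    by (simp add: vec_eq_iff forall_2 matrix_matrix_mult_def sum_2 cmult_def map_matrix_def algebra_simps)
qed

lemma sl2_closed:
  fixes X Y :: "'a::field^2^2"
  shows "(0::'a^2^2) \<in> sl2" "X \<in> sl2 \<Longrightarrow> Y \<in> sl2 \<Longrightarrow> X + Y \<in> sl2" "X \<in> sl2 \<Longrightarrow> - X \<in> sl2"
proof -
  show "(0::'a^2^2) \<in> sl2" by (simp add: sl2_def trace_def)
  assume X: "X \<in> sl2"
  then show "- X \<in> sl2" by (simp add: sl2_def trace_def sum_negf)
  assume "Y \<in> sl2"
  then show "X + Y \<in> sl2" using X by (simp add: sl2_def trace_def sum.distrib)
qed

lemma cmat_add: "cmat (X + Y) = cmat X + cmat Y"
  by (simp add: vec_eq_iff cmat_def map_matrix_def)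

lemma cmult_add: "cmult c (X + Y) = cmult c X + cmult c Y"
  by (simp add: vec_eq_iff cmult_def map_matrix_def distrib_left)

lemma cmat_sl2: "X \<in> sl2 \<Longrightarrow> cmat X \<in> sl2"
proof -
  assume "X \<in> sl2"
  then have "X$1$1 + X$2$2 = 0" by (simp add: sl2_def trace_def sum_2)
  then have "complex_of_real (X$1$1 + X$2$2) = 0" by simp
  then show ?thesis by (simp add: sl2_def trace_def sum_2 cmat_def map_matrix_def)
qed

lemma cmult_sl2: "X \<in> sl2 \<Longrightarrow> cmult c X \<in> sl2"
proof -
  assume "X \<in> sl2"
  then have "X$1$1 + X$2$2 = 0" by (simp add: sl2_def trace_def sum_2)
  then have "c * (X$1$1 + X$2$2) = 0" by simp
  then show ?thesis by (simp add: sl2_def trace_def sum_2 cmult_def map_matrix_def distrib_left)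
qed

context
  fixes \<Gamma> :: "(real^2^2) set set"
  assumes \<Gamma>: "subgroup \<Gamma> PSL2"
begin

lemma subPSL_group: "group (subPSL \<Gamma>)"
  by (rule subgroup.subgroup_is_group[OF \<Gamma> PSL2_group])

lemma subPSL_carrier: "\<gamma> \<in> \<Gamma> \<Longrightarrow> \<gamma> \<in> carrier PSL2"
  using subgroup.mem_carrier[OF \<Gamma>] .

lemma gmodule_Ad: "gmodule (subPSL \<Gamma>) Ad sl2"
  by (intro gmodule.intro subPSL_group gmodule_axioms.intro)
     (auto simp: sl2_closed Ad_sl2 Ad_add Ad_mult subPSL_carrier)

lemma gmodule_cAd: "gmodule (subPSL \<Gamma>) cAd sl2"
  by (intro gmodule.intro subPSL_group gmodule_axioms.intro)
     (auto simp: sl2_closed Ad_sl2 Ad_add Ad_mult subPSL_carrier cpsl_carrier cpsl_mult)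

lemma gmodule_pact: "gmodule (subPSL \<Gamma>) pact UNIV"
  by (intro gmodule.intro subPSL_group gmodule_axioms.intro)
     (auto simp: pact_mult subPSL_carrier linear_add[OF linear_pact])

lemma H1_decomposition:
  "(\<lambda>(h, k). H1_map (subPSL \<Gamma>) cAd sl2 cmat h \<otimes>\<^bsub>H1 (subPSL \<Gamma>) cAd sl2\<^esub>
      H1_map (subPSL \<Gamma>) cAd sl2 (\<lambda>X. cmult \<i> (cmat X)) k) \<in>
    iso (H1 (subPSL \<Gamma>) Ad sl2 \<times>\<times> H1 (subPSL \<Gamma>) Ad sl2) (H1 (subPSL \<Gamma>) cAd sl2)"
proof (rule H1_complexification[OF gmodule_Ad gmodule_cAd])
  fix w :: "complex^2^2" assume w: "w \<in> sl2"
  let ?u = "map_matrix Re w" and ?v = "map_matrix Im w"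
  have "?u \<in> sl2" "?v \<in> sl2" using w by (auto simp: sl2_def trace_def sum_2 map_matrix_def complex_eq_iff)
  moreover have "w = cmat ?u + cmult \<i> (cmat ?v)"
    by (simp add: vec_eq_iff cmat_def cmult_def map_matrix_def complex_eq_iff)
  ultimately show "\<exists>u\<in>sl2. \<exists>v\<in>sl2. w = cmat u + cmult \<i> (cmat v)" by blast
next
  fix u v u' v' :: "real^2^2"
  assume "cmat u + cmult \<i> (cmat v) = cmat u' + cmult \<i> (cmat v')"
  then show "u = u' \<and> v = v'"
    by (simp add: vec_eq_iff cmat_def cmult_def map_matrix_def complex_eq_iff)
next
  show "cmult \<i> (cmat (Ad g v)) = cAd g (cmult \<i> (cmat v))" if "g \<in> carrier (subPSL \<Gamma>)" for g v
    using that by (simp add: Ad_cmult cAd_cmat subPSL_carrier cpsl_carrier)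
  show "cmat (Ad g v) = cAd g (cmat v)" if "g \<in> carrier (subPSL \<Gamma>)" for g v
    using that by (simp add: cAd_cmat subPSL_carrier)
qed (simp_all add: cmat_sl2 cmult_sl2 cmat_add cmult_add)

end

section \<open>The limit of the bending products\<close>

definition rsum :: "(real \<Rightarrow> real) \<Rightarrow> subdiv \<Rightarrow> real^3" where
  "rsum G = (\<lambda>(r, s, l). \<Sum>j<r. (G (s (Suc j)) - G (s j)) *\<^sub>R rnormal (l j))"

context meas_lam
begin

lemma bend_prod_ordprod:
  assumes x: "x \<in> hyp2 - weighted_part lam" and y: "y \<in> hyp2 - weighted_part lam" and t: "0 \<le> t"
    and sub: "is_subdiv lam x y (r, s, l)"
  shows "bend_prod (scale_lam t lam) x y (r, s, l) =
    ordprod (\<lambda>j. rot (Phi (rnormal (l j))) (t / 2 * cmass x y (s (Suc j)) - t / 2 * cmass x y (s j))) r"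
  unfolding bend_prod_def prod.case
proof (rule ordprod_cong)
  fix j assume j: "j < r"
  note D = subdivD[OF x y sub]
  define m where "m = t * (cmass x y (s (Suc j)) - cmass x y (s j))"
  have sm: "seg_mass (scale_lam t lam) x y (cell x y s j) = m"
    by (simp only: seg_mass_scale[OF t] D(7)[OF j] m_def)
  have m2: "t / 2 * cmass x y (s (Suc j)) - t / 2 * cmass x y (s j) = m / 2" by (simp add: m_def algebra_simps)
  have le: "cmass x y (s j) \<le> cmass x y (s (Suc j))"
    by (rule mono_onD[OF cmass_props(1)[OF x y]]) (use D(4)[OF j] D(5)[of j] D(5)[of "Suc j"] j in auto)
  show "mexp (cmult (\<i> * of_real (seg_mass (scale_lam t lam) x y (cell x y s j)) / 2) (cmat (Xgen (l j)))) =
      rot (Phi (rnormal (l j))) (t / 2 * cmass x y (s (Suc j)) - t / 2 * cmass x y (s j))"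
  proof (cases "cmass x y (s j) < cmass x y (s (Suc j))")
    case True
    have l: "is_ogeod (l j)" using D(8)[OF j True] by blast
    have u: "lform (rnormal (l j)) (rnormal (l j)) = 1" by (rule lform_rnormal_self[OF l])
    show ?thesis unfolding sm m2 Xgen_eq[OF l] by (rule mexp_rot[OF u])
  next
    case False
    then have "m = 0" using le by (simp add: m_def)
    then show ?thesis unfolding sm m2 by (simp add: mexp_cmult_0 rot_0)
  qed
qed

lemma eventually_fine:
  assumes x: "x \<in> hyp2 - weighted_part lam" and y: "y \<in> hyp2 - weighted_part lam" and ne: "x \<noteq> y" and e: "\<eta> > 0"
  shows "eventually (\<lambda>\<sigma>. is_subdiv lam x y \<sigma> \<and> (case \<sigma> of (r, s, l) \<Rightarrow> \<forall>j<r. s (Suc j) - s j < \<eta>)) (mesh_filter lam x y)"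
proof -
  have xy: "x \<in> hyp2" "y \<in> hyp2" using x y by auto
  obtain d where d: "d > 0" "\<forall>r s l. is_subdiv lam x y (r, s, l) \<longrightarrow> (\<forall>j\<le>r. s j \<in> {0..1}) \<longrightarrow> mesh x y (r, s, l) < d \<longrightarrow>
      (\<forall>j<r. s (Suc j) - s j < \<eta>)"
    by (rule mesh_close[OF xy ne e]) blast
  have "is_subdiv lam x y \<sigma> \<and> (case \<sigma> of (r, s, l) \<Rightarrow> \<forall>j<r. s (Suc j) - s j < \<eta>)"
    if a: "is_subdiv lam x y \<sigma>" "mesh x y \<sigma> < d" for \<sigma>
  proof -
    obtain r s l where \<sigma>: "\<sigma> = (r, s, l)" by (metis prod_cases3)
    have "\<forall>j\<le>r. s j \<in> {0..1}" using subdivD(5)[OF x y a(1)[unfolded \<sigma>]] by blast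
    then have "\<forall>j<r. s (Suc j) - s j < \<eta>" using d(2) a unfolding \<sigma> by blast
    then show ?thesis using a(1) unfolding \<sigma> by simp
  qed
  then show ?thesis unfolding eventually_mesh using d(1) by blast
qed

lemma bend_prod_first_order:
  assumes x: "x \<in> hyp2 - weighted_part lam" and y: "y \<in> hyp2 - weighted_part lam" and t: "0 \<le> t"
    and B: "\<And>n. n \<in> seps \<L> x y \<Longrightarrow> norm (Phi n) \<le> B" "B \<ge> 0"
    and sub: "is_subdiv lam x y \<sigma>"
  shows "norm (bend_prod (scale_lam t lam) x y \<sigma> - mat 1 - (t / 2) *\<^sub>R Phi (rsum (cmass x y) \<sigma>))
      \<le> exp ((2 + B) * (t / 2 * cmass x y 1)) - 1 - (2 + B) * (t / 2 * cmass x y 1)"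
    "det (bend_prod (scale_lam t lam) x y \<sigma>) = 1"
proof -
  obtain r s l where \<sigma>: "\<sigma> = (r, s, l)" by (metis prod_cases3)
  note D = subdivD[OF x y sub[unfolded \<sigma>]]
  define g where "g j = t / 2 * cmass x y (s (Suc j)) - t / 2 * cmass x y (s j)" for j
  have bp: "bend_prod (scale_lam t lam) x y \<sigma> = ordprod (\<lambda>j. rot (Phi (rnormal (l j))) (g j)) r"
    unfolding \<sigma> g_def by (rule bend_prod_ordprod[OF x y t sub[unfolded \<sigma>]])
  have le: "cmass x y (s j) \<le> cmass x y (s (Suc j))" if j: "j < r" for j
    by (rule mono_onD[OF cmass_props(1)[OF x y]]) (use D(4)[OF j] D(5)[of j] D(5)[of "Suc j"] j in auto)
  have g0: "0 \<le> g j" if "j < r" for j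
    using mult_left_mono[OF le[OF that], of "t / 2"] t by (simp add: g_def)
  have cases: "g j = 0 \<or> (norm (Phi (rnormal (l j))) \<le> B \<and> lform (rnormal (l j)) (rnormal (l j)) = 1)" if j: "j < r" for j
  proof (cases "cmass x y (s j) < cmass x y (s (Suc j))")
    case True
    then show ?thesis using D(8)[OF j True] B(1) lform_rnormal_self by blast
  next
    case False
    then show ?thesis using le[OF j] by (simp add: g_def)
  qed
  have fo: "norm (rot (Phi (rnormal (l j))) (g j) - mat 1 - g j *\<^sub>R Phi (rnormal (l j))) \<le>
      exp ((2 + B) * g j) - 1 - (2 + B) * g j" if j: "j < r" for j
    using cases[OF j]
  proof
    assume "g j = 0" then show ?thesis by (simp add: rot_0)
  next
    assume "norm (Phi (rnormal (l j))) \<le> B \<and> lform (rnormal (l j)) (rnormal (l j)) = 1"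
    then show ?thesis by (intro rot_first_order g0 j) simp
  qed
  have an: "norm (g j *\<^sub>R Phi (rnormal (l j))) \<le> (2 + B) * g j" if j: "j < r" for j
    using cases[OF j]
  proof
    assume "norm (Phi (rnormal (l j))) \<le> B \<and> lform (rnormal (l j)) (rnormal (l j)) = 1"
    then have "g j * norm (Phi (rnormal (l j))) \<le> g j * (2 + B)" by (intro mult_left_mono g0 j) simp
    then show ?thesis using g0[OF j] by (simp add: mult.commute)
  qed simp
  have tel: "(\<Sum>j<r. (2 + B) * g j) = (2 + B) * (t / 2 * cmass x y 1)"
    using sum_lessThan_telescope[of "\<lambda>j. t / 2 * cmass x y (s j)" r] D(2,3) cmass_props(2)[OF x y]
    by (simp add: g_def flip: sum_distrib_left)
  have "(\<Sum>j<r. g j *\<^sub>R Phi (rnormal (l j))) = (t / 2) *\<^sub>R (\<Sum>j<r. (cmass x y (s (Suc j)) - cmass x y (s j)) *\<^sub>R Phi (rnormal (l j)))"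
    unfolding scaleR_sum_right by (rule sum.cong) (simp_all add: g_def right_diff_distrib)
  also have "\<dots> = (t / 2) *\<^sub>R Phi (rsum (cmass x y) \<sigma>)"
    by (simp add: \<sigma> rsum_def linear_sum[OF bounded_linear.linear[OF bounded_linear_Phi]] linear_scale[OF bounded_linear.linear[OF bounded_linear_Phi]])
  finally have s: "(\<Sum>j<r. g j *\<^sub>R Phi (rnormal (l j))) = (t / 2) *\<^sub>R Phi (rsum (cmass x y) \<sigma>)" .
  have c0: "0 \<le> (2 + B) * g j" if "j < r" for j using g0[OF that] B(2) by simp
  show "norm (bend_prod (scale_lam t lam) x y \<sigma> - mat 1 - (t / 2) *\<^sub>R Phi (rsum (cmass x y) \<sigma>))
      \<le> exp ((2 + B) * (t / 2 * cmass x y 1)) - 1 - (2 + B) * (t / 2 * cmass x y 1)"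
    unfolding bp s[symmetric] tel[symmetric]
    by (rule ordprod_first_order[THEN conjunct1]) (use c0 an fo in blast)+
  show "det (bend_prod (scale_lam t lam) x y \<sigma>) = 1" unfolding bp
  proof (rule det_ordprod)
    fix j assume "j < r"
    from cases[OF this] show "det (rot (Phi (rnormal (l j))) (g j)) = 1"
    proof
      assume "g j = 0" then show ?thesis by (simp add: rot_0)
    qed (simp add: det_rot_Phi)
  qed
qed

text \<open>Two leaves chosen in overlapping cells cross the segment at parameters that differ by at most
  the sum of the lengths of the cells, so their normals are close.\<close>

lemma bend_prod_close:
  assumes x: "x \<in> hyp2 - weighted_part lam" and y: "y \<in> hyp2 - weighted_part lam" and t: "0 \<le> t"
    and C: "\<And>n m. n \<in> seps \<L> x y \<Longrightarrow> m \<in> seps \<L> x y \<Longrightarrow> norm (Phi n - Phi m) \<le> C * \<bar>cpar x y n - cpar x y m\<bar>" "C \<ge> 0"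
    and B: "\<And>n. n \<in> seps \<L> x y \<Longrightarrow> norm (Phi n) \<le> B" "B \<ge> 0"
    and sub: "is_subdiv lam x y (r, s, l)" "\<And>j. j < r \<Longrightarrow> s (Suc j) - s j < \<eta>"
    and sub': "is_subdiv lam x y (r', s', l')" "\<And>j. j < r' \<Longrightarrow> s' (Suc j) - s' j < \<eta>" and \<eta>: "\<eta> > 0"
  shows "norm (bend_prod (scale_lam t lam) x y (r, s, l) - bend_prod (scale_lam t lam) x y (r', s', l'))
    \<le> (exp ((2 + B) * (t / 2 * cmass x y 1)) + 2) * (C * (2 * \<eta>)) * (t / 2 * cmass x y 1) * exp ((2 + B) * (t / 2 * cmass x y 1))"
  unfolding bend_prod_ordprod[OF x y t sub(1)] bend_prod_ordprod[OF x y t sub'(1)]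
proof (rule cutprod_compare)
  note D = subdivD[OF x y sub(1)] and D' = subdivD[OF x y sub'(1)]
  show "incr s r" "incr s' r'" using D(4) D'(4) by (auto simp: incr_def)
  show "s 0 = 0" "s r = 1" "s' 0 = 0" "s' r' = 1" by (rule D D')+
  show "mono_on {0..1} (\<lambda>u. t / 2 * cmass x y u)"
    by (intro mono_onI mult_left_mono mono_onD[OF cmass_props(1)[OF x y]]) (use t in auto)
  show "t / 2 * cmass x y 0 = 0" by (simp add: cmass_props(2)[OF x y])
  have lt: "cmass x y a < cmass x y b" if "t / 2 * cmass x y a < t / 2 * cmass x y b" for a b
    using that t by (simp add: mult_less_cancel_left)
  show "Phi (rnormal (l i)) ** Phi (rnormal (l i)) = - mat 1 \<and> norm (Phi (rnormal (l i))) \<le> B"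
    if "i < r" "t / 2 * cmass x y (s i) < t / 2 * cmass x y (s (Suc i))" for i
    using D(8)[OF that(1) lt[OF that(2)]] B(1) Phi_square lform_rnormal_self by blast
  show "Phi (rnormal (l' i)) ** Phi (rnormal (l' i)) = - mat 1 \<and> norm (Phi (rnormal (l' i))) \<le> B"
    if "i < r'" "t / 2 * cmass x y (s' i) < t / 2 * cmass x y (s' (Suc i))" for i
    using D'(8)[OF that(1) lt[OF that(2)]] B(1) Phi_square lform_rnormal_self by blast
  show "norm (Phi (rnormal (l i)) - Phi (rnormal (l' j))) \<le> C * (2 * \<eta>)"
    if ij: "i < r" "j < r'" and pos: "t / 2 * cmass x y (s i) < t / 2 * cmass x y (s (Suc i))"
      "t / 2 * cmass x y (s' j) < t / 2 * cmass x y (s' (Suc j))" and ov: "s i \<le> s' (Suc j)" "s' j \<le> s (Suc i)" for i j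
  proof -
    note n = D(8)[OF ij(1) lt[OF pos(1)]] and n' = D'(8)[OF ij(2) lt[OF pos(2)]]
    have "\<bar>cpar x y (rnormal (l i)) - cpar x y (rnormal (l' j))\<bar> \<le> 2 * \<eta>"
      using n n' ov sub(2)[OF ij(1)] sub'(2)[OF ij(2)] by auto
    then have "C * \<bar>cpar x y (rnormal (l i)) - cpar x y (rnormal (l' j))\<bar> \<le> C * (2 * \<eta>)" using C(2) by (rule mult_left_mono)
    then show ?thesis using C(1)[of "rnormal (l i)" "rnormal (l' j)"] n n' by linarith
  qed
qed (use B C \<eta> in auto)

text \<open>The products form a Cauchy filter by \<open>bend_prod_close\<close>. The determinant and the first order estimate
  pass to the limit, in which the Riemann sums become the integral. The estimate has the same constant \<open>K\<close> for all \<open>t\<close>.\<close>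

lemma bend_limit_transverse:
  assumes x: "x \<in> hyp2 - weighted_part lam" and y: "y \<in> hyp2 - weighted_part lam" and ts: "tseg x y"
  shows "\<exists>K. \<forall>t>0. \<exists>A. (bend_prod (scale_lam t lam) x y \<longlongrightarrow> A) (mesh_filter lam x y) \<and> det A = 1 \<and>
    norm (A - mat 1 - (t / 2) *\<^sub>R Phi (transl x y)) \<le> exp (K * t) - 1 - K * t"
proof -
  have xy: "x \<in> hyp2" "y \<in> hyp2" using x y by auto
  have np: "no_common_leaf \<L> x y" and ne: "x \<noteq> y" using ts transverse_hseg_iff[OF xy] by auto
  obtain C where C: "C > 0" "\<And>n m. n \<in> seps \<L> x y \<Longrightarrow> m \<in> seps \<L> x y \<Longrightarrow> norm (n - m) \<le> C * \<bar>cpar x y n - cpar x y m\<bar>"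
    by (rule normals_lipschitz[OF xy np]) blast
  obtain P where P: "P > 0" "\<And>v. norm (Phi v) \<le> norm v * P"
    using bounded_linear.pos_bounded[OF bounded_linear_Phi] by blast
  define B where "B = 2 * (x$3 + y$3) * P"
  have B: "norm (Phi n) \<le> B" if "n \<in> seps \<L> x y" for n
    unfolding B_def by (rule order_trans[OF P(2) mult_right_mono[OF seps_bounded[OF xy np that] less_imp_le[OF P(1)]]])
  have B0: "B \<ge> 0" using xy P(1) by (auto simp: B_def hyp2_def intro!: mult_nonneg_nonneg)
  have PC: "norm (Phi n - Phi m) \<le> (C * P) * \<bar>cpar x y n - cpar x y m\<bar>" if "n \<in> seps \<L> x y" "m \<in> seps \<L> x y" for n m
  proof -
    have "norm (Phi n - Phi m) \<le> norm (n - m) * P" using P(2)[of "n - m"] by (simp add: linear_diff[OF bounded_linear.linear[OF bounded_linear_Phi]])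
    also have "\<dots> \<le> (C * \<bar>cpar x y n - cpar x y m\<bar>) * P" using C(2)[OF that] P(1) by (intro mult_right_mono) auto
    finally show ?thesis by (simp add: mult_ac)
  qed
  let ?F = "mesh_filter lam x y"
  have F: "?F \<noteq> bot" by (rule mesh_filter_nontrivial[OF x y])
  define M where "M = cmass x y 1"
  have M0: "M \<ge> 0" by (simp add: M_def cmass_def)
  have lim_r: "(rsum (cmass x y) \<longlongrightarrow> transl x y) ?F"
    unfolding tendsto_iff
  proof (intro allI impI)
    fix e :: real assume e: "e > 0"
    define \<eta> where "\<eta> = e / (2 * (C * (M + 1)))"
    have \<eta>: "\<eta> > 0" using e C(1) M0 by (simp add: \<eta>_def)
    have "C * \<eta> * M \<le> C * \<eta> * (M + 1)" using C(1) \<eta> by (intro mult_left_mono) auto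
    also have "\<dots> = e / 2"
      using C(1) M0 by (simp add: \<eta>_def) (simp add: field_simps)
    finally have small: "C * \<eta> * M < e" using e by simp
    show "eventually (\<lambda>\<sigma>. dist (rsum (cmass x y) \<sigma>) (transl x y) < e) ?F"
      using eventually_fine[OF x y ne \<eta>]
    proof eventually_elim
      case (elim \<sigma>)
      obtain r s l where \<sigma>: "\<sigma> = (r, s, l)" by (metis prod_cases3)
      have a: "is_subdiv lam x y (r, s, l)" "\<And>j. j < r \<Longrightarrow> s (Suc j) - s j \<le> \<eta>" using elim by (auto simp: \<sigma> less_imp_le)
      have "norm (rsum (cmass x y) \<sigma> - transl x y) \<le> C * \<eta> * M"
        unfolding \<sigma> rsum_def prod.case M_def by (rule riemann_sum[OF x y ts C(2) C(1) a])
      then show ?case using small by (simp add: dist_norm)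
    qed
  qed
  define K where "K = (2 + B) * (M / 2)"
  have K: "(2 + B) * (t / 2 * cmass x y 1) = K * t" for t by (simp add: K_def M_def)
  show ?thesis
  proof (intro exI[of _ K] allI impI)
    fix t :: real assume t: "t > 0"
    let ?f = "bend_prod (scale_lam t lam) x y"
    have "cauchy_filter (filtermap ?f ?F)"
      unfolding cauchy_filter_metric_filtermap
    proof (intro allI impI)
      fix e :: real assume e: "e > 0"
      define Q where "Q = (exp (K * t) + 2) * (C * P) * 2 * (t / 2 * M) * exp (K * t)"
      have Q0: "Q \<ge> 0" unfolding Q_def using C(1) P(1) t M0 by (intro mult_nonneg_nonneg add_nonneg_nonneg) auto
      define \<eta> where "\<eta> = e / (Q + 1)"
      have \<eta>: "\<eta> > 0" using e Q0 by (simp add: \<eta>_def)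
      have small: "Q * \<eta> < e"
      proof -
        have "Q * \<eta> < (Q + 1) * \<eta>" using \<eta> by (intro mult_strict_right_mono) auto
        also have "\<dots> = e" using Q0 by (simp add: \<eta>_def)
        finally show ?thesis .
      qed
      define R where "R \<sigma> \<longleftrightarrow> is_subdiv lam x y \<sigma> \<and> (case \<sigma> of (r, s, l) \<Rightarrow> \<forall>j<r. s (Suc j) - s j < \<eta>)" for \<sigma> :: subdiv
      have "dist (?f \<sigma>) (?f \<sigma>') < e" if R: "R \<sigma>" "R \<sigma>'" for \<sigma> \<sigma>'
      proof -
        obtain r s l where \<sigma>: "\<sigma> = (r, s, l)" by (metis prod_cases3)
        obtain r' s' l' where \<sigma>': "\<sigma>' = (r', s', l')" by (metis prod_cases3)
        have a: "is_subdiv lam x y (r, s, l)" "\<And>j. j < r \<Longrightarrow> s (Suc j) - s j < \<eta>" using R(1) by (auto simp: R_def \<sigma>)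
        have a': "is_subdiv lam x y (r', s', l')" "\<And>j. j < r' \<Longrightarrow> s' (Suc j) - s' j < \<eta>" using R(2) by (auto simp: R_def \<sigma>')
        have CP: "C * P \<ge> 0" using C(1) P(1) by simp
        have "norm (?f \<sigma> - ?f \<sigma>') \<le> Q * \<eta>"
          using bend_prod_close[OF x y less_imp_le[OF t] PC CP B B0 a a' \<eta>] unfolding K \<sigma> \<sigma>' by (simp add: Q_def M_def mult_ac)
        then show ?thesis using small by (simp add: dist_norm)
      qed
      moreover have "eventually R ?F" unfolding R_def by (rule eventually_fine[OF x y ne \<eta>])
      ultimately show "\<exists>P. eventually P ?F \<and> (\<forall>\<sigma> \<sigma>'. P \<sigma> \<and> P \<sigma>' \<longrightarrow> dist (?f \<sigma>) (?f \<sigma>') < e)" by blast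
    qed
    then obtain A where "filtermap ?f ?F \<le> nhds A"
      using complete_UNIV[unfolded complete_uniform] F by (force simp: filtermap_bot_iff)
    then have A: "(?f \<longlongrightarrow> A) ?F" by (simp add: filterlim_def)
    have sub: "eventually (is_subdiv lam x y) ?F"
      using eventually_fine[OF x y ne zero_less_one] by (rule eventually_mono) simp
    have "((\<lambda>\<sigma>. det (?f \<sigma>)) \<longlongrightarrow> det A) ?F"
      unfolding det_2 by (intro tendsto_intros tendsto_vec_nth A)
    moreover have "eventually (\<lambda>\<sigma>. det (?f \<sigma>) = 1) ?F"
      using sub by (rule eventually_mono) (rule bend_prod_first_order(2)[OF x y less_imp_le[OF t] B B0])
    then have "((\<lambda>\<sigma>. det (?f \<sigma>)) \<longlongrightarrow> 1) ?F" by (rule tendsto_eventually)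
    ultimately have d: "det A = 1" using tendsto_unique[OF F] by blast
    have "((\<lambda>\<sigma>. norm (?f \<sigma> - mat 1 - (t / 2) *\<^sub>R Phi (rsum (cmass x y) \<sigma>))) \<longlongrightarrow>
        norm (A - mat 1 - (t / 2) *\<^sub>R Phi (transl x y))) ?F"
      by (intro tendsto_intros A bounded_linear.tendsto[OF bounded_linear_Phi] lim_r)
    moreover have "eventually (\<lambda>\<sigma>. norm (?f \<sigma> - mat 1 - (t / 2) *\<^sub>R Phi (rsum (cmass x y) \<sigma>)) \<le> exp (K * t) - 1 - K * t) ?F"
      using sub by (rule eventually_mono) (rule bend_prod_first_order(1)[OF x y less_imp_le[OF t] B B0, unfolded K])
    ultimately have "norm (A - mat 1 - (t / 2) *\<^sub>R Phi (transl x y)) \<le> exp (K * t) - 1 - K * t"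
      by (rule tendsto_upperbound[OF _ _ F])
    then show "\<exists>A. (?f \<longlongrightarrow> A) ?F \<and> det A = 1 \<and> norm (A - mat 1 - (t / 2) *\<^sub>R Phi (transl x y)) \<le> exp (K * t) - 1 - K * t"
      using A d by blast
  qed
qed

lemma bend_limit:
  assumes x: "x \<in> hyp2 - weighted_part lam" and y: "y \<in> hyp2 - weighted_part lam"
  obtains A K where "\<And>t. 0 \<le> t \<Longrightarrow> bending (scale_lam t lam) x y = psl (A t)" "A 0 = mat 1"
    "\<And>t. 0 \<le> t \<Longrightarrow> det (A t) = 1"
    "\<And>t. 0 \<le> t \<Longrightarrow> norm (A t - mat 1 - (t / 2) *\<^sub>R Phi (transl x y)) \<le> exp (K * t) - 1 - K * t"
proof -
  define A where "A t = Lim (mesh_filter (scale_lam t lam) x y) (bend_prod (scale_lam t lam) x y)" for t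
  have L: "A t = a" if "0 \<le> t" "(bend_prod (scale_lam t lam) x y \<longlongrightarrow> a) (mesh_filter (scale_lam t lam) x y)" for t a
    unfolding A_def by (rule tendsto_Lim[OF mesh_filter_scale_nontrivial[OF x y that(1)] that(2)])
  have triv: "A t = mat 1" if "t = 0 \<or> \<not> tseg x y" "0 \<le> t" for t
  proof (rule L[OF that(2)])
    show "(bend_prod (scale_lam t lam) x y \<longlongrightarrow> mat 1) (mesh_filter (scale_lam t lam) x y)"
      unfolding bend_prod_trivial[OF that, abs_def] by (rule tendsto_const)
  qed
  obtain K where K: "0 < t \<Longrightarrow> det (A t) = 1 \<and> norm (A t - mat 1 - (t / 2) *\<^sub>R Phi (transl x y)) \<le> exp (K * t) - 1 - K * t" for t
  proof (cases "tseg x y")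
    case True
    obtain K where K: "\<forall>t>0. \<exists>a. (bend_prod (scale_lam t lam) x y \<longlongrightarrow> a) (mesh_filter lam x y) \<and> det a = 1 \<and>
        norm (a - mat 1 - (t / 2) *\<^sub>R Phi (transl x y)) \<le> exp (K * t) - 1 - K * t"
      using bend_limit_transverse[OF x y True] by blast
    show thesis
    proof (rule that[of K])
      fix t :: real assume t: "0 < t"
      obtain a where a: "(bend_prod (scale_lam t lam) x y \<longlongrightarrow> a) (mesh_filter lam x y)" "det a = 1"
        "norm (a - mat 1 - (t / 2) *\<^sub>R Phi (transl x y)) \<le> exp (K * t) - 1 - K * t"
        using K t by blast
      have "A t = a" using L[OF less_imp_le[OF t]] a(1) mesh_filter_scale[OF t] by simp
      then show "det (A t) = 1 \<and> norm (A t - mat 1 - (t / 2) *\<^sub>R Phi (transl x y)) \<le> exp (K * t) - 1 - K * t"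
        using a by simp
    qed
  next
    case False
    have z: "transl x y = 0" by (simp add: transl_def segm_n[OF False] integral_null_measure)
    show thesis
    proof (rule that[of 0])
      fix t :: real assume t: "0 < t"
      show "det (A t) = 1 \<and> norm (A t - mat 1 - (t / 2) *\<^sub>R Phi (transl x y)) \<le> exp (0 * t) - 1 - 0 * t"
        using triv[of t] t False by (simp add: z linear_0[OF bounded_linear.linear[OF bounded_linear_Phi]])
    qed
  qed
  show thesis
  proof (rule that[of A K])
    show "A 0 = mat 1" by (rule triv) auto
    show "bending (scale_lam t lam) x y = psl (A t)" for t by (simp add: bending_def A_def)
    show "det (A t) = 1" if "0 \<le> t" for t using K[of t] that \<open>A 0 = mat 1\<close> by (cases "t = 0") auto
    show "norm (A t - mat 1 - (t / 2) *\<^sub>R Phi (transl x y)) \<le> exp (K * t) - 1 - K * t" if "0 \<le> t" for t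
      using K[of t] that \<open>A 0 = mat 1\<close> by (cases "t = 0") auto
  qed
qed

text \<open>The remainder \<open>exp (K * t) - 1 - K * t\<close> has derivative \<open>0\<close> at \<open>0\<close>.\<close>

lemma bend_derivative:
  assumes x: "x \<in> hyp2 - weighted_part lam" and y: "y \<in> hyp2 - weighted_part lam"
  shows "psl_derivative (\<lambda>t. bending (scale_lam t lam) x y) ((1 / 2) *\<^sub>R Phi (transl x y))"
proof -
  obtain A K where A: "\<And>t. 0 \<le> t \<Longrightarrow> bending (scale_lam t lam) x y = psl (A t)" "A 0 = mat 1"
    "\<And>t. 0 \<le> t \<Longrightarrow> det (A t) = 1"
    "\<And>t. 0 \<le> t \<Longrightarrow> norm (A t - mat 1 - (t / 2) *\<^sub>R Phi (transl x y)) \<le> exp (K * t) - 1 - K * t"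
    by (rule bend_limit[OF x y]) blast
  define X where "X = (1 / 2) *\<^sub>R Phi (transl x y)"
  have "(A has_vector_derivative X) (at 0 within {0..})"
    unfolding has_vector_derivative_def has_derivative_within
  proof (intro conjI bounded_linear_scaleR_left)
    have "((\<lambda>t. (exp (K * t) - 1 - K * t) / t) \<longlongrightarrow> 0) (at 0 within {0..})"
    proof -
      have "((\<lambda>t. exp (K * t) - 1 - K * t) has_real_derivative 0) (at 0 within {0..})"
        by (auto intro!: derivative_eq_intros)
      then show ?thesis by (simp add: has_field_derivative_iff)
    qed
    then show "((\<lambda>y. (1 / norm (y - 0)) *\<^sub>R (A y - (A 0 + (y - 0) *\<^sub>R X))) \<longlongrightarrow> 0) (at 0 within {0..})"
    proof (rule Lim_null_comparison[rotated])
      show "\<forall>\<^sub>F t in at 0 within {0..}. norm ((1 / norm (t - 0)) *\<^sub>R (A t - (A 0 + (t - 0) *\<^sub>R X))) \<le> (exp (K * t) - 1 - K * t) / t"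
        unfolding eventually_at
      proof (intro exI[of _ 1] conjI ballI impI)
        fix t :: real assume "t \<in> {0..}" "t \<noteq> 0 \<and> dist t 0 < 1"
        then have t: "t > 0" by simp
        have e: "A t - (A 0 + (t - 0) *\<^sub>R X) = A t - mat 1 - (t / 2) *\<^sub>R Phi (transl x y)" by (simp add: A(2) X_def)
        show "norm ((1 / norm (t - 0)) *\<^sub>R (A t - (A 0 + (t - 0) *\<^sub>R X))) \<le> (exp (K * t) - 1 - K * t) / t"
          unfolding e using A(4)[of t] t by (simp add: divide_right_mono)
      qed simp
    qed
  qed
  then show ?thesis unfolding psl_derivative_def X_def[symmetric] using A by blast
qed

end

section \<open>Equivariance\<close>

locale invariant_meas_lam = meas_lam lam for lam +
  fixes \<Gamma> :: "(real^2^2) set set"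
  assumes subgroup_\<Gamma>: "subgroup \<Gamma> PSL2" and invariant: "invariant_lam \<Gamma> lam"
begin

lemma \<Gamma>_PSL2: "\<gamma> \<in> \<Gamma> \<Longrightarrow> \<gamma> \<in> carrier PSL2"
  using subgroup.mem_carrier[OF subgroup_\<Gamma>] .

lemma pact_inverse:
  assumes g: "\<gamma> \<in> \<Gamma>"
  obtains \<gamma>' where "\<gamma>' \<in> \<Gamma>" "\<And>v. pact \<gamma>' (pact \<gamma> v) = v" "\<And>v. pact \<gamma> (pact \<gamma>' v) = v"
    "\<And>v w. lform v (pact \<gamma> w) = lform (pact \<gamma>' v) w"
proof -
  interpret P: group "PSL2 :: (real^2^2) set monoid" by (rule PSL2_group)
  define h where "h = inv\<^bsub>PSL2\<^esub> \<gamma>"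
  have h: "h \<in> \<Gamma>" unfolding h_def by (rule subgroup.m_inv_closed[OF subgroup_\<Gamma> g])
  have gc: "\<gamma> \<in> carrier PSL2" and hc: "h \<in> carrier PSL2" using g h by (auto intro: \<Gamma>_PSL2)
  have hg: "pact h (pact \<gamma> v) = v" for v
    using pact_mult[OF hc gc, of v] by (simp only: h_def P.l_inv[OF gc] pact_one)
  have gh: "pact \<gamma> (pact h v) = v" for v
    using pact_mult[OF gc hc, of v] by (simp only: h_def P.r_inv[OF gc] pact_one)
  have lf: "lform v (pact \<gamma> w) = lform (pact h v) w" for v w
    using lform_pact[OF hc, of v "pact \<gamma> w"] by (simp add: hg)
  show thesis by (rule that[OF h hg gh lf])
qed

lemma pact_normals:
  assumes g: "\<gamma> \<in> \<Gamma>" and n: "n \<in> normals \<L>" shows "pact \<gamma> n \<in> normals \<L>"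
proof -
  obtain \<gamma>' where g': "\<gamma>' \<in> \<Gamma>" "\<And>v. pact \<gamma>' (pact \<gamma> v) = v" "\<And>v. pact \<gamma> (pact \<gamma>' v) = v"
    "\<And>v w. lform v (pact \<gamma> w) = lform (pact \<gamma>' v) w"
    by (rule pact_inverse[OF g]) blast
  have n': "lform n n = 1" "geo n \<in> \<L>" using n normals_iff by auto
  have "geo (pact \<gamma> n) = pact \<gamma> ` geo n"
  proof
    show "pact \<gamma> ` geo n \<subseteq> geo (pact \<gamma> n)"
      using pact_hyp2[OF \<Gamma>_PSL2[OF g]] lform_pact[OF \<Gamma>_PSL2[OF g]] by (auto simp: geo_def)
    show "geo (pact \<gamma> n) \<subseteq> pact \<gamma> ` geo n"
    proof
      fix z assume "z \<in> geo (pact \<gamma> n)"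
      then have z: "z \<in> hyp2" "lform (pact \<gamma> n) z = 0" by (auto simp: geo_def)
      have "lform n (pact \<gamma>' z) = 0" using z(2) lform_pact[OF \<Gamma>_PSL2[OF g], of n "pact \<gamma>' z"] by (simp add: g'(3))
      then have "pact \<gamma>' z \<in> geo n" using pact_hyp2[OF \<Gamma>_PSL2[OF g'(1)] z(1)] by (simp add: geo_def)
      then show "z \<in> pact \<gamma> ` geo n" by (rule image_eqI[rotated]) (simp add: g'(3))
    qed
  qed
  moreover have "pact \<gamma> ` geo n \<in> \<L>" using invariant g n'(2) unfolding invariant_lam_def by blast
  ultimately show ?thesis unfolding normals_iff using n'(1) lform_pact[OF \<Gamma>_PSL2[OF g], of n n] by simp
qed

lemma pact_seps: "\<gamma> \<in> \<Gamma> \<Longrightarrow> n \<in> seps \<L> x y \<Longrightarrow> pact \<gamma> n \<in> seps \<L> (pact \<gamma> x) (pact \<gamma> y)"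
  using pact_normals lform_pact[OF \<Gamma>_PSL2] by (simp add: seps_def)

lemma pact_hseg:
  assumes g: "\<gamma> \<in> \<Gamma>" shows "hseg (pact \<gamma> x) (pact \<gamma> y) s = pact \<gamma> (hseg x y s)"
proof -
  have e: "(1 - s) *\<^sub>R pact \<gamma> x + s *\<^sub>R pact \<gamma> y = pact \<gamma> ((1 - s) *\<^sub>R x + s *\<^sub>R y)"
    by (simp add: linear_add[OF linear_pact] linear_scale[OF linear_pact])
  show ?thesis unfolding hseg_def Let_def e lform_pact[OF \<Gamma>_PSL2[OF g]] by (simp only: linear_scale[OF linear_pact])
qed

lemma path_image_pact_hseg:
  "\<gamma> \<in> \<Gamma> \<Longrightarrow> path_image (hseg (pact \<gamma> x) (pact \<gamma> y)) = pact \<gamma> ` path_image (hseg x y)"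
  by (simp add: path_image_def pact_hseg image_image)

lemma transverse_arc_pact:
  assumes g: "\<gamma> \<in> \<Gamma>" and h: "transverse_arc \<L> h"
  shows "transverse_arc \<L> (pact \<gamma> \<circ> h)"
proof -
  obtain \<gamma>' where g': "\<gamma>' \<in> \<Gamma>" "\<And>v. pact \<gamma>' (pact \<gamma> v) = v" "\<And>v. pact \<gamma> (pact \<gamma>' v) = v"
    "\<And>v w. lform v (pact \<gamma> w) = lform (pact \<gamma>' v) w"
    by (rule pact_inverse[OF g]) blast
  note H = h[unfolded transverse_arc_iff]
  have "inj (pact \<gamma>)" by (rule inj_on_inverseI[of _ "pact \<gamma>'"]) (rule g'(2))
  then have "inj_on (pact \<gamma>) A" for A by (rule inj_on_subset) simp
  moreover have "continuous_on A (pact \<gamma>)" for A by (rule linear_continuous_on) (rule linear_linear[THEN iffD2, OF linear_pact])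
  moreover have "continuous_on {0..1} h" "inj_on h {0..1}" using H by (auto simp: arc_def path_def)
  ultimately have "arc (pact \<gamma> \<circ> h)"
    unfolding arc_def path_def by (intro conjI continuous_on_compose comp_inj_on)
  moreover have "path_image (pact \<gamma> \<circ> h) \<subseteq> hyp2" using H pact_hyp2[OF \<Gamma>_PSL2[OF g]] by (auto simp: path_image_def)
  moreover have "hrectifiable (pact \<gamma> \<circ> h)"
    using H by (simp add: hrectifiable_def hdist_def lform_pact[OF \<Gamma>_PSL2[OF g]])
  moreover have cr: "crosses (pact \<gamma> \<circ> h) n u S \<longleftrightarrow> crosses h (pact \<gamma>' n) u S" for n u S
    by (simp add: crosses_def g'(4))
  have "\<forall>s\<in>{0..1}. \<exists>e>0. \<forall>n\<in>normals \<L>. \<forall>u\<in>{0..1} \<inter> ball s e. lform n ((pact \<gamma> \<circ> h) u) = 0 \<longrightarrow>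
        crosses (pact \<gamma> \<circ> h) n u ({0..1} \<inter> ball s e)"
  proof
    fix s :: real assume "s \<in> {0..1}"
    then obtain e where e: "e > 0" "\<forall>n\<in>normals \<L>. \<forall>u\<in>{0..1} \<inter> ball s e. lform n (h u) = 0 \<longrightarrow> crosses h n u ({0..1} \<inter> ball s e)"
      using H by blast
    show "\<exists>e>0. \<forall>n\<in>normals \<L>. \<forall>u\<in>{0..1} \<inter> ball s e. lform n ((pact \<gamma> \<circ> h) u) = 0 \<longrightarrow>
        crosses (pact \<gamma> \<circ> h) n u ({0..1} \<inter> ball s e)"
      using e(1) e(2)[rule_format, OF pact_normals[OF g'(1)]] by (intro exI[of _ e]) (simp add: cr g'(4))
  qed
  ultimately show ?thesis unfolding transverse_arc_iff by blast
qed

lemma weighted_part_pact: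
  assumes g: "\<gamma> \<in> \<Gamma>" and z: "z \<in> weighted_part lam" shows "pact \<gamma> z \<in> weighted_part lam"
proof -
  obtain k h p where k: "k \<in> \<L>" "z \<in> k" and h: "transverse_arc \<L> h" and p: "p \<in> k" "p \<in> path_image h"
    and m: "emeasure (tmeas lam (path_image h)) {p} > 0"
    using z unfolding weighted_part_def by blast
  have "{p} \<in> sets (tmeas lam (path_image h))" using p by (simp add: tmeas_sets_iff[OF h])
  then have "emeasure (tmeas lam (pact \<gamma> ` path_image h)) (pact \<gamma> ` {p}) = emeasure (tmeas lam (path_image h)) {p}"
    using invariant g h unfolding invariant_lam_def by blast
  then have "emeasure (tmeas lam (path_image (pact \<gamma> \<circ> h))) {pact \<gamma> p} > 0" using m by (simp add: path_image_compose)
  moreover have "pact \<gamma> ` k \<in> \<L>" using invariant g k unfolding invariant_lam_def by blast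
  moreover have "pact \<gamma> p \<in> pact \<gamma> ` k \<inter> path_image (pact \<gamma> \<circ> h)" using p by (simp add: path_image_compose)
  moreover have "pact \<gamma> z \<in> pact \<gamma> ` k" using k by simp
  ultimately show ?thesis unfolding weighted_part_def using transverse_arc_pact[OF g h] by blast
qed

lemma pact_unweighted:
  assumes g: "\<gamma> \<in> \<Gamma>" and z: "z \<in> hyp2 - weighted_part lam" shows "pact \<gamma> z \<in> hyp2 - weighted_part lam"
proof -
  obtain \<gamma>' where g': "\<gamma>' \<in> \<Gamma>" "\<And>v. pact \<gamma>' (pact \<gamma> v) = v" by (rule pact_inverse[OF g]) blast
  have "pact \<gamma> z \<notin> weighted_part lam"
  proof
    assume "pact \<gamma> z \<in> weighted_part lam"
    then have "pact \<gamma>' (pact \<gamma> z) \<in> weighted_part lam" by (rule weighted_part_pact[OF g'(1)])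
    then show False using z by (simp add: g'(2))
  qed
  then show ?thesis using z pact_hyp2[OF \<Gamma>_PSL2[OF g]] by blast
qed

lemma tseg_pact:
  assumes g: "\<gamma> \<in> \<Gamma>" and t: "tseg x y" shows "tseg (pact \<gamma> x) (pact \<gamma> y)"
proof -
  have "pact \<gamma> \<circ> hseg x y = hseg (pact \<gamma> x) (pact \<gamma> y)" by (simp add: fun_eq_iff pact_hseg[OF g])
  then show ?thesis using transverse_arc_pact[OF g t] by simp
qed

lemma dirvec_pact:
  assumes g: "\<gamma> \<in> \<Gamma>" and xy: "x \<in> hyp2" "y \<in> hyp2" and t: "tseg x y" and r: "r \<in> path_image (hseg x y)"
  shows "dirvec lam (pact \<gamma> x) (pact \<gamma> y) (pact \<gamma> r) = pact \<gamma> (dirvec lam x y r)"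
proof -
  obtain \<gamma>' where g': "\<gamma>' \<in> \<Gamma>" "\<And>v. pact \<gamma>' (pact \<gamma> v) = v" "\<And>v. pact \<gamma> (pact \<gamma>' v) = v"
    "\<And>v w. lform v (pact \<gamma> w) = lform (pact \<gamma>' v) w"
    by (rule pact_inverse[OF g]) blast
  note P = pact_hyp2[OF \<Gamma>_PSL2[OF g]]
  have rh: "r \<in> hyp2" using hseg_image_hyp2[OF xy] r by blast
  show ?thesis
  proof (cases "r \<in> lamset lam")
    case True
    note d = dirvec_seg[OF xy t r True]
    have np: "no_common_leaf \<L> (pact \<gamma> x) (pact \<gamma> y)"
      using tseg_pact[OF g t] transverse_hseg_iff[OF P[OF xy(1)] P[OF xy(2)]] by blast
    show ?thesis
      by (rule dirvec_eq[OF np pact_seps[OF g d(1)] P[OF rh]]) (simp add: lform_pact[OF \<Gamma>_PSL2[OF g]] d(2))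
  next
    case False
    have "pact \<gamma> r \<notin> lamset lam"
    proof
      assume "pact \<gamma> r \<in> lamset lam"
      then obtain n where n: "n \<in> normals \<L>" "lform n (pact \<gamma> r) = 0" using lamset_iff[OF P[OF rh]] by blast
      then have "r \<in> lamset lam" unfolding lamset_iff[OF rh] using pact_normals[OF g'(1) n(1)] by (auto simp: g'(4))
      then show False using False by simp
    qed
    then show ?thesis using False by (simp add: dirvec_off linear_0[OF linear_pact])
  qed
qed

text \<open>By the invariance of the lamination, the isometry carries the measure of a segment to the measure of
  the image segment, and it carries the normal field to the normal field.\<close>

lemma transl_pact:
  assumes g: "\<gamma> \<in> \<Gamma>" and xy: "x \<in> hyp2" "y \<in> hyp2"
  shows "transl (pact \<gamma> x) (pact \<gamma> y) = pact \<gamma> (transl x y)"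
proof -
  obtain \<gamma>' where g': "\<gamma>' \<in> \<Gamma>" "\<And>v. pact \<gamma>' (pact \<gamma> v) = v" "\<And>v. pact \<gamma> (pact \<gamma>' v) = v"
    by (rule pact_inverse[OF g]) blast
  note P = pact_hyp2[OF \<Gamma>_PSL2[OF g]]
  show ?thesis
  proof (cases "tseg x y")
    case True
    note t = True and t' = tseg_pact[OF g True]
    let ?M = "segm x y" and ?N = "segm (pact \<gamma> x) (pact \<gamma> y)"
    let ?k = "path_image (hseg x y)"
    have N: "?N = tmeas lam (pact \<gamma> ` ?k)" by (simp add: segm_t[OF t'] path_image_pact_hseg[OF g])
    have spN: "space ?N = pact \<gamma> ` ?k" and spM: "space ?M = ?k"
      by (simp_all add: space_segm t t' path_image_pact_hseg[OF g])
    have setsN: "A \<in> sets ?N \<longleftrightarrow> A \<in> sets borel \<and> A \<subseteq> pact \<gamma> ` ?k" for A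
      using tmeas_sets_iff[OF t', of A] by (simp add: segm_t[OF t'] path_image_pact_hseg[OF g])
    have setsM: "A \<in> sets ?M \<longleftrightarrow> A \<in> sets borel \<and> A \<subseteq> ?k" for A
      using tmeas_sets_iff[OF t, of A] by (simp add: segm_t[OF t])
    have bl: "bounded_linear (pact \<gamma>)" by (rule linear_linear[THEN iffD2, OF linear_pact])
    have kb: "?k \<in> sets borel" using path_image_arc_borel[OF t] .
    have pb: "pact \<gamma> \<in> borel_measurable borel"
      by (rule borel_measurable_continuous_onI[OF linear_continuous_on[OF bl]])
    have pre: "pact \<gamma> -` A \<inter> ?k \<in> sets ?M" if "A \<in> sets borel" for A
      using measurable_sets[OF pb that] kb by (auto simp: setsM)
    have meas: "pact \<gamma> \<in> measurable ?M ?N"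
      by (rule measurableI) (auto simp: spM spN setsN intro: pre)
    have D: "distr ?M ?N (pact \<gamma>) = ?N"
    proof (rule measure_eqI)
      fix A assume "A \<in> sets (distr ?M ?N (pact \<gamma>))"
      then have A: "A \<in> sets ?N" by simp
      then have A': "A \<in> sets borel" "A \<subseteq> pact \<gamma> ` ?k" by (auto simp: setsN)
      have E: "pact \<gamma> -` A \<inter> ?k \<in> sets (tmeas lam ?k)" using pre[OF A'(1)] by (simp add: segm_t[OF t])
      have im: "pact \<gamma> ` (pact \<gamma> -` A \<inter> ?k) = A" using A'(2) by auto
      have "emeasure (distr ?M ?N (pact \<gamma>)) A = emeasure (tmeas lam ?k) (pact \<gamma> -` A \<inter> ?k)"
        using A by (simp add: emeasure_distr[OF meas] spM) (simp add: segm_t[OF t])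
      also have "\<dots> = emeasure (tmeas lam (pact \<gamma> ` ?k)) (pact \<gamma> ` (pact \<gamma> -` A \<inter> ?k))"
        using invariant g t E unfolding invariant_lam_def by metis
      finally show "emeasure (distr ?M ?N (pact \<gamma>)) A = emeasure ?N A" unfolding im N .
    qed simp
    have "transl (pact \<gamma> x) (pact \<gamma> y) = integral\<^sup>L (distr ?M ?N (pact \<gamma>)) (dirvec lam (pact \<gamma> x) (pact \<gamma> y))"
      unfolding D transl_def ..
    also have "\<dots> = (\<integral>r. dirvec lam (pact \<gamma> x) (pact \<gamma> y) (pact \<gamma> r) \<partial>?M)"
      by (rule integral_distr[OF meas dirvec_measurable[OF P[OF xy(1)] P[OF xy(2)] t']])
    also have "\<dots> = (\<integral>r. pact \<gamma> (dirvec lam x y r) \<partial>?M)"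
      by (rule Bochner_Integration.integral_cong) (simp_all add: spM dirvec_pact[OF g xy t])
    also have "\<dots> = pact \<gamma> (transl x y)"
      unfolding transl_def by (rule integral_bounded_linear[OF bl dirvec_integrable[OF xy t]])
    finally show ?thesis .
  next
    case False
    have "\<not> tseg (pact \<gamma> x) (pact \<gamma> y)" using tseg_pact[OF g'(1), of "pact \<gamma> x" "pact \<gamma> y"] False by (auto simp: g'(2))
    then show ?thesis using False by (simp add: transl_def segm_n integral_null_measure linear_0[OF linear_pact])
  qed
qed

lemma tau_transl: "tau lam x0 \<gamma> = transl x0 (pact \<gamma> x0)"
  by (simp add: tau_def transl_def)

text \<open>Additivity for the points \<open>x0\<close>, \<open>\<alpha> x0\<close> and \<open>\<alpha> \<beta> x0\<close>, with equivariance for the last two.\<close>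

lemma tau_cocycle:
  assumes x0: "x0 \<in> hyp2 - weighted_part lam"
  shows "(\<lambda>\<gamma>\<in>\<Gamma>. tau lam x0 \<gamma>) \<in> carrier (Z1 (subPSL \<Gamma>) pact UNIV)"
proof -
  have "tau lam x0 (\<alpha> \<otimes>\<^bsub>PSL2\<^esub> \<beta>) = tau lam x0 \<alpha> + pact \<alpha> (tau lam x0 \<beta>)" if a: "\<alpha> \<in> \<Gamma>" and b: "\<beta> \<in> \<Gamma>" for \<alpha> \<beta>
  proof -
    have e: "pact (\<alpha> \<otimes>\<^bsub>PSL2\<^esub> \<beta>) x0 = pact \<alpha> (pact \<beta> x0)" by (rule pact_mult[OF \<Gamma>_PSL2[OF a] \<Gamma>_PSL2[OF b]])
    have "transl x0 (pact \<alpha> (pact \<beta> x0)) = transl x0 (pact \<alpha> x0) + transl (pact \<alpha> x0) (pact \<alpha> (pact \<beta> x0))"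
      by (rule transl_additive[OF x0 pact_unweighted[OF a x0] pact_unweighted[OF a pact_unweighted[OF b x0]]])
    moreover have "transl (pact \<alpha> x0) (pact \<alpha> (pact \<beta> x0)) = pact \<alpha> (transl x0 (pact \<beta> x0))"
      by (rule transl_pact[OF a]) (use x0 pact_unweighted[OF b x0] in auto)
    ultimately show ?thesis by (simp add: tau_transl e)
  qed
  moreover have "\<alpha> \<otimes>\<^bsub>PSL2\<^esub> \<beta> \<in> \<Gamma>" if "\<alpha> \<in> \<Gamma>" "\<beta> \<in> \<Gamma>" for \<alpha> \<beta>
    using subgroup.m_closed[OF subgroup_\<Gamma> that] .
  ultimately show ?thesis by (simp add: gmodule.Z1_carrier[OF gmodule_pact[OF subgroup_\<Gamma>]])
qed

text \<open>Since \<open>\<rho>\<^sub>0(\<gamma>) = \<gamma>\<close>, the curve is that of the bending products.\<close>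

lemma rho_derivative:
  assumes x0: "x0 \<in> hyp2 - weighted_part lam" and g: "\<gamma> \<in> \<Gamma>"
  shows "psl_derivative
    (\<lambda>t. rho (scale_lam t lam) x0 \<gamma> \<otimes>\<^bsub>PSL2\<^esub> inv\<^bsub>PSL2\<^esub> (rho (scale_lam 0 lam) x0 \<gamma>))
    ((1 / 2) *\<^sub>R Phi (tau lam x0 \<gamma>))"
proof -
  interpret P: group "PSL2 :: (complex^2^2) set monoid" by (rule PSL2_group)
  let ?y = "pact \<gamma> x0"
  have "psl_derivative (\<lambda>t. bending (scale_lam t lam) x0 ?y) ((1 / 2) *\<^sub>R Phi (transl x0 ?y))"
    by (rule bend_derivative[OF x0 pact_unweighted[OF g x0]])
  then obtain A where A: "A 0 = mat 1" "\<forall>t\<ge>0. det (A t) = 1 \<and> bending (scale_lam t lam) x0 ?y = psl (A t)"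
    "(A has_vector_derivative (1 / 2) *\<^sub>R Phi (transl x0 ?y)) (at 0 within {0..})"
    unfolding psl_derivative_def by blast
  have c: "cpsl \<gamma> \<in> carrier PSL2" by (rule cpsl_carrier[OF \<Gamma>_PSL2[OF g]])
  have r0: "rho (scale_lam 0 lam) x0 \<gamma> = cpsl \<gamma>"
    using A(1) A(2)[rule_format, of 0] c by (simp add: rho_def psl_one[symmetric])
  have "rho (scale_lam t lam) x0 \<gamma> \<otimes>\<^bsub>PSL2\<^esub> inv\<^bsub>PSL2\<^esub> (rho (scale_lam 0 lam) x0 \<gamma>) = psl (A t)" if "t \<ge> 0" for t
  proof -
    have b: "bending (scale_lam t lam) x0 ?y = psl (A t)" "psl (A t) \<in> carrier PSL2" using A(2) that psl_carrier by auto
    show ?thesis unfolding r0 unfolding rho_def b(1) using b(2) c by (simp add: P.m_assoc)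
  qed
  then show ?thesis unfolding psl_derivative_def tau_transl using A by (intro exI[of _ A]) auto
qed

end

section \<open>The derivative of the bending representations\<close>

lemma Phi_half: "(1 / 2) *\<^sub>R Phi v = cmult (\<i> / 2) (cmat (vec_sl2 v))"
  by (simp add: Phi_def vec_eq_iff cmult_nth cmat_nth scaleR_conv_of_real[where 'a=complex])

lemma cmult_ii_half: "cmult (\<i> / 2) (cmat X) = cmult \<i> (cmat ((1 / 2) *\<^sub>R X))"
  by (simp add: vec_eq_iff cmult_nth cmat_nth)

text \<open>The derivative is the composition of \<open>\<tau>\<close> with \<open>f v = (\<i>/2) v\<close>. As \<open>f\<close> is equivariant, its class is
  the image of the class of \<open>\<tau>\<close>. As \<open>f\<close> factors through \<open>v \<mapsto> v/2\<close> and the multiplication by \<open>\<i>\<close>, the class is imaginary.\<close>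

theorem corollary7p4:
  fixes \<Gamma> :: "(real^2^2) set set" and lam :: mlam and x0 :: "real^3"
  assumes "subgroup \<Gamma> PSL2" and "acts_freely \<Gamma>" and "acts_properly \<Gamma>"
    and "measured_lamination lam" and "invariant_lam \<Gamma> lam"
    and "x0 \<in> hyp2 - weighted_part lam"
  defines "G \<equiv> subPSL \<Gamma>"
  defines "\<tau> \<equiv> (\<lambda>\<gamma>\<in>\<Gamma>. flam lam x0 \<gamma> 0)"
  defines "re \<equiv> H1_map G cAd sl2 cmat"
  defines "im \<equiv> H1_map G cAd sl2 (\<lambda>X. cmult \<i> (cmat X))"
  shows "(\<lambda>(h, k). re h \<otimes>\<^bsub>H1 G cAd sl2\<^esub> im k) \<in> iso (H1 G Ad sl2 \<times>\<times> H1 G Ad sl2) (H1 G cAd sl2) \<and>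
    \<tau> \<in> carrier (Z1 G pact UNIV) \<and>
    (\<exists>c. (\<forall>\<gamma>\<in>\<Gamma>. psl_derivative
            (\<lambda>t. rho (scale_lam t lam) x0 \<gamma> \<otimes>\<^bsub>PSL2\<^esub> inv\<^bsub>PSL2\<^esub> (rho (scale_lam 0 lam) x0 \<gamma>)) (c \<gamma>)) \<and>
      c \<in> carrier (Z1 G cAd sl2) \<and>
      (\<forall>\<gamma>\<in>\<Gamma>. c \<gamma> \<in> (\<lambda>X. cmult \<i> (cmat X)) ` sl2) \<and>
      H1_class G cAd sl2 c \<in> im ` carrier (H1 G Ad sl2) \<and>
      H1_class G cAd sl2 c =
        H1_map G cAd sl2 (\<lambda>v. cmult (\<i> / 2) (cmat (to_sl2 v))) (H1_class G pact UNIV \<tau>))"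
proof -
  interpret invariant_meas_lam lam \<Gamma>
    by (intro invariant_meas_lam.intro meas_lam.intro invariant_meas_lam_axioms.intro) fact+
  note x0 = \<open>x0 \<in> hyp2 - weighted_part lam\<close>
  have carr: "carrier G = \<Gamma>" by (simp add: G_def)
  have mA: "gmodule G Ad sl2" and mC: "gmodule G cAd sl2" and mP: "gmodule G pact UNIV"
    unfolding G_def by (rule gmodule_Ad gmodule_cAd gmodule_pact, rule subgroup_\<Gamma>)+
  have tau: "\<tau> = (\<lambda>\<gamma>\<in>\<Gamma>. tau lam x0 \<gamma>)" by (simp add: \<tau>_def flam_def linear_0[OF linear_pact])
  have \<tau>Z: "\<tau> \<in> carrier (Z1 G pact UNIV)" unfolding tau G_def by (rule tau_cocycle[OF x0])
  let ?f = "\<lambda>v. cmult (\<i> / 2) (cmat (to_sl2 v))"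
  let ?h = "\<lambda>v. (1 / 2) *\<^sub>R to_sl2 v"
  let ?i = "\<lambda>X. cmult \<i> (cmat X)"
  have gP: "g \<in> carrier PSL2" if "g \<in> carrier G" for g using that \<Gamma>_PSL2 carr by simp
  have f1: "?f v \<in> sl2" for v unfolding to_sl2_eq by (intro cmult_sl2 cmat_sl2 vec_sl2_mem)
  have f2: "?f (u + v) = ?f u + ?f v" for u v
    by (simp add: to_sl2_eq linear_add[OF linear_vec_sl2] cmat_add cmult_add)
  have f3: "?f (pact g v) = cAd g (?f v)" if "g \<in> carrier G" for g v
    by (simp add: to_sl2_eq vec_sl2_equivariant[OF gP[OF that]] Ad_cmult[OF cpsl_carrier[OF gP[OF that]]] cAd_cmat[OF gP[OF that]])
  have h1: "?h v \<in> sl2" for v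
    using vec_sl2_mem[of v] by (simp add: to_sl2_eq sl2_def trace_def sum_2)
  have h2: "?h (u + v) = ?h u + ?h v" for u v by (simp add: to_sl2_eq linear_add[OF linear_vec_sl2] scaleR_add_right)
  have h3: "?h (pact g v) = Ad g (?h v)" if "g \<in> carrier G" for g v
  proof -
    have "?h w = vec_sl2 ((1 / 2) *\<^sub>R w)" for w by (simp add: to_sl2_eq linear_scale[OF linear_vec_sl2])
    then show ?thesis by (simp add: vec_sl2_equivariant[OF gP[OF that], symmetric] linear_scale[OF linear_pact])
  qed
  have i1: "?i X \<in> sl2" if "X \<in> sl2" for X by (intro cmult_sl2 cmat_sl2 that)
  have i2: "?i (X + Y) = ?i X + ?i Y" for X Y by (simp add: cmat_add cmult_add)
  have i3: "?i (Ad g X) = cAd g (?i X)" if "g \<in> carrier G" for g X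
    by (simp add: Ad_cmult[OF cpsl_carrier[OF gP[OF that]]] cAd_cmat[OF gP[OF that]])
  define c where "c = (\<lambda>\<gamma>\<in>carrier G. ?f (\<tau> \<gamma>))"
  define b where "b = (\<lambda>\<gamma>\<in>carrier G. ?h (\<tau> \<gamma>))"
  have cZ: "c \<in> carrier (Z1 G cAd sl2)" and cH: "H1_map G cAd sl2 ?f (H1_class G pact UNIV \<tau>) = H1_class G cAd sl2 c"
    unfolding c_def by (rule H1_map_class[where f = ?f, OF mP mC f1 f2 f3 \<tau>Z]; assumption)+
  have bZ: "b \<in> carrier (Z1 G Ad sl2)"
    unfolding b_def by (rule H1_map_class(1)[where f = ?h, OF mP mA h1 h2 h3 \<tau>Z])
  have "H1_map G cAd sl2 ?i (H1_class G Ad sl2 b) = H1_class G cAd sl2 (\<lambda>\<gamma>\<in>carrier G. ?i (b \<gamma>))"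
    by (rule H1_map_class(2)[where f = ?i, OF mA mC i1 i2 i3 bZ])
  moreover have "(\<lambda>\<gamma>\<in>carrier G. ?i (b \<gamma>)) = c" by (auto simp: b_def c_def cmult_ii_half)
  ultimately have im: "H1_class G cAd sl2 c = im (H1_class G Ad sl2 b)" by (simp add: im_def)
  have cg: "c \<gamma> = (1 / 2) *\<^sub>R Phi (tau lam x0 \<gamma>)" if "\<gamma> \<in> \<Gamma>" for \<gamma>
    using that by (simp add: c_def carr tau Phi_half to_sl2_eq)
  have "(\<lambda>(h, k). re h \<otimes>\<^bsub>H1 G cAd sl2\<^esub> im k) \<in> iso (H1 G Ad sl2 \<times>\<times> H1 G Ad sl2) (H1 G cAd sl2)"
    unfolding re_def im_def G_def by (rule H1_decomposition[OF subgroup_\<Gamma>])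
  moreover have "\<forall>\<gamma>\<in>\<Gamma>. psl_derivative
            (\<lambda>t. rho (scale_lam t lam) x0 \<gamma> \<otimes>\<^bsub>PSL2\<^esub> inv\<^bsub>PSL2\<^esub> (rho (scale_lam 0 lam) x0 \<gamma>)) (c \<gamma>)"
    using rho_derivative[OF x0] cg by simp
  moreover have "\<forall>\<gamma>\<in>\<Gamma>. c \<gamma> \<in> ?i ` sl2"
    using h1 by (auto simp: c_def carr cmult_ii_half)
  moreover have "H1_class G cAd sl2 c \<in> im ` carrier (H1 G Ad sl2)"
    unfolding im gmodule.H1_carrier[OF mA] using bZ by blast
  ultimately show ?thesis using \<tau>Z cZ cH by metis
qed

end
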